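(* Assume: (1) for every $y\in\mathbb{W}$, $\lambda\,\mathrm{R}(\lambda,\Psi_0^T)(y)\to0$ strongly in $\mathbb{W}$ as $\lambda\downarrow0$; (2) $\mathrm{R}(\lambda_0,\mathrm{A})$ is compact for some $\lambda_0\in\rho(\mathrm{A})$; (3) $f:J\times\mathfrak{B}\to\mathbb{W}$ is such that $f(t,\cdot):\mathfrak{B}\to\mathbb{W}$ is continuous for a.e. $t\in J$, $t\mapsto f(t,\phi)$ is strongly measurable on $J$ for each $\phi\in\mathfrak{B}$, and there is $\gamma\in\mathrm{L}^1(J;\mathbb{R}^+)$ with $\|f(t,\phi)\|_{\mathbb{W}}\le\gamma(t)$ for a.e. $t\in J$ and all $\phi\in\mathfrak{B}$. Then the system $$\frac{\mathrm{d}}{\mathrm{d}t}\Big[w(t)+\int_{-\infty}^t\mathrm{G}(t-s)w(s)\,\mathrm{d}s\Big]=\mathrm{A}w(t)+\int_{-\infty}^t\mathrm{N}(t-s)w(s)\,\mathrm{d}s+\mathrm{B}u(t)+f(t,w_t),\ t\in(0,T],\qquad w_0=\psi,$$ is approximately controllable over $J$.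
   Context: Setting. $T>0$, $J=[0,T]$. $\mathbb{W}$ is a separable reflexive Banach space whose dual $\mathbb{W}^*$ is uniformly convex; $\mathbb{U}$ is a Hilbert space identified with its dual; $\mathrm{B}:\mathbb{U}\to\mathbb{W}$ is bounded linear; $\langle\cdot,\cdot\rangle$ is the duality pairing of $\mathbb{W}$ and $\mathbb{W}^*$; $^*$ on operators denotes the adjoint. $\mathcal{L}(X;Y)$ denotes bounded linear operators with the operator norm, $\mathcal{L}(X)=\mathcal{L}(X;X)$. $\mathrm{A}:D(\mathrm{A})\subseteq\mathbb{W}\to\mathbb{W}$ is a closed linear operator, $\mathrm{G}(t)$ ($t\ge0$) are bounded linear operators on $\mathbb{W}$, $\mathrm{N}(t)$ ($t\ge 0$) are closed linear operators in $\mathbb{W}$. $D_1(\mathrm{A})$ is $D(\mathrm{A})$ with the graph norm $\|z\|_1=\|z\|_{\mathbb{W}}+\|\mathrm{A}z\|_{\mathbb{W}}$. A hat denotes the Laplace transform, and $\Lambda_\nu=\{\lambda\in\mathbb{C}\setminus\{0\}:|\arg\lambda|<\nu\}$. Standing conditions. (Cd1) $\mathrm{A}$ generates an analytic semigroup on $\mathbb{W}$; there are $M_0>0$ and $\nu\in(\pi/2,\pi)$ with $\rho(\mathrm{A})\supseteq\Lambda_\nu$ and $\|\mathrm{R}(\lambda,\mathrm{A})\|_{\mathcal{L}(\mathbb{W})}\le M_0/|\lambda|$ for $\lambda\in\Lambda_\nu$, where $\mathrm{R}(\lambda,\mathrm{A})$ is the resolvent of $\mathrm{A}$. (Cd2)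 $\mathrm{G}:[0,\infty)\to\mathcal{L}(\mathbb{W})$ is strongly continuous, $\widehat{\mathrm{G}}(\lambda)z$ is absolutely convergent for $z\in\mathbb{W}$, $\mathrm{Re}\,\lambda>0$; there are $\alpha>0$, $N_1,N_2>0$ and an analytic extension of $\widehat{\mathrm{G}}$ to $\Lambda_\nu$ (same notation) with $\|\widehat{\mathrm{G}}(\lambda)\|_{\mathcal{L}(\mathbb{W})}\le N_1|\lambda|^{-\alpha}$ for $\lambda\in\Lambda_\nu$ and $\|\widehat{\mathrm{G}}(\lambda)z\|_{\mathbb{W}}\le N_2|\lambda|^{-1}\|z\|_1$ for $\lambda\in\Lambda_\nu$, $z\in D(\mathrm{A})$. (Cd3) For each $t\ge0$, $\mathrm{N}(t)$ is closed linear with $D(\mathrm{A})\subseteq D(\mathrm{N}(t))$, and $\mathrm{N}(\cdot)z$ is strongly measurable on $(0,\infty)$ for $z\in D(\mathrm{A})$. There is $\varPi\in \mathrm{L}^1_{loc}(\mathbb{R}^+)$ such that $\widehat{\varPi}(\lambda)$ exists for $\mathrm{Re}\,\lambda>0$ and $\|\mathrm{N}(t)z\|_{\mathbb{W}}\le\varPi(t)\|z\|_1$ for $t>0$, $z\in D(\mathrm{A})$. The function $\widehat{\mathrm{N}}:\Lambda_{\pi/2}\to\mathcal{L}(D_1(\mathrm{A});\mathbb{W})$ has an analytic extension (same notation) to $\Lambda_\nu$ with $\|\widehat{\mathrm{N}}(\lambda)z\|_{\mathbb{W}}\le\|\widehat{\mathrm{N}}(\lambda)\|_{\mathcal{L}(D_1(\mathrm{A});\mathbb{W})}\|z\|_1$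 for $z\in D(\mathrm{A})$, and $\|\widehat{\mathrm{N}}(\lambda)\|_{\mathcal{L}(D_1(\mathrm{A});\mathbb{W})}\to0$ as $|\lambda|\to\infty$. (Cd4) There are a subspace $Y\subseteq D(\mathrm{A})$, dense in $D(\mathrm{A})$ for the graph norm, and $M_1,M_2>0$ with $\mathrm{A}(Y)\subseteq D(\mathrm{A})$, $\widehat{\mathrm{N}}(\lambda)(Y)\subseteq D(\mathrm{A})$, $\widehat{\mathrm{G}}(\lambda)(Y)\subseteq D(\mathrm{A})$, $\|\mathrm{A}\widehat{\mathrm{N}}(\lambda)z\|_{\mathbb{W}}\le M_1\|z\|_1$ and $\|\widehat{\mathrm{G}}(\lambda)z\|_1\le M_2|\lambda|^{-\alpha}\|z\|_1$ for all $\lambda\in\Lambda_\nu$, $z\in Y$. Resolvent operator. $(\mathscr{R}(t))_{t\ge0}\subset\mathcal{L}(\mathbb{W})$ denotes the resolvent operator of the homogeneous problem $\frac{\mathrm{d}}{\mathrm{d}t}[w(t)+\int_0^t\mathrm{G}(t-s)w(s)\mathrm{d}s]=\mathrm{A}w(t)+\int_0^t\mathrm{N}(t-s)w(s)\mathrm{d}s$, $w(0)=\zeta$: it is exponentially bounded, strongly continuous, $\mathscr{R}(0)=\mathrm{I}$, and for $z\in D(\mathrm{A})$ one has $\mathscr{R}(\cdot)z\in C([0,\infty);D_1(\mathrm{A}))\cap C^1((0,\infty);\mathbb{W})$ with, for every $t\ge0$, $\frac{\mathrm{d}}{\mathrm{d}t}[\mathscr{R}(t)z+\int_0^t\mathrm{G}(t-s)\mathscr{R}(s)z\,\mathrm{d}s]=\mathrm{A}\mathscr{R}(t)z+\int_0^t\mathrm{N}(t-s)\mathscr{R}(s)z\,\mathrm{d}s$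 and $\frac{\mathrm{d}}{\mathrm{d}t}[\mathscr{R}(t)z+\int_0^t\mathscr{R}(t-s)\mathrm{G}(s)z\,\mathrm{d}s]=\mathscr{R}(t)\mathrm{A}z+\int_0^t\mathscr{R}(t-s)\mathrm{N}(s)z\,\mathrm{d}s$. Under (Cd1)-(Cd4) it exists and is unique; explicitly (known result), for $\theta\in(\pi/2,\nu)$ and $r>0$ large enough, $\mathscr{R}(t)=\frac1{2\pi i}\int_{\Gamma_{r,\theta}}e^{\lambda t}\mathrm{F}(\lambda)\,\mathrm{d}\lambda$ for $t>0$, where $\mathrm{F}(\lambda)=(\lambda\mathrm{I}+\lambda\widehat{\mathrm{G}}(\lambda)-\mathrm{A}-\widehat{\mathrm{N}}(\lambda))^{-1}$ and $\Gamma_{r,\theta}$ is the counterclockwise oriented path $\{te^{i\theta}:t\ge r\}\cup\{re^{i\phi}:-\theta\le\phi\le\theta\}\cup\{te^{-i\theta}:t\ge r\}$. If $\mathrm{R}(\lambda_0,\mathrm{A})$ is compact for some $\lambda_0\in\rho(\mathrm{A})$, then $\mathscr{R}(t)$ is compact for all $t>0$ (known result). Phase space. $\mathfrak{B}$ is a linear space of functions $(-\infty,0]\to\mathbb{W}$ with a seminorm $\|\cdot\|_{\mathfrak{B}}$ such that: (A1) if $z:(-\infty,\sigma+\vartheta)\to\mathbb{W}$, $\vartheta>0$, is continuous on $[\sigma,\sigma+\vartheta)$ and $z_\sigma\in\mathfrak{B}$, then for every $t\in[\sigma,\sigma+\vartheta)$: (i) $z_t\in\mathfrak{B}$; (ii)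 $\|z(t)\|_{\mathbb{W}}\le K_1\|z_t\|_{\mathfrak{B}}$ with a constant $K_1$ independent of $z$; (iii) $\|z_t\|_{\mathfrak{B}}\le\varLambda(t-\sigma)\sup_{\sigma\le s\le t}\|z(s)\|_{\mathbb{W}}+\varUpsilon(t-\sigma)\|z_\sigma\|_{\mathfrak{B}}$, where $\varLambda:[0,\infty)\to[1,\infty)$ is continuous, $\varUpsilon:[0,\infty)\to[1,\infty)$ is locally bounded, both independent of $z$; (A2) for such $z$, $t\mapsto z_t$ is continuous from $[\sigma,\sigma+\vartheta)$ to $\mathfrak{B}$; (A3) $\mathfrak{B}$ is complete. Here $z_t(\theta)=z(t+\theta)$, $\theta\le0$. Mild solution. For $\psi\in\mathfrak{B}$ put $f_1(t)=-\int_{-\infty}^0\mathrm{G}(t-s)\psi(s)\mathrm{d}s$ and $f_2(t)=\int_{-\infty}^0\mathrm{N}(t-s)\psi(s)\mathrm{d}s$, $t\in J$. The initial functions $\psi\in\mathfrak{B}$ considered are those with $f_1\in\mathrm{W}^{1,1}(J;\mathbb{W})$ and $f_2\in\mathrm{L}^1(J;\mathbb{W})$; $f_1'$ is the a.e. derivative. A mild solution of the neutral system with control $u\in\mathrm{L}^2(J;\mathbb{U})$ is a function $w:(-\infty,T]\to\mathbb{W}$ with $w_0=\psi$, $w|_J\in C(J;\mathbb{W})$ and, for $t\in J$, $w(t)=\mathscr{R}(t)\psi(0)+\int_0^t\mathscr{R}(t-s)[\mathrm{B}u(s)+f(s,w_s)]\mathrm{d}s+\int_0^t\mathscr{R}(t-s)[f_1'(s)+f_2(s)]\mathrm{d}s$.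 Approximate controllability over $J$. For every such initial function $\psi$, every $\zeta_1\in\mathbb{W}$ and every $\epsilon>0$ there exist a control $u\in\mathrm{L}^2(J;\mathbb{U})$ and a corresponding mild solution $w$ with $\|w(T)-\zeta_1\|_{\mathbb{W}}\le\epsilon$. Control operators. $\mathscr{J}:\mathbb{W}\to\mathbb{W}^*$ is the duality mapping, $\mathscr{J}[z]=\{z^*:\langle z,z^*\rangle=\|z\|_{\mathbb{W}}^2=\|z^*\|_{\mathbb{W}^*}^2\}$ (single valued since $\mathbb{W}^*$ is strictly convex). $\Psi_0^T:=\int_0^T\mathscr{R}(T-t)\mathrm{B}\mathrm{B}^*\mathscr{R}(T-t)^*\mathrm{d}t:\mathbb{W}^*\to\mathbb{W}$, and $\mathrm{R}(\lambda,\Psi_0^T):=(\lambda\mathrm{I}+\Psi_0^T\mathscr{J})^{-1}:\mathbb{W}\to\mathbb{W}$ for $\lambda>0$ (a generally nonlinear map; $\lambda\mathrm{I}+\Psi_0^T\mathscr{J}$ is a bijection of $\mathbb{W}$). *)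

theory Defs
  imports "HOL-Analysis.Analysis"
begin

section \<open>Complex Banach and Hilbert spaces, bounded complex-linear operators\<close>

class complex_normed_vector = real_normed_vector +
  fixes scaleC :: "complex \<Rightarrow> 'a \<Rightarrow> 'a"  (infixr \<open>*\<^sub>C\<close> 75)
  assumes scaleC_add_right: "c *\<^sub>C (x + y) = c *\<^sub>C x + c *\<^sub>C y"
    and scaleC_add_left: "(c + d) *\<^sub>C x = c *\<^sub>C x + d *\<^sub>C x"
    and scaleC_scaleC: "c *\<^sub>C (d *\<^sub>C x) = (c * d) *\<^sub>C x"
    and scaleC_of_real: "complex_of_real r *\<^sub>C x = r *\<^sub>R x"
    and norm_scaleC: "norm (c *\<^sub>C x) = cmod c * norm x"

text \<open>Separability of a space is expressed throughout by the additional sort constraint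
  \<open>second_countable_topology\<close>, on which the Bochner integral of the library is based.\<close>

class complex_banach = complex_normed_vector + banach

text \<open>The inner product is conjugate-linear in its first argument.\<close>

class complex_hilbert = complex_banach +
  fixes cinner :: "'a \<Rightarrow> 'a \<Rightarrow> complex"
  assumes cinner_commute: "cinner x y = cnj (cinner y x)"
    and cinner_add_right: "cinner x (y + z) = cinner x y + cinner x z"
    and cinner_scaleC_right: "cinner x (c *\<^sub>C y) = c * cinner x y"
    and cinner_self: "cinner x x = complex_of_real ((norm x)\<^sup>2)"

instantiation complex :: complex_hilbert
begin

definition scaleC_complex :: "complex \<Rightarrow> complex \<Rightarrow> complex"
  where "scaleC_complex c x = c * x"

definition cinner_complex :: "complex \<Rightarrow> complex \<Rightarrow> complex"
  where "cinner_complex x y = cnj x * y"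

instance
proof
  fix x :: complex
  show "cinner x x = complex_of_real ((norm x)\<^sup>2)"
    unfolding cinner_complex_def complex_norm_square by (rule mult.commute)
qed (simp_all add: scaleC_complex_def cinner_complex_def algebra_simps norm_mult
      scaleR_conv_of_real)

end

lemma bounded_linear_scaleC: "bounded_linear (\<lambda>x::'a::complex_normed_vector. c *\<^sub>C x)"
proof (rule bounded_linear_intro[where K = "cmod c"])
  fix x y :: 'a and r :: real
  show "c *\<^sub>C (x + y) = c *\<^sub>C x + c *\<^sub>C y" by (rule scaleC_add_right)
  show "c *\<^sub>C (r *\<^sub>R x) = r *\<^sub>R (c *\<^sub>C x)"
    by (simp add: scaleC_of_real[symmetric] scaleC_scaleC mult.commute)
  show "norm (c *\<^sub>C x) \<le> norm x * cmod c" by (simp add: norm_scaleC)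
qed

lemmas scaleC_linear_simps =
  linear_simps[OF bounded_linear_scaleC]

typedef (overloaded) ('a, 'b) cblinfun (\<open>(_ \<Rightarrow>\<^sub>C\<^sub>L /_)\<close> [22, 21] 21) =
  "{f :: 'a::complex_normed_vector \<Rightarrow>\<^sub>L 'b::complex_normed_vector.
      \<forall>c x. blinfun_apply f (c *\<^sub>C x) = c *\<^sub>C blinfun_apply f x}"
  morphisms blinfun_of_cblinfun Abs_cblinfun
  by (rule exI[of _ 0]) (simp add: scaleC_linear_simps)

setup_lifting type_definition_cblinfun

lift_definition cblinfun_apply ::
  "('a::complex_normed_vector \<Rightarrow>\<^sub>C\<^sub>L 'b::complex_normed_vector) \<Rightarrow> 'a \<Rightarrow> 'b"  (infixr \<open>*\<^sub>V\<close> 70)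
  is blinfun_apply .

lift_definition cblinfun_compose ::
  "('b::complex_normed_vector \<Rightarrow>\<^sub>C\<^sub>L 'c::complex_normed_vector) \<Rightarrow>
   ('a::complex_normed_vector \<Rightarrow>\<^sub>C\<^sub>L 'b) \<Rightarrow> ('a \<Rightarrow>\<^sub>C\<^sub>L 'c)"  (infixl \<open>o\<^sub>C\<^sub>L\<close> 67)
  is blinfun_compose
  by simp

lift_definition id_cblinfun :: "'a::complex_normed_vector \<Rightarrow>\<^sub>C\<^sub>L 'a" is id_blinfun
  by simp

instantiation cblinfun :: (complex_normed_vector, complex_normed_vector) complex_normed_vector
begin

lift_definition norm_cblinfun :: "'a \<Rightarrow>\<^sub>C\<^sub>L 'b \<Rightarrow> real" is norm .

lift_definition zero_cblinfun :: "'a \<Rightarrow>\<^sub>C\<^sub>L 'b" is 0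
  by (simp add: scaleC_linear_simps)

lift_definition plus_cblinfun :: "'a \<Rightarrow>\<^sub>C\<^sub>L 'b \<Rightarrow> 'a \<Rightarrow>\<^sub>C\<^sub>L 'b \<Rightarrow> 'a \<Rightarrow>\<^sub>C\<^sub>L 'b" is "(+)"
  by (simp add: plus_blinfun.rep_eq scaleC_add_right)

lift_definition minus_cblinfun :: "'a \<Rightarrow>\<^sub>C\<^sub>L 'b \<Rightarrow> 'a \<Rightarrow>\<^sub>C\<^sub>L 'b \<Rightarrow> 'a \<Rightarrow>\<^sub>C\<^sub>L 'b" is "(-)"
  by (simp add: minus_blinfun.rep_eq scaleC_linear_simps)

lift_definition uminus_cblinfun :: "'a \<Rightarrow>\<^sub>C\<^sub>L 'b \<Rightarrow> 'a \<Rightarrow>\<^sub>C\<^sub>L 'b" is uminus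
  by (simp add: uminus_blinfun.rep_eq scaleC_linear_simps)

lift_definition scaleR_cblinfun :: "real \<Rightarrow> 'a \<Rightarrow>\<^sub>C\<^sub>L 'b \<Rightarrow> 'a \<Rightarrow>\<^sub>C\<^sub>L 'b" is "(*\<^sub>R)"
  by (simp add: scaleR_blinfun.rep_eq scaleC_linear_simps)

lift_definition scaleC_cblinfun :: "complex \<Rightarrow> 'a \<Rightarrow>\<^sub>C\<^sub>L 'b \<Rightarrow> 'a \<Rightarrow>\<^sub>C\<^sub>L 'b"
  is "\<lambda>c f. Blinfun (\<lambda>x. c *\<^sub>C blinfun_apply f x)"
  by (simp add: bounded_linear_Blinfun_apply scaleC_scaleC mult.commute
      bounded_linear_compose[OF bounded_linear_scaleC blinfun.bounded_linear_right])

definition dist_cblinfun :: "'a \<Rightarrow>\<^sub>C\<^sub>L 'b \<Rightarrow> 'a \<Rightarrow>\<^sub>C\<^sub>L 'b \<Rightarrow> real"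
  where "dist_cblinfun a b = norm (a - b)"

definition [code del]:
  "(uniformity :: (('a \<Rightarrow>\<^sub>C\<^sub>L 'b) \<times> ('a \<Rightarrow>\<^sub>C\<^sub>L 'b)) filter) = (INF e\<in>{0 <..}. principal {(x, y). dist x y < e})"

definition open_cblinfun :: "('a \<Rightarrow>\<^sub>C\<^sub>L 'b) set \<Rightarrow> bool"
  where [code del]: "open_cblinfun S = (\<forall>x\<in>S. \<forall>\<^sub>F (x', y) in uniformity. x' = x \<longrightarrow> y \<in> S)"

definition sgn_cblinfun :: "'a \<Rightarrow>\<^sub>C\<^sub>L 'b \<Rightarrow> 'a \<Rightarrow>\<^sub>C\<^sub>L 'b"
  where "sgn_cblinfun x = scaleR (inverse (norm x)) x"

lemma cblinfun_scaleC_apply: "(c *\<^sub>C f) *\<^sub>V x = c *\<^sub>C (f *\<^sub>V x)" for f :: "'a \<Rightarrow>\<^sub>C\<^sub>L 'b"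
  by transfer
    (simp add: bounded_linear_Blinfun_apply
      bounded_linear_compose[OF bounded_linear_scaleC blinfun.bounded_linear_right])

lemma cblinfun_eqI: "(\<And>x. f *\<^sub>V x = g *\<^sub>V x) \<Longrightarrow> f = g" for f g :: "'a \<Rightarrow>\<^sub>C\<^sub>L 'b"
  by transfer (simp add: blinfun_eqI)

lemma cblinfun_plus_apply: "(f + g) *\<^sub>V x = f *\<^sub>V x + g *\<^sub>V x" for f g :: "'a \<Rightarrow>\<^sub>C\<^sub>L 'b"
  by transfer (simp add: plus_blinfun.rep_eq)

lemma cblinfun_scaleR_apply: "(r *\<^sub>R f) *\<^sub>V x = r *\<^sub>R (f *\<^sub>V x)" for f :: "'a \<Rightarrow>\<^sub>C\<^sub>L 'b"
  by transfer (simp add: scaleR_blinfun.rep_eq)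

lemma norm_cblinfun_scaleC: "norm (c *\<^sub>C f) = cmod c * norm f" for f :: "'a \<Rightarrow>\<^sub>C\<^sub>L 'b"
proof (transfer fixing: c)
  fix f :: "'a \<Rightarrow>\<^sub>L 'b"
  have "bounded_linear (\<lambda>x. c *\<^sub>C blinfun_apply f x)"
    by (rule bounded_linear_compose[OF bounded_linear_scaleC blinfun.bounded_linear_right])
  then have "norm (Blinfun (\<lambda>x. c *\<^sub>C blinfun_apply f x)) = onorm (\<lambda>x. c *\<^sub>C blinfun_apply f x)"
    by (simp add: norm_blinfun.rep_eq bounded_linear_Blinfun_apply)
  also have "\<dots> = onorm (\<lambda>x. cmod c *\<^sub>R blinfun_apply f x)"
    by (simp add: onorm_def norm_scaleC)
  also have "\<dots> = cmod c * norm f"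
    by (simp add: onorm_scaleR[OF blinfun.bounded_linear_right] norm_blinfun.rep_eq)
  finally show "norm (Blinfun (\<lambda>x. c *\<^sub>C blinfun_apply f x)) = cmod c * norm f" .
qed

instance
proof
  fix f g :: "'a \<Rightarrow>\<^sub>C\<^sub>L 'b" and c d :: complex and r :: real
  show "c *\<^sub>C (f + g) = c *\<^sub>C f + c *\<^sub>C g"
    by (rule cblinfun_eqI) (simp add: cblinfun_scaleC_apply cblinfun_plus_apply scaleC_add_right)
  show "(c + d) *\<^sub>C f = c *\<^sub>C f + d *\<^sub>C f"
    by (rule cblinfun_eqI) (simp add: cblinfun_scaleC_apply cblinfun_plus_apply scaleC_add_left)
  show "c *\<^sub>C (d *\<^sub>C f) = (c * d) *\<^sub>C f"
    by (rule cblinfun_eqI) (simp add: cblinfun_scaleC_apply scaleC_scaleC)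
  show "complex_of_real r *\<^sub>C f = r *\<^sub>R f"
    by (rule cblinfun_eqI) (simp add: cblinfun_scaleC_apply cblinfun_scaleR_apply scaleC_of_real)
  show "norm (c *\<^sub>C f) = cmod c * norm f"
    by (rule norm_cblinfun_scaleC)
qed (unfold dist_cblinfun_def open_cblinfun_def sgn_cblinfun_def uniformity_cblinfun_def,
    (rule refl | (transfer, simp add: algebra_simps norm_triangle_ineq))+)

end

instance cblinfun :: (complex_normed_vector, complex_banach) complex_banach
proof
  fix X :: "nat \<Rightarrow> 'a \<Rightarrow>\<^sub>C\<^sub>L 'b"
  assume X: "Cauchy X"
  have d: "dist (blinfun_of_cblinfun a) (blinfun_of_cblinfun b) = dist a b" for a b :: "'a \<Rightarrow>\<^sub>C\<^sub>L 'b"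
    by (simp add: dist_norm norm_cblinfun.rep_eq minus_cblinfun.rep_eq)
  have "Cauchy (\<lambda>n. blinfun_of_cblinfun (X n))"
    using X unfolding Cauchy_def d .
  have hom: "blinfun_apply (blinfun_of_cblinfun (X n)) (c *\<^sub>C x) =
      c *\<^sub>C blinfun_apply (blinfun_of_cblinfun (X n)) x" for n c x
    using blinfun_of_cblinfun[of "X n"] by simp
  from \<open>Cauchy (\<lambda>n. blinfun_of_cblinfun (X n))\<close>
  obtain L where L: "(\<lambda>n. blinfun_of_cblinfun (X n)) \<longlonglongrightarrow> L"
    using Cauchy_convergent convergent_def by blast
  have "blinfun_apply L (c *\<^sub>C x) = c *\<^sub>C blinfun_apply L x" for c x
  proof (rule LIMSEQ_unique)
    show "(\<lambda>n. blinfun_apply (blinfun_of_cblinfun (X n)) (c *\<^sub>C x)) \<longlonglongrightarrow> blinfun_apply L (c *\<^sub>C x)"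
      by (intro tendsto_intros L)
    have "(\<lambda>n. c *\<^sub>C blinfun_apply (blinfun_of_cblinfun (X n)) x) \<longlonglongrightarrow> c *\<^sub>C blinfun_apply L x"
      by (intro bounded_linear.tendsto[OF bounded_linear_scaleC] tendsto_intros L)
    then show "(\<lambda>n. blinfun_apply (blinfun_of_cblinfun (X n)) (c *\<^sub>C x)) \<longlonglongrightarrow> c *\<^sub>C blinfun_apply L x"
      by (simp add: hom)
  qed
  then have "blinfun_of_cblinfun (Abs_cblinfun L) = L"
    by (simp add: Abs_cblinfun_inverse)
  then have "(\<lambda>n. dist (X n) (Abs_cblinfun L)) \<longlonglongrightarrow> 0"
    using L by (simp add: d[symmetric] tendsto_dist_iff[symmetric])
  then show "convergent X"
    unfolding convergent_def using tendsto_dist_iff by blast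
qed

text \<open>Adjoint, acting between the spaces of bounded complex-linear functionals, and the
  inverse of the (antilinear) Riesz identification of a Hilbert space with its dual.\<close>

definition cadjoint ::
  "('a::complex_normed_vector \<Rightarrow>\<^sub>C\<^sub>L 'b::complex_normed_vector) \<Rightarrow> ('b \<Rightarrow>\<^sub>C\<^sub>L complex) \<Rightarrow> ('a \<Rightarrow>\<^sub>C\<^sub>L complex)"
  where "cadjoint S \<phi> = \<phi> o\<^sub>C\<^sub>L S"

definition riesz_vector :: "('u::complex_hilbert \<Rightarrow>\<^sub>C\<^sub>L complex) \<Rightarrow> 'u"
  where "riesz_vector \<phi> = (THE v. \<forall>x. \<phi> *\<^sub>V x = cinner v x)"

definition reflexive_space :: "'a::complex_normed_vector itself \<Rightarrow> bool"
  where "reflexive_space _ \<longleftrightarrow>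
    (\<forall>F :: ('a \<Rightarrow>\<^sub>C\<^sub>L complex) \<Rightarrow>\<^sub>C\<^sub>L complex. \<exists>x. \<forall>\<phi>. F *\<^sub>V \<phi> = \<phi> *\<^sub>V x)"

definition uniformly_convex :: "'a::real_normed_vector itself \<Rightarrow> bool"
  where "uniformly_convex _ \<longleftrightarrow>
    (\<forall>\<epsilon>>0. \<exists>\<delta>>0. \<forall>x y :: 'a. norm x = 1 \<longrightarrow> norm y = 1 \<longrightarrow> \<epsilon> \<le> norm (x - y) \<longrightarrow>
       norm ((1/2) *\<^sub>R (x + y)) \<le> 1 - \<delta>)"

definition compact_operator :: "('a::complex_normed_vector \<Rightarrow>\<^sub>C\<^sub>L 'b::complex_normed_vector) \<Rightarrow> bool"
  where "compact_operator S \<longleftrightarrow> (\<forall>E. bounded E \<longrightarrow> compact (closure (cblinfun_apply S ` E)))"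

section \<open>Vector-valued functions\<close>

definition sector :: "real \<Rightarrow> complex set"
  where "sector \<nu> = {l. l \<noteq> 0 \<and> \<bar>Arg l\<bar> < \<nu>}"

definition banach_analytic_on :: "(complex \<Rightarrow> 'a::complex_normed_vector) \<Rightarrow> complex set \<Rightarrow> bool"
  where "banach_analytic_on F S \<longleftrightarrow>
    (\<forall>l\<in>S. \<exists>D. (F has_derivative (\<lambda>h. h *\<^sub>C D)) (at l))"

text \<open>Strong (Bochner) measurability: almost everywhere limit of simple functions.  Needed because
  Borel measurability is weaker than this when the range space is not separable.\<close>

definition strongly_measurable :: "'s measure \<Rightarrow> ('s \<Rightarrow> 'a::real_normed_vector) \<Rightarrow> bool"
  where "strongly_measurable M f \<longleftrightarrow>
    (\<exists>s. (\<forall>i::nat. simple_function M (s i)) \<and> (AE x in M. (\<lambda>i. s i x) \<longlonglongrightarrow> f x))"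

definition L2_function :: "real \<Rightarrow> (real \<Rightarrow> 'a::real_normed_vector) \<Rightarrow> bool"
  where "L2_function T u \<longleftrightarrow>
    strongly_measurable (lebesgue_on {0..T}) u \<and>
    set_integrable lebesgue {0..T} (\<lambda>t. (norm (u t))\<^sup>2)"

definition laplace_converges ::
  "(real \<Rightarrow> 'a::{complex_banach, second_countable_topology}) \<Rightarrow> complex \<Rightarrow> bool"
  where "laplace_converges g l \<longleftrightarrow>
    set_integrable lebesgue {0..} (\<lambda>t. exp (- l * complex_of_real t) *\<^sub>C g t)"

definition laplace_transform ::
  "(real \<Rightarrow> 'a::{complex_banach, second_countable_topology}) \<Rightarrow> complex \<Rightarrow> 'a"
  where "laplace_transform g l =
    (LINT t:{0..}|lebesgue. exp (- l * complex_of_real t) *\<^sub>C g t)"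

text \<open>\<open>h\<close> belongs to \<open>W\<^sup>1\<^sup>,\<^sup>1(0,T)\<close> with derivative \<open>g\<close>: up to a null set, \<open>h\<close> agrees with an
  absolutely continuous \<open>k\<close> whose almost everywhere derivative is the integrable function \<open>g\<close>.\<close>

definition has_W11_derivative ::
  "real \<Rightarrow> (real \<Rightarrow> 'a::{banach, second_countable_topology}) \<Rightarrow> (real \<Rightarrow> 'a) \<Rightarrow> bool"
  where "has_W11_derivative T h g \<longleftrightarrow>
    set_integrable lebesgue {0..T} g \<and>
    (\<exists>k. (AE t\<in>{0..T} in lebesgue. h t = k t) \<and>
         (\<forall>t\<in>{0..T}. k t = k 0 + (LINT s:{0..t}|lebesgue. g s)) \<and>
         (AE t\<in>{0..T} in lebesgue. (k has_vector_derivative g t) (at t within {0..T})))"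

section \<open>Unbounded operators\<close>

text \<open>An operator with domain \<open>D\<close> is given by \<open>D\<close> and a total function whose values outside
  \<open>D\<close> are irrelevant.\<close>

definition csubspace :: "'a::complex_normed_vector set \<Rightarrow> bool"
  where "csubspace D \<longleftrightarrow>
    0 \<in> D \<and> (\<forall>x\<in>D. \<forall>y\<in>D. x + y \<in> D) \<and> (\<forall>c. \<forall>x\<in>D. c *\<^sub>C x \<in> D)"

definition clinear_on ::
  "'a::complex_normed_vector set \<Rightarrow> ('a \<Rightarrow> 'b::complex_normed_vector) \<Rightarrow> bool"
  where "clinear_on D S \<longleftrightarrow>
    (\<forall>x\<in>D. \<forall>y\<in>D. S (x + y) = S x + S y) \<and> (\<forall>c. \<forall>x\<in>D. S (c *\<^sub>C x) = c *\<^sub>C S x)"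

definition closed_linear_operator ::
  "'a::complex_normed_vector set \<Rightarrow> ('a \<Rightarrow> 'a) \<Rightarrow> bool"
  where "closed_linear_operator D S \<longleftrightarrow>
    csubspace D \<and> clinear_on D S \<and> closed ((\<lambda>x. (x, S x)) ` D)"

definition graph_norm :: "('a::complex_normed_vector \<Rightarrow> 'a) \<Rightarrow> 'a \<Rightarrow> real"
  where "graph_norm A z = norm z + norm (A z)"

text \<open>The space \<open>L(D\<^sub>1(A); W)\<close> and its norm.  As in \<^const>\<open>onorm\<close>, the point \<open>z = 0\<close>
  contributes \<open>0 / 0 = 0\<close> to the supremum.\<close>

definition graph_bounded ::
  "'a::complex_normed_vector set \<Rightarrow> ('a \<Rightarrow> 'a) \<Rightarrow> ('a \<Rightarrow> 'a) \<Rightarrow> bool"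
  where "graph_bounded D A S \<longleftrightarrow>
    clinear_on D S \<and> (\<exists>K. \<forall>z\<in>D. norm (S z) \<le> K * graph_norm A z)"

definition graph_opnorm ::
  "'a::complex_normed_vector set \<Rightarrow> ('a \<Rightarrow> 'a) \<Rightarrow> ('a \<Rightarrow> 'a) \<Rightarrow> real"
  where "graph_opnorm D A S = (SUP z\<in>D. norm (S z) / graph_norm A z)"

definition graph_analytic_on ::
  "'a::complex_normed_vector set \<Rightarrow> ('a \<Rightarrow> 'a) \<Rightarrow> (complex \<Rightarrow> 'a \<Rightarrow> 'a) \<Rightarrow> complex set \<Rightarrow> bool"
  where "graph_analytic_on D A F S \<longleftrightarrow>
    (\<forall>l\<in>S. graph_bounded D A (F l)) \<and>
    (\<forall>l\<in>S. \<exists>L. graph_bounded D A L \<and>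
       ((\<lambda>m. graph_opnorm D A (\<lambda>z. inverse (m - l) *\<^sub>C (F m z - F l z) - L z)) \<longlongrightarrow> 0) (at l))"

definition is_resolvent_at ::
  "'a::complex_normed_vector set \<Rightarrow> ('a \<Rightarrow> 'a) \<Rightarrow> complex \<Rightarrow> ('a \<Rightarrow>\<^sub>C\<^sub>L 'a) \<Rightarrow> bool"
  where "is_resolvent_at D A l S \<longleftrightarrow>
    (\<forall>z. S *\<^sub>V z \<in> D \<and> l *\<^sub>C (S *\<^sub>V z) - A (S *\<^sub>V z) = z) \<and>
    (\<forall>z\<in>D. S *\<^sub>V (l *\<^sub>C z - A z) = z)"

definition resolvent_set :: "'a::complex_normed_vector set \<Rightarrow> ('a \<Rightarrow> 'a) \<Rightarrow> complex set"
  where "resolvent_set D A = {l. \<exists>S. is_resolvent_at D A l S}"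

definition resolvent ::
  "'a::complex_normed_vector set \<Rightarrow> ('a \<Rightarrow> 'a) \<Rightarrow> complex \<Rightarrow> ('a \<Rightarrow>\<^sub>C\<^sub>L 'a)"
  where "resolvent D A l = (THE S. is_resolvent_at D A l S)"

definition generates_analytic_semigroup ::
  "'a::complex_normed_vector set \<Rightarrow> ('a \<Rightarrow> 'a) \<Rightarrow> bool"
  where "generates_analytic_semigroup D A \<longleftrightarrow>
    (\<exists>(S :: complex \<Rightarrow> 'a \<Rightarrow>\<^sub>C\<^sub>L 'a) \<delta>. 0 < \<delta> \<and> \<delta> \<le> pi / 2 \<and>
       banach_analytic_on S (sector \<delta>) \<and>
       S 0 = id_cblinfun \<and>
       (\<forall>a\<in>insert 0 (sector \<delta>). \<forall>b\<in>insert 0 (sector \<delta>). S (a + b) = S a o\<^sub>C\<^sub>L S b) \<and>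
       (\<forall>z. ((\<lambda>a. S a *\<^sub>V z) \<longlongrightarrow> z) (at 0 within sector \<delta>)) \<and>
       D = {z. \<exists>y. ((\<lambda>h. (1 / h) *\<^sub>R (S (complex_of_real h) *\<^sub>V z - z)) \<longlongrightarrow> y) (at_right 0)} \<and>
       (\<forall>z\<in>D. ((\<lambda>h. (1 / h) *\<^sub>R (S (complex_of_real h) *\<^sub>V z - z)) \<longlongrightarrow> A z) (at_right 0)))"

section \<open>The standing conditions\<close>

text \<open>\<open>Ghat\<close> and \<open>Nhat\<close> are the analytic extensions to \<open>sector \<nu>\<close> of the Laplace transforms of
  \<open>G\<close> and \<open>N\<close>; their values outside the sector are irrelevant.\<close>

definition Cd1 ::
  "real \<Rightarrow> 'w::complex_banach set \<Rightarrow> ('w \<Rightarrow> 'w) \<Rightarrow> bool"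
  where "Cd1 \<nu> DA A \<longleftrightarrow>
    generates_analytic_semigroup DA A \<and>
    pi / 2 < \<nu> \<and> \<nu> < pi \<and>
    sector \<nu> \<subseteq> resolvent_set DA A \<and>
    (\<exists>M0>0. \<forall>l\<in>sector \<nu>. norm (resolvent DA A l) \<le> M0 / cmod l)"

definition Cd2 ::
  "real \<Rightarrow> real \<Rightarrow> 'w::{complex_banach, second_countable_topology} set \<Rightarrow> ('w \<Rightarrow> 'w) \<Rightarrow>
   (real \<Rightarrow> 'w \<Rightarrow>\<^sub>C\<^sub>L 'w) \<Rightarrow> (complex \<Rightarrow> 'w \<Rightarrow>\<^sub>C\<^sub>L 'w) \<Rightarrow> bool"
  where "Cd2 \<nu> \<alpha> DA A G Ghat \<longleftrightarrow>
    (\<forall>z. continuous_on {0..} (\<lambda>t. G t *\<^sub>V z)) \<and>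
    (\<forall>z l. Re l > 0 \<longrightarrow> laplace_converges (\<lambda>t. G t *\<^sub>V z) l \<and>
        Ghat l *\<^sub>V z = laplace_transform (\<lambda>t. G t *\<^sub>V z) l) \<and>
    \<alpha> > 0 \<and>
    banach_analytic_on Ghat (sector \<nu>) \<and>
    (\<exists>N1>0. \<forall>l\<in>sector \<nu>. norm (Ghat l) \<le> N1 * cmod l powr (- \<alpha>)) \<and>
    (\<exists>N2>0. \<forall>l\<in>sector \<nu>. \<forall>z\<in>DA. norm (Ghat l *\<^sub>V z) \<le> N2 / cmod l * graph_norm A z)"

definition Cd3 ::
  "real \<Rightarrow> 'w::{complex_banach, second_countable_topology} set \<Rightarrow> ('w \<Rightarrow> 'w) \<Rightarrow>
   (real \<Rightarrow> 'w set) \<Rightarrow> (real \<Rightarrow> 'w \<Rightarrow> 'w) \<Rightarrow> (complex \<Rightarrow> 'w \<Rightarrow> 'w) \<Rightarrow> bool"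
  where "Cd3 \<nu> DA A DN N Nhat \<longleftrightarrow>
    (\<forall>t\<ge>0. closed_linear_operator (DN t) (N t) \<and> DA \<subseteq> DN t) \<and>
    (\<forall>z\<in>DA. strongly_measurable (lebesgue_on {0<..}) (\<lambda>t. N t z)) \<and>
    (\<exists>P :: real \<Rightarrow> real.
       (\<forall>b. set_integrable lebesgue {0..b} P) \<and>
       (\<forall>l. Re l > 0 \<longrightarrow> laplace_converges (\<lambda>t. complex_of_real (P t)) l) \<and>
       (\<forall>t>0. \<forall>z\<in>DA. norm (N t z) \<le> P t * graph_norm A z)) \<and>
    (\<forall>z\<in>DA. \<forall>l. Re l > 0 \<longrightarrow> Nhat l z = laplace_transform (\<lambda>t. N t z) l) \<and>
    graph_analytic_on DA A Nhat (sector \<nu>) \<and>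
    (\<forall>l\<in>sector \<nu>. \<forall>z\<in>DA. norm (Nhat l z) \<le> graph_opnorm DA A (Nhat l) * graph_norm A z) \<and>
    ((\<lambda>l. graph_opnorm DA A (Nhat l)) \<longlongrightarrow> 0) (inf at_infinity (principal (sector \<nu>)))"

definition Cd4 ::
  "real \<Rightarrow> real \<Rightarrow> 'w::complex_banach set \<Rightarrow> ('w \<Rightarrow> 'w) \<Rightarrow>
   (complex \<Rightarrow> 'w \<Rightarrow>\<^sub>C\<^sub>L 'w) \<Rightarrow> (complex \<Rightarrow> 'w \<Rightarrow> 'w) \<Rightarrow> bool"
  where "Cd4 \<nu> \<alpha> DA A Ghat Nhat \<longleftrightarrow>
    (\<exists>Y M1 M2. csubspace Y \<and> Y \<subseteq> DA \<and>
       (\<forall>z\<in>DA. \<forall>\<epsilon>>0. \<exists>y\<in>Y. graph_norm A (z - y) < \<epsilon>) \<and>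
       M1 > 0 \<and> M2 > 0 \<and>
       A ` Y \<subseteq> DA \<and>
       (\<forall>l\<in>sector \<nu>. Nhat l ` Y \<subseteq> DA \<and> cblinfun_apply (Ghat l) ` Y \<subseteq> DA) \<and>
       (\<forall>l\<in>sector \<nu>. \<forall>z\<in>Y.
          norm (A (Nhat l z)) \<le> M1 * graph_norm A z \<and>
          graph_norm A (Ghat l *\<^sub>V z) \<le> M2 * cmod l powr (- \<alpha>) * graph_norm A z))"

section \<open>The resolvent operator of the homogeneous problem\<close>

definition resolvent_operator ::
  "'w::{complex_banach, second_countable_topology} set \<Rightarrow> ('w \<Rightarrow> 'w) \<Rightarrow> (real \<Rightarrow> 'w \<Rightarrow>\<^sub>C\<^sub>L 'w) \<Rightarrow>
   (real \<Rightarrow> 'w \<Rightarrow> 'w) \<Rightarrow> (real \<Rightarrow> 'w \<Rightarrow>\<^sub>C\<^sub>L 'w) \<Rightarrow> bool"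
  where "resolvent_operator DA A G N R \<longleftrightarrow>
    (\<exists>M \<omega>. \<forall>t\<ge>0. norm (R t) \<le> M * exp (\<omega> * t)) \<and>
    (\<forall>z. continuous_on {0..} (\<lambda>t. R t *\<^sub>V z)) \<and>
    R 0 = id_cblinfun \<and>
    (\<forall>z\<in>DA.
       (\<forall>t\<ge>0. R t *\<^sub>V z \<in> DA) \<and>
       continuous_on {0..} (\<lambda>t. A (R t *\<^sub>V z)) \<and>
       (\<exists>R'. continuous_on {0<..} R' \<and>
          (\<forall>t>0. ((\<lambda>t. R t *\<^sub>V z) has_vector_derivative R' t) (at t))) \<and>
       (\<forall>t\<ge>0.
          ((\<lambda>t. R t *\<^sub>V z + (LINT s:{0..t}|lebesgue. G (t - s) *\<^sub>V R s *\<^sub>V z)) has_vector_derivative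
             (A (R t *\<^sub>V z) + (LINT s:{0..t}|lebesgue. N (t - s) (R s *\<^sub>V z)))) (at t within {0..}) \<and>
          ((\<lambda>t. R t *\<^sub>V z + (LINT s:{0..t}|lebesgue. R (t - s) *\<^sub>V G s *\<^sub>V z)) has_vector_derivative
             (R t *\<^sub>V A z + (LINT s:{0..t}|lebesgue. R (t - s) *\<^sub>V N s z))) (at t within {0..})))"

section \<open>The phase space\<close>

text \<open>A function on \<open>(-\<infinity>, 0]\<close> is encoded as a total function that vanishes on \<open>(0, \<infinity>)\<close>;
  \<open>segment z t\<close> is \<open>z\<^sub>t\<close> in this encoding and depends only on the values of \<open>z\<close> on \<open>(-\<infinity>, t]\<close>.\<close>

definition segment :: "(real \<Rightarrow> 'w::zero) \<Rightarrow> real \<Rightarrow> (real \<Rightarrow> 'w)"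
  where "segment z t = (\<lambda>\<theta>. if \<theta> \<le> 0 then z (t + \<theta>) else 0)"

definition seminormed_function_space ::
  "(real \<Rightarrow> 'w::complex_banach) set \<Rightarrow> ((real \<Rightarrow> 'w) \<Rightarrow> real) \<Rightarrow> bool"
  where "seminormed_function_space \<BB> p \<longleftrightarrow>
    (\<forall>\<phi>\<in>\<BB>. \<forall>\<theta>>0. \<phi> \<theta> = 0) \<and>
    (\<lambda>\<theta>. 0) \<in> \<BB> \<and>
    (\<forall>\<phi>\<in>\<BB>. \<forall>\<psi>\<in>\<BB>. (\<lambda>\<theta>. \<phi> \<theta> + \<psi> \<theta>) \<in> \<BB> \<and> p (\<lambda>\<theta>. \<phi> \<theta> + \<psi> \<theta>) \<le> p \<phi> + p \<psi>) \<and>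
    (\<forall>c. \<forall>\<phi>\<in>\<BB>. (\<lambda>\<theta>. c *\<^sub>C \<phi> \<theta>) \<in> \<BB> \<and> p (\<lambda>\<theta>. c *\<^sub>C \<phi> \<theta>) = cmod c * p \<phi>)"

definition phase_space ::
  "(real \<Rightarrow> 'w::complex_banach) set \<Rightarrow> ((real \<Rightarrow> 'w) \<Rightarrow> real) \<Rightarrow> bool"
  where "phase_space \<BB> p \<longleftrightarrow>
    seminormed_function_space \<BB> p \<and>
    (\<exists>K1 \<Lambda> \<Upsilon>.
       continuous_on {0..} \<Lambda> \<and> (\<forall>t\<ge>0. \<Lambda> t \<ge> 1) \<and>
       (\<forall>b. bounded (\<Upsilon> ` {0..b})) \<and> (\<forall>t\<ge>0. \<Upsilon> t \<ge> 1) \<and>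
       (\<forall>z \<sigma> \<tau>. \<tau> > 0 \<longrightarrow> continuous_on {\<sigma>..<\<sigma> + \<tau>} z \<longrightarrow> segment z \<sigma> \<in> \<BB> \<longrightarrow>
          (\<forall>t\<in>{\<sigma>..<\<sigma> + \<tau>}.
             segment z t \<in> \<BB> \<and>
             norm (z t) \<le> K1 * p (segment z t) \<and>
             p (segment z t) \<le> \<Lambda> (t - \<sigma>) * (SUP s\<in>{\<sigma>..t}. norm (z s))
                               + \<Upsilon> (t - \<sigma>) * p (segment z \<sigma>)))) \<and>
    (\<forall>z \<sigma> \<tau>. \<tau> > 0 \<longrightarrow> continuous_on {\<sigma>..<\<sigma> + \<tau>} z \<longrightarrow> segment z \<sigma> \<in> \<BB> \<longrightarrow>
       (\<forall>t\<in>{\<sigma>..<\<sigma> + \<tau>}.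
          ((\<lambda>s. p (\<lambda>\<theta>. segment z s \<theta> - segment z t \<theta>)) \<longlongrightarrow> 0) (at t within {\<sigma>..<\<sigma> + \<tau>}))) \<and>
    (\<forall>X :: nat \<Rightarrow> real \<Rightarrow> 'w. (\<forall>n. X n \<in> \<BB>) \<longrightarrow>
       (\<forall>\<epsilon>>0. \<exists>n0. \<forall>m\<ge>n0. \<forall>n\<ge>n0. p (\<lambda>\<theta>. X m \<theta> - X n \<theta>) < \<epsilon>) \<longrightarrow>
       (\<exists>\<phi>\<in>\<BB>. (\<lambda>n. p (\<lambda>\<theta>. X n \<theta> - \<phi> \<theta>)) \<longlonglongrightarrow> 0))"

definition seminorm_continuous_on ::
  "(real \<Rightarrow> 'w::real_normed_vector) set \<Rightarrow> ((real \<Rightarrow> 'w) \<Rightarrow> real) \<Rightarrow> ((real \<Rightarrow> 'w) \<Rightarrow> 'w) \<Rightarrow> bool"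
  where "seminorm_continuous_on \<BB> p F \<longleftrightarrow>
    (\<forall>\<phi>\<in>\<BB>. \<forall>\<epsilon>>0. \<exists>\<delta>>0. \<forall>\<psi>\<in>\<BB>. p (\<lambda>\<theta>. \<psi> \<theta> - \<phi> \<theta>) < \<delta> \<longrightarrow> norm (F \<psi> - F \<phi>) < \<epsilon>)"

section \<open>Mild solutions and approximate controllability\<close>

definition history_G ::
  "(real \<Rightarrow> 'w::{complex_banach, second_countable_topology} \<Rightarrow>\<^sub>C\<^sub>L 'w) \<Rightarrow> (real \<Rightarrow> 'w) \<Rightarrow> real \<Rightarrow> 'w"
  where "history_G G \<psi> t = - (LINT s:{..0}|lebesgue. G (t - s) *\<^sub>V \<psi> s)"

definition history_N ::
  "(real \<Rightarrow> 'w::{complex_banach, second_countable_topology} \<Rightarrow> 'w) \<Rightarrow> (real \<Rightarrow> 'w) \<Rightarrow> real \<Rightarrow> 'w"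
  where "history_N N \<psi> t = (LINT s:{..0}|lebesgue. N (t - s) (\<psi> s))"

text \<open>The initial functions considered.  The integrals defining \<open>f\<^sub>1\<close> and \<open>f\<^sub>2\<close> are required to
  exist for almost every \<open>t\<close> (a non-existing integral would be \<open>0\<close> by convention), and
  \<open>f1'\<close> is the derivative of \<open>f\<^sub>1\<close>, which is determined up to a null set.\<close>

definition admissible_history ::
  "real \<Rightarrow> (real \<Rightarrow> 'w::{complex_banach, second_countable_topology} \<Rightarrow>\<^sub>C\<^sub>L 'w) \<Rightarrow>
   (real \<Rightarrow> 'w set) \<Rightarrow> (real \<Rightarrow> 'w \<Rightarrow> 'w) \<Rightarrow> (real \<Rightarrow> 'w) \<Rightarrow> (real \<Rightarrow> 'w) \<Rightarrow> bool"
  where "admissible_history T G DN N \<psi> f1' \<longleftrightarrow>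
    (AE t\<in>{0..T} in lebesgue. set_integrable lebesgue {..0} (\<lambda>s. G (t - s) *\<^sub>V \<psi> s)) \<and>
    has_W11_derivative T (history_G G \<psi>) f1' \<and>
    (AE t\<in>{0..T} in lebesgue.
       (AE s\<in>{..0} in lebesgue. \<psi> s \<in> DN (t - s)) \<and>
       set_integrable lebesgue {..0} (\<lambda>s. N (t - s) (\<psi> s))) \<and>
    set_integrable lebesgue {0..T} (history_N N \<psi>)"

definition mild_solution ::
  "real \<Rightarrow> (real \<Rightarrow> 'w::{complex_banach, second_countable_topology} \<Rightarrow>\<^sub>C\<^sub>L 'w) \<Rightarrow>
   (real \<Rightarrow> 'w \<Rightarrow> 'w) \<Rightarrow> ('u::complex_hilbert \<Rightarrow>\<^sub>C\<^sub>L 'w) \<Rightarrow> (real \<Rightarrow> (real \<Rightarrow> 'w) \<Rightarrow> 'w) \<Rightarrow>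
   (real \<Rightarrow> 'w) \<Rightarrow> (real \<Rightarrow> 'w) \<Rightarrow> (real \<Rightarrow> 'u) \<Rightarrow> (real \<Rightarrow> 'w) \<Rightarrow> bool"
  where "mild_solution T R N B f \<psi> f1' u w \<longleftrightarrow>
    segment w 0 = \<psi> \<and>
    continuous_on {0..T} w \<and>
    (\<forall>t\<in>{0..T}.
       set_integrable lebesgue {0..t} (\<lambda>s. R (t - s) *\<^sub>V (B *\<^sub>V u s + f s (segment w s))) \<and>
       set_integrable lebesgue {0..t} (\<lambda>s. R (t - s) *\<^sub>V (f1' s + history_N N \<psi> s)) \<and>
       w t = R t *\<^sub>V \<psi> 0
           + (LINT s:{0..t}|lebesgue. R (t - s) *\<^sub>V (B *\<^sub>V u s + f s (segment w s)))
           + (LINT s:{0..t}|lebesgue. R (t - s) *\<^sub>V (f1' s + history_N N \<psi> s)))"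

definition approximately_controllable ::
  "real \<Rightarrow> (real \<Rightarrow> 'w::{complex_banach, second_countable_topology} \<Rightarrow>\<^sub>C\<^sub>L 'w) \<Rightarrow>
   (real \<Rightarrow> 'w \<Rightarrow>\<^sub>C\<^sub>L 'w) \<Rightarrow> (real \<Rightarrow> 'w set) \<Rightarrow> (real \<Rightarrow> 'w \<Rightarrow> 'w) \<Rightarrow>
   ('u::complex_hilbert \<Rightarrow>\<^sub>C\<^sub>L 'w) \<Rightarrow> (real \<Rightarrow> (real \<Rightarrow> 'w) \<Rightarrow> 'w) \<Rightarrow> (real \<Rightarrow> 'w) set \<Rightarrow> bool"
  where "approximately_controllable T R G DN N B f \<BB> \<longleftrightarrow>
    (\<forall>\<psi>\<in>\<BB>. \<forall>f1'. admissible_history T G DN N \<psi> f1' \<longrightarrow>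
       (\<forall>\<zeta>1. \<forall>\<epsilon>>0. \<exists>u w. L2_function T u \<and> mild_solution T R N B f \<psi> f1' u w \<and>
          norm (w T - \<zeta>1) \<le> \<epsilon>))"

section \<open>The control operators\<close>

definition duality_set :: "'w::complex_banach \<Rightarrow> ('w \<Rightarrow>\<^sub>C\<^sub>L complex) set"
  where "duality_set z =
    {\<phi>. \<phi> *\<^sub>V z = complex_of_real ((norm z)\<^sup>2) \<and> (norm z)\<^sup>2 = (norm \<phi>)\<^sup>2}"

definition duality_map :: "'w::complex_banach \<Rightarrow> ('w \<Rightarrow>\<^sub>C\<^sub>L complex)"
  where "duality_map z = the_elem (duality_set z)"

definition gramian ::
  "real \<Rightarrow> (real \<Rightarrow> 'w::{complex_banach, second_countable_topology} \<Rightarrow>\<^sub>C\<^sub>L 'w) \<Rightarrow>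
   ('u::complex_hilbert \<Rightarrow>\<^sub>C\<^sub>L 'w) \<Rightarrow> ('w \<Rightarrow>\<^sub>C\<^sub>L complex) \<Rightarrow> 'w"
  where "gramian T R B \<phi> =
    (LINT t:{0..T}|lebesgue.
       R (T - t) *\<^sub>V B *\<^sub>V riesz_vector (cadjoint B (cadjoint (R (T - t)) \<phi>)))"

definition gramian_resolvent ::
  "real \<Rightarrow> (real \<Rightarrow> 'w::{complex_banach, second_countable_topology} \<Rightarrow>\<^sub>C\<^sub>L 'w) \<Rightarrow>
   ('u::complex_hilbert \<Rightarrow>\<^sub>C\<^sub>L 'w) \<Rightarrow> real \<Rightarrow> 'w \<Rightarrow> 'w"
  where "gramian_resolvent T R B \<kappa> = inv (\<lambda>z. \<kappa> *\<^sub>R z + gramian T R B (duality_map z))"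

end

theory Submission
  imports Defs "HOL-Complex_Analysis.Complex_Analysis" "HOL-Probability.Sinc_Integral"
    "HOL-Probability.Characteristic_Functions"
begin

text \<open>Write \<open>\<Psi>\<close> for the Gramian. The equation \<open>\<kappa> z + \<Psi> (J z) = y\<close> is solvable for \<open>\<kappa> > 0\<close>: a minimiser of
  the quadratic functional \<open>\<kappa> / 2 \<parallel>\<phi>\<parallel>\<^sup>2 + \<langle>\<Psi> \<phi>, \<phi>\<rangle> / 2 - Re \<langle>y, \<phi>\<rangle>\<close> on the uniformly convex dual is \<open>J z\<close> for a
  solution \<open>z\<close>. By the hypothesis on \<open>\<kappa> z\<close>, the vectors \<open>\<Psi> (J z)\<close> tend to \<open>y\<close> as \<open>\<kappa>\<close> tends to \<open>0\<close>, so
  that every state is approximated by final states of the linear system started at \<open>0\<close>.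

  The Laplace transform of \<open>R\<close> is the inverse of the characteristic operator
  \<open>\<lambda> + \<lambda> Ghat(\<lambda>) - A - Nhat(\<lambda>)\<close>; it inherits compactness from the resolvent of \<open>A\<close>, and its difference
  between \<open>\<lambda>\<close> and \<open>\<lambda> + 1\<close> decays quadratically on vertical lines. Hence \<open>R\<close> is norm continuous and
  compact on \<open>(0, \<infinity>)\<close>, and convolution with \<open>R\<close> maps the functions dominated by \<open>\<gamma>\<close> to a relatively
  compact set of continuous functions. The corrections that the control has to produce at time \<open>T\<close>
  then range over a compact set, and Schauder's theorem applies to the closed-loop equation.\<close>

section \<open>Bounded complex-linear operators and the Hahn-Banach theorem\<close>

text \<open>The operators on a separable space need not form a separable space, so integrals are
  formed only after testing with a functional and a vector; estimates uniform in both become norm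
  estimates again by Hahn-Banach.

  The transform of \<open>R\<close> is identified without a contour integral. The resolvent equation
  with \<open>A\<close> to the right of \<open>R\<close> makes it a left inverse of the
  characteristic operator; a perturbation argument gives a right inverse \<open>Q\<close>; the two
  must agree.

  The bound available for the transform on a vertical line, of order \<open>1 / cmod l\<close>, is
  not integrable. Passing to the difference between \<open>l\<close> and \<open>l + 1\<close>
  multiplies \<open>R t\<close> by \<open>1 - exp (- t)\<close>, a weight that vanishes only at
  \<open>t = 0\<close>; norm continuity for \<open>t > 0\<close> survives division by it.

  The regularised inverse of the Gramian is nonlinear and is controlled for each state separately,
  with no common rate and no continuity to rely on. Only finitely many states can be steered to in
  this way, and compactness is what reduces the problem to finitely many.\<close>

lemma bounded_linear_cblinfun_apply: "bounded_linear (\<lambda>x. f *\<^sub>V x)"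
  by transfer (rule blinfun.bounded_linear_right)

lemmas cblinfun_linear_simps = linear_simps[OF bounded_linear_cblinfun_apply]

lemma cblinfun_apply_scaleC: "f *\<^sub>V (c *\<^sub>C x) = c *\<^sub>C (f *\<^sub>V x)"
  by transfer simp

lemma norm_cblinfun: "norm (f *\<^sub>V x) \<le> norm f * norm x"
  by transfer (rule norm_blinfun)

lemma norm_cblinfun_le: "norm f \<le> K \<Longrightarrow> norm (f *\<^sub>V x) \<le> K * norm x"
  by (meson mult_right_mono norm_cblinfun norm_ge_zero order_trans)

lemma norm_cblinfun_bound: "0 \<le> K \<Longrightarrow> (\<And>x. norm (f *\<^sub>V x) \<le> K * norm x) \<Longrightarrow> norm f \<le> K"
  by transfer (rule norm_blinfun_bound)

lemma cblinfun_minus_apply: "(f - g) *\<^sub>V x = f *\<^sub>V x - g *\<^sub>V x"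
  by transfer (simp add: minus_blinfun.rep_eq)

lemma cblinfun_zero_apply: "0 *\<^sub>V x = 0"
  by transfer simp

lemma cblinfun_sum_apply: "(\<Sum>i\<in>I. f i) *\<^sub>V x = (\<Sum>i\<in>I. f i *\<^sub>V x)"
  by (induction I rule: infinite_finite_induct) (simp_all add: cblinfun_zero_apply cblinfun_plus_apply)

lemma cblinfun_compose_apply: "(f o\<^sub>C\<^sub>L g) *\<^sub>V x = f *\<^sub>V g *\<^sub>V x"
  by transfer simp

lemma norm_cblinfun_compose: "norm (f o\<^sub>C\<^sub>L g) \<le> norm f * norm g"
  by transfer (rule norm_blinfun_compose)

lemma id_cblinfun_apply [simp]: "id_cblinfun *\<^sub>V x = x"
  by transfer simp

lemma cadjoint_apply: "cadjoint S \<phi> *\<^sub>V x = \<phi> *\<^sub>V S *\<^sub>V x"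
  by (simp add: cadjoint_def cblinfun_compose_apply)

lemma cblinfun_exists:
  assumes add: "\<And>x y. f (x + y) = f x + f y"
    and scale: "\<And>c x. f (c *\<^sub>C x) = c *\<^sub>C f x"
    and bound: "\<And>x. norm (f x) \<le> K * norm x"
  obtains F where "\<And>x. F *\<^sub>V x = f x"
proof -
  \<comment> \<open>Real homogeneity is the special case of a real scalar in
    \<open>scale\<close>.\<close>
  have bl: "bounded_linear f"
    by (rule bounded_linear_intro[where K = K])
      (simp_all add: add scaleC_of_real[symmetric] scale bound mult.commute)
  have app: "blinfun_apply (Blinfun f) = f"
    by (rule bounded_linear_Blinfun_apply[OF bl])
  then have "Abs_cblinfun (Blinfun f) *\<^sub>V x = f x" for x
    by (simp add: cblinfun_apply.rep_eq Abs_cblinfun_inverse scale)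
  then show thesis
    by (rule that)
qed

lemma bounded_linear_cblinfun_apply_left: "bounded_linear (\<lambda>f. f *\<^sub>V x)"
  by (rule bounded_linear_intro[where K = "norm x"])
    (simp_all add: cblinfun_plus_apply cblinfun_scaleR_apply norm_cblinfun)

lemma tendsto_cblinfun_apply:
  assumes "(f \<longlongrightarrow> a) F" "(g \<longlongrightarrow> b) F"
  shows "((\<lambda>x. f x *\<^sub>V g x) \<longlongrightarrow> a *\<^sub>V b) F"
proof -
  have "bounded_bilinear cblinfun_apply"
    by (unfold_locales)
      (auto simp: cblinfun_plus_apply cblinfun_scaleR_apply cblinfun_linear_simps
        intro!: exI[of _ 1] norm_cblinfun)
  then show ?thesis
    using assms by (rule bounded_bilinear.tendsto)
qed

lemma continuous_on_cblinfun_apply: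
  "continuous_on S f \<Longrightarrow> continuous_on S g \<Longrightarrow> continuous_on S (\<lambda>x. f x *\<^sub>V g x)"
  unfolding continuous_on_def by (auto intro: tendsto_cblinfun_apply)

section \<open>Sublinear functionals and the Hahn-Banach theorem\<close>

definition sublinear :: "('a::real_vector \<Rightarrow> real) \<Rightarrow> bool"
  where "sublinear q \<longleftrightarrow> (\<forall>x y. q (x + y) \<le> q x + q y) \<and> (\<forall>c x. 0 \<le> c \<longrightarrow> q (c *\<^sub>R x) = c * q x)"

lemma sublinear_zero: "sublinear q \<Longrightarrow> q 0 = 0"
  unfolding sublinear_def by (metis order_refl scale_zero_left mult_zero_left)

text \<open>Shearing a sublinear functional along \<open>y\<close> lowers its value at \<open>- y\<close> to \<open>- q y\<close>; hence a minimal
  sublinear functional is odd, that is, linear.\<close>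

lemma sublinear_shear:
  assumes q: "sublinear q"
  obtains q' where "sublinear q'" "\<And>x. q' x \<le> q x" "q' (- y) \<le> - q y"
proof -
  have add: "q (x + z) \<le> q x + q z" and scale: "0 \<le> c \<Longrightarrow> q (c *\<^sub>R x) = c * q x" for x z c
    using q by (auto simp: sublinear_def)
  \<comment> \<open>A move by \<open>t\<close> along \<open>y\<close> is discounted by
    \<open>t * q y\<close>. Taking \<open>t = 0\<close> shows that \<open>q'\<close> lies below
    \<open>q\<close>, and \<open>t = 1\<close> at the point \<open>- y\<close> gives
    \<open>q 0 - q y\<close>, the required drop.\<close>
  define S where "S x = (\<lambda>t. q (x + t *\<^sub>R y) - t * q y) ` {0..}" for x
  define q' where "q' x = Inf (S x)" for x
  have ne: "S x \<noteq> {}" for x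
    by (auto simp: S_def)
  have q0: "q 0 = 0"
    using scale[of 0 0] by simp
  \<comment> \<open>Subadditivity bounds the set below, so its infimum is a genuine one.\<close>
  have lower: "- q (- x) \<le> r" if "r \<in> S x" for r x
  proof -
    obtain t where t: "t \<ge> 0" "r = q (x + t *\<^sub>R y) - t * q y"
      using \<open>r \<in> S x\<close> by (auto simp: S_def)
    have "t * q y = q ((x + t *\<^sub>R y) + (- x))"
      using scale[of t y] t by simp
    also have "\<dots> \<le> q (x + t *\<^sub>R y) + q (- x)"
      by (rule add)
    finally show ?thesis
      using t by simp
  qed
  then have bdd: "bdd_below (S x)" for x
    by (auto simp: bdd_below_def)
  have q'_le: "q' x \<le> q (x + t *\<^sub>R y) - t * q y" if "t \<ge> 0" for x t
    unfolding q'_def by (rule cInf_lower) (use bdd that in \<open>auto simp: S_def\<close>)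
  have q'_ge: "b \<le> q' x" if "\<And>t. t \<ge> 0 \<Longrightarrow> b \<le> q (x + t *\<^sub>R y) - t * q y" for b x
    unfolding q'_def by (rule cInf_greatest[OF ne]) (use that in \<open>auto simp: S_def\<close>)
  have "sublinear q'"
    unfolding sublinear_def
  proof (intro conjI allI impI)
    fix x z
    have "q' (x + z) - (q (x + s *\<^sub>R y) - s * q y) \<le> q' z" if s: "s \<ge> 0" for s
    proof (rule q'_ge)
      fix t :: real assume t: "t \<ge> 0"
      have "q' (x + z) \<le> q ((x + z) + (s + t) *\<^sub>R y) - (s + t) * q y"
        using s t by (intro q'_le) auto
      also have "(x + z) + (s + t) *\<^sub>R y = (x + s *\<^sub>R y) + (z + t *\<^sub>R y)"
        by (simp add: algebra_simps)
      also have "q \<dots> \<le> q (x + s *\<^sub>R y) + q (z + t *\<^sub>R y)"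
        by (rule add)
      finally show "q' (x + z) - (q (x + s *\<^sub>R y) - s * q y) \<le> q (z + t *\<^sub>R y) - t * q y"
        by (simp add: algebra_simps)
    qed
    then have "q' (x + z) - q' z \<le> q' x"
      by (intro q'_ge) (smt (verit))
    then show "q' (x + z) \<le> q' x + q' z"
      by simp
  next
    fix c :: real and x
    assume c: "0 \<le> c"
    show "q' (c *\<^sub>R x) = c * q' x"
    proof (cases "c = 0")
      case True
      have "q' 0 \<le> 0"
        using q'_le[of 0 0] q0 by simp
      moreover have "0 \<le> q' 0"
        by (rule q'_ge) (simp add: scale)
      ultimately show ?thesis
        using True by simp
    next
      case False
      with c have c: "c > 0" by simp
      have eq: "q (c *\<^sub>R x + (c * t) *\<^sub>R y) = c * q (x + t *\<^sub>R y)" if "t \<ge> 0" for t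
        using scale[of c "x + t *\<^sub>R y"] c by (simp add: scaleR_add_right)
      have "c * q' x \<le> q' (c *\<^sub>R x)"
      proof (rule q'_ge)
        fix t :: real assume "t \<ge> 0"
        then have "q' x \<le> q (x + (t/c) *\<^sub>R y) - (t/c) * q y" and "t / c \<ge> 0"
          using c q'_le[of "t / c" x] by auto
        then have "c * q' x \<le> c * (q (x + (t/c) *\<^sub>R y) - (t/c) * q y)"
          using c by simp
        also have "\<dots> = q (c *\<^sub>R x + t *\<^sub>R y) - t * q y"
          using eq[OF \<open>t / c \<ge> 0\<close>] c by (simp add: right_diff_distrib)
        finally show "c * q' x \<le> q (c *\<^sub>R x + t *\<^sub>R y) - t * q y" .
      qed
      moreover have "q' (c *\<^sub>R x) / c \<le> q' x"
      proof (rule q'_ge)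
        fix t :: real assume t: "t \<ge> 0"
        then have "q' (c *\<^sub>R x) \<le> q (c *\<^sub>R x + (c * t) *\<^sub>R y) - (c * t) * q y"
          using c by (intro q'_le) auto
        also have "\<dots> = c * (q (x + t *\<^sub>R y) - t * q y)"
          by (simp add: eq[OF t] right_diff_distrib)
        finally show "q' (c *\<^sub>R x) / c \<le> q (x + t *\<^sub>R y) - t * q y"
          using c by (simp add: field_simps)
      qed
      ultimately show ?thesis
        using c by (simp add: field_simps)
    qed
  qed
  moreover have "q' x \<le> q x" for x
    using q'_le[of 0 x] by simp
  moreover have "q' (- y) \<le> - q y"
    using q'_le[of 1 "- y"] q0 by simp
  ultimately show thesis
    by (rule that)
qed

text \<open>Subadditivity of an infimum rests on comparability: of two members nearly optimal at
  \<open>x\<close> and at \<open>y\<close>, the smaller one serves at both points. This supplies the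
  bounds for chains that Zorn's lemma asks for.\<close>

lemma sublinear_chain_lower_bound:
  assumes "C \<noteq> {}" and sub: "\<And>q. q \<in> C \<Longrightarrow> sublinear q"
    and chain: "\<And>q r. q \<in> C \<Longrightarrow> r \<in> C \<Longrightarrow> (\<forall>x. q x \<le> r x) \<or> (\<forall>x. r x \<le> q x)"
    and bdd: "\<And>x. bdd_below ((\<lambda>q. q x) ` C)"
  shows "sublinear (\<lambda>x. INF q\<in>C. q x)"
  unfolding sublinear_def
proof (intro conjI allI impI)
  fix x y :: 'a
  show "(INF q\<in>C. q (x + y)) \<le> (INF q\<in>C. q x) + (INF q\<in>C. q y)"
  proof -
    have *: "(INF q\<in>C. q (x + y)) \<le> q x + r y" if qr: "q \<in> C" "r \<in> C" for q r
    proof -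
      obtain s where s: "s \<in> C" "s x \<le> q x" "s y \<le> r y"
        using chain[OF qr] qr by (metis order_refl)
      have "(INF q\<in>C. q (x + y)) \<le> s (x + y)"
        by (rule cINF_lower[OF bdd s(1)])
      also have "\<dots> \<le> s x + s y"
        using sub[OF s(1)] unfolding sublinear_def by blast
      finally show ?thesis using s by simp
    qed
    have "(INF q\<in>C. q (x + y)) - r y \<le> (INF q\<in>C. q x)" if "r \<in> C" for r
      using *[OF _ that] by (intro cINF_greatest[OF \<open>C \<noteq> {}\<close>]) (simp add: diff_le_eq)
    then have "(INF q\<in>C. q (x + y)) - (INF q\<in>C. q x) \<le> (INF q\<in>C. q y)"
      by (intro cINF_greatest[OF \<open>C \<noteq> {}\<close>]) (simp add: diff_le_eq le_diff_eq add.commute)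
    then show ?thesis by simp
  qed
next
  fix c :: real and x :: 'a
  assume c: "0 \<le> c"
  have "(INF q\<in>C. q (c *\<^sub>R x)) = (INF q\<in>C. c * q x)"
  proof (rule INF_cong[OF refl])
    fix q assume "q \<in> C"
    then show "q (c *\<^sub>R x) = c * q x"
      using sub c unfolding sublinear_def by blast
  qed
  also have "\<dots> = c * (INF q\<in>C. q x)"
  proof (cases "c = 0")
    case True
    then show ?thesis using \<open>C \<noteq> {}\<close> by simp
  next
    case False
    with c have c: "c > 0" by simp
    show ?thesis
    proof (rule antisym)
      have "(INF q\<in>C. c * q x) / c \<le> (INF q\<in>C. q x)"
      proof (rule cINF_greatest[OF \<open>C \<noteq> {}\<close>])
        fix q assume "q \<in> C"
        obtain b where "\<And>q. q \<in> C \<Longrightarrow> b \<le> q x"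
          using bdd[of x] unfolding bdd_below_def by blast
        then have "bdd_below ((\<lambda>q. c * q x) ` C)"
          using c by (intro bdd_belowI2[where m = "c * b"]) (simp add: mult_left_mono)
        then have "(INF q\<in>C. c * q x) \<le> c * q x"
          by (rule cINF_lower) fact
        then show "(INF q\<in>C. c * q x) / c \<le> q x"
          using c by (simp add: field_simps)
      qed
      then show "(INF q\<in>C. c * q x) \<le> c * (INF q\<in>C. q x)"
        using c by (simp add: field_simps)
      show "c * (INF q\<in>C. q x) \<le> (INF q\<in>C. c * q x)"
      proof (rule cINF_greatest[OF \<open>C \<noteq> {}\<close>])
        fix q assume "q \<in> C"
        then have "(INF q\<in>C. q x) \<le> q x"
          by (rule cINF_lower[OF bdd])
        then show "c * (INF q\<in>C. q x) \<le> c * q x"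
          using c by simp
      qed
    qed
  qed
  finally show "(INF q\<in>C. q (c *\<^sub>R x)) = c * (INF q\<in>C. q x)" .
qed

text \<open>No functional is extended from a subspace. The norm is sheared along \<open>x0\<close>
  to a \<open>p0\<close> with \<open>p0 (- x0) \<le> - norm x0\<close>, so every linear functional
  below \<open>p0\<close> is at least \<open>norm x0\<close> at \<open>x0\<close>; a minimal
  sublinear functional below \<open>p0\<close> is such a linear functional.\<close>

lemma hahn_banach_real:
  fixes x0 :: "'a::real_normed_vector"
  obtains l where "linear l" "\<And>x. l x \<le> norm x" "l x0 = norm x0"
proof -
  have "sublinear (norm :: 'a \<Rightarrow> real)"
    by (simp add: sublinear_def norm_triangle_ineq)
  then obtain p0 where p0: "sublinear p0" "\<And>x. p0 x \<le> norm x" "p0 (- x0) \<le> - norm x0"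
    using sublinear_shear[of norm x0] by metis
  define A where "A = {q. sublinear q \<and> (\<forall>x. q x \<le> p0 x)}"
  \<comment> \<open>The order is reversed, so that the maximal element delivered by Zorn's lemma is
    a minimal functional.\<close>
  define P where "P = (\<lambda>q r :: 'a \<Rightarrow> real. \<forall>x. r x \<le> q x)"
  have low: "- p0 (- x) \<le> q x" if "q \<in> A" for q x
  proof -
    have "sublinear q"
      using that by (simp add: A_def)
    then have "q (x + - x) \<le> q x + q (- x)"
      unfolding sublinear_def by blast
    moreover have "q 0 = 0"
      using \<open>sublinear q\<close> by (rule sublinear_zero)
    moreover have "q (- x) \<le> p0 (- x)"
      using that by (simp add: A_def)
    ultimately show ?thesis by simp
  qed
  have "\<exists>m\<in>A. \<forall>a\<in>A. P m a \<longrightarrow> a = m"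
  proof (rule predicate_Zorn)
    show "partial_order_on A (relation_of P A)"
      unfolding partial_order_on_def preorder_on_def refl_on_def trans_def antisym_def relation_of_def P_def
      by (auto simp: fun_eq_iff order_antisym) (meson order_trans)
  next
    fix C assume "C \<in> Chains (relation_of P A)"
    then have C: "q \<in> A" and chain: "(\<forall>x. q x \<le> r x) \<or> (\<forall>x. r x \<le> q x)"
      if "q \<in> C" "r \<in> C" for q r
      using that by (auto simp: Chains_def relation_of_def P_def)
    show "\<exists>u\<in>A. \<forall>a\<in>C. P a u"
    proof (cases "C = {}")
      case True
      then show ?thesis using p0 by (auto simp: A_def)
    next
      case False
      define u where "u x = (INF q\<in>C. q x)" for x
      have bdd: "bdd_below ((\<lambda>q. q x) ` C)" for x
        using low C by (auto simp: bdd_below_def intro!: exI[of _ "- p0 (- x)"])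
      have "sublinear u"
        unfolding u_def using False chain bdd C
        by (intro sublinear_chain_lower_bound) (auto simp: A_def)
      moreover have le: "u x \<le> q x" if "q \<in> C" for q x
        unfolding u_def by (rule cINF_lower[OF bdd that])
      moreover have "u x \<le> p0 x" for x
      proof -
        obtain q where "q \<in> C"
          using False by blast
        then show ?thesis
          using C[of q q] le[of q x] by (auto simp: A_def intro: order_trans)
      qed
      ultimately show ?thesis
        by (auto simp: A_def P_def)
    qed
  qed
  then obtain l where l: "l \<in> A" and min: "\<And>q. q \<in> A \<Longrightarrow> (\<And>x. q x \<le> l x) \<Longrightarrow> q = l"
    by (auto simp: P_def)
  then have sub: "sublinear l" and lp0: "\<And>x. l x \<le> p0 x"
    by (auto simp: A_def)
  have l0: "l 0 = 0"
    using sub by (rule sublinear_zero)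
  have odd: "l (- y) = - l y" for y
  proof -
    obtain q where q: "sublinear q" "\<And>x. q x \<le> l x" "q (- y) \<le> - l y"
      using sublinear_shear[OF sub, of y] by metis
    have "q = l"
      using q lp0 by (intro min) (auto simp: A_def intro: order_trans[OF q(2) lp0])
    moreover have "l (y + - y) \<le> l y + l (- y)"
      using sub unfolding sublinear_def by blast
    ultimately show ?thesis
      using q(3) l0 by simp
  qed
  have scale: "l (c *\<^sub>R x) = c * l x" for c x
  proof (cases "c \<ge> 0")
    case True
    then show ?thesis using sub by (simp add: sublinear_def)
  next
    case False
    then have "0 \<le> - c"
      by simp
    then have "l ((- c) *\<^sub>R x) = - c * l x"
      using sub unfolding sublinear_def by blast
    then show ?thesis
      using odd[of "(- c) *\<^sub>R x"] by simp
  qed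
  have "linear l"
  proof (rule linearI)
    fix x y
    have "l (x + y) \<le> l x + l y" "l ((- x) + (- y)) \<le> l (- x) + l (- y)"
      using sub unfolding sublinear_def by blast+
    moreover have "- x + - y = - (x + y)" by simp
    ultimately show "l (x + y) = l x + l y"
      using odd[of x] odd[of y] odd[of "x + y"] by simp
  qed (simp add: scale)
  moreover have "l x \<le> norm x" for x
    using lp0 p0 by (meson order_trans)
  moreover have "l x0 = norm x0"
    using lp0[of "- x0"] p0(3) odd[of x0] \<open>l x0 \<le> norm x0\<close> by simp
  ultimately show thesis
    by (rule that)
qed

text \<open>The modulus leaves no room for an imaginary part. Used to upgrade equalities of real
  parts, which is all that real variational arguments give.\<close>

lemma complex_eq_of_Re:
  assumes "cmod z \<le> r" "Re z = r"
  shows "z = complex_of_real r"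
proof -
  have "(Re z)\<^sup>2 + (Im z)\<^sup>2 \<le> r\<^sup>2"
    using assms(1) by (metis cmod_power2 norm_ge_zero power_mono)
  then show ?thesis
    using assms(2) by (simp add: complex_eq_iff)
qed

lemma hahn_banach_norming:
  fixes x0 :: "'a::complex_normed_vector"
  obtains \<phi> :: "'a \<Rightarrow>\<^sub>C\<^sub>L complex"
  where "norm \<phi> \<le> 1" "\<phi> *\<^sub>V x0 = complex_of_real (norm x0)"
proof -
  obtain l where l: "linear l" "\<And>x. l x \<le> norm x" "l x0 = norm x0"
    using hahn_banach_real[of x0] by blast
  \<comment> \<open>The complex-linear functional whose real part is \<open>l\<close>.\<close>
  define f where "f x = Complex (l x) (- l (\<i> *\<^sub>C x))" for x
  have ladd: "l (x + y) = l x + l y" and lscale: "l (r *\<^sub>R x) = r * l x" for x y r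
    using l(1) by (auto simp: linear_add linear_scale)
  have add: "f (x + y) = f x + f y" for x y
    by (simp add: f_def complex_eq_iff scaleC_add_right ladd)
  have lC: "l (c *\<^sub>C x) = Re c * l x + Im c * l (\<i> *\<^sub>C x)" for c x
  proof -
    have "c = complex_of_real (Re c) + complex_of_real (Im c) * \<i>"
      by (simp add: complex_eq_iff)
    then have "c *\<^sub>C x = (complex_of_real (Re c) + complex_of_real (Im c) * \<i>) *\<^sub>C x"
      by simp
    also have "\<dots> = Re c *\<^sub>R x + Im c *\<^sub>R (\<i> *\<^sub>C x)"
      by (simp only: scaleC_add_left scaleC_scaleC[symmetric] scaleC_of_real)
    finally show ?thesis
      by (simp add: ladd lscale)
  qed
  have scale: "f (c *\<^sub>C x) = c *\<^sub>C f x" for c x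
  proof -
    have "l (\<i> *\<^sub>C c *\<^sub>C x) = - Im c * l x + Re c * l (\<i> *\<^sub>C x)"
      using lC[of "\<i> * c" x] by (simp add: scaleC_scaleC)
    then show ?thesis
      using lC[of c x] by (simp add: f_def complex_eq_iff scaleC_complex_def)
  qed
  have bound: "norm (f x) \<le> 1 * norm x" for x
  proof (cases "f x = 0")
    case False
    \<comment> \<open>A phase that rotates \<open>f x\<close> onto the positive real axis, where the
      bound for the real functional \<open>l\<close> applies.\<close>
    define c where "c = cnj (f x) / cmod (f x)"
    have "cmod c = 1"
      using False by (simp add: c_def norm_divide)
    have "f (c *\<^sub>C x) = complex_of_real (cmod (f x))"
    proof -
      have "f (c *\<^sub>C x) = (f x * cnj (f x)) / cmod (f x)"
        by (simp add: scale scaleC_complex_def c_def)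
      also have "\<dots> = complex_of_real (cmod (f x))"
        using False by (simp only: complex_norm_square[symmetric]) (simp add: power2_eq_square)
      finally show ?thesis .
    qed
    then have "Re (f (c *\<^sub>C x)) = cmod (f x)"
      by simp
    then have "cmod (f x) = l (c *\<^sub>C x)"
      unfolding f_def by simp
    also have "\<dots> \<le> norm x"
      using l(2)[of "c *\<^sub>C x"] \<open>cmod c = 1\<close> by (simp add: norm_scaleC)
    finally show ?thesis by simp
  qed simp
  obtain \<phi> where \<phi>: "\<And>x. \<phi> *\<^sub>V x = f x"
    by (rule cblinfun_exists[OF add scale bound]) blast
  have n: "norm \<phi> \<le> 1"
    using bound by (intro norm_cblinfun_bound) (simp_all add: \<phi>)
  have "cmod (\<phi> *\<^sub>V x0) \<le> norm x0"
    using bound[of x0] by (simp add: \<phi>)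
  moreover have "Re (\<phi> *\<^sub>V x0) = norm x0"
    by (simp add: \<phi> f_def l)
  ultimately have "\<phi> *\<^sub>V x0 = complex_of_real (norm x0)"
    by (intro complex_eq_of_Re)
  with n show thesis by (rule that)
qed

text \<open>The bridge from scalar to vector estimates: below, Cauchy's inequality and the Fourier
  and Laplace integrals are applied to scalar functions only, with bounds that do not depend on the
  functional.\<close>

lemma norm_le_by_functionals:
  fixes x :: "'a::complex_normed_vector"
  assumes "\<And>\<phi> :: 'a \<Rightarrow>\<^sub>C\<^sub>L complex. norm \<phi> \<le> 1 \<Longrightarrow> cmod (\<phi> *\<^sub>V x) \<le> C"
  shows "norm x \<le> C"
  using hahn_banach_norming[of x] assms by (metis abs_norm_cancel norm_of_real)

section \<open>The duality map and the regularised equation\<close>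

text \<open>Uniform convexity restated for the squared norm on a ball: a small midpoint defect
  forces small distance. A small defect makes the two norms nearly equal, which reduces the question
  to the unit vectors of the definition. This form is the one that minimising sequences can
  use.\<close>

lemma uniformly_convexE:
  fixes e :: real
  assumes uc: "uniformly_convex TYPE('a::real_normed_vector)" and e: "e > 0" and r: "r > 0"
  obtains d where "d > 0"
    "\<And>x y :: 'a. norm x \<le> r \<Longrightarrow> norm y \<le> r \<Longrightarrow>
      ((norm x)\<^sup>2 + (norm y)\<^sup>2) / 2 - (norm ((1/2) *\<^sub>R (x + y)))\<^sup>2 < d \<Longrightarrow> norm (x - y) < e"
proof -
  obtain \<delta> where \<delta>: "\<delta> > 0" and uc': "\<And>x y :: 'a. norm x = 1 \<Longrightarrow> norm y = 1 \<Longrightarrow> e / (2 * r) \<le> norm (x - y) \<Longrightarrow>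
       norm ((1/2) *\<^sub>R (x + y)) \<le> 1 - \<delta>"
    using uc e r unfolding uniformly_convex_def by (metis divide_pos_pos mult_pos_pos zero_less_numeral)
  \<comment> \<open>The first entry forces the norms to differ by less than \<open>e / 8\<close>.
    The second is \<open>(e / 4) * (e / 8) * \<delta>\<close>, a lower bound for the defect when
    both norms are not small and the directions are far apart.\<close>
  define d where "d = min ((e/16)\<^sup>2) (e\<^sup>2 * \<delta> / 32)"
  have d: "d > 0"
    using e \<delta> by (simp add: d_def)
  have main: "norm (x - y) < e" if xy: "norm y \<le> norm x" "norm x \<le> r"
    and D: "((norm x)\<^sup>2 + (norm y)\<^sup>2) / 2 - (norm ((1/2) *\<^sub>R (x + y)))\<^sup>2 < d" for x y :: 'a
  proof (cases "norm x \<le> e / 4")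
    case True
    have "norm (x - y) \<le> norm x + norm y"
      by (rule norm_triangle_ineq4)
    then show ?thesis
      using True xy e by linarith
  next
    case False
    define a b where "a = norm x" and "b = norm y"
    have ba: "b \<le> a" "0 \<le> b" "a \<le> r" and a: "a > e / 4"
      using xy False by (auto simp: a_def b_def)
    have mid: "norm ((1/2) *\<^sub>R (x + y)) \<le> (a + b) / 2"
      using norm_triangle_ineq[of x y] by (simp add: a_def b_def)
    have "((a - b) / 2)\<^sup>2 = (a\<^sup>2 + b\<^sup>2) / 2 - ((a + b) / 2)\<^sup>2"
      by (simp add: power2_eq_square field_simps)
    also have "\<dots> \<le> (a\<^sup>2 + b\<^sup>2) / 2 - (norm ((1/2) *\<^sub>R (x + y)))\<^sup>2"
      using power_mono[OF mid norm_ge_zero, of 2] by simp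
    also have "\<dots> < (e/16)\<^sup>2"
      using D by (simp add: a_def b_def d_def)
    finally have "((a - b) / 2)\<^sup>2 < (e/16)\<^sup>2" .
    then have "(a - b) / 2 < e / 16"
      by (rule power_less_imp_less_base) (use e in simp)
    then have diff: "a - b < e / 8"
      by simp
    then have b: "b > e / 8"
      using a by simp
    define u v where "u = (1 / a) *\<^sub>R x" and "v = (1 / b) *\<^sub>R y"
    have pos: "a > 0" "b > 0"
      using a b e by auto
    have uv: "norm u = 1" "norm v = 1" "x = a *\<^sub>R u" "y = b *\<^sub>R v"
      using pos by (auto simp: u_def v_def a_def b_def)
    show ?thesis
    proof (cases "norm (u - v) < e / (2 * r)")
      case True
      have "x - y = a *\<^sub>R (u - v) + (a - b) *\<^sub>R v"
        by (simp add: uv(3,4) algebra_simps)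
      also have "norm \<dots> \<le> a * norm (u - v) + (a - b)"
        using norm_triangle_ineq[of "a *\<^sub>R (u - v)" "(a - b) *\<^sub>R v"] pos ba uv by simp
      also have "a * norm (u - v) \<le> r * (e / (2 * r))"
        using True ba pos r by (intro mult_mono) auto
      also have "r * (e / (2 * r)) + (a - b) < e"
        using r e diff by simp
      finally show ?thesis by simp
    next
      case False
      \<comment> \<open>Convexity is available for the unit vectors only, so the midpoint of
        \<open>x\<close> and \<open>y\<close> is split into \<open>b\<close> times the midpoint of
        \<open>u\<close> and \<open>v\<close> and a remainder of length \<open>(a - b) / 2\<close>.
        The defect is then at least \<open>a * b * \<delta>\<close>, contradicting the choice of
        \<open>d\<close>.\<close>
      then have h: "norm ((1/2) *\<^sub>R (u + v)) \<le> 1 - \<delta>"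
        using uc' uv by simp
      then have \<delta>1: "\<delta> \<le> 1"
        using norm_ge_zero[of "(1/2) *\<^sub>R (u + v)"] by linarith
      have "(1/2) *\<^sub>R (x + y) = b *\<^sub>R ((1/2) *\<^sub>R (u + v)) + ((a - b) / 2) *\<^sub>R u"
      proof -
        have "((a - b) / 2) *\<^sub>R u = (a / 2) *\<^sub>R u - (b / 2) *\<^sub>R u"
          by (simp add: scaleR_diff_left[symmetric] diff_divide_distrib)
        then show ?thesis
          unfolding uv(3,4) by (simp add: scaleR_add_right)
      qed
      also have "norm \<dots> \<le> norm (b *\<^sub>R ((1/2) *\<^sub>R (u + v))) + norm (((a - b) / 2) *\<^sub>R u)"
        by (rule norm_triangle_ineq)
      also have "\<dots> = b * norm ((1/2) *\<^sub>R (u + v)) + (a - b) / 2"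
        using pos ba uv by simp
      also have "\<dots> \<le> b * (1 - \<delta>) + (a - b) / 2"
        using h pos by (intro add_right_mono mult_left_mono) auto
      also have "\<dots> = (a + b) / 2 - b * \<delta>"
        by (simp add: field_simps)
      finally have n: "norm ((1/2) *\<^sub>R (x + y)) \<le> (a + b) / 2 - b * \<delta>" .
      have "e\<^sup>2 * \<delta> / 32 = (e / 4) * (e / 8) * \<delta>"
        by (simp add: power2_eq_square)
      also have "\<dots> \<le> a * b * \<delta>"
        using a b e \<delta> pos by (intro mult_mono) auto
      also have "\<dots> \<le> a * b * \<delta> + b\<^sup>2 * \<delta> * (1 - \<delta>) + ((a - b) / 2)\<^sup>2"
        using pos \<delta> \<delta>1 by simp
      also have "\<dots> = (a\<^sup>2 + b\<^sup>2) / 2 - ((a + b) / 2 - b * \<delta>)\<^sup>2"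
        by (simp add: power2_eq_square field_simps)
      also have "\<dots> \<le> (a\<^sup>2 + b\<^sup>2) / 2 - (norm ((1/2) *\<^sub>R (x + y)))\<^sup>2"
        using power_mono[OF n norm_ge_zero, of 2] by simp
      finally show ?thesis
        using D by (simp add: a_def b_def d_def)
    qed
  qed
  show thesis
  proof (rule that[OF d])
    fix x y :: 'a
    assume *: "norm x \<le> r" "norm y \<le> r"
      "((norm x)\<^sup>2 + (norm y)\<^sup>2) / 2 - (norm ((1/2) *\<^sub>R (x + y)))\<^sup>2 < d"
    show "norm (x - y) < e"
    proof (cases "norm y \<le> norm x")
      case True
      then show ?thesis using main[of y x] * by simp
    next
      case False
      then show ?thesis
        using main[of x y] * by (simp add: add.commute norm_minus_commute)
    qed
  qed
qed

text \<open>The direct method without weak compactness: midpoint convexity of \<open>l\<close>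
  transfers the smallness of the excess over the infimum to the midpoint defect of the squared norm,
  so a minimising sequence is Cauchy in norm.\<close>

lemma uniformly_convex_minimiser:
  fixes l :: "'a::banach \<Rightarrow> real"
  assumes uc: "uniformly_convex TYPE('a)" and cont: "continuous_on UNIV l"
    and mid: "\<And>x y. l ((1/2) *\<^sub>R (x + y)) \<le> (l x + l y) / 2"
    and lower: "\<And>x. - C * norm x \<le> l x"
  obtains x where "\<And>y. (norm x)\<^sup>2 + l x \<le> (norm y)\<^sup>2 + l y"
proof -
  define \<Phi> where "\<Phi> x = (norm x)\<^sup>2 + l x" for x
  \<comment> \<open>Completing the square; gives both boundedness below and coercivity.\<close>
  have low: "(norm x - C / 2)\<^sup>2 - (C / 2)\<^sup>2 \<le> \<Phi> x" for x
    using lower[of x] by (simp add: \<Phi>_def power2_eq_square field_simps)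
  have bdd: "bdd_below (range \<Phi>)"
    by (rule bdd_belowI2[where m = "- (C / 2)\<^sup>2"]) (rule order_trans[OF _ low], simp)
  define m where "m = Inf (range \<Phi>)"
  have m_le: "m \<le> \<Phi> x" for x
    unfolding m_def by (rule cInf_lower[OF _ bdd]) simp
  have "\<exists>x. \<Phi> x < m + e" if "e > 0" for e
    using that cInf_lessD[of "range \<Phi>" "m + e"] by (auto simp: m_def)
  then have "\<forall>n. \<exists>x. \<Phi> x < m + inverse (real (Suc n))"
    by simp
  then obtain X where X: "\<And>n. \<Phi> (X n) < m + inverse (real (Suc n))"
    unfolding choice_iff by blast
  \<comment> \<open>Outside this ball \<open>low\<close> puts the functional above
    \<open>\<bar>m\<bar> + 2\<close>, out of reach of a sequence that stays below
    \<open>m + 1\<close>.\<close>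
  define r where "r = \<bar>C\<bar> / 2 + (\<bar>m\<bar> + 2 + (C / 2)\<^sup>2)"
  have r: "r > 0"
    using zero_le_power2[of "C / 2"] abs_ge_zero[of C] abs_ge_zero[of m] unfolding r_def by linarith
  have bounded: "norm (X n) \<le> r" for n
  proof (rule ccontr)
    assume "\<not> norm (X n) \<le> r"
    then have "norm (X n) - C / 2 > \<bar>m\<bar> + 2 + (C / 2)\<^sup>2"
      using abs_ge_self[of C] by (simp add: r_def)
    moreover have "(\<bar>m\<bar> + 2 + (C / 2)\<^sup>2) * 1 \<le> (\<bar>m\<bar> + 2 + (C / 2)\<^sup>2) * (\<bar>m\<bar> + 2 + (C / 2)\<^sup>2)"
      using zero_le_power2[of "C / 2"] abs_ge_zero[of m] by (intro mult_left_mono) linarith+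
    ultimately have "\<bar>m\<bar> + 2 + (C / 2)\<^sup>2 \<le> (norm (X n) - C / 2)\<^sup>2"
      using power_mono[of "\<bar>m\<bar> + 2 + (C / 2)\<^sup>2" "norm (X n) - C / 2" 2] by (simp add: power2_eq_square)
    then have "\<bar>m\<bar> + 2 \<le> \<Phi> (X n)"
      using low[of "X n"] by linarith
    moreover have "inverse (real (Suc n)) \<le> 1"
      by (simp add: inverse_le_1_iff)
    ultimately show False
      using X[of n] by linarith
  qed
  \<comment> \<open>The functional at the midpoint is at least \<open>m\<close>; subtracting this
    from the average of the two values leaves only the excesses.\<close>
  have D: "((norm (X i))\<^sup>2 + (norm (X j))\<^sup>2) / 2 - (norm ((1/2) *\<^sub>R (X i + X j)))\<^sup>2
      < (inverse (real (Suc i)) + inverse (real (Suc j))) / 2" for i j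
  proof -
    have "m \<le> (norm ((1/2) *\<^sub>R (X i + X j)))\<^sup>2 + (l (X i) + l (X j)) / 2"
      using m_le[of "(1/2) *\<^sub>R (X i + X j)"] mid[of "X i" "X j"] unfolding \<Phi>_def by linarith
    moreover have "(norm (X i))\<^sup>2 + l (X i) < m + inverse (real (Suc i))"
      "(norm (X j))\<^sup>2 + l (X j) < m + inverse (real (Suc j))"
      using X[of i] X[of j] by (simp_all only: \<Phi>_def)
    ultimately show ?thesis by argo
  qed
  have "Cauchy X"
  proof (rule CauchyI)
    fix e :: real assume e: "e > 0"
    obtain d where d: "d > 0" and *: "\<And>x y :: 'a. norm x \<le> r \<Longrightarrow> norm y \<le> r \<Longrightarrow>
      ((norm x)\<^sup>2 + (norm y)\<^sup>2) / 2 - (norm ((1/2) *\<^sub>R (x + y)))\<^sup>2 < d \<Longrightarrow> norm (x - y) < e"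
      by (rule uniformly_convexE[OF uc e r]) blast
    obtain M where M: "inverse (real (Suc M)) < d"
      using reals_Archimedean[OF d] by blast
    show "\<exists>M. \<forall>i\<ge>M. \<forall>j\<ge>M. norm (X i - X j) < e"
    proof (intro exI[of _ M] allI impI)
      fix i j assume "M \<le> i" "M \<le> j"
      then have "inverse (real (Suc i)) \<le> inverse (real (Suc M))" "inverse (real (Suc j)) \<le> inverse (real (Suc M))"
        by (auto simp: field_simps)
      then show "norm (X i - X j) < e"
        using M D[of i j] by (intro * bounded) argo
    qed
  qed
  then obtain x where x: "X \<longlonglongrightarrow> x"
    using Cauchy_convergent convergent_def by blast
  have "(\<lambda>n. l (X n)) \<longlonglongrightarrow> l x"
    by (rule continuous_on_tendsto_compose[OF cont x]) simp_all
  then have lim: "(\<lambda>n. \<Phi> (X n)) \<longlonglongrightarrow> \<Phi> x"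
    unfolding \<Phi>_def by (intro tendsto_intros x)
  have "(\<lambda>n. m + inverse (real (Suc n))) \<longlonglongrightarrow> m + 0"
    by (intro tendsto_intros LIMSEQ_inverse_real_of_nat)
  then have "\<Phi> x \<le> m + 0"
    by (rule LIMSEQ_le[OF lim]) (use X less_imp_le in blast)
  then have "\<Phi> x \<le> \<Phi> y" for y
    using m_le[of y] by simp
  then show thesis
    unfolding \<Phi>_def by (rule that)
qed

section \<open>Hilbert spaces: uniform convexity and the Riesz representation\<close>

lemma cinner_add_left: "cinner (x + y) z = cinner x z + cinner y z"
  by (metis cinner_add_right cinner_commute complex_cnj_add)

lemma cinner_scaleR_right: "cinner x (r *\<^sub>R y) = r * cinner x y"
  by (simp add: scaleC_of_real[symmetric] cinner_scaleC_right)

lemma cinner_minus_right: "cinner x (- y) = - cinner x y"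
  using cinner_scaleR_right[of x "-1" y] by simp

lemma cinner_diff_right: "cinner x (y - z) = cinner x y - cinner x z"
  using cinner_add_right[of x y "- z"] by (simp add: cinner_minus_right)

lemma cinner_diff_left: "cinner (x - y) z = cinner x z - cinner y z"
  by (metis cinner_diff_right cinner_commute complex_cnj_diff)

lemma Re_cinner_commute: "Re (cinner x y) = Re (cinner y x)"
  using cinner_commute[of x y] by simp

lemma norm_add_cinner: "(norm (x + y))\<^sup>2 = (norm x)\<^sup>2 + 2 * Re (cinner x y) + (norm y)\<^sup>2"
proof -
  have "cinner (x + y) (x + y) = cinner x x + cinner x y + (cinner y x + cinner y y)"
    by (simp add: cinner_add_left cinner_add_right del: cinner_self)
  then have "Re (cinner (x + y) (x + y)) = Re (cinner x x + cinner x y + (cinner y x + cinner y y))"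
    by (rule arg_cong)
  then show ?thesis
    using Re_cinner_commute[of y x] by (simp add: cinner_self)
qed

text \<open>By the parallelogram law the squared norm of the midpoint is at most
  \<open>1 - e\<^sup>2 / 4\<close>, which is below the square of \<open>1 - e\<^sup>2 / 8\<close>.
  This allows one minimisation lemma to serve for both the Riesz theorem and the Gramian.\<close>

lemma uniformly_convex_hilbert: "uniformly_convex TYPE('u::complex_hilbert)"
  unfolding uniformly_convex_def
proof (intro allI impI)
  fix e :: real assume e: "e > 0"
  show "\<exists>\<delta>>0. \<forall>x y :: 'u. norm x = 1 \<longrightarrow> norm y = 1 \<longrightarrow> e \<le> norm (x - y) \<longrightarrow> norm ((1/2) *\<^sub>R (x + y)) \<le> 1 - \<delta>"
  proof (intro exI[of _ "e\<^sup>2 / 8"] conjI allI impI)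
    fix x y :: 'u
    assume xy: "norm x = 1" "norm y = 1" "e \<le> norm (x - y)"
    have "(norm (x + y))\<^sup>2 + (norm (x - y))\<^sup>2 = 4"
      using norm_add_cinner[of x y] norm_add_cinner[of x "- y"] xy by (simp add: cinner_minus_right)
    moreover have "e\<^sup>2 \<le> (norm (x - y))\<^sup>2"
      using xy e by (intro power_mono) auto
    moreover have "(norm ((1/2) *\<^sub>R (x + y)))\<^sup>2 = (norm (x + y))\<^sup>2 / 4"
      by (simp add: power_divide)
    moreover have "(1 - e\<^sup>2 / 8)\<^sup>2 = 1 - e\<^sup>2 / 4 + (e\<^sup>2 / 8)\<^sup>2"
      by (simp add: power2_eq_square field_simps)
    ultimately have sq: "(norm ((1/2) *\<^sub>R (x + y)))\<^sup>2 \<le> (1 - e\<^sup>2 / 8)\<^sup>2"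
      using zero_le_power2[of "e\<^sup>2 / 8"] by linarith
    have "e\<^sup>2 \<le> 4"
      using \<open>e\<^sup>2 \<le> (norm (x - y))\<^sup>2\<close> \<open>(norm (x + y))\<^sup>2 + (norm (x - y))\<^sup>2 = 4\<close> zero_le_power2[of "norm (x + y)"] by linarith
    then show "norm ((1/2) *\<^sub>R (x + y)) \<le> 1 - e\<^sup>2 / 8"
      by (intro power2_le_imp_le[OF sq]) simp
  qed (use e in simp)
qed

text \<open>The quadratic error must vanish to first order: a minimiser is a critical point.\<close>

lemma linear_le_quadratic_imp_zero:
  fixes a C :: real
  assumes "\<And>t. t * a \<le> C * t\<^sup>2"
  shows "a = 0"
proof -
  define K where "K = \<bar>C\<bar> + 1"
  have K: "K > 0" "K - C \<ge> 1"
    by (auto simp: K_def)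
  have "a\<^sup>2 / K \<le> C * a\<^sup>2 / K\<^sup>2"
    using assms[of "a / K"] by (simp add: power_divide power2_eq_square)
  then have "a\<^sup>2 / K * K\<^sup>2 \<le> C * a\<^sup>2"
    using K by (simp add: pos_le_divide_eq)
  then have "a\<^sup>2 * (K - C) \<le> 0"
    using K by (simp add: power2_eq_square algebra_simps)
  moreover have "a\<^sup>2 * 1 \<le> a\<^sup>2 * (K - C)"
    using K by (intro mult_left_mono) auto
  ultimately have "a\<^sup>2 \<le> 0"
    by linarith
  then show ?thesis
    by simp
qed

text \<open>The representing vector minimises the squared norm minus twice the real part of the
  functional. Criticality yields equality of real parts, and replacing \<open>x\<close> by
  \<open>\<i> *\<^sub>C x\<close> yields the imaginary parts.\<close>

lemma riesz_representation:
  fixes \<phi> :: "'u::complex_hilbert \<Rightarrow>\<^sub>C\<^sub>L complex"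
  obtains v where "\<And>x. \<phi> *\<^sub>V x = cinner v x"
proof -
  define l where "l x = - 2 * Re (\<phi> *\<^sub>V x)" for x
  have cont: "continuous_on UNIV l"
    unfolding l_def by (intro continuous_intros continuous_on_cblinfun_apply)
  have mid: "l ((1/2) *\<^sub>R (x + y)) \<le> (l x + l y) / 2" for x y
    by (simp add: l_def cblinfun_linear_simps field_simps)
  have lower: "- (2 * norm \<phi>) * norm x \<le> l x" for x
    using complex_Re_le_cmod[of "\<phi> *\<^sub>V x"] norm_cblinfun[of \<phi> x] by (simp add: l_def)
  obtain v where v: "\<And>y. (norm v)\<^sup>2 + l v \<le> (norm y)\<^sup>2 + l y"
    by (rule uniformly_convex_minimiser[OF uniformly_convex_hilbert cont mid lower]) blast
  have re: "Re (\<phi> *\<^sub>V x) = Re (cinner v x)" for x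
  proof -
    have "t * (2 * Re (\<phi> *\<^sub>V x) - 2 * Re (cinner v x)) \<le> (norm x)\<^sup>2 * t\<^sup>2" for t
      using v[of "v + t *\<^sub>R x"] unfolding norm_add_cinner l_def
      by (simp add: cblinfun_linear_simps cinner_scaleR_right power_mult_distrib algebra_simps)
    from linear_le_quadratic_imp_zero[OF this] show ?thesis
      by simp
  qed
  have "\<phi> *\<^sub>V x = cinner v x" for x
  proof (rule complex_eqI[OF re])
    have "Re (\<phi> *\<^sub>V (\<i> *\<^sub>C x)) = Re (cinner v (\<i> *\<^sub>C x))"
      by (rule re)
    then show "Im (\<phi> *\<^sub>V x) = Im (cinner v x)"
      by (simp add: cblinfun_apply_scaleC cinner_scaleC_right scaleC_complex_def)
  qed
  then show thesis by (rule that)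
qed

lemma riesz_vector_unique: "(\<And>x. cinner v x = cinner w x) \<Longrightarrow> v = w"
proof -
  assume "\<And>x. cinner v x = cinner w x"
  then have "cinner (v - w) (v - w) = 0"
    by (simp only: cinner_diff_left) simp
  then have "norm (v - w) = 0"
    by (simp add: cinner_self)
  then show "v = w" by simp
qed

lemma riesz_vector_apply: "\<phi> *\<^sub>V x = cinner (riesz_vector \<phi>) x"
proof -
  obtain v where v: "\<And>x. \<phi> *\<^sub>V x = cinner v x"
    using riesz_representation by blast
  then have "riesz_vector \<phi> = v"
    unfolding riesz_vector_def by (intro the_equality) (auto intro: riesz_vector_unique)
  then show ?thesis using v by simp
qed

lemma riesz_vector_diff: "riesz_vector (\<phi> - \<psi>) = riesz_vector \<phi> - riesz_vector \<psi>"
  by (rule riesz_vector_unique)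
    (simp add: cinner_diff_left riesz_vector_apply[symmetric] cblinfun_minus_apply)

lemma norm_riesz_vector: "norm (riesz_vector \<phi>) \<le> norm \<phi>"
proof -
  have "norm (riesz_vector \<phi>) * norm (riesz_vector \<phi>) = cmod (\<phi> *\<^sub>V riesz_vector \<phi>)"
    unfolding riesz_vector_apply cinner_self norm_of_real by (simp add: power2_eq_square)
  also have "\<dots> \<le> norm \<phi> * norm (riesz_vector \<phi>)"
    by (rule norm_cblinfun)
  finally show ?thesis
    by (cases "riesz_vector \<phi> = 0") auto
qed

text \<open>The midpoint of two elements still takes the value \<open>(norm x)\<^sup>2\<close> at
  \<open>x\<close>, so its norm cannot drop below \<open>norm x\<close>: the midpoint defect is
  zero. This gives the \<open>the_elem\<close> in \<open>duality_map\<close> its intended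
  value.\<close>

lemma duality_set_eq_singleton:
  fixes x :: "'w::complex_banach"
  assumes uc: "uniformly_convex TYPE('w \<Rightarrow>\<^sub>C\<^sub>L complex)" and \<phi>: "\<phi> \<in> duality_set x"
  shows "duality_set x = {\<phi>}"
proof -
  have "\<psi> = \<phi>" if \<psi>: "\<psi> \<in> duality_set x" for \<psi>
  proof (rule ccontr)
    assume ne: "\<psi> \<noteq> \<phi>"
    have n: "norm \<phi> = norm x" "norm \<psi> = norm x" and app: "\<phi> *\<^sub>V x = complex_of_real ((norm x)\<^sup>2)" "\<psi> *\<^sub>V x = complex_of_real ((norm x)\<^sup>2)"
      using \<phi> \<psi> by (auto simp: duality_set_def power2_eq_iff_nonneg)
    have pos: "norm x > 0"
    proof (rule ccontr)
      assume "\<not> norm x > 0"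
      then have "norm \<phi> = 0" "norm \<psi> = 0"
        using n by auto
      then show False using ne by simp
    qed
    define d where "d = norm (\<psi> - \<phi>)"
    have "d > 0" using ne by (simp add: d_def)
    obtain d' where d': "d' > 0" and *: "\<And>a b :: 'w \<Rightarrow>\<^sub>C\<^sub>L complex. norm a \<le> norm x \<Longrightarrow> norm b \<le> norm x \<Longrightarrow>
      ((norm a)\<^sup>2 + (norm b)\<^sup>2) / 2 - (norm ((1/2) *\<^sub>R (a + b)))\<^sup>2 < d' \<Longrightarrow> norm (a - b) < d"
      by (rule uniformly_convexE[OF uc \<open>d > 0\<close> pos]) blast
    have "((1/2) *\<^sub>R (\<psi> + \<phi>)) *\<^sub>V x = complex_of_real ((norm x)\<^sup>2)"
      by (simp add: cblinfun_scaleR_apply cblinfun_plus_apply app scaleR_conv_of_real)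
    then have "(norm x)\<^sup>2 \<le> norm ((1/2) *\<^sub>R (\<psi> + \<phi>)) * norm x"
      using norm_cblinfun[of "(1/2) *\<^sub>R (\<psi> + \<phi>)" x] by (simp only: norm_of_real)
    then have "norm x \<le> norm ((1/2) *\<^sub>R (\<psi> + \<phi>))"
      using pos by (simp add: power2_eq_square)
    then have "(norm x)\<^sup>2 \<le> (norm ((1/2) *\<^sub>R (\<psi> + \<phi>)))\<^sup>2"
      by (intro power_mono) auto
    then have "((norm \<psi>)\<^sup>2 + (norm \<phi>)\<^sup>2) / 2 - (norm ((1/2) *\<^sub>R (\<psi> + \<phi>)))\<^sup>2 < d'"
      unfolding n using d' by argo
    then have "norm (\<psi> - \<phi>) < d"
      by (intro *) (simp_all add: n)
    then show False by (simp add: d_def)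
  qed
  then show ?thesis using \<phi> by blast
qed

text \<open>Surjectivity of the map that \<open>gramian_resolvent\<close> inverts. The Gramian
  enters only as a symmetric, positive and bounded form in real parts.\<close>

lemma regularised_equation_solvable:
  fixes \<Psi> :: "('w::complex_banach \<Rightarrow>\<^sub>C\<^sub>L complex) \<Rightarrow> 'w"
  assumes uc: "uniformly_convex TYPE('w \<Rightarrow>\<^sub>C\<^sub>L complex)"
    and sym: "\<And>\<phi> \<eta>. Re (\<eta> *\<^sub>V \<Psi> \<phi>) = Re (\<phi> *\<^sub>V \<Psi> \<eta>)"
    and pos: "\<And>\<phi>. Re (\<phi> *\<^sub>V \<Psi> \<phi>) \<ge> 0"
    and bound: "\<And>\<phi>. norm (\<Psi> \<phi>) \<le> C * norm \<phi>"
    and \<kappa>: "\<kappa> > 0"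
  obtains x where "\<kappa> *\<^sub>R x + \<Psi> (duality_map x) = y"
proof -
  define b where "b \<eta> \<phi> = Re (\<eta> *\<^sub>V \<Psi> \<phi>)" for \<eta> \<phi>
  have b_sym: "b \<eta> \<phi> = b \<phi> \<eta>" for \<eta> \<phi>
    unfolding b_def by (rule sym)
  have b_left: "b (\<eta> + \<eta>') \<phi> = b \<eta> \<phi> + b \<eta>' \<phi>" "b (r *\<^sub>R \<eta>) \<phi> = r * b \<eta> \<phi>" for \<eta> \<eta>' \<phi> r
    by (simp_all add: b_def cblinfun_plus_apply cblinfun_scaleR_apply)
  \<comment> \<open>Evaluation is linear in the functional, which gives the first argument; symmetry
    carries this over to the second.\<close>
  have b_right: "b \<phi> (\<eta> + \<eta>') = b \<phi> \<eta> + b \<phi> \<eta>'" "b \<phi> (r *\<^sub>R \<eta>) = r * b \<phi> \<eta>" for \<eta> \<eta>' \<phi> r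
    by (simp_all only: b_sym[of \<phi>] b_left)
  interpret b: bounded_bilinear b
  proof
    show "\<exists>K. \<forall>a b'. norm (b a b') \<le> norm a * norm b' * K"
    proof (intro exI[of _ C] allI)
      fix \<eta> \<phi>
      have "\<bar>b \<eta> \<phi>\<bar> \<le> norm \<eta> * norm (\<Psi> \<phi>)"
        unfolding b_def using abs_Re_le_cmod norm_cblinfun order_trans by blast
      also have "\<dots> \<le> norm \<eta> * (C * norm \<phi>)"
        by (intro mult_left_mono bound) auto
      finally show "norm (b \<eta> \<phi>) \<le> norm \<eta> * norm \<phi> * C"
        by (simp add: mult_ac)
    qed
  qed (simp_all add: b_left b_right)
  \<comment> \<open>The quadratic functional divided by \<open>\<kappa> / 2\<close>, so that the
    squared norm of the dual appears with coefficient one.\<close>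
  define l where "l \<phi> = (b \<phi> \<phi> - 2 * Re (\<phi> *\<^sub>V y)) / \<kappa>" for \<phi>
  have cont: "continuous_on UNIV l"
    unfolding l_def using \<kappa>
    by (intro continuous_intros b.continuous_on continuous_on_cblinfun_apply) auto
  have mid: "l ((1/2) *\<^sub>R (\<phi> + \<eta>)) \<le> (l \<phi> + l \<eta>) / 2" for \<phi> \<eta>
  proof -
    have "0 \<le> b (\<phi> - \<eta>) (\<phi> - \<eta>)"
      unfolding b_def by (rule pos)
    then have "b \<phi> \<eta> + b \<eta> \<phi> \<le> b \<phi> \<phi> + b \<eta> \<eta>"
      by (simp add: b.diff_left b.diff_right)
    then have "b ((1/2) *\<^sub>R (\<phi> + \<eta>)) ((1/2) *\<^sub>R (\<phi> + \<eta>)) - 2 * Re (((1/2) *\<^sub>R (\<phi> + \<eta>)) *\<^sub>V y)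
        \<le> ((b \<phi> \<phi> - 2 * Re (\<phi> *\<^sub>V y)) + (b \<eta> \<eta> - 2 * Re (\<eta> *\<^sub>V y))) / 2"
      by (simp add: b.scaleR_left b.scaleR_right b.add_left b.add_right cblinfun_plus_apply cblinfun_scaleR_apply)
        argo
    from divide_right_mono[OF this less_imp_le[OF \<kappa>]] show ?thesis
      unfolding l_def by (simp add: add_divide_distrib)
  qed
  have lower: "- (2 * norm y / \<kappa>) * norm \<phi> \<le> l \<phi>" for \<phi>
  proof -
    have "2 * Re (\<phi> *\<^sub>V y) \<le> 2 * norm y * norm \<phi>"
      using complex_Re_le_cmod[of "\<phi> *\<^sub>V y"] norm_cblinfun[of \<phi> y] by (simp add: mult.commute)
    then have "- (2 * norm y * norm \<phi>) \<le> b \<phi> \<phi> - 2 * Re (\<phi> *\<^sub>V y)"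
      using pos[of \<phi>] by (simp add: b_def)
    then show ?thesis
      using \<kappa> by (simp add: l_def field_simps)
  qed
  obtain \<phi> where \<phi>: "\<And>\<eta>. (norm \<phi>)\<^sup>2 + l \<phi> \<le> (norm \<eta>)\<^sup>2 + l \<eta>"
    by (rule uniformly_convex_minimiser[OF uc cont mid lower]) blast
  \<comment> \<open>The equation solved for its first summand, with \<open>\<phi>\<close> in the
    place of \<open>duality_map x\<close>. What remains is to show that \<open>\<phi>\<close>
    belongs to the duality set of this \<open>x\<close>.\<close>
  define x where "x = (1 / \<kappa>) *\<^sub>R (y - \<Psi> \<phi>)"
  have key: "2 * t * Re (\<eta> *\<^sub>V x) \<le> (norm (\<phi> + t *\<^sub>R \<eta>))\<^sup>2 - (norm \<phi>)\<^sup>2 + (b \<eta> \<eta> / \<kappa>) * t\<^sup>2" for \<eta> t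
  proof -
    have "l (\<phi> + t *\<^sub>R \<eta>) - l \<phi> = (2 * t * b \<eta> \<phi> + t\<^sup>2 * b \<eta> \<eta> - 2 * t * Re (\<eta> *\<^sub>V y)) / \<kappa>"
      by (simp add: l_def b.add_left b.add_right b.scaleR_left b.scaleR_right b_sym[of \<phi> \<eta>]
          cblinfun_plus_apply cblinfun_scaleR_apply power2_eq_square diff_divide_distrib[symmetric] algebra_simps)
    also have "\<dots> = b \<eta> \<eta> / \<kappa> * t\<^sup>2 - 2 * t * Re (\<eta> *\<^sub>V x)"
      using \<kappa> by (simp add: x_def cblinfun_linear_simps b_def[of \<eta> \<phi>] field_simps)
    finally show ?thesis
      using \<phi>[of "\<phi> + t *\<^sub>R \<eta>"] by linarith
  qed
  \<comment> \<open>Along the ray through \<open>\<phi>\<close> itself the squared norm is a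
    polynomial in \<open>t\<close>, so criticality gives an equality.\<close>
  have re: "Re (\<phi> *\<^sub>V x) = (norm \<phi>)\<^sup>2"
  proof -
    have "t * (2 * Re (\<phi> *\<^sub>V x) - 2 * (norm \<phi>)\<^sup>2) \<le> ((norm \<phi>)\<^sup>2 + b \<phi> \<phi> / \<kappa>) * t\<^sup>2" for t
    proof -
      have "norm (\<phi> + t *\<^sub>R \<phi>) = norm ((1 + t) *\<^sub>R \<phi>)"
        by (simp add: scaleR_add_left)
      then have "(norm (\<phi> + t *\<^sub>R \<phi>))\<^sup>2 = (1 + t)\<^sup>2 * (norm \<phi>)\<^sup>2"
        by (simp add: power_mult_distrib)
      then show ?thesis
        using key[of t \<phi>] by (simp add: power2_eq_square algebra_simps)
    qed
    from linear_le_quadratic_imp_zero[OF this] show ?thesis by simp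
  qed
  \<comment> \<open>In other directions differentiability of the norm is not at hand. The triangle
    inequality and one-sided \<open>t\<close> give an upper bound, and Hahn-Banach turns it into
    \<open>norm x \<le> norm \<phi>\<close>.\<close>
  have le: "Re (\<eta> *\<^sub>V x) \<le> norm \<phi> * norm \<eta>" for \<eta>
  proof (rule tendsto_lowerbound)
    show "((\<lambda>t. norm \<phi> * norm \<eta> + ((norm \<eta>)\<^sup>2 + b \<eta> \<eta> / \<kappa>) * t / 2) \<longlongrightarrow> norm \<phi> * norm \<eta>) (at_right 0)"
      by (auto intro!: tendsto_eq_intros)
    have "Re (\<eta> *\<^sub>V x) \<le> norm \<phi> * norm \<eta> + ((norm \<eta>)\<^sup>2 + b \<eta> \<eta> / \<kappa>) * t / 2" if t: "t > 0" for t
    proof -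
      have "norm (\<phi> + t *\<^sub>R \<eta>) \<le> norm \<phi> + t * norm \<eta>"
        using norm_triangle_ineq[of \<phi> "t *\<^sub>R \<eta>"] t by simp
      then have "(norm (\<phi> + t *\<^sub>R \<eta>))\<^sup>2 \<le> (norm \<phi> + t * norm \<eta>)\<^sup>2"
        by (intro power_mono) auto
      then have "2 * t * Re (\<eta> *\<^sub>V x) \<le> 2 * t * (norm \<phi> * norm \<eta> + ((norm \<eta>)\<^sup>2 + b \<eta> \<eta> / \<kappa>) * t / 2)"
      proof -
        define \<beta> where "\<beta> = b \<eta> \<eta> / \<kappa>"
        show ?thesis
          using key[of t \<eta>] \<open>_ \<le> (norm \<phi> + t * norm \<eta>)\<^sup>2\<close> unfolding \<beta>_def[symmetric]
          by (simp add: power2_eq_square algebra_simps add_divide_distrib)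
      qed
      then show ?thesis
        using t by simp
    qed
    then show "\<forall>\<^sub>F t in at_right 0. Re (\<eta> *\<^sub>V x) \<le> norm \<phi> * norm \<eta> + ((norm \<eta>)\<^sup>2 + b \<eta> \<eta> / \<kappa>) * t / 2"
      by (auto simp: eventually_at_right_field intro!: exI[of _ 1])
  qed simp
  have nx: "norm x \<le> norm \<phi>"
  proof -
    obtain \<eta> :: "'w \<Rightarrow>\<^sub>C\<^sub>L complex" where \<eta>: "norm \<eta> \<le> 1" "\<eta> *\<^sub>V x = complex_of_real (norm x)"
      by (rule hahn_banach_norming)
    have "norm x \<le> norm \<phi> * norm \<eta>"
      using le[of \<eta>] \<eta> by simp
    also have "\<dots> \<le> norm \<phi> * 1"
      using \<eta> by (intro mult_left_mono) auto
    finally show ?thesis by simp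
  qed
  have up: "cmod (\<phi> *\<^sub>V x) \<le> norm \<phi> * norm x"
    by (rule norm_cblinfun)
  have "norm \<phi> \<le> norm x"
  proof (cases "norm \<phi> = 0")
    case False
    have "norm \<phi> * norm \<phi> \<le> norm \<phi> * norm x"
      using up complex_Re_le_cmod[of "\<phi> *\<^sub>V x"] re unfolding power2_eq_square by linarith
    then show ?thesis
      using False by simp
  qed simp
  with nx have n: "norm \<phi> = norm x" by simp
  have "\<phi> *\<^sub>V x = complex_of_real ((norm x)\<^sup>2)"
    using up re n by (intro complex_eq_of_Re) (simp_all add: power2_eq_square)
  then have "\<phi> \<in> duality_set x"
    by (simp add: duality_set_def n)
  then have "duality_map x = \<phi>"
    using duality_set_eq_singleton[OF uc \<open>\<phi> \<in> duality_set x\<close>] by (simp add: duality_map_def)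
  then have "\<kappa> *\<^sub>R x + \<Psi> (duality_map x) = y"
    using \<kappa> by (simp add: x_def)
  then show thesis by (rule that)
qed

section \<open>Schauder's fixed point theorem\<close>

text \<open>The Hilbert cube with the product topology. A finite-dimensional cube is represented by
  its first \<open>n\<close> coordinates, because \<open>n\<close> will be the size of a net
  produced inside a proof and no type can depend on it.\<close>

definition unit_cube :: "(nat \<Rightarrow> real) set"
  where "unit_cube = {x. \<forall>i. x i \<in> {0..1}}"

lemma compact_unit_cube: "compact unit_cube"
proof -
  have "compactin (product_topology (\<lambda>i::nat. euclidean) UNIV) (PiE UNIV (\<lambda>i. {0..1::real}))"
    unfolding compactin_PiE by (auto simp: compactin_euclidean_iff)
  moreover have "PiE UNIV (\<lambda>i::nat. {0..1::real}) = unit_cube"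
    by (auto simp: unit_cube_def PiE_def Pi_def)
  ultimately show ?thesis
    by (simp add: euclidean_product_topology)
qed

lemma continuous_on_coordinate: "continuous_on S (\<lambda>x::nat \<Rightarrow> real. x i)"
  by (rule continuous_on_subset[OF continuous_on_product_coordinates]) simp

lemma tendsto_fun_iff:
  fixes X :: "'b \<Rightarrow> nat \<Rightarrow> real"
  shows "(X \<longlongrightarrow> x) F \<longleftrightarrow> (\<forall>i. ((\<lambda>k. X k i) \<longlongrightarrow> x i) F)"
  using limitin_componentwise[of "\<lambda>i. euclidean" UNIV X x F]
  by (simp add: euclidean_product_topology)

text \<open>Brouwer's theorem for the first \<open>n\<close> coordinates, from Kuhn's combinatorial
  lemma. In a fine grid some cell has, for each coordinate, one corner where \<open>F\<close> does
  not decrease it and one where \<open>F\<close> does not increase it; the cells shrink to a point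
  where both inequalities hold.\<close>

lemma brouwer_unit_cube:
  fixes F :: "(nat \<Rightarrow> real) \<Rightarrow> nat \<Rightarrow> real"
  assumes cont: "\<And>i. i < n \<Longrightarrow> continuous_on unit_cube (\<lambda>x. F x i)"
    and maps: "\<And>x i. x \<in> unit_cube \<Longrightarrow> i < n \<Longrightarrow> F x i \<in> {0..1}"
  obtains x where "x \<in> unit_cube" "\<And>i. i < n \<Longrightarrow> F x i = x i"
proof -
  define pt where "pt p y = (\<lambda>i. if i < n then real (y i) / real p else 0)" for p :: nat and y :: "nat \<Rightarrow> nat"
  have pt_cube: "pt p y \<in> unit_cube" if "p > 0" "\<forall>i<n. y i \<le> p" for p y
    using that by (auto simp: pt_def unit_cube_def)
  have "\<exists>q. (\<forall>i<n. q i < p) \<and> (\<forall>i<n. \<exists>r s. (\<forall>j<n. q j \<le> r j \<and> r j \<le> q j + 1) \<and>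
      (\<forall>j<n. q j \<le> s j \<and> s j \<le> q j + 1) \<and>
      pt p r i \<le> F (pt p r) i \<and> F (pt p s) i \<le> pt p s i)" if p: "p > 0" for p
  proof -
    \<comment> \<open>Label 1 marks a coordinate that \<open>F\<close> does not increase, label 0
      one that it does not decrease. On the faces the label is prescribed as Kuhn's lemma requires;
      this is consistent because \<open>F\<close> takes its values between 0 and 1.\<close>
    define label where "label y i = (if y i = p \<or> (y i \<noteq> 0 \<and> F (pt p y) i < pt p y i) then 1 else (0::nat))" for y i
    have l0: "pt p y i \<le> F (pt p y) i" if "label y i = 0" "\<forall>i<n. y i \<le> p" "i < n" for y i
      using that maps[OF pt_cube[OF p that(2)] that(3)] by (auto simp: label_def pt_def split: if_splits)
    have l1: "F (pt p y) i \<le> pt p y i" if "label y i = 1" "\<forall>i<n. y i \<le> p" "i < n" for y i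
      using that maps[OF pt_cube[OF p that(2)] that(3)] p by (auto simp: label_def pt_def split: if_splits)
    obtain q where q: "\<forall>i<n. q i < p" and
      rs: "\<forall>i<n. \<exists>r s. (\<forall>j<n. q j \<le> r j \<and> r j \<le> q j + 1) \<and>
      (\<forall>j<n. q j \<le> s j \<and> s j \<le> q j + 1) \<and> label r i \<noteq> label s i"
      by (rule kuhn_lemma[OF p, of n label]) (use p in \<open>auto simp: label_def\<close>)
    have "\<exists>r s. (\<forall>j<n. q j \<le> r j \<and> r j \<le> q j + 1) \<and>
      (\<forall>j<n. q j \<le> s j \<and> s j \<le> q j + 1) \<and>
      pt p r i \<le> F (pt p r) i \<and> F (pt p s) i \<le> pt p s i" if i: "i < n" for i
    proof -
      obtain r s where r: "\<forall>j<n. q j \<le> r j \<and> r j \<le> q j + 1"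
        and s: "\<forall>j<n. q j \<le> s j \<and> s j \<le> q j + 1" and ne: "label r i \<noteq> label s i"
        using rs i by blast
      have "\<forall>j<n. r j \<le> p" "\<forall>j<n. s j \<le> p"
        using r s q by (metis Suc_eq_plus1 Suc_leI order_trans)+
      moreover have "label r i = 0 \<and> label s i = 1 \<or> label r i = 1 \<and> label s i = 0"
        using ne by (auto simp: label_def split: if_splits)
      ultimately show ?thesis
        using r s l0 l1 i by metis
    qed
    then show ?thesis using q by blast
  qed
  then obtain q where q: "\<And>p i. p > 0 \<Longrightarrow> i < n \<Longrightarrow> q p i < p"
    and rs: "\<And>p i. p > 0 \<Longrightarrow> i < n \<Longrightarrow> \<exists>r s. (\<forall>j<n. q p j \<le> r j \<and> r j \<le> q p j + 1) \<and>
      (\<forall>j<n. q p j \<le> s j \<and> s j \<le> q p j + 1) \<and>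
      pt p r i \<le> F (pt p r) i \<and> F (pt p s) i \<le> pt p s i"
    by metis
  define X where "X k = pt (Suc k) (q (Suc k))" for k
  have X: "X k \<in> unit_cube" for k
    unfolding X_def using q by (intro pt_cube) (auto intro: less_imp_le)
  obtain x \<sigma> where x: "x \<in> unit_cube" and \<sigma>: "strict_mono (\<sigma> :: nat \<Rightarrow> nat)" and lim: "(X \<circ> \<sigma>) \<longlonglongrightarrow> x"
    using compact_unit_cube X unfolding compact_def by metis
  have X_lim: "(\<lambda>k. X (\<sigma> k) i) \<longlonglongrightarrow> x i" for i
    using continuous_on_tendsto_compose[OF continuous_on_coordinate[of UNIV i] lim] by simp
  \<comment> \<open>All corners of the selected cells have the same limit, since a cell at level
    \<open>p\<close> has width \<open>1 / p\<close>.\<close>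
  have near: "(\<lambda>k. pt (Suc (\<sigma> k)) (r k)) \<longlonglongrightarrow> x"
    if r: "\<And>k. \<forall>j<n. q (Suc (\<sigma> k)) j \<le> r k j \<and> r k j \<le> q (Suc (\<sigma> k)) j + 1" for r
  proof (rule tendsto_fun_iff[THEN iffD2, rule_format])
    fix j
    show "(\<lambda>k. pt (Suc (\<sigma> k)) (r k) j) \<longlonglongrightarrow> x j"
    proof (rule Lim_transform[OF X_lim], rule Lim_null_comparison)
      show "\<forall>\<^sub>F k in sequentially. norm (pt (Suc (\<sigma> k)) (r k) j - X (\<sigma> k) j) \<le> 1 / real (Suc (\<sigma> k))"
      proof (rule always_eventually, intro allI)
        fix k
        show "norm (pt (Suc (\<sigma> k)) (r k) j - X (\<sigma> k) j) \<le> 1 / real (Suc (\<sigma> k))"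
        proof (cases "j < n")
          case True
          then have "\<bar>real (r k j) - real (q (Suc (\<sigma> k)) j)\<bar> \<le> 1"
            using r[of k] by (auto simp: abs_le_iff)
          then show ?thesis
            using True by (simp add: X_def pt_def diff_divide_distrib[symmetric] divide_right_mono)
        qed (simp add: X_def pt_def)
      qed
      show "(\<lambda>k. 1 / real (Suc (\<sigma> k))) \<longlonglongrightarrow> 0"
        using LIMSEQ_subseq_LIMSEQ[OF LIMSEQ_inverse_real_of_nat \<sigma>] by (simp add: o_def divide_inverse)
    qed
  qed
  have "F x i = x i" if i: "i < n" for i
  proof -
    obtain r s where r: "\<And>k. \<forall>j<n. q (Suc (\<sigma> k)) j \<le> r k j \<and> r k j \<le> q (Suc (\<sigma> k)) j + 1"
      and s: "\<And>k. \<forall>j<n. q (Suc (\<sigma> k)) j \<le> s k j \<and> s k j \<le> q (Suc (\<sigma> k)) j + 1"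
      and Fr: "\<And>k. pt (Suc (\<sigma> k)) (r k) i \<le> F (pt (Suc (\<sigma> k)) (r k)) i"
      and Fs: "\<And>k. F (pt (Suc (\<sigma> k)) (s k)) i \<le> pt (Suc (\<sigma> k)) (s k) i"
    proof -
      have "\<forall>k. \<exists>r s. (\<forall>j<n. q (Suc (\<sigma> k)) j \<le> r j \<and> r j \<le> q (Suc (\<sigma> k)) j + 1) \<and>
          (\<forall>j<n. q (Suc (\<sigma> k)) j \<le> s j \<and> s j \<le> q (Suc (\<sigma> k)) j + 1) \<and>
          pt (Suc (\<sigma> k)) r i \<le> F (pt (Suc (\<sigma> k)) r) i \<and> F (pt (Suc (\<sigma> k)) s) i \<le> pt (Suc (\<sigma> k)) s i"
        using rs[OF zero_less_Suc i] by blast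
      then obtain r s where "\<forall>k. (\<forall>j<n. q (Suc (\<sigma> k)) j \<le> r k j \<and> r k j \<le> q (Suc (\<sigma> k)) j + 1) \<and>
          (\<forall>j<n. q (Suc (\<sigma> k)) j \<le> s k j \<and> s k j \<le> q (Suc (\<sigma> k)) j + 1) \<and>
          pt (Suc (\<sigma> k)) (r k) i \<le> F (pt (Suc (\<sigma> k)) (r k)) i \<and>
          F (pt (Suc (\<sigma> k)) (s k)) i \<le> pt (Suc (\<sigma> k)) (s k) i"
        unfolding choice_iff by (elim exE)
      then show thesis
        by (intro that[of r s]) simp_all
    qed
    have cube: "pt (Suc (\<sigma> k)) (y k) \<in> unit_cube"
      if "\<And>k. \<forall>j<n. q (Suc (\<sigma> k)) j \<le> y k j \<and> y k j \<le> q (Suc (\<sigma> k)) j + 1" for y k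
      using that q[of "Suc (\<sigma> k)"] by (intro pt_cube) (auto, metis Suc_leI order_trans zero_less_Suc)
    have lim_F: "(\<lambda>k. F (pt (Suc (\<sigma> k)) (y k)) i) \<longlonglongrightarrow> F x i"
      and lim_y: "(\<lambda>k. pt (Suc (\<sigma> k)) (y k) i) \<longlonglongrightarrow> x i"
      if y: "\<And>k. \<forall>j<n. q (Suc (\<sigma> k)) j \<le> y k j \<and> y k j \<le> q (Suc (\<sigma> k)) j + 1" for y
      using continuous_on_tendsto_compose[OF cont[OF i] near[OF y] x] cube[OF y]
        continuous_on_tendsto_compose[OF continuous_on_coordinate[of UNIV i] near[OF y]]
      by auto
    show ?thesis
      by (rule antisym)
        (rule LIMSEQ_le[OF lim_F[OF s] lim_y[OF s]] LIMSEQ_le[OF lim_y[OF r] lim_F[OF r]];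
          use Fr Fs in blast)+
  qed
  with x show thesis by (rule that)
qed

text \<open>Normalised hat functions of radius \<open>e\<close> around a finite net. The same tool
  serves for the finite-dimensional reduction in Schauder's theorem, for discretising an arc of
  compact operators, and for mixing controls.\<close>

lemma compact_partition_of_unity:
  fixes K :: "'a::metric_space set"
  assumes K: "compact K" and e: "e > 0"
  obtains Y \<rho> where "finite Y" "Y \<subseteq> K"
    "\<And>y. continuous_on K (\<rho> y)" "\<And>y x. x \<in> K \<Longrightarrow> \<rho> y x \<ge> (0::real)"
    "\<And>x. x \<in> K \<Longrightarrow> (\<Sum>y\<in>Y. \<rho> y x) = 1"
    "\<And>y x. \<rho> y x \<noteq> 0 \<Longrightarrow> dist x y < e"
proof -
  obtain Y where Y: "finite Y" "Y \<subseteq> K" "K \<subseteq> (\<Union>y\<in>Y. ball y e)"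
  proof (rule compactE_image[OF K, of K "\<lambda>y. ball y e"])
    show "K \<subseteq> (\<Union>y\<in>K. ball y e)" using e by force
  qed (auto intro: that)
  define \<mu> where "\<mu> y x = max 0 (e - dist x y)" for x y :: 'a
  have pos: "(\<Sum>y\<in>Y. \<mu> y x) > 0" if x: "x \<in> K" for x
  proof -
    obtain y where "y \<in> Y" "dist x y < e"
      using subsetD[OF Y(3) x] by (auto simp: dist_commute)
    then show ?thesis
      using Y by (intro sum_pos2[of _ y]) (auto simp: \<mu>_def)
  qed
  define \<rho> where "\<rho> y x = \<mu> y x / (\<Sum>y\<in>Y. \<mu> y x)" for x y
  show thesis
  proof (rule that[of Y \<rho>])
    show "continuous_on K (\<rho> y)" for y
      unfolding \<rho>_def \<mu>_def
      by (intro continuous_intros) (use pos in \<open>force simp: \<mu>_def\<close>)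
    show "\<rho> y x \<ge> 0" if "x \<in> K" for y x
      using pos[OF that] by (simp add: \<rho>_def \<mu>_def)
    show "(\<Sum>y\<in>Y. \<rho> y x) = 1" if "x \<in> K" for x
      using pos[OF that] by (simp add: \<rho>_def sum_divide_distrib[symmetric])
    show "dist x y < e" if "\<rho> y x \<noteq> 0" for x y
      using that by (auto simp: \<rho>_def \<mu>_def max_def split: if_splits)
  qed (use Y in auto)
qed

text \<open>Companion of the partition of unity: only the terms with non-zero weight have to be near
  \<open>x\<close>.\<close>

lemma norm_convex_combination_diff:
  fixes f :: "'b \<Rightarrow> 'a::real_normed_vector"
  assumes "(\<Sum>y\<in>Y. c y) = 1" "\<And>y. y \<in> Y \<Longrightarrow> 0 \<le> c y"
    and near: "\<And>y. y \<in> Y \<Longrightarrow> c y \<noteq> 0 \<Longrightarrow> norm (f y - x) \<le> e"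
  shows "norm ((\<Sum>y\<in>Y. c y *\<^sub>R f y) - x) \<le> e"
proof -
  have "(\<Sum>y\<in>Y. c y *\<^sub>R f y) - x = (\<Sum>y\<in>Y. c y *\<^sub>R (f y - x))"
    using assms(1) by (simp add: scaleR_diff_right sum_subtractf scaleR_left.sum[symmetric])
  also have "norm \<dots> \<le> (\<Sum>y\<in>Y. norm (c y *\<^sub>R (f y - x)))"
    by (rule norm_sum)
  also have "\<dots> \<le> (\<Sum>y\<in>Y. c y * e)"
  proof (rule sum_mono)
    fix y assume "y \<in> Y"
    then show "norm (c y *\<^sub>R (f y - x)) \<le> c y * e"
      using assms(2)[of y] near[of y] by (cases "c y = 0") (auto intro: mult_left_mono)
  qed
  also have "\<dots> = e"
    using assms(1) by (simp add: sum_distrib_right[symmetric])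
  finally show ?thesis .
qed

text \<open>Compactness is asked of the range alone, and the map lives on the whole space, so no
  convex domain has to be constructed. The Schauder projection onto a net gives approximate fixed
  points, and compactness of \<open>K\<close> gives a limit.\<close>

lemma schauder_fixed_point:
  fixes \<Phi> :: "'a::real_normed_vector \<Rightarrow> 'a"
  assumes cont: "continuous_on UNIV \<Phi>" and K: "compact K" and ran: "\<And>x. \<Phi> x \<in> K"
  obtains x where "\<Phi> x = x"
proof -
  have approx: "\<exists>w. norm (w - \<Phi> w) \<le> e" if e: "e > 0" for e
  proof -
    obtain Y \<rho> where Y: "finite Y" and cont_\<rho>: "\<And>y. continuous_on K (\<rho> y)"
      and pos: "\<And>y x. x \<in> K \<Longrightarrow> \<rho> y x \<ge> (0::real)"
      and sum1: "\<And>x. x \<in> K \<Longrightarrow> (\<Sum>y\<in>Y. \<rho> y x) = 1"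
      and near: "\<And>y x. \<rho> y x \<noteq> 0 \<Longrightarrow> dist x y < e"
      by (rule compact_partition_of_unity[OF K e]) blast
    obtain h where h: "bij_betw h {..<card Y} Y"
      using ex_bij_betw_nat_finite[OF Y] by (auto simp: lessThan_atLeast0)
    \<comment> \<open>Brouwer is applied to the coefficients, on a cube instead of a simplex: at a
      fixed point they are the values of the partition functions and therefore sum to one of
      themselves.\<close>
    define w where "w c = (\<Sum>i<card Y. c i *\<^sub>R h i)" for c :: "nat \<Rightarrow> real"
    have le1: "\<rho> (h i) x \<le> 1" if "x \<in> K" "i < card Y" for x i
    proof -
      have "h i \<in> Y"
        using h that by (auto simp: bij_betw_def)
      then show ?thesis
        using member_le_sum[of "h i" Y "\<lambda>y. \<rho> y x"] Y pos sum1 that by auto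
    qed
    have "continuous_on unit_cube w"
      unfolding w_def by (intro continuous_intros continuous_on_coordinate)
    then have "continuous_on unit_cube (\<lambda>c. \<rho> (h i) (\<Phi> (w c)))" for i
      by (intro continuous_on_compose2[OF cont_\<rho>] continuous_on_compose2[OF cont]) (auto simp: ran)
    then obtain c where c: "\<And>i. i < card Y \<Longrightarrow> \<rho> (h i) (\<Phi> (w c)) = c i"
      using brouwer_unit_cube[of "card Y" "\<lambda>c i. \<rho> (h i) (\<Phi> (w c))"] le1 pos ran
      by (metis atLeastAtMost_iff)
    have "w c = (\<Sum>i<card Y. \<rho> (h i) (\<Phi> (w c)) *\<^sub>R h i)"
      unfolding w_def[of c] by (rule sum.cong) (use c in \<open>auto simp: w_def\<close>)
    also have "\<dots> = (\<Sum>y\<in>Y. \<rho> y (\<Phi> (w c)) *\<^sub>R y)"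
      by (rule sum.reindex_bij_betw[OF h])
    finally have "norm (w c - \<Phi> (w c)) \<le> e"
      using norm_convex_combination_diff[OF sum1[OF ran] pos[OF ran], where f = "\<lambda>y. y" and x = "\<Phi> (w c)" and e = e] near
      by (metis dist_commute dist_norm less_imp_le)
    then show ?thesis ..
  qed
  have "\<forall>k. \<exists>w. norm (w - \<Phi> w) \<le> inverse (real (Suc k))"
    by (intro allI approx) simp
  then obtain w where w: "\<And>k. norm (w k - \<Phi> (w k)) \<le> inverse (real (Suc k))"
    unfolding choice_iff by blast
  \<comment> \<open>A subsequence of the images converges; the points follow, as they differ from
    their images by a null sequence.\<close>
  obtain z \<sigma> where \<sigma>: "strict_mono (\<sigma> :: nat \<Rightarrow> nat)" and lim: "((\<lambda>k. \<Phi> (w k)) \<circ> \<sigma>) \<longlonglongrightarrow> z"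
    using K ran unfolding compact_def by metis
  have "(\<lambda>k. inverse (real (Suc (\<sigma> k)))) \<longlonglongrightarrow> 0"
    using LIMSEQ_subseq_LIMSEQ[OF LIMSEQ_inverse_real_of_nat \<sigma>] by (simp add: o_def)
  then have "(\<lambda>k. w (\<sigma> k) - \<Phi> (w (\<sigma> k))) \<longlonglongrightarrow> 0"
    by (rule Lim_null_comparison[rotated]) (use w in auto)
  from tendsto_add[OF this lim] have "(\<lambda>k. w (\<sigma> k)) \<longlonglongrightarrow> z"
    by simp
  then have "(\<lambda>k. \<Phi> (w (\<sigma> k))) \<longlonglongrightarrow> \<Phi> z"
    by (rule continuous_on_tendsto_compose[OF cont]) simp_all
  then have "\<Phi> z = z"
    using lim by (simp add: o_def LIMSEQ_unique)
  then show thesis by (rule that)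
qed

section \<open>Exponentially bounded operator families\<close>

lemma lebesgue_measurable_cong_AE:
  fixes f g :: "real \<Rightarrow> 'a::topological_space"
  assumes g: "g \<in> borel_measurable lebesgue" and ae: "AE x in lebesgue. f x = g x"
  shows "f \<in> borel_measurable lebesgue"
proof (rule measurableI)
  fix A :: "'a set" assume A: "A \<in> sets borel"
  show "f -` A \<inter> space lebesgue \<in> sets lebesgue"
  proof (rule completion.in_sets_AE)
    show "AE x in lebesgue. x \<in> g -` A \<inter> space lebesgue \<longleftrightarrow> x \<in> f -` A \<inter> space lebesgue"
      using ae by eventually_elim auto
    show "g -` A \<inter> space lebesgue \<in> sets lebesgue"
      by (rule measurable_sets[OF g A])
  qed auto
qed simp

lemma lebesgue_measurable_lim_AE:
  fixes f :: "real \<Rightarrow> 'a::{banach, second_countable_topology}"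
  assumes [measurable]: "\<And>i. s i \<in> borel_measurable lebesgue" and ae: "AE x in lebesgue. (\<lambda>i. s i x) \<longlonglongrightarrow> f x"
  shows "f \<in> borel_measurable lebesgue"
proof (rule lebesgue_measurable_cong_AE)
  show "(\<lambda>x. lim (\<lambda>i. s i x)) \<in> borel_measurable lebesgue"
    by measurable
  show "AE x in lebesgue. f x = lim (\<lambda>i. s i x)"
    using ae by eventually_elim (simp add: limI)
qed

lemma strongly_measurable_imp_measurable:
  fixes f :: "real \<Rightarrow> 'a::{banach, second_countable_topology}"
  assumes sm: "strongly_measurable (lebesgue_on S) f" and S: "S \<in> sets lebesgue"
  shows "(\<lambda>x. indicator S x *\<^sub>R f x) \<in> borel_measurable lebesgue"
proof -
  obtain s where s: "\<And>i::nat. simple_function (lebesgue_on S) (s i)"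
    and lim: "AE x in lebesgue_on S. (\<lambda>i. s i x) \<longlonglongrightarrow> f x"
    using sm by (auto simp: strongly_measurable_def)
  show ?thesis
  proof (rule lebesgue_measurable_lim_AE)
    show "(\<lambda>x. indicator S x *\<^sub>R s i x) \<in> borel_measurable lebesgue" for i
      using borel_measurable_simple_function[OF s[of i]] S
      by (subst (asm) borel_measurable_restrict_space_iff) (simp_all add: mult.commute)
    have "AE x in lebesgue. x \<in> S \<longrightarrow> (\<lambda>i. s i x) \<longlonglongrightarrow> f x"
      using lim S by (simp add: AE_restrict_space_iff)
    then show "AE x in lebesgue. (\<lambda>i. indicator S x *\<^sub>R s i x) \<longlonglongrightarrow> indicator S x *\<^sub>R f x"
      by eventually_elim (auto simp: indicator_def)
  qed
qed

text \<open>Fubini's theorem is applied on the product of two copies of \<open>lborel\<close>, which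
  needs Borel measurable integrands. The approximating simple functions are altered on null sets,
  countably many in all.\<close>

lemma lebesgue_measurable_borel_version:
  fixes f :: "real \<Rightarrow> 'a::{banach, second_countable_topology}"
  assumes f: "f \<in> borel_measurable lebesgue"
  obtains g where "g \<in> borel_measurable borel" "AE x in lebesgue. f x = g x"
proof -
  obtain s where s: "\<And>i. simple_function lebesgue (s i)" and lim: "\<And>x. (\<lambda>i. s i x) \<longlonglongrightarrow> f x"
    using borel_measurable_implies_sequence_metric[OF f, of 0] by auto
  obtain s' where s': "\<And>i. simple_function lborel (s' i)" and ae: "\<And>i. AE x in lborel. s i x = s' i x"
    using completion_ex_simple_function[OF s] by metis
  have [measurable]: "s' i \<in> borel_measurable borel" for i
    using borel_measurable_simple_function[OF s'[of i]] by simp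
  have "AE x in lborel. \<forall>i. s i x = s' i x"
    using ae by (simp add: AE_all_countable)
  then have "AE x in lborel. f x = lim (\<lambda>i. s' i x)"
  proof eventually_elim
    case (elim x)
    then have "(\<lambda>i. s' i x) \<longlonglongrightarrow> f x"
      using lim[of x] by simp
    then show ?case by (simp add: limI)
  qed
  then have "AE x in lebesgue. f x = lim (\<lambda>i. s' i x)"
    by (rule AE_completion)
  moreover have "(\<lambda>x. lim (\<lambda>i. s' i x)) \<in> borel_measurable borel"
    by measurable
  ultimately show thesis
    using that by blast
qed

lemma integral_lebesgue_eq_lborel:
  fixes g :: "real \<Rightarrow> 'a::{banach, second_countable_topology}"
  assumes g: "g \<in> borel_measurable borel" and ae: "AE x in lebesgue. f x = g x"
  shows "integrable lebesgue f \<longleftrightarrow> integrable lborel g" and "(LINT x|lebesgue. f x) = (LINT x|lborel. g x)"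
proof -
  have g': "g \<in> borel_measurable lborel" "g \<in> borel_measurable lebesgue"
    using g by (auto intro: measurable_completion)
  have f: "f \<in> borel_measurable lebesgue"
    by (rule lebesgue_measurable_cong_AE[OF g'(2) ae])
  show "integrable lebesgue f \<longleftrightarrow> integrable lborel g"
    using integrable_cong_AE[OF f g'(2) ae] integrable_completion[OF g'(1)] by simp
  show "(LINT x|lebesgue. f x) = (LINT x|lborel. g x)"
    using integral_cong_AE[OF f g'(2) ae] integral_completion[OF g'(1)] by simp
qed

text \<open>Source of the product majorants for the applications of Fubini's theorem.\<close>

lemma integrable_lborel_prod:
  fixes a b :: "real \<Rightarrow> real"
  assumes a: "integrable lborel a" and b: "integrable lborel b"
  shows "integrable (lborel \<Otimes>\<^sub>M lborel) (\<lambda>(x, y). a x * b y)"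
proof (rule lborel_pair.Fubini_integrable)
  have [measurable]: "a \<in> borel_measurable borel" "b \<in> borel_measurable borel"
    using a b by auto
  show "(\<lambda>(x, y). a x * b y) \<in> borel_measurable (lborel \<Otimes>\<^sub>M lborel)"
    by measurable
  have "integrable lborel (\<lambda>x. \<bar>a x\<bar> * (LINT y|lborel. \<bar>b y\<bar>))"
    using a by (intro integrable_mult_left integrable_abs)
  then show "integrable lborel (\<lambda>x. LINT y|lborel. norm (case (x, y) of (x, y) \<Rightarrow> a x * b y))"
    by (simp add: abs_mult)
  show "AE x in lborel. integrable lborel (\<lambda>y. case (x, y) of (x, y) \<Rightarrow> a x * b y)"
    using b by auto
qed

lemma measurable_functional:
  "g \<in> borel_measurable N \<Longrightarrow> (\<lambda>x. \<phi> *\<^sub>V g x) \<in> borel_measurable N"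
  by (rule borel_measurable_continuous_on[OF linear_continuous_on[OF bounded_linear_cblinfun_apply]])

lemma scaleC_one: "1 *\<^sub>C x = x"
  using scaleC_of_real[of 1 x] by simp

lemma bounded_bilinear_scaleC: "bounded_bilinear (\<lambda>c (z::'a::complex_normed_vector). c *\<^sub>C z)"
proof
  fix c d :: complex and z w :: 'a and r :: real
  show "(c + d) *\<^sub>C z = c *\<^sub>C z + d *\<^sub>C z" "c *\<^sub>C (z + w) = c *\<^sub>C z + c *\<^sub>C w"
    by (rule scaleC_add_left scaleC_add_right)+
  show "(r *\<^sub>R c) *\<^sub>C z = r *\<^sub>R c *\<^sub>C z"
    by (metis scaleC_of_real scaleC_scaleC scaleR_conv_of_real)
  show "c *\<^sub>C r *\<^sub>R z = r *\<^sub>R c *\<^sub>C z"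
    by (rule scaleC_linear_simps)
  show "\<exists>K. \<forall>c (z::'a). norm (c *\<^sub>C z) \<le> norm c * norm z * K"
    by (intro exI[of _ 1]) (simp add: norm_scaleC)
qed

text \<open>A positive exponent makes the bound increasing in \<open>t\<close> and puts the
  half-plane \<open>Re l > \<omega>\<close> inside the region where the transforms of the kernels
  converge.\<close>

locale exp_bounded_family =
  fixes R :: "real \<Rightarrow> 'w::{complex_banach, second_countable_topology} \<Rightarrow>\<^sub>C\<^sub>L 'w" and M \<omega> :: real
  assumes strongly_continuous: "\<And>z. continuous_on {0..} (\<lambda>t. R t *\<^sub>V z)"
    and bound: "\<And>t. t \<ge> 0 \<Longrightarrow> norm (R t) \<le> M * exp (\<omega> * t)"
    and \<omega>_pos: "\<omega> > 0"
begin

lemma M_nonneg: "M \<ge> 0"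
  using order_trans[OF norm_ge_zero bound[of 0]] by simp

lemma norm_apply: "t \<ge> 0 \<Longrightarrow> norm (R t *\<^sub>V z) \<le> M * exp (\<omega> * t) * norm z"
  by (intro norm_cblinfun_le bound)

text \<open>Strong continuity and the local norm bound together give continuity in both variables.
  Continuing \<open>R\<close> constantly to negative times by \<open>max 0\<close> makes this a
  continuous map on the whole product, hence Borel: the source of all measurability of convolution
  integrands.\<close>

lemma jointly_continuous: "continuous_on UNIV (\<lambda>(t, z). R (max 0 t) *\<^sub>V z)"
  unfolding continuous_on_def
proof
  fix p :: "real \<times> 'w"
  obtain t z where p: "p = (t, z)" by (cases p)

  have c': "((\<lambda>(s, y). R (max 0 s) *\<^sub>V z) \<longlongrightarrow> R (max 0 t) *\<^sub>V z) (at (t, z))"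
  proof -
    have "continuous_on UNIV (\<lambda>p::real \<times> 'w. R (max 0 (fst p)) *\<^sub>V z)"
      by (rule continuous_on_compose2[OF strongly_continuous]) (auto intro!: continuous_intros)
    then show ?thesis
      by (simp add: continuous_on_def case_prod_unfold)
  qed
  have d: "((\<lambda>(s, y). R (max 0 s) *\<^sub>V (y - z)) \<longlongrightarrow> 0) (at (t, z))"
  proof (rule Lim_null_comparison)
    show "\<forall>\<^sub>F p in at (t, z). norm (case p of (s, y) \<Rightarrow> R (max 0 s) *\<^sub>V (y - z))
        \<le> M * exp (\<omega> * max 0 (fst p)) * norm (snd p - z)"
      by (intro always_eventually) (auto simp: case_prod_unfold intro!: norm_apply)
    have "((\<lambda>p. M * exp (\<omega> * max 0 (fst p)) * norm (snd p - z)) \<longlongrightarrow>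
        M * exp (\<omega> * max 0 (fst (t, z))) * norm (snd (t, z) - z)) (at (t, z))"
      by (intro tendsto_intros)
    then show "((\<lambda>p. M * exp (\<omega> * max 0 (fst p)) * norm (snd p - z)) \<longlongrightarrow> 0) (at (t, z))"
      by simp
  qed
  have "((\<lambda>(s, y). R (max 0 s) *\<^sub>V y) \<longlongrightarrow> R (max 0 t) *\<^sub>V z) (at (t, z))"
    using tendsto_add[OF c' d] by (simp add: case_prod_unfold cblinfun_linear_simps)
  then show "((\<lambda>(s, y). R (max 0 s) *\<^sub>V y) \<longlongrightarrow> (case p of (s, y) \<Rightarrow> R (max 0 s) *\<^sub>V y)) (at p)"
    by (simp add: p)
qed

lemma measurable_family_apply:
  assumes [measurable]: "a \<in> borel_measurable N" "g \<in> borel_measurable N"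
  shows "(\<lambda>x. R (max 0 (a x)) *\<^sub>V g x) \<in> borel_measurable N"
proof -
  have "(\<lambda>(t, z). R (max 0 t) *\<^sub>V z) \<in> borel_measurable (borel \<Otimes>\<^sub>M borel)"
    using borel_measurable_continuous_onI[OF jointly_continuous] by (simp add: borel_prod)
  moreover have "(\<lambda>x. (a x, g x)) \<in> N \<rightarrow>\<^sub>M (borel \<Otimes>\<^sub>M borel)"
    by measurable
  ultimately show ?thesis
    using measurable_compose by fastforce
qed

lemma conv_measurable:
  assumes "(\<lambda>s. indicator {0..t} s *\<^sub>R g s) \<in> borel_measurable lebesgue"
  shows "(\<lambda>s. indicator {0..t} s *\<^sub>R (R (t - s) *\<^sub>V g s)) \<in> borel_measurable lebesgue"
proof -
  have "(\<lambda>s. R (max 0 (t - s)) *\<^sub>V (indicator {0..t} s *\<^sub>R g s)) \<in> borel_measurable lebesgue"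
    by (rule measurable_family_apply[OF _ assms]) (intro measurable_completion, simp)
  moreover have "R (max 0 (t - s)) *\<^sub>V (indicator {0..t} s *\<^sub>R g s) = indicator {0..t} s *\<^sub>R (R (t - s) *\<^sub>V g s)" for s
    by (auto simp: indicator_def cblinfun_linear_simps max_def)
  ultimately show ?thesis by simp
qed

lemma conv_norm_le:
  assumes "s \<in> {0..t}"
  shows "norm (R (t - s) *\<^sub>V z) \<le> M * exp (\<omega> * t) * norm z"
proof -
  have "norm (R (t - s) *\<^sub>V z) \<le> M * exp (\<omega> * (t - s)) * norm z"
    using assms by (intro norm_apply) simp
  also have "\<dots> \<le> M * exp (\<omega> * t) * norm z"
    using assms \<omega>_pos M_nonneg by (intro mult_right_mono mult_left_mono) auto
  finally show ?thesis .
qed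

lemma conv_integrable:
  assumes g: "set_integrable lebesgue {0..t} g"
  shows "set_integrable lebesgue {0..t} (\<lambda>s. R (t - s) *\<^sub>V g s)"
  unfolding set_integrable_def
proof (rule Bochner_Integration.integrable_bound)
  show "integrable lebesgue (\<lambda>s. (M * exp (\<omega> * t)) * norm (indicator {0..t} s *\<^sub>R g s))"
    using g unfolding set_integrable_def by (intro integrable_mult_right integrable_norm)
  show "(\<lambda>s. indicator {0..t} s *\<^sub>R (R (t - s) *\<^sub>V g s)) \<in> borel_measurable lebesgue"
    using g unfolding set_integrable_def by (intro conv_measurable borel_measurable_integrable)
  show "AE s in lebesgue. norm (indicator {0..t} s *\<^sub>R (R (t - s) *\<^sub>V g s))
      \<le> norm ((M * exp (\<omega> * t)) * norm (indicator {0..t} s *\<^sub>R g s))"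
    using conv_norm_le M_nonneg by (intro AE_I2) (auto simp: indicator_def)
qed

text \<open>The transform of \<open>R\<close> tested with \<open>\<phi>\<close> and
  \<open>v\<close>. It stays a scalar integral until an operator with the same tested values has
  been found.\<close>

definition laplace :: "('w \<Rightarrow>\<^sub>C\<^sub>L complex) \<Rightarrow> complex \<Rightarrow> 'w \<Rightarrow> complex"
  where "laplace \<phi> l v = (LINT t|lborel. indicator {0..} t *\<^sub>R (exp (- l * complex_of_real t) * (\<phi> *\<^sub>V R (max 0 t) *\<^sub>V v)))"

lemma integrable_exp_decay: "c > 0 \<Longrightarrow> integrable lborel (\<lambda>t. indicator {0..} t *\<^sub>R exp (- c * t :: real))"
  using integrable_on_exp_minus_to_infinity[of c 0] 
    nonnegative_absolutely_integrable_1[of "\<lambda>t. exp (- c * t)" "{0..}"]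
  by (auto simp: set_integrable_def absolutely_integrable_on_def integrable_completion)

lemma norm_laplace_integrand:
  assumes "t \<ge> 0"
  shows "cmod (exp (- l * complex_of_real t) * (\<phi> *\<^sub>V R t *\<^sub>V v)) \<le> norm \<phi> * M * norm v * exp (- (Re l - \<omega>) * t)"
proof -
  have "cmod (\<phi> *\<^sub>V R t *\<^sub>V v) \<le> norm \<phi> * (M * exp (\<omega> * t) * norm v)"
    by (rule order_trans[OF norm_cblinfun]) (use assms in \<open>intro mult_left_mono norm_apply; simp\<close>)
  then have "cmod (exp (- l * complex_of_real t) * (\<phi> *\<^sub>V R t *\<^sub>V v))
      \<le> exp (- Re l * t) * (norm \<phi> * (M * exp (\<omega> * t) * norm v))"
    by (simp add: norm_mult)
  also have "\<dots> = norm \<phi> * M * norm v * (exp (- Re l * t) * exp (\<omega> * t))"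
    by simp
  also have "exp (- Re l * t) * exp (\<omega> * t) = exp (- (Re l - \<omega>) * t)"
    by (simp add: exp_add[symmetric] algebra_simps)
  finally show ?thesis .
qed

lemma laplace_integrable:
  assumes "Re l > \<omega>"
  shows "integrable lborel (\<lambda>t. indicator {0..} t *\<^sub>R (exp (- l * complex_of_real t) * (\<phi> *\<^sub>V R (max 0 t) *\<^sub>V v)))"
proof (rule Bochner_Integration.integrable_bound)
  show "integrable lborel (\<lambda>t. (norm \<phi> * M * norm v) * (indicator {0..} t *\<^sub>R exp (- (Re l - \<omega>) * t)))"
    using assms by (intro integrable_mult_right integrable_exp_decay) simp
  have [measurable]: "(\<lambda>t. \<phi> *\<^sub>V R (max 0 t) *\<^sub>V v) \<in> borel_measurable borel"
    by (intro measurable_functional measurable_family_apply) simp_all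
  show "(\<lambda>t. indicator {0..} t *\<^sub>R (exp (- l * complex_of_real t) * (\<phi> *\<^sub>V R (max 0 t) *\<^sub>V v))) \<in> borel_measurable lborel"
    by measurable
  show "AE t in lborel. norm (indicator {0..} t *\<^sub>R (exp (- l * complex_of_real t) * (\<phi> *\<^sub>V R (max 0 t) *\<^sub>V v)))
      \<le> norm ((norm \<phi> * M * norm v) * (indicator {0..} t *\<^sub>R exp (- (Re l - \<omega>) * t)))"
    using norm_laplace_integrand[of _ l \<phi> v] M_nonneg by (intro AE_I2) (auto simp: indicator_def abs_mult)
qed

lemma laplace_add: "Re l > \<omega> \<Longrightarrow> laplace \<phi> l (v + w) = laplace \<phi> l v + laplace \<phi> l w"
  unfolding laplace_def
  by (subst Bochner_Integration.integral_add[symmetric, OF laplace_integrable laplace_integrable])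
    (auto intro!: Bochner_Integration.integral_cong simp: cblinfun_linear_simps algebra_simps)

lemma laplace_scaleC: "laplace \<phi> l (c *\<^sub>C v) = c * laplace \<phi> l v"
  unfolding laplace_def
  by (subst integral_mult_right_zero[symmetric])
    (auto intro!: Bochner_Integration.integral_cong simp: cblinfun_apply_scaleC scaleC_complex_def)

lemma laplace_diff: "Re l > \<omega> \<Longrightarrow> laplace \<phi> l (v - w) = laplace \<phi> l v - laplace \<phi> l w"
  using laplace_add[of l \<phi> v "(-1) *\<^sub>C w"] laplace_scaleC[of \<phi> l "-1" w] scaleC_of_real[of "-1" w] by simp

definition conv :: "('w \<Rightarrow>\<^sub>C\<^sub>L complex) \<Rightarrow> (real \<Rightarrow> 'w) \<Rightarrow> real \<Rightarrow> complex"
  where "conv \<phi> g t = \<phi> *\<^sub>V (LINT s:{0..t}|lebesgue. R (t - s) *\<^sub>V g s)"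

text \<open>The convolution theorem, proved by shifting the time variable of a product kernel and
  applying Fubini in both orders. The exponential is split between the factors, so that the
  transform of \<open>g\<close> can be taken first.\<close>

lemma laplace_conv:
  assumes l: "Re l > \<omega>" and g: "laplace_converges g l"
    and loc: "\<And>t. set_integrable lebesgue {0..t} g"
  shows "integrable lebesgue (\<lambda>t. indicator {0..} t *\<^sub>R (exp (- l * complex_of_real t) * conv \<phi> g t))"
    and "(LINT t|lebesgue. indicator {0..} t *\<^sub>R (exp (- l * complex_of_real t) * conv \<phi> g t))
      = laplace \<phi> l (laplace_transform g l)"
proof -
  define e where "e t = exp (- l * complex_of_real t)" for t
  have e_add: "e (s + t) = e s * e t" for s t
    by (simp add: e_def distrib_left exp_add[symmetric])
  have e_nz: "e t \<noteq> 0" for t by (simp add: e_def)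
  have e_meas [measurable]: "e \<in> borel_measurable borel"
    unfolding e_def by measurable
  have int_g: "integrable lebesgue (\<lambda>s. indicator {0..} s *\<^sub>R (e s *\<^sub>C g s))"
    using g by (simp add: laplace_converges_def set_integrable_def e_def)
  then obtain k0 where k0 [measurable]: "k0 \<in> borel_measurable borel"
    and ae0: "AE s in lebesgue. indicator {0..} s *\<^sub>R (e s *\<^sub>C g s) = k0 s"
    using lebesgue_measurable_borel_version[OF borel_measurable_integrable] by metis
  \<comment> \<open>A Borel version of the weighted \<open>g\<close>. The indicator is imposed once
    more so that \<open>k\<close> vanishes at every negative time, and not only at almost every
    one.\<close>
  define k where "k s = indicator {0..} s *\<^sub>R k0 s" for s
  have k [measurable]: "k \<in> borel_measurable borel"
    unfolding k_def by measurable
  have ae: "AE s in lebesgue. indicator {0..} s *\<^sub>R (e s *\<^sub>C g s) = k s"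
    using ae0 by eventually_elim (auto simp: k_def indicator_def)
  have int_k: "integrable lborel k" and k_val: "(LINT s|lborel. k s) = laplace_transform g l"
    using integral_lebesgue_eq_lborel[OF k ae] int_g
    by (simp_all add: laplace_transform_def set_lebesgue_integral_def e_def)
  \<comment> \<open>The shift of \<open>t\<close> by \<open>s\<close> turns this kernel into the
    convolution integrand, because the exponential weight is already contained in
    \<open>k s\<close>.\<close>
  define K where "K s t = indicator {0..} t *\<^sub>R (e t * (\<phi> *\<^sub>V R (max 0 t) *\<^sub>V k s))" for s t
  have meas_phi: "(\<lambda>p. \<phi> *\<^sub>V R (max 0 (snd p)) *\<^sub>V k (fst p)) \<in> borel_measurable (lborel \<Otimes>\<^sub>M lborel)"
    by (intro measurable_functional measurable_family_apply) measurable
  have K_meas [measurable]: "(\<lambda>(s, t). K s t) \<in> borel_measurable (lborel \<Otimes>\<^sub>M lborel)"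
    using meas_phi unfolding K_def case_prod_unfold by measurable
  have K_int: "integrable (lborel \<Otimes>\<^sub>M lborel) (\<lambda>(s, t). K s t)"
  proof (rule Bochner_Integration.integrable_bound)
    show "integrable (lborel \<Otimes>\<^sub>M lborel) (\<lambda>(s, t). norm (k s) * ((norm \<phi> * M) * (indicator {0..} t *\<^sub>R exp (- (Re l - \<omega>) * t))))"
      using l by (intro integrable_lborel_prod integrable_norm int_k integrable_mult_right integrable_exp_decay) simp
    show "AE p in lborel \<Otimes>\<^sub>M lborel. norm (case p of (s, t) \<Rightarrow> K s t)
        \<le> norm (case p of (s, t) \<Rightarrow> norm (k s) * ((norm \<phi> * M) * (indicator {0..} t *\<^sub>R exp (- (Re l - \<omega>) * t))))"
    proof (intro AE_I2, clarify)
      fix s t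
      have "norm (k s) * ((norm \<phi> * M) * exp (- (Re l - \<omega>) * t)) = norm \<phi> * M * norm (k s) * exp (- (Re l - \<omega>) * t)"
        by simp
      then have "norm (K s t) \<le> norm (k s) * ((norm \<phi> * M) * exp (- (Re l - \<omega>) * t))" if "t \<ge> 0"
        using norm_laplace_integrand[OF that, of l \<phi> "k s"] that by (simp only: K_def e_def) simp
      then show "norm (K s t) \<le> norm (norm (k s) * ((norm \<phi> * M) * (indicator {0..} t *\<^sub>R exp (- (Re l - \<omega>) * t))))"
        using M_nonneg by (cases "t \<ge> 0") (simp_all add: K_def)
    qed
  qed (rule K_meas)
  have K2_meas: "(\<lambda>(s, t). K s (t - s)) \<in> borel_measurable (lborel \<Otimes>\<^sub>M lborel)"
  proof -
    have "(\<lambda>(s, t). (s, t - s)) \<in> (lborel \<Otimes>\<^sub>M lborel) \<rightarrow>\<^sub>M (lborel \<Otimes>\<^sub>M lborel)"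
      by measurable
    from measurable_compose[OF this K_meas] show ?thesis
      by (simp add: case_prod_unfold)
  qed
  have shift: "(LINT t|lborel. h (t - s)) = (LINT t|lborel. h t)"
    for h :: "real \<Rightarrow> 'b::{banach, second_countable_topology}" and s
    using lborel_integral_real_affine[of 1 h "- s"] by simp
  have shift': "integrable lborel (\<lambda>t. h (t - s)) \<longleftrightarrow> integrable lborel h"
    for h :: "real \<Rightarrow> 'b::{banach, second_countable_topology}" and s
    using lborel_integrable_real_affine_iff[of 1 h "- s"] by simp
  have K2_int: "integrable (lborel \<Otimes>\<^sub>M lborel) (\<lambda>(s, t). K s (t - s))"
  proof (rule lborel_pair.Fubini_integrable[OF K2_meas])
    have "integrable (lborel \<Otimes>\<^sub>M lborel) (\<lambda>(s, t). norm (K s t))"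
      using integrable_norm[OF K_int] by (simp add: case_prod_unfold)
    from lborel_pair.integrable_fst[OF this]
    show "integrable lborel (\<lambda>s. LINT t|lborel. norm (case (s, t) of (s, t) \<Rightarrow> K s (t - s)))"
      by (simp add: shift[of "\<lambda>t. norm (K _ t)"])
    show "AE s in lborel. integrable lborel (\<lambda>t. case (s, t) of (s, t) \<Rightarrow> K s (t - s))"
      using lborel_pair.AE_integrable_fst[OF K_int] by (simp add: shift'[of "K _"])
  qed
  \<comment> \<open>For negative \<open>t\<close> the integrand is zero: \<open>k\<close> needs
    \<open>s \<ge> 0\<close> and the indicator needs \<open>s \<le> t\<close>.\<close>
  have inner: "(LINT s|lborel. K s (t - s)) = indicator {0..} t *\<^sub>R (e t * conv \<phi> g t)" for t
  proof -
    let ?f = "\<lambda>s. indicator {0..t} s *\<^sub>R (R (t - s) *\<^sub>V g s)"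
    let ?h = "\<lambda>s. indicator {..t} s *\<^sub>R (inverse (e s) *\<^sub>C (R (max 0 (t - s)) *\<^sub>V k s))"
    have h_meas: "?h \<in> borel_measurable borel"
    proof -
      have "(\<lambda>s. inverse (e s) *\<^sub>C k s) \<in> borel_measurable borel"
      proof -
        have "continuous_on UNIV (\<lambda>(c, z::'w). c *\<^sub>C z)"
          unfolding case_prod_unfold
          by (intro bounded_bilinear.continuous_on[OF bounded_bilinear_scaleC] continuous_intros)
        then have "(\<lambda>(c, z::'w). c *\<^sub>C z) \<in> borel_measurable (borel \<Otimes>\<^sub>M borel)"
          using borel_measurable_continuous_onI by (metis borel_prod)
        moreover have "(\<lambda>s. (inverse (e s), k s)) \<in> borel \<rightarrow>\<^sub>M (borel \<Otimes>\<^sub>M borel)"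
          by measurable
        ultimately show ?thesis
          using measurable_compose by fastforce
      qed
      from measurable_family_apply[OF _ this, of "\<lambda>s. t - s"]
      show ?thesis
        by (simp add: cblinfun_apply_scaleC)
    qed
    have "AE s in lebesgue. ?f s = ?h s"
      using ae
    proof eventually_elim
      case (elim s)
      show ?case
      proof (cases "s \<in> {0..t}")
        case True
        then have "k s = e s *\<^sub>C g s"
          using elim by simp
        then show ?thesis
          using True e_nz[of s] by (simp add: scaleC_one cblinfun_apply_scaleC scaleC_scaleC)
      next
        case False
        then show ?thesis
          using elim by (auto simp: indicator_def k_def cblinfun_linear_simps scaleC_linear_simps)
      qed
    qed
    note eq = integral_lebesgue_eq_lborel[OF h_meas this]
    have Kh: "K s (t - s) = e t * (\<phi> *\<^sub>V ?h s)" for s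
      using e_add[of s "t - s"] e_nz[of s]
      by (auto simp: K_def indicator_def cblinfun_apply_scaleC scaleC_complex_def cblinfun_linear_simps field_simps)
    show ?thesis
    proof (cases "t \<ge> 0")
      case True
      have "integrable lborel ?h"
        using conv_integrable[OF loc[of t]] eq(1) by (simp add: set_integrable_def)
      then have "\<phi> *\<^sub>V (LINT s|lborel. ?h s) = (LINT s|lborel. \<phi> *\<^sub>V ?h s)"
        by (intro integral_bounded_linear[OF bounded_linear_cblinfun_apply, symmetric])
      then show ?thesis
        using True eq(2) unfolding Kh by (simp add: conv_def set_lebesgue_integral_def)
    next
      case False
      then have "K s (t - s) = 0" for s
        by (auto simp: K_def indicator_def k_def cblinfun_linear_simps)
      then show ?thesis
        using False by simp
    qed
  qed
  have borel_int: "integrable lborel (\<lambda>t. indicator {0..} t *\<^sub>R (e t * conv \<phi> g t))"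
    using lborel_pair.integrable_snd[OF K2_int] by (simp add: inner)
  then show "integrable lebesgue (\<lambda>t. indicator {0..} t *\<^sub>R (exp (- l * complex_of_real t) * conv \<phi> g t))"
    unfolding e_def[symmetric] by (simp add: integrable_completion borel_measurable_integrable)
  have inner2: "(LINT s|lborel. K s t) = indicator {0..} t *\<^sub>R (e t * (\<phi> *\<^sub>V R (max 0 t) *\<^sub>V laplace_transform g l))" for t
  proof -
    have "bounded_linear (\<lambda>z. indicator {0..} t *\<^sub>R (e t * (\<phi> *\<^sub>V R (max 0 t) *\<^sub>V z)))"
      by (intro bounded_linear_compose[OF bounded_linear_scaleR_right] bounded_linear_compose[OF bounded_linear_mult_right]
          bounded_linear_compose[OF bounded_linear_cblinfun_apply] bounded_linear_cblinfun_apply)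
    from integral_bounded_linear[OF this int_k] show ?thesis
      by (simp add: K_def k_val)
  qed
  have "(LINT t|lebesgue. indicator {0..} t *\<^sub>R (e t * conv \<phi> g t)) = (LINT t|lborel. LINT s|lborel. K s (t - s))"
    using borel_int by (simp add: integral_completion inner)
  also have "\<dots> = (LINT s|lborel. LINT t|lborel. K s (t - s))"
    by (rule lborel_pair.Fubini_integral[OF K2_int])
  also have "\<dots> = (LINT s|lborel. LINT t|lborel. K s t)"
    by (simp add: shift[of "K _"])
  also have "\<dots> = (LINT t|lborel. LINT s|lborel. K s t)"
    by (rule lborel_pair.Fubini_integral[OF K_int, symmetric])
  also have "\<dots> = laplace \<phi> l (laplace_transform g l)"
    unfolding inner2 by (simp add: laplace_def e_def)
  finally show "(LINT t|lebesgue. indicator {0..} t *\<^sub>R (exp (- l * complex_of_real t) * conv \<phi> g t))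
      = laplace \<phi> l (laplace_transform g l)"
    by (simp only: e_def)
qed

end

context exp_bounded_family
begin

text \<open>The factor \<open>exp (\<omega> * (b - s))\<close> splits into
  \<open>exp (\<omega> * b)\<close> and a weight that makes \<open>g\<close> integrable over the
  half-line. Hence the boundary term in the transformed equation vanishes at infinity.\<close>

lemma norm_conv_le:
  assumes g: "laplace_converges g (complex_of_real \<omega>)" and loc: "set_integrable lebesgue {0..b} g"
  shows "cmod (conv \<phi> g b) \<le> norm \<phi> * M * (LINT s|lebesgue. norm (indicator {0..} s *\<^sub>R (exp (- complex_of_real \<omega> * complex_of_real s) *\<^sub>C g s))) * exp (\<omega> * b)"
proof -
  define h where "h s = norm (indicator {0..} s *\<^sub>R (exp (- complex_of_real \<omega> * complex_of_real s) *\<^sub>C g s))" for s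
  have h: "integrable lebesgue h"
    using g unfolding h_def laplace_converges_def set_integrable_def by (rule integrable_norm)
  have "norm (LINT s:{0..b}|lebesgue. R (b - s) *\<^sub>V g s) \<le> (LINT s|lebesgue. (M * exp (\<omega> * b)) * h s)"
    unfolding set_lebesgue_integral_def
  proof (rule Bochner_Integration.integral_norm_bound_integral)
    show "integrable lebesgue (\<lambda>s. indicator {0..b} s *\<^sub>R (R (b - s) *\<^sub>V g s))"
      using conv_integrable[OF loc] by (simp add: set_integrable_def)
    show "integrable lebesgue (\<lambda>s. (M * exp (\<omega> * b)) * h s)"
      by (intro integrable_mult_right h)
    fix s
    show "norm (indicator {0..b} s *\<^sub>R (R (b - s) *\<^sub>V g s)) \<le> (M * exp (\<omega> * b)) * h s"
    proof (cases "s \<in> {0..b}")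
      case True
      then have "norm (R (b - s) *\<^sub>V g s) \<le> M * exp (\<omega> * (b - s)) * norm (g s)"
        by (intro norm_apply) simp
      also have "exp (\<omega> * (b - s)) = exp (\<omega> * b) * exp (- \<omega> * s)"
        by (simp add: exp_add[symmetric] algebra_simps)
      finally show ?thesis
        using True by (simp add: h_def norm_scaleC mult_ac)
    next
      case False
      then show ?thesis
        using M_nonneg by (simp add: h_def)
    qed
  qed
  then have le: "norm (LINT s:{0..b}|lebesgue. R (b - s) *\<^sub>V g s) \<le> M * exp (\<omega> * b) * (LINT s|lebesgue. h s)"
    by simp
  have "cmod (conv \<phi> g b) \<le> norm \<phi> * norm (LINT s:{0..b}|lebesgue. R (b - s) *\<^sub>V g s)"
    unfolding conv_def by (rule norm_cblinfun)
  also have "\<dots> \<le> norm \<phi> * (M * exp (\<omega> * b) * (LINT s|lebesgue. h s))"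
    by (intro mult_left_mono le) simp
  finally show ?thesis
    by (simp add: h_def mult_ac)
qed

text \<open>The tested equation is multiplied by the exponential and integrated over the half-line.
  The boundary term at infinity vanishes, the one at zero is \<open>\<phi> *\<^sub>V z\<close>.
  Since the operators act on \<open>z\<close> before \<open>R\<close> does, the result is a left
  inverse property of the transform.\<close>

lemma resolvent_laplace_equation:
  assumes R0: "R 0 = id_cblinfun"
    and deriv: "\<And>t. t \<ge> 0 \<Longrightarrow> ((\<lambda>t. R t *\<^sub>V z + (LINT s:{0..t}|lebesgue. R (t - s) *\<^sub>V g s)) has_vector_derivative
             (R t *\<^sub>V a + (LINT s:{0..t}|lebesgue. R (t - s) *\<^sub>V n s))) (at t within {0..})"
    and g: "\<And>l. Re l > 0 \<Longrightarrow> laplace_converges g l" and g_loc: "\<And>b. set_integrable lebesgue {0..b} g"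
    and n: "\<And>l. Re l > 0 \<Longrightarrow> laplace_converges n l" and n_loc: "\<And>b. set_integrable lebesgue {0..b} n"
    and l: "Re l > \<omega>"
  shows "laplace \<phi> l (l *\<^sub>C z + l *\<^sub>C laplace_transform g l - a - laplace_transform n l) = \<phi> *\<^sub>V z"
proof -
  define E where "E t = exp (- l * complex_of_real t)" for t
  define x where "x t = \<phi> *\<^sub>V R t *\<^sub>V z + conv \<phi> g t" for t
  define y where "y t = \<phi> *\<^sub>V R t *\<^sub>V a + conv \<phi> n t" for t
  have l0: "Re l > 0"
    using l \<omega>_pos by simp
  have xy: "(x has_vector_derivative y t) (at t within {0..})" if "t \<ge> 0" for t
    using bounded_linear.has_vector_derivative[OF bounded_linear_cblinfun_apply deriv[OF that], of \<phi>]
    by (simp add: x_def[abs_def] y_def conv_def[abs_def] cblinfun_linear_simps)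
  have laplace_lebesgue:
    "integrable lebesgue (\<lambda>t. indicator {0..} t *\<^sub>R (E t * (\<phi> *\<^sub>V R t *\<^sub>V v)))"
    "(LINT t|lebesgue. indicator {0..} t *\<^sub>R (E t * (\<phi> *\<^sub>V R t *\<^sub>V v))) = laplace \<phi> l v" for v
  proof -
    have eq: "indicator {0..} t *\<^sub>R (E t * (\<phi> *\<^sub>V R t *\<^sub>V v)) = indicator {0..} t *\<^sub>R (exp (- l * complex_of_real t) * (\<phi> *\<^sub>V R (max 0 t) *\<^sub>V v))" for t
      by (auto simp: indicator_def E_def max_def)
    show "integrable lebesgue (\<lambda>t. indicator {0..} t *\<^sub>R (E t * (\<phi> *\<^sub>V R t *\<^sub>V v)))"
      "(LINT t|lebesgue. indicator {0..} t *\<^sub>R (E t * (\<phi> *\<^sub>V R t *\<^sub>V v))) = laplace \<phi> l v"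
      unfolding eq laplace_def using laplace_integrable[OF l, of \<phi> v]
      by (simp_all add: integrable_completion integral_completion borel_measurable_integrable)
  qed
  note conv_g = laplace_conv[OF l g[OF l0] g_loc, of \<phi>, folded E_def]
  note conv_n = laplace_conv[OF l n[OF l0] n_loc, of \<phi>, folded E_def]
  have int_x: "integrable lebesgue (\<lambda>t. indicator {0..} t *\<^sub>R (E t * x t))"
    and val_x: "(LINT t|lebesgue. indicator {0..} t *\<^sub>R (E t * x t)) = laplace \<phi> l z + laplace \<phi> l (laplace_transform g l)"
    using Bochner_Integration.integrable_add[OF laplace_lebesgue(1)[of z] conv_g(1)]
      Bochner_Integration.integral_add[OF laplace_lebesgue(1)[of z] conv_g(1)] laplace_lebesgue(2)[of z] conv_g(2)
    by (simp_all add: x_def algebra_simps)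
  have int_y: "integrable lebesgue (\<lambda>t. indicator {0..} t *\<^sub>R (E t * y t))"
    and val_y: "(LINT t|lebesgue. indicator {0..} t *\<^sub>R (E t * y t)) = laplace \<phi> l a + laplace \<phi> l (laplace_transform n l)"
    using Bochner_Integration.integrable_add[OF laplace_lebesgue(1)[of a] conv_n(1)]
      Bochner_Integration.integral_add[OF laplace_lebesgue(1)[of a] conv_n(1)] laplace_lebesgue(2)[of a] conv_n(2)
    by (simp_all add: y_def algebra_simps)
  \<comment> \<open>The derivative of \<open>E t * x t\<close>.\<close>
  define F where "F t = E t * y t - l * (E t * x t)" for t
  have F_eq: "indicator {0..} t *\<^sub>R F t = indicator {0..} t *\<^sub>R (E t * y t) - l * (indicator {0..} t *\<^sub>R (E t * x t))" for t
    by (simp add: F_def indicator_def)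
  have int_F: "set_integrable lebesgue {0..} F"
    unfolding set_integrable_def F_eq by (intro Bochner_Integration.integrable_diff int_y integrable_mult_right int_x)
  have val_F: "(LINT t:{0..}|lebesgue. F t) =
      (laplace \<phi> l a + laplace \<phi> l (laplace_transform n l)) - l * (laplace \<phi> l z + laplace \<phi> l (laplace_transform g l))"
    unfolding set_lebesgue_integral_def F_eq
    by (subst Bochner_Integration.integral_diff[OF int_y integrable_mult_right[OF int_x]])
      (simp only: integral_mult_right_zero val_x val_y)
  have FTC: "(LINT t:{0..b}|lebesgue. F t) = E b * x b - x 0" if b: "b \<ge> 0" for b
  proof -
    have hi: "(F has_integral (E b * x b - E 0 * x 0)) {0..b}"
    proof (rule fundamental_theorem_of_calculus[OF b])
      fix t assume t: "t \<in> {0..b}"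
      have "(x has_vector_derivative y t) (at t within {0..b})"
        using xy t by (intro has_vector_derivative_within_subset[OF xy]) auto
      moreover have "(E has_vector_derivative (- l * E t)) (at t within {0..b})"
        unfolding E_def by (rule has_vector_derivative_real_field) (auto intro!: derivative_eq_intros)
      ultimately have "((\<lambda>t. E t * x t) has_vector_derivative (E t * y t + (- l * E t) * x t)) (at t within {0..b})"
        by (intro has_vector_derivative_mult)
      then show "((\<lambda>t. E t * x t) has_vector_derivative F t) (at t within {0..b})"
        by (simp add: F_def mult_ac)
    qed
    have si: "set_integrable lebesgue {0..b} F"
      by (rule set_integrable_subset[OF int_F]) auto
    have "E 0 = 1"
      by (simp add: E_def)
    then show ?thesis
      using set_lebesgue_integral_eq_integral(2)[OF si] integral_unique[OF hi] by simp
  qed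
  define Cg where "Cg = (LINT s|lebesgue. norm (indicator {0..} s *\<^sub>R (exp (- complex_of_real \<omega> * complex_of_real s) *\<^sub>C g s)))"
  have bound_x: "cmod (E b * x b) \<le> (norm \<phi> * M * norm z + norm \<phi> * M * Cg) * exp (- (Re l - \<omega>) * b)" if b: "b \<ge> 0" for b
  proof -
    have "cmod (conv \<phi> g b) \<le> norm \<phi> * M * Cg * exp (\<omega> * b)"
      unfolding Cg_def using \<omega>_pos by (intro norm_conv_le g g_loc) simp
    then have "cmod (E b * conv \<phi> g b) \<le> exp (- Re l * b) * (norm \<phi> * M * Cg * exp (\<omega> * b))"
      by (simp add: norm_mult E_def)
    also have "\<dots> = norm \<phi> * M * Cg * (exp (- Re l * b) * exp (\<omega> * b))"
      by simp
    also have "exp (- Re l * b) * exp (\<omega> * b) = exp (- (Re l - \<omega>) * b)"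
      by (simp add: exp_add[symmetric] algebra_simps)
    finally have "cmod (E b * conv \<phi> g b) \<le> norm \<phi> * M * Cg * exp (- (Re l - \<omega>) * b)" .
    moreover have "cmod (E b * (\<phi> *\<^sub>V R b *\<^sub>V z)) \<le> norm \<phi> * M * norm z * exp (- (Re l - \<omega>) * b)"
      unfolding E_def by (rule norm_laplace_integrand[OF b])
    ultimately show ?thesis
      unfolding x_def distrib_left distrib_right by (intro order_trans[OF norm_triangle_ineq] add_mono)
  qed
  have "((\<lambda>b. exp (- (Re l - \<omega>) * b)) \<longlongrightarrow> 0) at_top"
  proof -
    have "filterlim (\<lambda>b. (Re l - \<omega>) * b) at_top at_top"
      using l by (intro filterlim_tendsto_pos_mult_at_top[OF tendsto_const _ filterlim_ident]) simp
    then have "filterlim (\<lambda>b. - ((Re l - \<omega>) * b)) at_bot at_top"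
      unfolding filterlim_uminus_at_top .
    from filterlim_compose[OF exp_at_bot this] show ?thesis
      unfolding mult_minus_left .
  qed
  then have "((\<lambda>b. (norm \<phi> * M * norm z + norm \<phi> * M * Cg) * exp (- (Re l - \<omega>) * b)) \<longlongrightarrow> 0) at_top"
    by (rule tendsto_mult_right_zero)
  then have "((\<lambda>b. E b * x b) \<longlongrightarrow> 0) at_top"
    by (rule Lim_null_comparison[rotated]) (use bound_x eventually_ge_at_top in \<open>auto intro: eventually_mono[OF eventually_ge_at_top[of 0]]\<close>)
  then have "((\<lambda>b. E b * x b - x 0) \<longlongrightarrow> 0 - x 0) at_top"
    by (intro tendsto_intros)
  moreover have "\<forall>\<^sub>F b in at_top. E b * x b - x 0 = (LINT t:{0..b}|lebesgue. F t)"
    using eventually_ge_at_top[of 0] by eventually_elim (simp add: FTC)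
  ultimately have "((\<lambda>b. LINT t:{0..b}|lebesgue. F t) \<longlongrightarrow> - x 0) at_top"
    by (simp add: tendsto_cong)
  \<comment> \<open>The integrals over bounded intervals also converge to the integral over the
    half-line; comparing the two limits gives the identity.\<close>
  moreover have "((\<lambda>b. LINT t:{0..b}|lebesgue. F t) \<longlongrightarrow> (LINT t:{0..}|lebesgue. F t)) at_top"
    unfolding set_lebesgue_integral_def
  proof (rule integral_dominated_convergence_at_top[where w = "\<lambda>t. norm (indicator {0..} t *\<^sub>R F t)"])
    show "(\<lambda>t. indicator {0..} t *\<^sub>R F t) \<in> borel_measurable lebesgue"
      "integrable lebesgue (\<lambda>t. norm (indicator {0..} t *\<^sub>R F t))"
      using int_F unfolding set_integrable_def by (rule borel_measurable_integrable integrable_norm)+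
    show "(\<lambda>t. indicator {0..b} t *\<^sub>R F t) \<in> borel_measurable lebesgue" for b
    proof -
      have "set_integrable lebesgue {0..b} F"
        by (rule set_integrable_subset[OF int_F]) auto
      then show ?thesis
        unfolding set_integrable_def by (rule borel_measurable_integrable)
    qed
    show "\<forall>\<^sub>F b in at_top. AE t in lebesgue. norm (indicator {0..b} t *\<^sub>R F t) \<le> norm (indicator {0..} t *\<^sub>R F t)"
      by (auto simp: indicator_def)
    show "AE t in lebesgue. ((\<lambda>b. indicator {0..b} t *\<^sub>R F t) \<longlongrightarrow> indicator {0..} t *\<^sub>R F t) at_top"
    proof (rule AE_I2)
      fix t
      have "\<forall>\<^sub>F b in at_top. indicator {0..b} t *\<^sub>R F t = indicator {0..} t *\<^sub>R F t"
        using eventually_ge_at_top[of t] by eventually_elim (auto simp: indicator_def)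
      then show "((\<lambda>b. indicator {0..b} t *\<^sub>R F t) \<longlongrightarrow> indicator {0..} t *\<^sub>R F t) at_top"
        by (rule tendsto_eventually)
    qed
  qed
  ultimately have "(LINT t:{0..}|lebesgue. F t) = - x 0"
    using tendsto_unique trivial_limit_at_top_linorder by blast
  moreover have "x 0 = \<phi> *\<^sub>V z"
  proof -
    have "(LINT s:{0..0::real}|lebesgue. R (0 - s) *\<^sub>V g s) = 0"
      unfolding set_lebesgue_integral_def
    proof (rule integral_eq_zero_AE)
      have "AE s in lebesgue. s \<noteq> (0::real)"
        by (rule AE_completion[OF AE_lborel_singleton])
      then show "AE s in lebesgue. indicator {0..0::real} s *\<^sub>R (R (0 - s) *\<^sub>V g s) = 0"
        by eventually_elim (auto simp: indicator_def)
    qed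
    then show ?thesis
      by (simp add: x_def conv_def R0 cblinfun_linear_simps)
  qed
  ultimately show ?thesis
    using val_F l by (simp add: laplace_diff laplace_add laplace_scaleC algebra_simps)
qed

end

section \<open>The characteristic operator\<close>

lemma sector_iff:
  assumes "0 \<le> \<nu>" "\<nu> \<le> pi"
  shows "l \<in> sector \<nu> \<longleftrightarrow> cmod l * cos \<nu> < Re l"
proof (cases "l = 0")
  case False
  have "l = rcis (cmod l) (Arg l)"
    by (simp add: rcis_cmod_Arg)
  then have "Re l = cmod l * cos (Arg l)"
    by (metis Re_rcis)
  then have re: "Re l = cmod l * cos \<bar>Arg l\<bar>"
    by simp
  have "\<bar>Arg l\<bar> \<le> pi"
    using Arg_bounded[of l] by auto
  then have "\<bar>Arg l\<bar> < \<nu> \<longleftrightarrow> cos \<nu> < cos \<bar>Arg l\<bar>"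
    using assms by (intro cos_mono_less_eq[symmetric]) auto
  then show ?thesis
    using False by (simp add: sector_def re)
qed (simp add: sector_def)

lemma open_sector:
  assumes "0 \<le> \<nu>" "\<nu> \<le> pi"
  shows "open (sector \<nu>)"
proof -
  have "sector \<nu> = {l. cmod l * cos \<nu> < Re l}"
    using sector_iff[OF assms] by auto
  then show ?thesis
    by (auto intro!: open_Collect_less continuous_intros)
qed

text \<open>An opening beyond \<open>pi / 2\<close> leaves room, around each point of the right
  half-plane, for a disc of radius proportional to its modulus. On such discs Cauchy's inequality
  gains a factor \<open>1 / cmod l\<close>.\<close>

lemma ball_subset_sector:
  assumes \<nu>: "pi / 2 < \<nu>" "\<nu> < pi"
  obtains c where "0 < c" "c \<le> 1 / 3"
    "\<And>l m. Re l > 0 \<Longrightarrow> cmod (m - l) < c * cmod l \<Longrightarrow> m \<in> sector \<nu> \<and> cmod l \<le> 2 * cmod m"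
proof -
  define k where "k = - cos \<nu>"
  have "cos \<nu> < 0"
    using \<nu> cos_monotone_0_pi[of "pi / 2" \<nu>] by simp
  then have k: "k > 0" "k \<le> 1"
    using cos_ge_minus_one[of \<nu>] by (auto simp: k_def)
  \<comment> \<open>With \<open>m\<close> in the disc, \<open>Re m\<close> exceeds
    \<open>- (k / 3) * cmod l\<close> while \<open>cmod m\<close> is at least two thirds of
    \<open>cmod l\<close>; so \<open>Re m\<close> exceeds \<open>- k * cmod m\<close>, which is the
    cosine condition.\<close>
  show thesis
  proof (rule that[of "k / 3"])
    fix l m :: complex
    assume l: "Re l > 0" and m: "cmod (m - l) < k / 3 * cmod l"
    have "l \<noteq> 0" using l by auto
    then have pos: "cmod l > 0" by simp
    have "k / 3 * cmod l \<le> 1 / 3 * cmod l"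
      using k by (intro mult_right_mono) auto
    then have "cmod (m - l) \<le> 1 / 3 * cmod l"
      using m by linarith
    then have big: "cmod m \<ge> 2 / 3 * cmod l"
      using norm_triangle_ineq2[of l "l - m"] by (simp add: norm_minus_commute)
    have "- (k / 3 * cmod l) < Re m"
      using l m abs_Re_le_cmod[of "m - l"] by simp
    moreover have "k * (2 / 3 * cmod l) \<le> k * cmod m"
      using big k by (intro mult_left_mono) auto
    moreover have "0 < k * cmod l"
      using k pos by simp
    ultimately have "- (k * cmod m) < Re m"
      by linarith
    then have "cmod m * cos \<nu> < Re m"
      by (simp add: k_def mult.commute)
    then have "m \<in> sector \<nu>"
      using \<nu> by (subst sector_iff) auto
    moreover have "cmod l \<le> 2 * cmod m"
      using big pos by linarith
    ultimately show "m \<in> sector \<nu> \<and> cmod l \<le> 2 * cmod m" ..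
  qed (use k in auto)
qed

lemma right_half_plane_subset_sector:
  assumes "pi / 2 < \<nu>" "\<nu> < pi" "Re l > 0"
  shows "l \<in> sector \<nu>"
  using ball_subset_sector[OF assms(1,2)] assms(3) by (metis diff_self mult_pos_pos norm_zero zero_less_norm_iff zero_complex.simps(1) less_irrefl)

text \<open>Around each point within distance 1 of \<open>l\<close> a disc of radius
  \<open>\<rho> / 4\<close> still fits, since \<open>\<rho> \<ge> 4\<close>. Cauchy's inequality
  bounds the derivative there and the mean value inequality covers the unit step.\<close>

lemma cauchy_step:
  assumes hol: "h holomorphic_on ball l \<rho>" and B: "\<And>w. w \<in> ball l \<rho> \<Longrightarrow> cmod (h w) \<le> B"
    and \<rho>: "\<rho> \<ge> 4"
  shows "cmod (h (l + 1) - h l) \<le> 4 * B / \<rho>"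
proof -
  have deriv: "cmod (deriv h w) \<le> 4 * B / \<rho>" if w: "w \<in> cball l 1" for w
  proof -
    have sub: "cball w (\<rho> / 4) \<subseteq> ball l \<rho>"
    proof
      fix z assume "z \<in> cball w (\<rho> / 4)"
      then show "z \<in> ball l \<rho>"
        using w \<rho> dist_triangle[of l z w] by (simp add: dist_commute)
    qed
    have "cmod ((deriv ^^ 1) h w) \<le> fact 1 * B / (\<rho> / 4) ^ 1"
    proof (rule Cauchy_inequality)
      show "h holomorphic_on ball w (\<rho> / 4)"
        using hol by (rule holomorphic_on_subset) (use sub ball_subset_cball in blast)
      show "continuous_on (cball w (\<rho> / 4)) h"
        by (rule holomorphic_on_imp_continuous_on, rule holomorphic_on_subset[OF hol sub])
      fix x assume "cmod (w - x) = \<rho> / 4"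
      then show "cmod (h x) \<le> B"
        using sub by (intro B) (auto simp: dist_norm)
    qed (use \<rho> in simp)
    then show ?thesis by (simp add: mult.commute)
  qed
  have "cmod (h (l + 1) - h l) \<le> (4 * B / \<rho>) * cmod ((l + 1) - l)"
  proof (rule field_differentiable_bound[OF convex_cball[of l 1]])
    fix z assume z: "z \<in> cball l 1"
    then have "z \<in> ball l \<rho>"
      using \<rho> by simp
    then have "(h has_field_derivative deriv h z) (at z)"
      using hol by (simp add: holomorphic_derivI)
    then show "(h has_field_derivative deriv h z) (at z within cball l 1)"
      by (rule has_field_derivative_at_within)
    show "cmod (deriv h z) \<le> 4 * B / \<rho>"
      by (rule deriv[OF z])
  qed (auto simp: dist_norm)
  then show ?thesis by simp
qed

text \<open>The inverse of the identity plus \<open>E\<close>, obtained from the contraction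
  \<open>y \<mapsto> v - E y\<close>. Plain functions are used because \<open>E\<close> is assembled
  from maps that are linear only on a subspace.\<close>

lemma neumann_inverse:
  fixes E :: "'a::complex_banach \<Rightarrow> 'a"
  assumes add: "\<And>x y. E (x + y) = E x + E y" and scale: "\<And>c x. E (c *\<^sub>C x) = c *\<^sub>C E x"
    and small: "\<And>x. norm (E x) \<le> norm x / 2"
  obtains S :: "'a \<Rightarrow>\<^sub>C\<^sub>L 'a" where "\<And>v. S *\<^sub>V v + E (S *\<^sub>V v) = v" "\<And>v. norm (S *\<^sub>V v) \<le> 2 * norm v"
proof -
  have neg: "E (- x) = - E x" for x
    using scale[of "-1" x] scaleC_of_real[of "-1" x] scaleC_of_real[of "-1" "E x"] by simp
  have diff: "E (x - y) = E x - E y" for x y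
    using add[of x "- y"] by (simp add: neg)
  have bound: "norm y \<le> 2 * norm v" if "y + E y = v" for y v
  proof -
    have "norm y \<le> norm v + norm (E y)"
      using norm_triangle_ineq4[of v "E y"] that by (metis add_diff_cancel_right')
    then show ?thesis
      using small[of y] by simp
  qed
  have "\<exists>y. y + E y = v" for v
  proof -
    have "\<exists>!y. v - E y = y"
    proof (rule banach_fix_type[of "1/2"])
      show "\<forall>x y. dist (v - E x) (v - E y) \<le> 1 / 2 * dist x y"
      proof (intro allI)
        fix x y
        show "dist (v - E x) (v - E y) \<le> 1 / 2 * dist x y"
          using small[of "y - x"] by (simp add: dist_norm diff norm_minus_commute)
      qed
    qed auto
    then show ?thesis
      by (metis diff_add_cancel)
  qed
  then obtain S where S: "\<And>v. S v + E (S v) = v"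
    by metis
  \<comment> \<open>Uniqueness of the solution is what makes the solution operator linear.\<close>
  have unique: "S v = y" if "y + E y = v" for y v
  proof -
    have "(S v - y) + E (S v - y) = 0"
      using S[of v] that by (simp add: diff algebra_simps)
    from bound[OF this] show ?thesis by simp
  qed
  obtain S' where S': "\<And>v. S' *\<^sub>V v = S v"
  proof (rule cblinfun_exists[of S 2])
    show "S (x + y) = S x + S y" for x y
      using S[of x] S[of y] by (intro unique) (simp add: add algebra_simps)
    show "S (c *\<^sub>C x) = c *\<^sub>C S x" for c x
      by (intro unique) (simp add: scale scaleC_add_right[symmetric] S)
    show "norm (S x) \<le> 2 * norm x" for x
      by (intro bound S)
  qed blast
  show thesis
    using that[of S'] S bound by (metis S')
qed

lemma is_resolvent_at_resolvent:
  assumes "l \<in> resolvent_set D A"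
  shows "is_resolvent_at D A l (resolvent D A l)"
proof -
  obtain S where S: "is_resolvent_at D A l S"
    using assms by (auto simp: resolvent_set_def)
  have "S' = S" if "is_resolvent_at D A l S'" for S'
    using S that unfolding is_resolvent_at_def by (metis cblinfun_eqI)
  then have "\<exists>!S. is_resolvent_at D A l S"
    using S by blast
  then show ?thesis
    unfolding resolvent_def by (rule theI')
qed

lemma graph_norm_nonneg: "graph_norm A z \<ge> 0"
  by (simp add: graph_norm_def)

text \<open>Graph boundedness makes the quotients bounded above, so that the supremum really
  dominates them. Points of graph norm zero need the bound itself, as their quotient is zero by
  convention.\<close>

lemma graph_opnorm_bound:
  assumes S: "graph_bounded D A S" and z: "z \<in> D"
  shows "norm (S z) \<le> graph_opnorm D A S * graph_norm A z"
proof (cases "graph_norm A z = 0")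
  case True
  obtain K where "\<forall>z\<in>D. norm (S z) \<le> K * graph_norm A z"
    using S by (auto simp: graph_bounded_def)
  then show ?thesis
    using True z by force
next
  case False
  then have pos: "graph_norm A z > 0"
    using graph_norm_nonneg[of A z] by linarith
  obtain K where K: "\<And>z. z \<in> D \<Longrightarrow> norm (S z) \<le> K * graph_norm A z"
    using S by (auto simp: graph_bounded_def)
  have "norm (S x) / graph_norm A x \<le> \<bar>K\<bar>" if "x \<in> D" for x
  proof (cases "graph_norm A x = 0")
    case False
    then have "graph_norm A x > 0"
      using graph_norm_nonneg[of A x] by linarith
    then show ?thesis
      using K[OF that] by (simp add: divide_le_eq) (meson abs_ge_self mult_right_mono order_trans less_imp_le)
  qed simp
  then have "bdd_above ((\<lambda>z. norm (S z) / graph_norm A z) ` D)"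
    by (auto simp: bdd_above_def)
  then have "norm (S z) / graph_norm A z \<le> graph_opnorm D A S"
    unfolding graph_opnorm_def using z by (rule cSUP_upper2[OF _ _ order_refl])
  then show ?thesis
    using pos by (simp add: divide_le_eq)
qed

lemma functional_holomorphic:
  assumes "banach_analytic_on F S" "open S"
  shows "(\<lambda>l. \<phi> *\<^sub>V F l *\<^sub>V x) holomorphic_on S"
  unfolding holomorphic_on_open[OF assms(2)]
proof
  fix l assume "l \<in> S"
  then obtain D where D: "(F has_derivative (\<lambda>h. h *\<^sub>C D)) (at l)"
    using assms(1) by (auto simp: banach_analytic_on_def)
  have "bounded_linear (\<lambda>T. \<phi> *\<^sub>V T *\<^sub>V x)"
    by (rule bounded_linear_compose[OF bounded_linear_cblinfun_apply bounded_linear_cblinfun_apply_left])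
  from bounded_linear.has_derivative[OF this D]
  have "((\<lambda>l. \<phi> *\<^sub>V F l *\<^sub>V x) has_derivative (\<lambda>h. (\<phi> *\<^sub>V D *\<^sub>V x) * h)) (at l)"
    by (simp add: cblinfun_scaleC_apply cblinfun_apply_scaleC scaleC_complex_def mult.commute)
  then show "\<exists>f'. ((\<lambda>l. \<phi> *\<^sub>V F l *\<^sub>V x) has_field_derivative f') (at l)"
    unfolding has_field_derivative_def by blast
qed

text \<open>The difference quotients converge in the operator norm from the graph norm, hence at
  each \<open>x\<close> in the domain after testing with a functional. This makes
  \<open>Nhat\<close> accessible to scalar Cauchy estimates.\<close>

lemma functional_graph_holomorphic:
  assumes an: "graph_analytic_on D A F S" and S: "open S" and x: "x \<in> D"
  shows "(\<lambda>l. \<phi> *\<^sub>V F l x) holomorphic_on S"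
  unfolding holomorphic_on_open[OF S]
proof
  fix l assume l: "l \<in> S"
  obtain L where L: "graph_bounded D A L"
    and lim: "((\<lambda>m. graph_opnorm D A (\<lambda>z. inverse (m - l) *\<^sub>C (F m z - F l z) - L z)) \<longlongrightarrow> 0) (at l)"
    using an l by (auto simp: graph_analytic_on_def)
  have gb: "graph_bounded D A (\<lambda>z. inverse (m - l) *\<^sub>C (F m z - F l z) - L z)" if m: "m \<in> S" for m
  proof -
    have F: "graph_bounded D A (F m)" "graph_bounded D A (F l)"
      using an l m by (auto simp: graph_analytic_on_def)
    obtain K1 K2 K3 where K: "\<And>z. z \<in> D \<Longrightarrow> norm (F m z) \<le> K1 * graph_norm A z"
      "\<And>z. z \<in> D \<Longrightarrow> norm (F l z) \<le> K2 * graph_norm A z" "\<And>z. z \<in> D \<Longrightarrow> norm (L z) \<le> K3 * graph_norm A z"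
      using F L unfolding graph_bounded_def by blast
    define c where "c = inverse (m - l)"
    have "norm (c *\<^sub>C (F m z - F l z) - L z) \<le> (cmod c * (K1 + K2) + K3) * graph_norm A z" if z: "z \<in> D" for z
    proof -
      have "norm (F m z - F l z) \<le> (K1 + K2) * graph_norm A z"
        using norm_triangle_ineq4[of "F m z" "F l z"] K[OF z] by (simp add: distrib_right)
      then have "norm (c *\<^sub>C (F m z - F l z)) \<le> cmod c * ((K1 + K2) * graph_norm A z)"
        by (simp add: norm_scaleC mult_left_mono)
      then show ?thesis
        using norm_triangle_ineq4[of "c *\<^sub>C (F m z - F l z)" "L z"] K(3)[OF z] by (simp add: distrib_right mult.assoc)
    qed
    moreover have "clinear_on D (\<lambda>z. c *\<^sub>C (F m z - F l z) - L z)"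
    proof -
      have cm: "c *\<^sub>C (d *\<^sub>C z) = d *\<^sub>C (c *\<^sub>C z)" for d and z :: 'a
        by (simp add: scaleC_scaleC mult.commute)
      show ?thesis
        using F L unfolding graph_bounded_def clinear_on_def
        by (auto simp: scaleC_linear_simps scaleC_add_right cm)
    qed
    ultimately show ?thesis
      unfolding graph_bounded_def c_def by blast
  qed
  have "((\<lambda>m. (\<phi> *\<^sub>V F m x - \<phi> *\<^sub>V F l x) / (m - l)) \<longlongrightarrow> \<phi> *\<^sub>V L x) (at l)"
  proof (rule Lim_transform[OF tendsto_const], rule Lim_null_comparison)
    have "\<forall>\<^sub>F m in at l. m \<in> S"
      using S l by (simp add: eventually_at_topological) blast
    then show "\<forall>\<^sub>F m in at l. norm ((\<phi> *\<^sub>V F m x - \<phi> *\<^sub>V F l x) / (m - l) - \<phi> *\<^sub>V L x)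
        \<le> norm \<phi> * (graph_opnorm D A (\<lambda>z. inverse (m - l) *\<^sub>C (F m z - F l z) - L z) * graph_norm A x)"
    proof eventually_elim
      case (elim m)
      have "(\<phi> *\<^sub>V F m x - \<phi> *\<^sub>V F l x) / (m - l) - \<phi> *\<^sub>V L x = \<phi> *\<^sub>V (inverse (m - l) *\<^sub>C (F m x - F l x) - L x)"
        by (simp add: cblinfun_linear_simps cblinfun_apply_scaleC scaleC_complex_def divide_inverse mult.commute)
      also have "cmod \<dots> \<le> norm \<phi> * norm (inverse (m - l) *\<^sub>C (F m x - F l x) - L x)"
        by (rule norm_cblinfun)
      also have "\<dots> \<le> norm \<phi> * (graph_opnorm D A (\<lambda>z. inverse (m - l) *\<^sub>C (F m z - F l z) - L z) * graph_norm A x)"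
        using graph_opnorm_bound[OF gb[OF elim] x] by (intro mult_left_mono) auto
      finally show ?case .
    qed
    have "((\<lambda>m. norm \<phi> * (graph_opnorm D A (\<lambda>z. inverse (m - l) *\<^sub>C (F m z - F l z) - L z) * graph_norm A x)) \<longlongrightarrow> norm \<phi> * (0 * graph_norm A x)) (at l)"
      by (intro tendsto_intros lim)
    then show "((\<lambda>m. norm \<phi> * (graph_opnorm D A (\<lambda>z. inverse (m - l) *\<^sub>C (F m z - F l z) - L z) * graph_norm A x)) \<longlongrightarrow> 0) (at l)"
      by simp
  qed
  then show "\<exists>f'. ((\<lambda>l. \<phi> *\<^sub>V F l x) has_field_derivative f') (at l)"
    unfolding has_field_derivative_iff by blast
qed

definition char_op ::
  "('w::complex_banach \<Rightarrow> 'w) \<Rightarrow> (complex \<Rightarrow> 'w \<Rightarrow>\<^sub>C\<^sub>L 'w) \<Rightarrow> (complex \<Rightarrow> 'w \<Rightarrow> 'w) \<Rightarrow> complex \<Rightarrow> 'w \<Rightarrow> 'w"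
  where "char_op A Ghat Nhat l x = l *\<^sub>C x + l *\<^sub>C (Ghat l *\<^sub>V x) - A x - Nhat l x"

lemma Cd3_small:
  assumes Cd3: "Cd3 \<nu> DA A DN N Nhat" and e: "e > 0"
  obtains r where "\<And>l z. l \<in> sector \<nu> \<Longrightarrow> cmod l \<ge> r \<Longrightarrow> z \<in> DA \<Longrightarrow> norm (Nhat l z) \<le> e * graph_norm A z"
proof -
  have "((\<lambda>l. graph_opnorm DA A (Nhat l)) \<longlongrightarrow> 0) (inf at_infinity (principal (sector \<nu>)))"
    using Cd3 by (simp add: Cd3_def)
  then have "\<forall>\<^sub>F l in inf at_infinity (principal (sector \<nu>)). graph_opnorm DA A (Nhat l) < e"
    using e by (rule order_tendstoD)
  then obtain r where r: "\<And>l. cmod l \<ge> r \<Longrightarrow> l \<in> sector \<nu> \<Longrightarrow> graph_opnorm DA A (Nhat l) < e"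
    by (auto simp: eventually_inf_principal eventually_at_infinity)
  show thesis
  proof (rule that[of r])
    fix l z assume *: "l \<in> sector \<nu>" "cmod l \<ge> r" "z \<in> DA"
    have "norm (Nhat l z) \<le> graph_opnorm DA A (Nhat l) * graph_norm A z"
      using Cd3 * by (simp add: Cd3_def)
    also have "\<dots> \<le> e * graph_norm A z"
      using r[OF *(2,1)] by (intro mult_right_mono graph_norm_nonneg) simp
    finally show "norm (Nhat l z) \<le> e * graph_norm A z" .
  qed
qed

text \<open>The characteristic operator after the resolvent \<open>T\<close> of \<open>A\<close> is
  the identity plus \<open>E\<close>. For large \<open>l\<close> the map \<open>E\<close> is a
  contraction, since \<open>l\<close> times \<open>T\<close> stays bounded while \<open>Ghat\<close>
  and \<open>Nhat\<close> become small. Keeping \<open>T\<close> as the left factor of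
  \<open>Q\<close> is what transmits compactness.\<close>

lemma char_op_right_inverse:
  assumes Cd1: "Cd1 \<nu> DA A" and Cd2: "Cd2 \<nu> \<alpha> DA A G Ghat" and Cd3: "Cd3 \<nu> DA A DN N Nhat"
    and A: "closed_linear_operator DA A"
  obtains Q r C where "r \<ge> 1" "C \<ge> 0"
    "\<And>l v. l \<in> sector \<nu> \<Longrightarrow> cmod l \<ge> r \<Longrightarrow> Q l *\<^sub>V v \<in> DA \<and> char_op A Ghat Nhat l (Q l *\<^sub>V v) = v"
    "\<And>l v. l \<in> sector \<nu> \<Longrightarrow> cmod l \<ge> r \<Longrightarrow> norm (Q l *\<^sub>V v) \<le> C / cmod l * norm v"
    "\<And>l v. l \<in> sector \<nu> \<Longrightarrow> cmod l \<ge> r \<Longrightarrow> graph_norm A (Q l *\<^sub>V v) \<le> C * norm v"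
    "\<And>l. l \<in> sector \<nu> \<Longrightarrow> cmod l \<ge> r \<Longrightarrow> \<exists>S. Q l = resolvent DA A l o\<^sub>C\<^sub>L S"
proof -
  obtain M0 where M0: "M0 > 0" "\<And>l. l \<in> sector \<nu> \<Longrightarrow> norm (resolvent DA A l) \<le> M0 / cmod l"
    and res: "sector \<nu> \<subseteq> resolvent_set DA A"
    using Cd1 by (auto simp: Cd1_def)
  obtain N1 where N1: "N1 > 0" "\<And>l. l \<in> sector \<nu> \<Longrightarrow> norm (Ghat l) \<le> N1 * cmod l powr (- \<alpha>)" and \<alpha>: "\<alpha> > 0"
    using Cd2 by (auto simp: Cd2_def)
  \<comment> \<open>Bound for \<open>T\<close> into the graph norm: \<open>M0\<close> for
    \<open>T\<close> itself and \<open>M0 + 1\<close> for \<open>A\<close> after \<open>T\<close>.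
    The thresholds \<open>r1\<close> and \<open>r2\<close> below then make each of the two terms of
    \<open>E\<close> at most a quarter.\<close>
  define K where "K = 2 * M0 + 1"
  have K: "K > 0" using M0 by (simp add: K_def)
  obtain r1 where r1: "\<And>l z. l \<in> sector \<nu> \<Longrightarrow> cmod l \<ge> r1 \<Longrightarrow> z \<in> DA \<Longrightarrow> norm (Nhat l z) \<le> 1 / (4 * K) * graph_norm A z"
    using Cd3_small[OF Cd3, of "1 / (4 * K)"] K by auto
  have "((\<lambda>x::real. x powr (- \<alpha>)) \<longlongrightarrow> 0) at_top"
    using tendsto_neg_powr[OF _ filterlim_ident, of "- \<alpha>"] \<alpha> by simp
  then have "\<forall>\<^sub>F x in at_top. x powr (- \<alpha>) < 1 / (4 * (N1 * M0))"
    by (rule order_tendstoD) (use N1 M0 in simp)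
  then obtain r2 where r2: "\<And>x. x \<ge> r2 \<Longrightarrow> x powr (- \<alpha>) < 1 / (4 * (N1 * M0))"
    by (auto simp: eventually_at_top_linorder)
  define r where "r = max 1 (max r1 r2)"
  have NC: "clinear_on DA (Nhat l)" if "l \<in> sector \<nu>" for l
    using Cd3 that by (auto simp: Cd3_def graph_analytic_on_def graph_bounded_def)
  have "\<exists>Q. (\<forall>v. Q *\<^sub>V v \<in> DA \<and> char_op A Ghat Nhat l (Q *\<^sub>V v) = v \<and> norm (Q *\<^sub>V v) \<le> 2 * K / cmod l * norm v
      \<and> graph_norm A (Q *\<^sub>V v) \<le> 2 * K * norm v) \<and> (\<exists>S. Q = resolvent DA A l o\<^sub>C\<^sub>L S)"
    if l: "l \<in> sector \<nu>" and lr: "cmod l \<ge> r" for l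
  proof -
    define T where "T = resolvent DA A l"
    have l1: "cmod l \<ge> 1" "cmod l \<ge> r1" "cmod l \<ge> r2"
      using lr by (auto simp: r_def)
    have T: "T *\<^sub>V y \<in> DA" "l *\<^sub>C (T *\<^sub>V y) - A (T *\<^sub>V y) = y" for y
      using is_resolvent_at_resolvent[of l DA A] res l unfolding T_def is_resolvent_at_def by blast+
    have nT: "norm (T *\<^sub>V y) \<le> M0 / cmod l * norm y" for y
      unfolding T_def by (intro norm_cblinfun_le M0 l)
    have lT: "cmod l * norm (T *\<^sub>V y) \<le> M0 * norm y" for y
    proof -
      have "l \<noteq> 0"
        using l1 by auto
      then show ?thesis
        using mult_left_mono[OF nT[of y], of "cmod l"] by simp
    qed
    have gT: "graph_norm A (T *\<^sub>V y) \<le> K * norm y" for y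
    proof -
      have "A (T *\<^sub>V y) = l *\<^sub>C (T *\<^sub>V y) - y"
        using T(2)[of y] by (metis add_diff_cancel_left' diff_add_cancel)
      then have "norm (A (T *\<^sub>V y)) \<le> cmod l * norm (T *\<^sub>V y) + norm y"
        using norm_triangle_ineq4[of "l *\<^sub>C (T *\<^sub>V y)" y] by (simp add: norm_scaleC)
      moreover have "1 * norm (T *\<^sub>V y) \<le> cmod l * norm (T *\<^sub>V y)"
        using l1 by (intro mult_right_mono) auto
      ultimately show ?thesis
        using lT[of y] by (simp add: graph_norm_def K_def algebra_simps)
    qed
    define E where "E y = l *\<^sub>C (Ghat l *\<^sub>V T *\<^sub>V y) - Nhat l (T *\<^sub>V y)" for y
    have nN: "norm (Nhat l (T *\<^sub>V y)) \<le> norm y / 4" for y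
    proof -
      have "norm (Nhat l (T *\<^sub>V y)) \<le> 1 / (4 * K) * graph_norm A (T *\<^sub>V y)"
        using l l1 T by (intro r1)
      also have "\<dots> \<le> 1 / (4 * K) * (K * norm y)"
        using K by (intro mult_left_mono gT) simp
      finally show ?thesis
        using K by simp
    qed
    have nG: "norm (l *\<^sub>C (Ghat l *\<^sub>V T *\<^sub>V y)) \<le> norm y / 4" for y
    proof -
      have "norm (Ghat l *\<^sub>V T *\<^sub>V y) \<le> (N1 * (1 / (4 * (N1 * M0)))) * norm (T *\<^sub>V y)"
      proof (rule norm_cblinfun_le)
        have "norm (Ghat l) \<le> N1 * cmod l powr (- \<alpha>)"
          by (rule N1(2)[OF l])
        also have "\<dots> \<le> N1 * (1 / (4 * (N1 * M0)))"
          using N1(1) r2[OF l1(3)] by (intro mult_left_mono) auto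
        finally show "norm (Ghat l) \<le> N1 * (1 / (4 * (N1 * M0)))" .
      qed
      then have "norm (Ghat l *\<^sub>V T *\<^sub>V y) \<le> norm (T *\<^sub>V y) / (4 * M0)"
        using N1 by simp
      then have "cmod l * norm (Ghat l *\<^sub>V T *\<^sub>V y) \<le> cmod l * (norm (T *\<^sub>V y) / (4 * M0))"
        by (intro mult_left_mono) auto
      also have "\<dots> \<le> norm y / 4"
        using lT[of y] M0 by (simp add: field_simps)
      finally show ?thesis
        by (simp add: norm_scaleC)
    qed
    have small: "norm (E y) \<le> norm y / 2" for y
      using norm_triangle_ineq4[of "l *\<^sub>C (Ghat l *\<^sub>V T *\<^sub>V y)" "Nhat l (T *\<^sub>V y)"] nN[of y] nG[of y]
      by (simp add: E_def)
    have add: "E (x + y) = E x + E y" for x y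
    proof -
      have "Nhat l (T *\<^sub>V x + T *\<^sub>V y) = Nhat l (T *\<^sub>V x) + Nhat l (T *\<^sub>V y)"
        using NC[OF l] T unfolding clinear_on_def by blast
      then show ?thesis
        by (simp add: E_def cblinfun_linear_simps scaleC_add_right)
    qed
    have scale: "E (c *\<^sub>C x) = c *\<^sub>C E x" for c x
    proof -
      have "Nhat l (c *\<^sub>C (T *\<^sub>V x)) = c *\<^sub>C Nhat l (T *\<^sub>V x)"
        using NC[OF l] T unfolding clinear_on_def by blast
      moreover have "l *\<^sub>C c *\<^sub>C z = c *\<^sub>C l *\<^sub>C z" for z :: 'a
        by (simp add: scaleC_scaleC mult.commute)
      ultimately show ?thesis
        by (simp add: E_def cblinfun_apply_scaleC scaleC_linear_simps)
    qed
    obtain S where S: "\<And>v. S *\<^sub>V v + E (S *\<^sub>V v) = v" "\<And>v. norm (S *\<^sub>V v) \<le> 2 * norm v"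
      by (rule neumann_inverse[OF add scale small]) blast
    show ?thesis
    proof (rule exI[of _ "T o\<^sub>C\<^sub>L S"], intro conjI allI)
      fix v
      show "(T o\<^sub>C\<^sub>L S) *\<^sub>V v \<in> DA"
        using T by (simp add: cblinfun_compose_apply)
      show "char_op A Ghat Nhat l ((T o\<^sub>C\<^sub>L S) *\<^sub>V v) = v"
        using T(2)[of "S *\<^sub>V v"] S(1)[of v] by (simp add: cblinfun_compose_apply char_op_def E_def algebra_simps)
      have "M0 / cmod l * norm (S *\<^sub>V v) \<le> M0 / cmod l * (2 * norm v)"
        using M0 by (intro mult_left_mono S) auto
      also have "\<dots> \<le> 2 * K / cmod l * norm v"
      proof -
        have "M0 * (2 * norm v) \<le> 2 * K * norm v"
          using M0 by (simp add: K_def algebra_simps)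
        then show ?thesis
          using divide_right_mono[of "M0 * (2 * norm v)" "2 * K * norm v" "cmod l"] by simp
      qed
      finally show "norm ((T o\<^sub>C\<^sub>L S) *\<^sub>V v) \<le> 2 * K / cmod l * norm v"
        using nT[of "S *\<^sub>V v"] by (simp add: cblinfun_compose_apply)
      have "K * norm (S *\<^sub>V v) \<le> K * (2 * norm v)"
        using K by (intro mult_left_mono S) auto
      then show "graph_norm A ((T o\<^sub>C\<^sub>L S) *\<^sub>V v) \<le> 2 * K * norm v"
        using gT[of "S *\<^sub>V v"] by (simp add: cblinfun_compose_apply)
      show "\<exists>S'. T o\<^sub>C\<^sub>L S = resolvent DA A l o\<^sub>C\<^sub>L S'"
        by (auto simp: T_def)
    qed
  qed
  then obtain Q where "\<And>l. l \<in> sector \<nu> \<Longrightarrow> cmod l \<ge> r \<Longrightarrow>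
      (\<forall>v. Q l *\<^sub>V v \<in> DA \<and> char_op A Ghat Nhat l (Q l *\<^sub>V v) = v \<and> norm (Q l *\<^sub>V v) \<le> 2 * K / cmod l * norm v
      \<and> graph_norm A (Q l *\<^sub>V v) \<le> 2 * K * norm v) \<and> (\<exists>S. Q l = resolvent DA A l o\<^sub>C\<^sub>L S)"
    by metis
  note Q = this
  show thesis
    by (rule that[of r "2 * K" Q]) (use K Q in \<open>auto simp: r_def\<close>)
qed

text \<open>\<open>A\<close> cancels in the difference. The unit step of \<open>Ghat\<close> gains
  \<open>1 / cmod l\<close> and so compensates its factor \<open>l\<close>; the unit step of
  \<open>Nhat\<close> gains the same factor against the graph norm.\<close>

lemma char_op_difference:
  assumes \<nu>: "pi / 2 < \<nu>" "\<nu> < pi" and Cd2: "Cd2 \<nu> \<alpha> DA A G Ghat" and Cd3: "Cd3 \<nu> DA A DN N Nhat"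
  obtains r C where "C \<ge> 0"
    "\<And>l x. Re l > 0 \<Longrightarrow> cmod l \<ge> r \<Longrightarrow> x \<in> DA \<Longrightarrow>
      norm (char_op A Ghat Nhat l x - char_op A Ghat Nhat (l + 1) x) \<le> C * (norm x + graph_norm A x / cmod l)"
proof -
  obtain c where c: "0 < c" "c \<le> 1 / 3"
    and ball: "\<And>l m. Re l > 0 \<Longrightarrow> cmod (m - l) < c * cmod l \<Longrightarrow> m \<in> sector \<nu> \<and> cmod l \<le> 2 * cmod m"
    using ball_subset_sector[OF \<nu>] by metis
  obtain N1 where N1: "N1 > 0" "\<And>l. l \<in> sector \<nu> \<Longrightarrow> norm (Ghat l) \<le> N1 * cmod l powr (- \<alpha>)" and \<alpha>: "\<alpha> > 0"
    using Cd2 by (auto simp: Cd2_def)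
  have G1: "norm (Ghat m) \<le> N1" if "m \<in> sector \<nu>" "cmod m \<ge> 1" for m
  proof -
    have "cmod m powr (- \<alpha>) \<le> 1"
      using that \<alpha> by (simp add: powr_minus inverse_le_1_iff ge_one_powr_ge_zero)
    then have "N1 * cmod m powr (- \<alpha>) \<le> N1 * 1"
      using N1 by (intro mult_left_mono) auto
    then show ?thesis
      using N1(2)[OF that(1)] by simp
  qed
  obtain r1 where r1: "\<And>l z. l \<in> sector \<nu> \<Longrightarrow> cmod l \<ge> r1 \<Longrightarrow> z \<in> DA \<Longrightarrow> norm (Nhat l z) \<le> 1 * graph_norm A z"
    using Cd3_small[OF Cd3, of 1] by auto
  have op: "open (sector \<nu>)"
    using \<nu> pi_gt_zero by (intro open_sector) auto
  \<comment> \<open>The first entry makes the disc radius \<open>c * cmod l\<close> at least 4, as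
    \<open>cauchy_step\<close> demands. The others keep the whole disc outside radius 1 and radius
    \<open>r1\<close>, because moduli shrink at most by half inside it.\<close>
  define r where "r = max (4 / c) (max 2 (2 * r1))"
  define C where "C = 1 + 4 * N1 / c + N1 + 4 / c"
  show thesis
  proof (rule that[of C r])
    show "C \<ge> 0"
      using N1 c by (simp add: C_def)
  next
    fix l x assume l: "Re l > 0" and lr: "cmod l \<ge> r" and x: "x \<in> DA"
    have l': "c * cmod l \<ge> 4" "cmod l \<ge> 2" "cmod l \<ge> 2 * r1"
      using lr c by (auto simp: r_def field_simps)
    have in_ball: "m \<in> sector \<nu>" "cmod m \<ge> 1" "cmod m \<ge> r1" if "m \<in> ball l (c * cmod l)" for m
      using ball[OF l, of m] that l' by (auto simp: dist_norm norm_minus_commute)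
    have pos: "cmod l > 0"
      using l' by linarith
    have stepG: "norm (Ghat (l + 1) *\<^sub>V x - Ghat l *\<^sub>V x) \<le> 4 * (N1 * norm x) / (c * cmod l)"
    proof (rule norm_le_by_functionals)
      fix \<phi> :: "'a \<Rightarrow>\<^sub>C\<^sub>L complex" assume \<phi>: "norm \<phi> \<le> 1"
      have "cmod (\<phi> *\<^sub>V Ghat (l + 1) *\<^sub>V x - \<phi> *\<^sub>V Ghat l *\<^sub>V x) \<le> 4 * (N1 * norm x) / (c * cmod l)"
      proof (rule cauchy_step)
        show "(\<lambda>m. \<phi> *\<^sub>V Ghat m *\<^sub>V x) holomorphic_on ball l (c * cmod l)"
          using functional_holomorphic[OF _ op, of Ghat \<phi> x] Cd2 in_ball(1)
          by (auto simp: Cd2_def intro: holomorphic_on_subset)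
        fix m assume m: "m \<in> ball l (c * cmod l)"
        have "norm (\<phi> *\<^sub>V Ghat m *\<^sub>V x) \<le> 1 * norm (Ghat m *\<^sub>V x)"
          by (rule norm_cblinfun_le[OF \<phi>])
        also have "\<dots> \<le> N1 * norm x"
          using norm_cblinfun_le[OF G1[OF in_ball(1,2)[OF m]]] by simp
        finally show "cmod (\<phi> *\<^sub>V Ghat m *\<^sub>V x) \<le> N1 * norm x" .
      qed (rule l')
      then show "cmod (\<phi> *\<^sub>V (Ghat (l + 1) *\<^sub>V x - Ghat l *\<^sub>V x)) \<le> 4 * (N1 * norm x) / (c * cmod l)"
        by (simp add: cblinfun_linear_simps)
    qed
    have stepN: "norm (Nhat (l + 1) x - Nhat l x) \<le> 4 * graph_norm A x / (c * cmod l)"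
    proof (rule norm_le_by_functionals)
      fix \<phi> :: "'a \<Rightarrow>\<^sub>C\<^sub>L complex" assume \<phi>: "norm \<phi> \<le> 1"
      have "cmod (\<phi> *\<^sub>V Nhat (l + 1) x - \<phi> *\<^sub>V Nhat l x) \<le> 4 * graph_norm A x / (c * cmod l)"
      proof (rule cauchy_step)
        show "(\<lambda>m. \<phi> *\<^sub>V Nhat m x) holomorphic_on ball l (c * cmod l)"
          using functional_graph_holomorphic[OF _ op x, of A Nhat \<phi>] Cd3 in_ball(1)
          by (auto simp: Cd3_def intro: holomorphic_on_subset)
        fix m assume m: "m \<in> ball l (c * cmod l)"
        have "norm (\<phi> *\<^sub>V Nhat m x) \<le> 1 * norm (Nhat m x)"
          by (rule norm_cblinfun_le[OF \<phi>])
        also have "\<dots> \<le> graph_norm A x"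
          using r1[OF in_ball(1,3)[OF m] x] by simp
        finally show "cmod (\<phi> *\<^sub>V Nhat m x) \<le> graph_norm A x" .
      qed (rule l')
      then show "cmod (\<phi> *\<^sub>V (Nhat (l + 1) x - Nhat l x)) \<le> 4 * graph_norm A x / (c * cmod l)"
        by (simp add: cblinfun_linear_simps)
    qed
    have "l + 1 \<in> ball l (c * cmod l)"
      using l' by (simp add: dist_norm)
    then have nG: "norm (Ghat (l + 1) *\<^sub>V x) \<le> N1 * norm x"
      using norm_cblinfun_le[OF G1] in_ball by blast
    have "char_op A Ghat Nhat l x - char_op A Ghat Nhat (l + 1) x
        = (Nhat (l + 1) x - Nhat l x) - (x + l *\<^sub>C (Ghat (l + 1) *\<^sub>V x - Ghat l *\<^sub>V x) + Ghat (l + 1) *\<^sub>V x)"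
      by (simp add: char_op_def scaleC_add_left scaleC_linear_simps scaleC_one)
    also have "norm \<dots> \<le> norm (Nhat (l + 1) x - Nhat l x)
        + (norm x + norm (l *\<^sub>C (Ghat (l + 1) *\<^sub>V x - Ghat l *\<^sub>V x)) + norm (Ghat (l + 1) *\<^sub>V x))"
      by (intro order_trans[OF norm_triangle_ineq4] add_mono order_refl order_trans[OF norm_triangle_ineq] norm_triangle_ineq)
    also have "\<dots> \<le> 4 * graph_norm A x / (c * cmod l) + (norm x + 4 * (N1 * norm x) / c + N1 * norm x)"
    proof -
      have "norm (l *\<^sub>C (Ghat (l + 1) *\<^sub>V x - Ghat l *\<^sub>V x)) \<le> cmod l * (4 * (N1 * norm x) / (c * cmod l))"
        unfolding norm_scaleC by (intro mult_left_mono stepG) simp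
      also have "\<dots> = 4 * (N1 * norm x) / c"
        using pos by simp
      finally show ?thesis
        using stepN nG by (intro add_mono order_refl)
    qed
    also have "\<dots> = (1 + 4 * N1 / c + N1) * norm x + (4 / c) * (graph_norm A x / cmod l)"
      using c pos by (simp add: field_simps)
    also have "\<dots> \<le> C * norm x + C * (graph_norm A x / cmod l)"
    proof (intro add_mono mult_right_mono)
      have "0 \<le> 4 * N1 / c" "0 \<le> 4 / c"
        using N1(1) c by simp_all
      then show "1 + 4 * N1 / c + N1 \<le> C" "4 / c \<le> C"
        using N1(1) unfolding C_def by linarith+
    qed (use pos graph_norm_nonneg[of A x] in simp_all)
    finally show "norm (char_op A Ghat Nhat l x - char_op A Ghat Nhat (l + 1) x) \<le> C * (norm x + graph_norm A x / cmod l)"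
      by (simp add: distrib_left)
  qed
qed

section \<open>Norm continuity and compactness of the resolvent operator\<close>

abbreviation gauss :: "real \<Rightarrow> real"
  where "gauss \<equiv> std_normal_density"

text \<open>Self-duality of the Gaussian, read off the characteristic function of the normal
  distribution.\<close>

lemma gauss_fourier:
  "complex_of_real (gauss x) = (1 / sqrt (2 * pi)) * (LINT y|lborel. gauss y * exp (\<i> * complex_of_real (x * y)))"
proof -
  have "char std_normal_distribution x = (LINT y|lborel. gauss y *\<^sub>R exp (\<i> * complex_of_real (x * y)))"
    unfolding char_def by (subst integral_density) auto
  then have "(LINT y|lborel. gauss y * exp (\<i> * complex_of_real (x * y))) = complex_of_real (exp (- (x\<^sup>2) / 2))"
    by (simp add: char_std_normal_distribution scaleR_conv_of_real)
  then show ?thesis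
    by (simp add: std_normal_density_def)
qed

lemma gauss_le: "gauss x \<le> 1 / sqrt (2 * pi)" and gauss_nonneg: "0 \<le> gauss x"
  by (simp_all add: std_normal_density_def divide_right_mono)

text \<open>Plays the role of Fourier inversion, stated directly as an estimate of increments.
  Gaussian averages of \<open>g\<close> have an exact integral formula in terms of the transform,
  the resulting bound does not depend on the width, and the width tends to zero.\<close>

lemma fourier_modulus:
  fixes g :: "real \<Rightarrow> complex" and b :: "real \<Rightarrow> real"
  assumes cont: "continuous_on UNIV g" and D: "\<And>t. cmod (g t) \<le> D" and int: "integrable lborel g"
    and b: "integrable lborel b" and fb: "\<And>v. cmod (LINT u|lborel. exp (- (\<i> * complex_of_real (v * u))) * g u) \<le> b v"
  shows "cmod (g t - g s) \<le> (LINT v|lborel. cmod (exp (\<i> * complex_of_real (v * t)) - exp (\<i> * complex_of_real (v * s))) * b v)"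
proof -
  have g_meas [measurable]: "g \<in> borel_measurable borel"
    using cont by (rule borel_measurable_continuous_onI)
  have b_meas [measurable]: "b \<in> borel_measurable borel"
    using b by auto
  define f where "f v = (LINT u|lborel. exp (- (\<i> * complex_of_real (v * u))) * g u)" for v
  have f_meas [measurable]: "f \<in> borel_measurable borel"
    unfolding f_def by measurable
  have f_le: "cmod (f v) \<le> b v" for v
    using fb by (simp add: f_def)
  have b0: "b v \<ge> 0" for v
    using order_trans[OF norm_ge_zero f_le] .
  define I where "I v t s = cmod (exp (\<i> * complex_of_real (v * t)) - exp (\<i> * complex_of_real (v * s))) * b v" for v t s
  have I_le: "I v t s \<le> 2 * b v" for v t s
  proof -
    have "cmod (exp (\<i> * complex_of_real (v * t)) - exp (\<i> * complex_of_real (v * s))) \<le> 2"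
      by (rule order_trans[OF norm_triangle_ineq4]) simp
    then show ?thesis
      unfolding I_def by (intro mult_right_mono b0)
  qed
  have I_int: "integrable lborel (\<lambda>v. I v t s)" for t s
  proof (rule Bochner_Integration.integrable_bound)
    show "integrable lborel (\<lambda>v. 2 * b v)"
      using b by simp
    show "(\<lambda>v. I v t s) \<in> borel_measurable lborel"
      unfolding I_def by measurable
    show "AE v in lborel. norm (I v t s) \<le> norm (2 * b v)"
      using I_le b0 by (intro AE_I2) (auto simp: I_def)
  qed
  \<comment> \<open>Average of \<open>g\<close> at scale \<open>\<epsilon>\<close>. Writing the
    Gaussian as a Fourier integral and exchanging the integrals turns the average of
    \<open>g\<close> into its transform, damped by a Gaussian factor.\<close>
  define ge where "ge \<epsilon> t = (LINT x|lborel. g (t + \<epsilon> * x) * gauss x)" for \<epsilon> t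
  have repr: "ge \<epsilon> t = (1 / sqrt (2 * pi)) * (LINT v|lborel. gauss (- \<epsilon> * v) * (exp (\<i> * complex_of_real (v * t)) * f v))"
    if \<epsilon>: "\<epsilon> > 0" for \<epsilon> t
  proof -
    define H where "H x y = g (t + \<epsilon> * x) * (gauss y * exp (\<i> * complex_of_real (x * y)))" for x y
    have H_int: "integrable (lborel \<Otimes>\<^sub>M lborel) (\<lambda>(x, y). H x y)"
    proof (rule Bochner_Integration.integrable_bound)
      show "integrable (lborel \<Otimes>\<^sub>M lborel) (\<lambda>(x, y). norm (g (t + \<epsilon> * x)) * gauss y)"
        using \<epsilon> int by (intro integrable_lborel_prod integrable_norm lborel_integrable_real_affine) auto
      show "(\<lambda>(x, y). H x y) \<in> borel_measurable (lborel \<Otimes>\<^sub>M lborel)"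
        unfolding H_def by measurable
      show "AE p in lborel \<Otimes>\<^sub>M lborel. norm (case p of (x, y) \<Rightarrow> H x y) \<le> norm (case p of (x, y) \<Rightarrow> norm (g (t + \<epsilon> * x)) * gauss y)"
        by (intro AE_I2) (auto simp: H_def norm_mult)
    qed
    have inner: "(LINT x|lborel. H x y) = gauss y * (exp (- (\<i> * complex_of_real (y * t / \<epsilon>))) * f (- y / \<epsilon>)) / \<epsilon>" for y
    proof -
      have "f (- y / \<epsilon>) = (LINT u|lborel. exp (\<i> * complex_of_real (y / \<epsilon> * u)) * g u)"
        unfolding f_def by simp
      also have "\<dots> = \<bar>\<epsilon>\<bar> *\<^sub>R (LINT x|lborel. exp (\<i> * complex_of_real (y / \<epsilon> * (t + \<epsilon> * x))) * g (t + \<epsilon> * x))"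
        using \<epsilon> by (intro lborel_integral_real_affine) simp
      also have "(\<lambda>x. exp (\<i> * complex_of_real (y / \<epsilon> * (t + \<epsilon> * x))) * g (t + \<epsilon> * x))
          = (\<lambda>x. exp (\<i> * complex_of_real (y * t / \<epsilon>)) * (g (t + \<epsilon> * x) * exp (\<i> * complex_of_real (x * y))))"
        using \<epsilon> by (intro ext) (simp add: field_simps exp_add[symmetric])
      finally have "f (- y / \<epsilon>) = \<epsilon> * (exp (\<i> * complex_of_real (y * t / \<epsilon>)) * (LINT x|lborel. g (t + \<epsilon> * x) * exp (\<i> * complex_of_real (x * y))))"
        using \<epsilon> by (simp add: scaleR_conv_of_real)
      then have "exp (- (\<i> * complex_of_real (y * t / \<epsilon>))) * f (- y / \<epsilon>) / \<epsilon> = (LINT x|lborel. g (t + \<epsilon> * x) * exp (\<i> * complex_of_real (x * y)))"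
        using \<epsilon> by (simp add: exp_minus field_simps)
      moreover have "(LINT x|lborel. H x y) = gauss y * (LINT x|lborel. g (t + \<epsilon> * x) * exp (\<i> * complex_of_real (x * y)))"
        unfolding H_def by (subst integral_mult_right_zero[symmetric]) (simp add: mult_ac)
      ultimately show ?thesis
        by (simp add: mult.assoc times_divide_eq_right[symmetric] del: times_divide_eq_right)
    qed
    have "ge \<epsilon> t = (LINT x|lborel. (1 / sqrt (2 * pi)) * (LINT y|lborel. H x y))"
      unfolding ge_def
    proof (rule Bochner_Integration.integral_cong[OF refl])
      fix x
      have "(LINT y|lborel. H x y) = g (t + \<epsilon> * x) * (LINT y|lborel. gauss y * exp (\<i> * complex_of_real (x * y)))"
        unfolding H_def by (rule integral_mult_right_zero)
      then show "g (t + \<epsilon> * x) * complex_of_real (gauss x) = (1 / sqrt (2 * pi)) * (LINT y|lborel. H x y)"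
        unfolding gauss_fourier[of x] by simp
    qed
    also have "\<dots> = (1 / sqrt (2 * pi)) * (LINT x|lborel. LINT y|lborel. H x y)"
      by (rule integral_mult_right_zero)
    also have "(LINT x|lborel. LINT y|lborel. H x y) = (LINT y|lborel. LINT x|lborel. H x y)"
      by (rule lborel_pair.Fubini_integral[OF H_int, symmetric])
    also have "\<dots> = \<bar>- \<epsilon>\<bar> *\<^sub>R (LINT v|lborel. LINT x|lborel. H x (0 + (- \<epsilon>) * v))"
      using \<epsilon> by (intro lborel_integral_real_affine) simp
    also have "\<dots> = (LINT v|lborel. gauss (- \<epsilon> * v) * (exp (\<i> * complex_of_real (v * t)) * f v))"
    proof -
      have "(LINT x|lborel. H x (0 + (- \<epsilon>) * v)) = complex_of_real (1 / \<epsilon>) * (gauss (- \<epsilon> * v) * (exp (\<i> * complex_of_real (v * t)) * f v))" for v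
        unfolding inner using \<epsilon> by simp
      then show ?thesis
        using \<epsilon> by (simp only: integral_mult_right_zero) (simp add: scaleR_conv_of_real)
    qed
    finally show ?thesis .
  qed
  \<comment> \<open>Both the damping factor and the constant are at most one, so they are dropped;
    sharpness is not sought.\<close>
  have diff: "cmod (ge \<epsilon> t - ge \<epsilon> s) \<le> (LINT v|lborel. I v t s)" if \<epsilon>: "\<epsilon> > 0" for \<epsilon>
  proof -
    define J where "J t v = gauss (- \<epsilon> * v) * (exp (\<i> * complex_of_real (v * t)) * f v)" for t v
    have g1: "gauss x \<le> 1" for x
    proof -
      have "1 \<le> sqrt (2 * pi)"
        using pi_ge_two by simp
      then have "1 / sqrt (2 * pi) \<le> 1"
        by (simp add: divide_le_eq_1)
      then show ?thesis
        using gauss_le[of x] by linarith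
    qed
    have J_int: "integrable lborel (J t)" for t
    proof (rule Bochner_Integration.integrable_bound[OF b])
      show "J t \<in> borel_measurable lborel"
        unfolding J_def by measurable
      show "AE v in lborel. norm (J t v) \<le> norm (b v)"
      proof (rule AE_I2)
        fix v
        have "gauss (- \<epsilon> * v) * cmod (f v) \<le> 1 * b v"
          using g1 f_le by (intro mult_mono) (auto simp: gauss_nonneg)
        then show "norm (J t v) \<le> norm (b v)"
          using b0[of v] by (simp add: J_def norm_mult gauss_nonneg)
      qed
    qed
    have "ge \<epsilon> t - ge \<epsilon> s = (1 / sqrt (2 * pi)) * (LINT v|lborel. J t v - J s v)"
      unfolding repr[OF \<epsilon>] J_def[symmetric] using J_int by (simp add: right_diff_distrib)
    also have "cmod \<dots> = (1 / sqrt (2 * pi)) * cmod (LINT v|lborel. J t v - J s v)"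
      by (simp add: norm_mult norm_divide)
    also have "\<dots> \<le> 1 * (LINT v|lborel. I v t s)"
    proof (rule mult_mono)
      have "1 \<le> sqrt (2 * pi)"
        using pi_ge_two by simp
      then show "1 / sqrt (2 * pi) \<le> 1"
        by (simp add: divide_le_eq_1)
      show "cmod (LINT v|lborel. J t v - J s v) \<le> (LINT v|lborel. I v t s)"
      proof (rule Bochner_Integration.integral_norm_bound_integral)
        show "integrable lborel (\<lambda>v. J t v - J s v)"
          using J_int by simp
        show "integrable lborel (\<lambda>v. I v t s)"
          by (rule I_int)
        fix v
        have "J t v - J s v = gauss (- \<epsilon> * v) * ((exp (\<i> * complex_of_real (v * t)) - exp (\<i> * complex_of_real (v * s))) * f v)"
          by (simp add: J_def algebra_simps)
        also have "cmod \<dots> = gauss (- \<epsilon> * v) * (cmod (exp (\<i> * complex_of_real (v * t)) - exp (\<i> * complex_of_real (v * s))) * cmod (f v))"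
          by (simp add: norm_mult gauss_nonneg)
        also have "\<dots> \<le> 1 * I v t s"
          unfolding I_def using g1 f_le b0 by (intro mult_mono) (auto simp: gauss_nonneg)
        finally show "cmod (J t v - J s v) \<le> I v t s"
          by simp
      qed
    qed auto
    finally show ?thesis by simp
  qed
  have lim: "(\<lambda>k. ge (inverse (real (Suc k))) t) \<longlonglongrightarrow> g t" for t
  proof -
    have "(\<lambda>k. LINT x|lborel. g (t + inverse (real (Suc k)) * x) * gauss x) \<longlonglongrightarrow> (LINT x|lborel. g t * gauss x)"
    proof (rule integral_dominated_convergence[where w = "\<lambda>x. D * gauss x"])
      show "integrable lborel (\<lambda>x. D * gauss x)"
        by (intro integrable_mult_right integrable_normal_density) simp
      show "AE x in lborel. (\<lambda>k. g (t + inverse (real (Suc k)) * x) * gauss x) \<longlonglongrightarrow> g t * gauss x"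
      proof (intro AE_I2 tendsto_mult tendsto_const)
        fix x
        have "(\<lambda>k. t + inverse (real (Suc k)) * x) \<longlonglongrightarrow> t + 0 * x"
          by (intro tendsto_intros LIMSEQ_inverse_real_of_nat)
        then have "(\<lambda>k. t + inverse (real (Suc k)) * x) \<longlonglongrightarrow> t"
          by simp
        then show "(\<lambda>k. g (t + inverse (real (Suc k)) * x)) \<longlonglongrightarrow> g t"
          by (rule continuous_on_tendsto_compose[OF cont]) simp_all
      qed
      show "AE x in lborel. norm (g (t + inverse (real (Suc k)) * x) * gauss x) \<le> D * gauss x" for k
        using D by (intro AE_I2) (simp add: norm_mult gauss_nonneg mult_right_mono)
    qed measurable
    moreover have "(LINT x|lborel. g t * complex_of_real (gauss x)) = g t"
    proof -
      have "(LINT x|lborel. g t * complex_of_real (gauss x)) = g t * (LINT x|lborel. complex_of_real (gauss x))"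
        by (rule integral_mult_right_zero)
      also have "(LINT x|lborel. complex_of_real (gauss x)) = complex_of_real (LINT x|lborel. gauss x)"
        by (rule integral_complex_of_real)
      finally show ?thesis
        by simp
    qed
    ultimately show ?thesis
      by (simp add: ge_def)
  qed
  have "(\<lambda>k. cmod (ge (inverse (real (Suc k))) t - ge (inverse (real (Suc k))) s)) \<longlonglongrightarrow> cmod (g t - g s)"
    by (intro tendsto_intros lim)
  then have "cmod (g t - g s) \<le> (LINT v|lborel. I v t s)"
    by (rule LIMSEQ_le_const2) (use diff in \<open>auto intro!: exI[of _ 0]\<close>)
  then show ?thesis
    by (simp add: I_def)
qed

lemma integrable_inverse_1_plus_square_lborel: "integrable lborel (\<lambda>x::real. inverse (1 + x\<^sup>2))"
  using integrable_inverse_1_plus_square by (simp add: set_integrable_def einterval_def)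

text \<open>One function of two times that dominates the increments for all functionals and vectors
  simultaneously. The weight is the decay of the transform along a vertical line.\<close>

definition modulus :: "real \<Rightarrow> real \<Rightarrow> real"
  where "modulus t s = (LINT v|lborel. cmod (exp (\<i> * complex_of_real (v * t)) - exp (\<i> * complex_of_real (v * s))) * inverse (1 + v\<^sup>2))"

lemma modulus_tendsto:
  assumes X: "X \<longlonglongrightarrow> t"
  shows "(\<lambda>k. modulus (X k) t) \<longlonglongrightarrow> 0"
proof -
  have "(\<lambda>k. modulus (X k) t) \<longlonglongrightarrow> (LINT v::real|lborel. 0 :: real)"
    unfolding modulus_def
  proof (rule integral_dominated_convergence[where w = "\<lambda>v. 2 * inverse (1 + v\<^sup>2)"])
    show "integrable lborel (\<lambda>v::real. 2 * inverse (1 + v\<^sup>2))"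
      by (intro integrable_mult_right integrable_inverse_1_plus_square_lborel)
    show "AE v in lborel. (\<lambda>k. cmod (exp (\<i> * complex_of_real (v * X k)) - exp (\<i> * complex_of_real (v * t))) * inverse (1 + v\<^sup>2)) \<longlonglongrightarrow> 0"
    proof (intro AE_I2)
      fix v :: real
      have "(\<lambda>k. cmod (exp (\<i> * complex_of_real (v * X k)) - exp (\<i> * complex_of_real (v * t))) * inverse (1 + v\<^sup>2)) \<longlonglongrightarrow>
          cmod (exp (\<i> * complex_of_real (v * t)) - exp (\<i> * complex_of_real (v * t))) * inverse (1 + v\<^sup>2)"
        by (intro tendsto_intros X)
      then show "(\<lambda>k. cmod (exp (\<i> * complex_of_real (v * X k)) - exp (\<i> * complex_of_real (v * t))) * inverse (1 + v\<^sup>2)) \<longlonglongrightarrow> 0"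
        by simp
    qed
    show "AE v in lborel. norm (cmod (exp (\<i> * complex_of_real (v * X k)) - exp (\<i> * complex_of_real (v * t))) * inverse (1 + v\<^sup>2)) \<le> 2 * inverse (1 + v\<^sup>2)" for k
    proof (intro AE_I2)
      fix v :: real
      have "cmod (exp (\<i> * complex_of_real (v * X k)) - exp (\<i> * complex_of_real (v * t))) \<le> 2"
        by (rule order_trans[OF norm_triangle_ineq4]) simp
      moreover have i: "0 \<le> inverse (1 + v\<^sup>2)"
        by simp
      ultimately show "norm (cmod (exp (\<i> * complex_of_real (v * X k)) - exp (\<i> * complex_of_real (v * t))) * inverse (1 + v\<^sup>2)) \<le> 2 * inverse (1 + v\<^sup>2)"
        unfolding real_norm_def abs_mult abs_norm_cancel abs_of_nonneg[OF i] by (rule mult_right_mono)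
    qed
  qed measurable
  then show ?thesis by simp
qed

section \<open>Total boundedness and compact operators\<close>

definition tot_bounded :: "'a::metric_space set \<Rightarrow> bool"
  where "tot_bounded S \<longleftrightarrow> (\<forall>e>0. \<exists>k. finite k \<and> S \<subseteq> (\<Union>x\<in>k. ball x e))"

text \<open>The closure property behind every compactness proof that follows: norm limits of compact
  operators, and convolutions approximated by truncated ones.\<close>

lemma tot_bounded_approx:
  assumes "\<And>e. e > 0 \<Longrightarrow> \<exists>B. tot_bounded B \<and> (\<forall>a\<in>A. \<exists>b\<in>B. dist a b < e)"
  shows "tot_bounded A"
  unfolding tot_bounded_def
proof (intro allI impI)
  fix e :: real assume e: "e > 0"
  then obtain B where B: "tot_bounded B" "\<And>a. a \<in> A \<Longrightarrow> \<exists>b\<in>B. dist a b < e / 2"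
    using assms[of "e / 2"] by auto
  then obtain k where k: "finite k" "B \<subseteq> (\<Union>x\<in>k. ball x (e / 2))"
    using e unfolding tot_bounded_def by (meson half_gt_zero)
  have "A \<subseteq> (\<Union>x\<in>k. ball x e)"
  proof
    fix a assume "a \<in> A"
    then obtain b where b: "b \<in> B" "dist a b < e / 2"
      using B by blast
    then obtain x where x: "x \<in> k" "dist x b < e / 2"
      using k by auto
    have "dist x a < e"
      using dist_triangle[of x a b] b x by (simp add: dist_commute)
    then show "a \<in> (\<Union>x\<in>k. ball x e)"
      using x by auto
  qed
  then show "\<exists>k. finite k \<and> A \<subseteq> (\<Union>x\<in>k. ball x e)"
    using k by blast
qed

lemma tot_bounded_subset: "tot_bounded B \<Longrightarrow> A \<subseteq> B \<Longrightarrow> tot_bounded A"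
  unfolding tot_bounded_def by (meson order_trans)

lemma compact_imp_tot_bounded: "compact K \<Longrightarrow> tot_bounded K"
  by (simp add: compact_eq_totally_bounded tot_bounded_def)

lemma tot_bounded_closure:
  assumes "tot_bounded A"
  shows "tot_bounded (closure A)"
proof (rule tot_bounded_approx)
  fix e :: real assume "e > 0"
  then show "\<exists>B. tot_bounded B \<and> (\<forall>a\<in>closure A. \<exists>b\<in>B. dist a b < e)"
    using assms by (intro exI[of _ A]) (auto simp: closure_approachable dist_commute)
qed

lemma compact_closure_iff_tot_bounded:
  fixes A :: "'a::complete_space set"
  shows "compact (closure A) \<longleftrightarrow> tot_bounded A"
proof
  assume "compact (closure A)"
  then show "tot_bounded A"
    using compact_imp_tot_bounded tot_bounded_subset closure_subset by metis
next
  assume "tot_bounded A"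
  then have "tot_bounded (closure A)"
    by (rule tot_bounded_closure)
  moreover have "complete (closure A)"
    by (simp add: complete_eq_closed)
  ultimately show "compact (closure A)"
    by (simp add: compact_eq_totally_bounded tot_bounded_def)
qed

lemma tot_bounded_add:
  fixes A B :: "'a::real_normed_vector set"
  assumes A: "tot_bounded A" and B: "tot_bounded B"
  shows "tot_bounded {a + b | a b. a \<in> A \<and> b \<in> B}"
  unfolding tot_bounded_def
proof (intro allI impI)
  fix e :: real assume e: "e > 0"
  obtain k l where k: "finite k" "A \<subseteq> (\<Union>x\<in>k. ball x (e / 2))" and l: "finite l" "B \<subseteq> (\<Union>x\<in>l. ball x (e / 2))"
    using A B e unfolding tot_bounded_def by (meson half_gt_zero)
  show "\<exists>m. finite m \<and> {a + b | a b. a \<in> A \<and> b \<in> B} \<subseteq> (\<Union>x\<in>m. ball x e)"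
  proof (intro exI[of _ "(\<lambda>(x, y). x + y) ` (k \<times> l)"] conjI subsetI)
    fix z assume "z \<in> {a + b | a b. a \<in> A \<and> b \<in> B}"
    then obtain a b where ab: "z = a + b" "a \<in> A" "b \<in> B"
      by blast
    obtain x where x: "x \<in> k" "dist x a < e / 2"
      using subsetD[OF k(2) ab(2)] by auto
    obtain y where y: "y \<in> l" "dist y b < e / 2"
      using subsetD[OF l(2) ab(3)] by auto
    note xy = x y
    have "dist (x + y) z < e"
      using xy(2,4) dist_triangle_add[of x y a b] unfolding ab(1) by linarith
    then show "z \<in> (\<Union>x\<in>(\<lambda>(x, y). x + y) ` (k \<times> l). ball x e)"
      using xy(1,3) by (intro UN_I[of "x + y"]) auto
  qed (use k l in auto)
qed

lemma tot_bounded_sum: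
  fixes A :: "'i \<Rightarrow> 'a::real_normed_vector set"
  assumes "finite I" "\<And>i. i \<in> I \<Longrightarrow> tot_bounded (A i)"
  shows "tot_bounded {\<Sum>i\<in>I. a i | a. \<forall>i\<in>I. a i \<in> A i}"
  using assms
proof (induction I)
  case empty
  show ?case
    by (auto simp: tot_bounded_def intro!: exI[of _ "{0}"])
next
  case (insert j I)
  show ?case
  proof (rule tot_bounded_subset)
    show "tot_bounded {a + b | a b. a \<in> A j \<and> b \<in> {\<Sum>i\<in>I. a i | a. \<forall>i\<in>I. a i \<in> A i}}"
      using insert by (intro tot_bounded_add) auto
    show "{\<Sum>i\<in>insert j I. a i | a. \<forall>i\<in>insert j I. a i \<in> A i} \<subseteq> {a + b | a b. a \<in> A j \<and> b \<in> {\<Sum>i\<in>I. a i | a. \<forall>i\<in>I. a i \<in> A i}}"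
      using insert(1,2) by auto
  qed
qed

lemma compact_operator_iff:
  fixes S :: "'a::complex_normed_vector \<Rightarrow>\<^sub>C\<^sub>L 'b::complex_banach"
  shows "compact_operator S \<longleftrightarrow> (\<forall>r. tot_bounded (cblinfun_apply S ` cball 0 r))"
proof -
  have "(\<forall>E. bounded E \<longrightarrow> tot_bounded (cblinfun_apply S ` E)) \<longleftrightarrow> (\<forall>r. tot_bounded (cblinfun_apply S ` cball 0 r))"
  proof (intro iffI allI impI)
    fix E :: "'a set"
    assume *: "\<forall>r. tot_bounded (cblinfun_apply S ` cball 0 r)" and "bounded E"
    then obtain r where "E \<subseteq> cball 0 r"
      by (force simp: bounded_iff)
    then show "tot_bounded (cblinfun_apply S ` E)"
      by (intro tot_bounded_subset[OF *[rule_format, of r]] image_mono)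
  qed simp
  then show ?thesis
    by (simp add: compact_operator_def compact_closure_iff_tot_bounded)
qed

lemma compact_operator_compose_right:
  assumes S: "compact_operator S"
  shows "compact_operator (S o\<^sub>C\<^sub>L U)"
  unfolding compact_operator_def
proof (intro allI impI)
  fix E :: "'c set" assume "bounded E"
  then have "bounded (cblinfun_apply U ` E)"
    by (rule bounded_linear_image[OF _ bounded_linear_cblinfun_apply])
  then have "compact (closure (cblinfun_apply S ` cblinfun_apply U ` E))"
    using S by (simp add: compact_operator_def)
  moreover have "cblinfun_apply S ` cblinfun_apply U ` E = cblinfun_apply (S o\<^sub>C\<^sub>L U) ` E"
    by (simp add: image_image cblinfun_compose_apply)
  ultimately show "compact (closure (cblinfun_apply (S o\<^sub>C\<^sub>L U) ` E))"
    by simp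
qed

lemma compact_operator_approx:
  fixes S :: "'a::complex_normed_vector \<Rightarrow>\<^sub>C\<^sub>L 'b::complex_banach"
  assumes "\<And>e. e > 0 \<Longrightarrow> \<exists>S'. compact_operator S' \<and> norm (S - S') \<le> e"
  shows "compact_operator S"
  unfolding compact_operator_iff
proof
  fix r
  show "tot_bounded (cblinfun_apply S ` cball 0 r)"
  proof (rule tot_bounded_approx)
    fix e :: real assume e: "e > 0"
    define d where "d = e / (2 * (\<bar>r\<bar> + 1))"
    have d: "d > 0" using e by (simp add: d_def)
    obtain S' where S': "compact_operator S'" "norm (S - S') \<le> d"
      using assms[OF d] by blast
    show "\<exists>B. tot_bounded B \<and> (\<forall>a\<in>cblinfun_apply S ` cball 0 r. \<exists>b\<in>B. dist a b < e)"
    proof (intro exI[of _ "cblinfun_apply S' ` cball 0 r"] conjI ballI)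
      show "tot_bounded (cblinfun_apply S' ` cball 0 r)"
        using S' by (simp add: compact_operator_iff)
      fix a assume "a \<in> cblinfun_apply S ` cball 0 r"
      then obtain x where x: "a = S *\<^sub>V x" "norm x \<le> r"
        by auto
      have "dist a (S' *\<^sub>V x) \<le> d * norm x"
        using norm_cblinfun_le[OF S'(2), of x] by (simp add: x dist_norm cblinfun_minus_apply)
      also have "\<dots> \<le> d * (\<bar>r\<bar> + 1)"
        using x d by (intro mult_left_mono) auto
      also have "\<dots> < e"
      proof -
        define K where "K = \<bar>r\<bar> + 1"
        have "K \<noteq> 0"
          unfolding K_def by linarith
        then have "d * K = e / 2"
          by (simp add: d_def K_def[symmetric])
        then show ?thesis using e by (simp add: K_def)
      qed
      finally show "\<exists>b\<in>cblinfun_apply S' ` cball 0 r. dist a b < e"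
        unfolding x(1) using x(2) by (intro bexI[of _ "S' *\<^sub>V x"] imageI) simp_all
    qed
  qed
qed

lemma compact_operator_sum:
  fixes S :: "'i \<Rightarrow> 'a::complex_normed_vector \<Rightarrow>\<^sub>C\<^sub>L 'b::complex_banach"
  assumes I: "finite I" and S: "\<And>i. i \<in> I \<Longrightarrow> compact_operator (S i)"
  shows "compact_operator (\<Sum>i\<in>I. S i)"
  unfolding compact_operator_iff
proof
  fix r
  show "tot_bounded (cblinfun_apply (\<Sum>i\<in>I. S i) ` cball 0 r)"
  proof (rule tot_bounded_subset)
    show "tot_bounded {\<Sum>i\<in>I. a i | a. \<forall>i\<in>I. a i \<in> cblinfun_apply (S i) ` cball 0 r}"
      using S by (intro tot_bounded_sum I) (auto simp: compact_operator_iff)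
    show "cblinfun_apply (\<Sum>i\<in>I. S i) ` cball 0 r \<subseteq> {\<Sum>i\<in>I. a i | a. \<forall>i\<in>I. a i \<in> cblinfun_apply (S i) ` cball 0 r}"
      by (auto simp: cblinfun_sum_apply)
  qed
qed

lemma compact_operator_scaleR:
  fixes S :: "'a::complex_normed_vector \<Rightarrow>\<^sub>C\<^sub>L 'b::complex_banach"
  assumes S: "compact_operator S"
  shows "compact_operator (c *\<^sub>R S)"
proof -
  have "c *\<^sub>R S = S o\<^sub>C\<^sub>L (c *\<^sub>R id_cblinfun)"
    by (rule cblinfun_eqI) (simp add: cblinfun_scaleR_apply cblinfun_compose_apply cblinfun_linear_simps)
  then show ?thesis
    using compact_operator_compose_right[OF S] by simp
qed

lemma cblinfun_apply_sum: "f *\<^sub>V (\<Sum>i\<in>I. g i) = (\<Sum>i\<in>I. f *\<^sub>V g i)"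
  by (rule linear_sum[OF bounded_linear.linear[OF bounded_linear_cblinfun_apply]])

lemma sum_scaleR_of_real:
  "(\<Sum>i\<in>I. \<beta> i *\<^sub>R (complex_of_real (A * B i) * X)) = complex_of_real (A * (\<Sum>i\<in>I. \<beta> i * B i)) * X"
  by (induction I rule: infinite_finite_induct) (simp_all add: scaleR_conv_of_real algebra_simps)

context exp_bounded_family
begin

text \<open>The transform of the weighted function along the line of real part \<open>a\<close> is
  the difference of the transforms of \<open>R\<close> at \<open>l\<close> and \<open>l + 1\<close>,
  so the hypothesis is exactly the integrable bound that \<open>fourier_modulus\<close>
  needs.\<close>

lemma weighted_norm_modulus:
  assumes a: "a > \<omega>" and C: "C \<ge> 0"
    and est: "\<And>\<phi> v y. norm \<phi> \<le> 1 \<Longrightarrow>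
      cmod (laplace \<phi> (Complex a y) v - laplace \<phi> (Complex a y + 1) v) \<le> C * norm v * inverse (1 + y\<^sup>2)"
    and t: "t \<ge> 0" and s: "s \<ge> 0"
  shows "norm ((exp (- a * t) * (1 - exp (- t))) *\<^sub>R R t - (exp (- a * s) * (1 - exp (- s))) *\<^sub>R R s) \<le> C * modulus t s"
proof (rule norm_cblinfun_bound)
  define h where "h t = exp (- a * t) * (1 - exp (- t))" for t
  have "modulus t s \<ge> 0"
    unfolding modulus_def by (intro Bochner_Integration.integral_nonneg) simp
  then show "0 \<le> C * modulus t s"
    using C by simp
  fix v
  show "norm (((exp (- a * t) * (1 - exp (- t))) *\<^sub>R R t - (exp (- a * s) * (1 - exp (- s))) *\<^sub>R R s) *\<^sub>V v) \<le> C * modulus t s * norm v"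
  proof (rule norm_le_by_functionals)
    fix \<phi> :: "'w \<Rightarrow>\<^sub>C\<^sub>L complex" assume \<phi>: "norm \<phi> \<le> 1"
    \<comment> \<open>For negative \<open>u\<close> this is zero, because \<open>h 0 = 0\<close>;
      the factor \<open>1 - exp (- t)\<close> thus also removes the jump that the tested
      \<open>R\<close> would have at time zero.\<close>
    define g where "g u = complex_of_real (h (max 0 u)) * (\<phi> *\<^sub>V R (max 0 u) *\<^sub>V v)" for u
    have cont: "continuous_on UNIV g"
    proof -
      have "continuous_on UNIV (\<lambda>u. R (max 0 u) *\<^sub>V v)"
        by (rule continuous_on_compose2[OF strongly_continuous]) (auto intro!: continuous_intros)
      then have "continuous_on UNIV (\<lambda>u. \<phi> *\<^sub>V R (max 0 u) *\<^sub>V v)"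
        by (rule continuous_on_cblinfun_apply[OF continuous_on_const])
      then show ?thesis
        unfolding g_def h_def by (intro continuous_intros)
    qed
    have decomp: "exp (- (\<i> * complex_of_real (y * u))) * g u =
        indicator {0..} u *\<^sub>R (exp (- Complex a y * complex_of_real u) * (\<phi> *\<^sub>V R (max 0 u) *\<^sub>V v))
        - indicator {0..} u *\<^sub>R (exp (- (Complex a y + 1) * complex_of_real u) * (\<phi> *\<^sub>V R (max 0 u) *\<^sub>V v))" for y u
    proof (cases "u \<ge> 0")
      case True
      have c: "Complex a y = complex_of_real a + \<i> * complex_of_real y"
        by (simp add: complex_eq_iff)
      define E where "E = exp (- (\<i> * complex_of_real (y * u)))"
      have e1: "exp (- Complex a y * complex_of_real u) = E * complex_of_real (exp (- a * u))"
        unfolding E_def c exp_of_real[symmetric] exp_add[symmetric] by (simp add: algebra_simps)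
      have e2: "exp (- (Complex a y + 1) * complex_of_real u) = E * complex_of_real (exp (- a * u)) * complex_of_real (exp (- u))"
      proof -
        have "- (Complex a y + 1) * complex_of_real u = - Complex a y * complex_of_real u + complex_of_real (- u)"
          by (simp add: algebra_simps)
        then show ?thesis
          by (simp only: exp_add e1 exp_of_real)
      qed
      show ?thesis
        using True unfolding e1 e2 E_def[symmetric] g_def h_def
        by (simp add: right_diff_distrib left_diff_distrib mult.assoc)
    qed (simp add: g_def h_def)
    have re: "Re (Complex a y) > \<omega>" "Re (Complex a y + 1) > \<omega>" for y
      using a by simp_all
    note li = laplace_integrable[OF re(1), where \<phi> = \<phi> and v = v] laplace_integrable[OF re(2), where \<phi> = \<phi> and v = v]
    have int_y: "integrable lborel (\<lambda>u. exp (- (\<i> * complex_of_real (y * u))) * g u)" for y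
      unfolding decomp by (intro Bochner_Integration.integrable_diff li)
    have val_y: "(LINT u|lborel. exp (- (\<i> * complex_of_real (y * u))) * g u) = laplace \<phi> (Complex a y) v - laplace \<phi> (Complex a y + 1) v" for y
      unfolding decomp laplace_def by (intro Bochner_Integration.integral_diff li)
    have D: "cmod (g u) \<le> M * norm v" for u
    proof -
      define w where "w = max 0 u"
      have w: "w \<ge> 0" by (simp add: w_def)
      have h: "\<bar>h w\<bar> \<le> exp (- a * w)"
        using w by (simp add: h_def abs_mult mult_left_le)
      have "cmod (\<phi> *\<^sub>V R w *\<^sub>V v) \<le> 1 * norm (R w *\<^sub>V v)"
        by (rule norm_cblinfun_le[OF \<phi>])
      also have "\<dots> \<le> M * exp (\<omega> * w) * norm v"
        using norm_apply[OF w] by simp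
      finally have "\<bar>h w\<bar> * cmod (\<phi> *\<^sub>V R w *\<^sub>V v) \<le> exp (- a * w) * (M * exp (\<omega> * w) * norm v)"
        using h by (intro mult_mono) auto
      also have "\<dots> = M * norm v * (exp (- a * w) * exp (\<omega> * w))"
        by simp
      also have "exp (- a * w) * exp (\<omega> * w) = exp (- (a - \<omega>) * w)"
        unfolding exp_add[symmetric] by (simp add: algebra_simps)
      also have "M * norm v * exp (- (a - \<omega>) * w) \<le> M * norm v * 1"
      proof (intro mult_left_mono)
        have "0 \<le> (a - \<omega>) * w"
          using a w by simp
        then show "exp (- (a - \<omega>) * w) \<le> 1"
          by (simp add: algebra_simps)
      qed (use M_nonneg in simp)
      finally show ?thesis
        by (simp add: g_def norm_mult w_def)
    qed
    have "cmod (g t - g s) \<le> (LINT y|lborel. cmod (exp (\<i> * complex_of_real (y * t)) - exp (\<i> * complex_of_real (y * s))) * (C * norm v * inverse (1 + y\<^sup>2)))"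
    proof (rule fourier_modulus[OF cont D])
      show "integrable lborel g"
        using int_y[of 0] by simp
      show "integrable lborel (\<lambda>y. C * norm v * inverse (1 + y\<^sup>2))"
        by (intro integrable_mult_right integrable_inverse_1_plus_square_lborel)
      show "cmod (LINT u|lborel. exp (- (\<i> * complex_of_real (y * u))) * g u) \<le> C * norm v * inverse (1 + y\<^sup>2)" for y
        unfolding val_y by (rule est[OF \<phi>])
    qed
    also have "\<dots> = (LINT y|lborel. (C * norm v) * (cmod (exp (\<i> * complex_of_real (y * t)) - exp (\<i> * complex_of_real (y * s))) * inverse (1 + y\<^sup>2)))"
      by (rule Bochner_Integration.integral_cong) (simp_all add: mult_ac)
    also have "\<dots> = (C * norm v) * modulus t s"
      unfolding modulus_def by (rule integral_mult_right_zero)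
    finally have "cmod (g t - g s) \<le> C * modulus t s * norm v"
      by (simp add: mult_ac)
    moreover have "\<phi> *\<^sub>V (((exp (- a * t) * (1 - exp (- t))) *\<^sub>R R t - (exp (- a * s) * (1 - exp (- s))) *\<^sub>R R s) *\<^sub>V v) = g t - g s"
      using t s by (simp add: g_def h_def cblinfun_minus_apply cblinfun_scaleR_apply cblinfun_linear_simps scaleR_conv_of_real)
    ultimately show "cmod (\<phi> *\<^sub>V (((exp (- a * t) * (1 - exp (- t))) *\<^sub>R R t - (exp (- a * s) * (1 - exp (- s))) *\<^sub>R R s) *\<^sub>V v)) \<le> C * modulus t s * norm v"
      by simp
  qed
qed

text \<open>The weight is continuous and positive at positive times, so it can be divided out. It
  vanishes at zero, which is why continuity is claimed on the open half-line.\<close>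

lemma norm_continuous:
  assumes a: "a > \<omega>" and C: "C \<ge> 0"
    and est: "\<And>\<phi> v y. norm \<phi> \<le> 1 \<Longrightarrow>
      cmod (laplace \<phi> (Complex a y) v - laplace \<phi> (Complex a y + 1) v) \<le> C * norm v * inverse (1 + y\<^sup>2)"
  shows "continuous_on {0<..} R"
  unfolding continuous_on_sequentially
proof (intro allI ballI impI)
  fix X :: "nat \<Rightarrow> real" and t assume t: "t \<in> {0<..}" and "(\<forall>n. X n \<in> {0<..}) \<and> X \<longlonglongrightarrow> t"
  then have X: "\<And>n. X n > 0" and lim: "X \<longlonglongrightarrow> t"
    by auto
  have weighted: "norm ((exp (- a * t) * (1 - exp (- t))) *\<^sub>R R t - (exp (- a * s) * (1 - exp (- s))) *\<^sub>R R s) \<le> C * modulus t s"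
    if "t \<ge> 0" "s \<ge> 0" for t s
    by (rule weighted_norm_modulus[OF a C _ that]) (rule est)
  define h where "h t = exp (- a * t) * (1 - exp (- t))" for t
  have h: "h t > 0" if "t > 0" for t
    using that by (simp add: h_def)
  have "(\<lambda>k. C * modulus (X k) t) \<longlonglongrightarrow> C * 0"
    by (intro tendsto_intros modulus_tendsto lim)
  then have C_lim: "(\<lambda>k. C * modulus (X k) t) \<longlonglongrightarrow> 0"
    by simp
  have "(\<lambda>k. h (X k) *\<^sub>R R (X k) - h t *\<^sub>R R t) \<longlonglongrightarrow> 0"
  proof (rule Lim_null_comparison[OF _ C_lim], intro always_eventually allI)
    fix k
    show "norm (h (X k) *\<^sub>R R (X k) - h t *\<^sub>R R t) \<le> C * modulus (X k) t"
      unfolding h_def by (rule weighted[OF less_imp_le[OF X[of k]]]) (use t in simp)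
  qed
  then have "(\<lambda>k. h (X k) *\<^sub>R R (X k)) \<longlonglongrightarrow> h t *\<^sub>R R t"
    by (rule LIM_zero_cancel)
  moreover have "(\<lambda>k. inverse (h (X k))) \<longlonglongrightarrow> inverse (h t)"
    unfolding h_def using h[of t] t by (intro tendsto_intros lim) (auto simp: h_def)
  ultimately have "(\<lambda>k. inverse (h (X k)) *\<^sub>R (h (X k) *\<^sub>R R (X k))) \<longlonglongrightarrow> inverse (h t) *\<^sub>R (h t *\<^sub>R R t)"
    by (rule tendsto_scaleR[rotated])
  moreover have "h (X k) \<noteq> 0" "h t \<noteq> 0" for k
    using h[OF X[of k]] h[of t] t by auto
  ultimately show "(R \<circ> X) \<longlonglongrightarrow> R t"
    by (simp add: o_def)
qed

text \<open>The operators \<open>Q k\<close> are the Laplace transforms of \<open>R\<close> at \<open>a + k\<close>. By the Weierstrass theorem in the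
  variable \<open>exp (- t)\<close>, a bump function at \<open>t0\<close> is approximated by a combination of the weights
  \<open>exp (- (a + k) * t)\<close>; so \<open>R t0\<close> is approximated by a combination of the \<open>Q k\<close>.\<close>

lemma compact_operator_by_laplace:
  assumes cont: "continuous_on {0<..} R" and a: "a > \<omega>"
    and Q: "\<And>k::nat. compact_operator (Q k)"
    and lap: "\<And>\<phi> k v. \<phi> *\<^sub>V Q k *\<^sub>V v = laplace \<phi> (complex_of_real (a + real k)) v"
    and t0: "t0 > 0"
  shows "compact_operator (R t0)"
proof (rule compact_operator_approx)
  fix e :: real assume e: "e > 0"
  obtain \<delta>0 where \<delta>0: "\<delta>0 > 0" and near: "\<And>t. t > 0 \<Longrightarrow> dist t t0 < \<delta>0 \<Longrightarrow> dist (R t) (R t0) < e / 2"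
    using cont t0 e unfolding continuous_on_iff by (metis greaterThan_iff half_gt_zero)
  \<comment> \<open>Small enough for the bump to live where \<open>R\<close> is close to
    \<open>R t0\<close>, and at positive times only.\<close>
  define \<delta> where "\<delta> = min \<delta>0 t0 / 2"
  have \<delta>: "\<delta> > 0" "\<delta> < \<delta>0" "\<delta> < t0"
    using \<delta>0 t0 by (auto simp: \<delta>_def)
  define \<rho> where "\<rho> t = max 0 (\<delta> - \<bar>t - t0\<bar>)" for t
  have \<rho>_cont: "continuous_on S \<rho>" for S
    unfolding \<rho>_def by (intro continuous_intros)
  have \<rho>_meas [measurable]: "\<rho> \<in> borel_measurable borel"
    using \<rho>_cont by (rule borel_measurable_continuous_onI)
  have \<rho>0: "\<rho> t \<ge> 0" for t by (simp add: \<rho>_def)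
  have \<rho>_supp: "t > 0 \<and> dist t t0 < \<delta>0" if "\<rho> t \<noteq> 0" for t
    using that \<delta> by (auto simp: \<rho>_def max_def dist_real_def split: if_splits)
  have \<rho>_int: "integrable lborel \<rho>"
  proof (rule Bochner_Integration.integrable_bound)
    show "integrable lborel (\<lambda>t. indicator {t0 - \<delta>..t0 + \<delta>} t * \<delta>)"
      by (intro integrable_mult_left integrable_real_indicator) (auto simp: emeasure_lborel_Icc_eq)
    show "AE t in lborel. norm (\<rho> t) \<le> norm (indicator {t0 - \<delta>..t0 + \<delta>} t * \<delta>)"
      using \<delta> by (intro AE_I2) (auto simp: \<rho>_def indicator_def)
  qed simp
  define c where "c = (LINT t|lborel. \<rho> t)"
  have "(LINT t|lborel. indicator {t0 - \<delta> / 2..t0 + \<delta> / 2} t * (\<delta> / 2)) \<le> c"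
    unfolding c_def
  proof (rule integral_mono[OF _ \<rho>_int])
    show "integrable lborel (\<lambda>t. indicator {t0 - \<delta> / 2..t0 + \<delta> / 2} t * (\<delta> / 2))"
      by (intro integrable_mult_left integrable_real_indicator) (auto simp: emeasure_lborel_Icc_eq)
    show "indicator {t0 - \<delta> / 2..t0 + \<delta> / 2} t * (\<delta> / 2) \<le> \<rho> t" for t
      by (auto simp: \<rho>_def indicator_def abs_if)
  qed
  then have c: "c > 0"
    using \<delta> by (simp add: field_simps) (smt (verit) mult_pos_pos)
  define I where "I = (LINT t|lborel. indicator {0..} t *\<^sub>R exp (- (a - \<omega>) * t))"
  have I0: "I \<ge> 0"
    unfolding I_def by (intro Bochner_Integration.integral_nonneg) simp
  \<comment> \<open>Uniform error allowed to the polynomial. Integrated against the exponential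
    bound of \<open>R\<close> it costs at most \<open>d * M * I\<close>, which is below half of
    \<open>c * e\<close>; the summand 1 keeps the quotient meaningful.\<close>
  define d where "d = (c * (e / 2)) / (M * I + 1)"
  have MI: "M * I \<ge> 0"
    using I0 M_nonneg by simp
  have d: "d > 0"
    using c e MI by (simp add: d_def)
  \<comment> \<open>The function \<open>\<rho> t * exp (a * t)\<close> in the variable
    \<open>x = exp (- t)\<close>. The bump is already zero where \<open>q\<close> is set to zero, so
    \<open>q\<close> is continuous up to \<open>x = 0\<close>, that is, up to infinite time.\<close>
  define q where "q x = (if x \<le> exp (- t0 - \<delta>) then 0 else \<rho> (- ln x) * exp (- a * ln x))" for x
  have "continuous_on {0..1} q"
  proof -
    have "continuous_on ({0..exp (- t0 - \<delta>)} \<union> {exp (- t0 - \<delta>)..1}) q"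
      unfolding q_def
    proof (rule continuous_on_If)
      show "continuous_on {exp (- t0 - \<delta>)..1} (\<lambda>x. \<rho> (- ln x) * exp (- a * ln x))"
      proof (intro continuous_intros continuous_on_compose2[OF \<rho>_cont[of UNIV]] ballI)
        fix x assume "x \<in> {exp (- t0 - \<delta>)..1}"
        then show "x \<noteq> 0"
          using exp_gt_zero[of "- t0 - \<delta>"] by (metis atLeastAtMost_iff not_less)
      qed auto
      fix x assume "x \<in> {exp (- t0 - \<delta>)..1} \<and> x \<le> exp (- t0 - \<delta>)"
    qed (auto simp: \<rho>_def)
    moreover have "{0..exp (- t0 - \<delta>)} \<union> {exp (- t0 - \<delta>)..1} = {0..1}"
      using \<delta> t0 by (intro ivl_disj_un_two_touch) auto
    ultimately show ?thesis by simp
  qed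
  then obtain p where p: "real_polynomial_function p" and close: "\<And>x. x \<in> {0..1} \<Longrightarrow> \<bar>q x - p x\<bar> < d"
    using Stone_Weierstrass_real_polynomial_function[of "{0..1}" q d] d by auto
  obtain \<beta> n where p_eq: "p = (\<lambda>x. \<Sum>i\<le>n. \<beta> i * x ^ i)"
    using p real_polynomial_function_iff_sum by auto
  define S where "S = (\<Sum>i\<le>n. \<beta> i *\<^sub>R Q i)"
  have weight: "\<bar>\<rho> t - exp (- a * t) * p (exp (- t))\<bar> \<le> d * exp (- a * t)" if t: "t \<ge> 0" for t
  proof -
    have "q (exp (- t)) = \<rho> t * exp (a * t)"
      by (auto simp: q_def \<rho>_def)
    then have "\<bar>\<rho> t * exp (a * t) - p (exp (- t))\<bar> \<le> d"
      using close[of "exp (- t)"] t by simp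
    then have "\<bar>\<rho> t * exp (a * t) - p (exp (- t))\<bar> * exp (- a * t) \<le> d * exp (- a * t)"
      by (intro mult_right_mono) auto
    also have "\<bar>\<rho> t * exp (a * t) - p (exp (- t))\<bar> * exp (- a * t) = \<bar>(\<rho> t * exp (a * t) - p (exp (- t))) * exp (- a * t)\<bar>"
      by (simp add: abs_mult)
    also have "(\<rho> t * exp (a * t) - p (exp (- t))) * exp (- a * t) = \<rho> t - exp (- a * t) * p (exp (- t))"
    proof -
      have "exp (a * t) * exp (- a * t) = 1"
        unfolding exp_add[symmetric] by simp
      moreover have "(\<rho> t * exp (a * t) - p (exp (- t))) * exp (- a * t) = \<rho> t * (exp (a * t) * exp (- a * t)) - exp (- a * t) * p (exp (- t))"
        by (simp only: left_diff_distrib mult.assoc mult.commute[of "p (exp (- t))"])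
      ultimately show ?thesis by simp
    qed
    finally show ?thesis .
  qed
  have "norm (c *\<^sub>R R t0 - S) \<le> c * e"
  proof (rule norm_cblinfun_bound)
    show "0 \<le> c * e" using c e by simp
    fix v
    show "norm ((c *\<^sub>R R t0 - S) *\<^sub>V v) \<le> c * e * norm v"
    proof (rule norm_le_by_functionals)
      fix \<phi> :: "'w \<Rightarrow>\<^sub>C\<^sub>L complex" assume \<phi>: "norm \<phi> \<le> 1"
      define x where "x t = \<phi> *\<^sub>V R (max 0 t) *\<^sub>V v" for t
      have x_meas [measurable]: "x \<in> borel_measurable borel"
        unfolding x_def by (intro measurable_functional measurable_family_apply) simp_all
      define y where "y i t = indicator {0..} t *\<^sub>R (exp (- complex_of_real (a + real i) * complex_of_real t) * x t)" for i t
      have y_int: "integrable lborel (y i)" and y_val: "(LINT t|lborel. y i t) = \<phi> *\<^sub>V Q i *\<^sub>V v" for i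
        unfolding y_def x_def lap laplace_def using a by (intro laplace_integrable refl; simp)+
      define K where "K t = (\<Sum>i\<le>n. \<beta> i *\<^sub>R y i t)" for t
      have K_int: "integrable lborel K"
        unfolding K_def by (intro Bochner_Integration.integrable_sum integrable_scaleR_right y_int)
      have K_val: "(LINT t|lborel. K t) = \<phi> *\<^sub>V S *\<^sub>V v"
        unfolding K_def S_def using y_int
        by (subst Bochner_Integration.integral_sum)
          (simp_all add: y_val cblinfun_sum_apply cblinfun_scaleR_apply cblinfun_linear_simps cblinfun_apply_sum)
      have K_eq: "K t = indicator {0..} t *\<^sub>R (complex_of_real (exp (- a * t) * p (exp (- t))) * x t)" for t
      proof (cases "t \<ge> 0")
        case True
        have "exp (- complex_of_real (a + real i) * complex_of_real t) = complex_of_real (exp (- a * t) * exp (- t) ^ i)" for i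
        proof -
          have "exp (- a * t) * exp (- t) ^ i = exp (- (a + real i) * t)"
            by (simp add: exp_of_nat_mult[symmetric] exp_add[symmetric] algebra_simps)
          moreover have "- complex_of_real (a + real i) * complex_of_real t = complex_of_real (- (a + real i) * t)"
            by simp
          ultimately show ?thesis
            by (simp only: exp_of_real)
        qed
        then have "K t = (\<Sum>i\<le>n. \<beta> i *\<^sub>R (complex_of_real (exp (- a * t) * exp (- t) ^ i) * x t))"
          using True unfolding K_def y_def by simp
        then show ?thesis
          using True unfolding p_eq sum_scaleR_of_real by simp
      qed (simp add: K_def y_def)
      define L where "L t = \<rho> t *\<^sub>R (\<phi> *\<^sub>V R t0 *\<^sub>V v)" for t
      have L_int: "integrable lborel L" and L_val: "(LINT t|lborel. L t) = c *\<^sub>R (\<phi> *\<^sub>V R t0 *\<^sub>V v)"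
        unfolding L_def using \<rho>_int by (simp_all add: c_def)
      define b where "b t = \<rho> t * (e / 2 * norm v) + (d * M * norm v) * (indicator {0..} t *\<^sub>R exp (- (a - \<omega>) * t))" for t
      have b_int: "integrable lborel b"
        unfolding b_def using a
        by (intro Bochner_Integration.integrable_add integrable_mult_left integrable_mult_right \<rho>_int integrable_exp_decay) simp
      have "cmod (LINT t|lborel. L t - K t) \<le> (LINT t|lborel. b t)"
      proof (rule Bochner_Integration.integral_norm_bound_integral)
        show "integrable lborel (\<lambda>t. L t - K t)"
          by (intro Bochner_Integration.integrable_diff L_int K_int)
        show "integrable lborel b" by (rule b_int)
        fix t
        show "cmod (L t - K t) \<le> b t"
        proof (cases "t \<ge> 0")
          case False
          then have "\<rho> t = 0"
            using \<rho>_supp[of t] by auto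
          then show ?thesis
            using False by (simp add: L_def K_eq b_def)
        next
          case True
          have xt: "x t = \<phi> *\<^sub>V R t *\<^sub>V v"
            using True by (simp add: x_def)
          have "L t - K t = \<rho> t *\<^sub>R (\<phi> *\<^sub>V (R t0 - R t) *\<^sub>V v) + complex_of_real (\<rho> t - exp (- a * t) * p (exp (- t))) * x t"
            using True by (simp add: L_def K_eq xt cblinfun_minus_apply cblinfun_linear_simps scaleR_conv_of_real algebra_simps)
          also have "cmod \<dots> \<le> cmod (\<rho> t *\<^sub>R (\<phi> *\<^sub>V (R t0 - R t) *\<^sub>V v)) + cmod (complex_of_real (\<rho> t - exp (- a * t) * p (exp (- t))) * x t)"
            by (rule norm_triangle_ineq)
          also have "\<dots> \<le> \<rho> t * (e / 2 * norm v) + (d * exp (- a * t)) * (M * exp (\<omega> * t) * norm v)"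
          proof (rule add_mono)
            show "cmod (\<rho> t *\<^sub>R (\<phi> *\<^sub>V (R t0 - R t) *\<^sub>V v)) \<le> \<rho> t * (e / 2 * norm v)"
            proof (cases "\<rho> t = 0")
              case False
              then have "norm (R t0 - R t) \<le> e / 2"
                using near \<rho>_supp by (metis dist_commute dist_norm less_imp_le)
              have "cmod (\<phi> *\<^sub>V (R t0 - R t) *\<^sub>V v) \<le> 1 * norm ((R t0 - R t) *\<^sub>V v)"
                by (rule norm_cblinfun_le[OF \<phi>])
              also have "1 * norm ((R t0 - R t) *\<^sub>V v) \<le> e / 2 * norm v"
                using norm_cblinfun_le[OF \<open>norm (R t0 - R t) \<le> e / 2\<close>] by simp
              finally show ?thesis
                unfolding norm_scaleR abs_of_nonneg[OF \<rho>0] by (rule mult_left_mono[OF _ \<rho>0])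
            qed simp
            have "cmod (x t) \<le> 1 * norm (R t *\<^sub>V v)"
              unfolding xt by (rule norm_cblinfun_le[OF \<phi>])
            also have "\<dots> \<le> M * exp (\<omega> * t) * norm v"
              using norm_apply[OF True] by simp
            finally show "cmod (complex_of_real (\<rho> t - exp (- a * t) * p (exp (- t))) * x t) \<le> (d * exp (- a * t)) * (M * exp (\<omega> * t) * norm v)"
              unfolding norm_mult norm_of_real by (rule mult_mono[OF weight[OF True]]) (use d in simp_all)
          qed
          also have "(d * exp (- a * t)) * (M * exp (\<omega> * t) * norm v) = (d * M * norm v) * (exp (- a * t) * exp (\<omega> * t))"
            by simp
          also have "exp (- a * t) * exp (\<omega> * t) = exp (- (a - \<omega>) * t)"
            unfolding exp_add[symmetric] by (simp add: algebra_simps)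
          finally show ?thesis
            using True by (simp add: b_def)
        qed
      qed
      also have "(LINT t|lborel. b t) = c * (e / 2 * norm v) + (d * M * norm v) * (LINT t|lborel. indicator {0..} t *\<^sub>R exp (- (a - \<omega>) * t))"
        unfolding b_def using a \<rho>_int integrable_exp_decay[of "a - \<omega>"]
        by (subst Bochner_Integration.integral_add) (simp_all add: c_def)
      also have "\<dots> \<le> c * e * norm v"
        unfolding I_def[symmetric]
      proof -
        have "d * M * I = (c * (e / 2)) * (M * I / (M * I + 1))"
          by (simp add: d_def)
        also have "\<dots> \<le> (c * (e / 2)) * 1"
          using c e MI by (intro mult_left_mono) auto
        finally have "d * M * I * norm v \<le> c * (e / 2) * norm v"
          by (intro mult_right_mono) auto
        then show "c * (e / 2 * norm v) + (d * M * norm v) * I \<le> c * e * norm v"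
          by (simp add: algebra_simps)
      qed
      finally have "cmod (LINT t|lborel. L t - K t) \<le> c * e * norm v" .
      moreover have "(LINT t|lborel. L t - K t) = \<phi> *\<^sub>V ((c *\<^sub>R R t0 - S) *\<^sub>V v)"
        using L_int K_int by (simp add: L_val K_val cblinfun_minus_apply cblinfun_scaleR_apply cblinfun_linear_simps)
      ultimately show "cmod (\<phi> *\<^sub>V ((c *\<^sub>R R t0 - S) *\<^sub>V v)) \<le> c * e * norm v"
        by simp
    qed
  qed
  then have "norm (c *\<^sub>R R t0 - S) / c \<le> e"
    using c by (simp add: divide_le_eq mult.commute)
  moreover have "R t0 - (1 / c) *\<^sub>R S = (1 / c) *\<^sub>R (c *\<^sub>R R t0 - S)"
    using c by (simp add: scaleR_diff_right)
  then have "norm (R t0 - (1 / c) *\<^sub>R S) = norm (c *\<^sub>R R t0 - S) / c"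
    using c by simp
  ultimately have "norm (R t0 - (1 / c) *\<^sub>R S) \<le> e"
    by simp
  moreover have "compact_operator ((1 / c) *\<^sub>R S)"
    unfolding S_def by (intro compact_operator_scaleR compact_operator_sum Q) simp
  ultimately show "\<exists>S'. compact_operator S' \<and> norm (R t0 - S') \<le> e"
    by blast
qed

end

section \<open>From the standing conditions to properties of the resolvent operator\<close>

lemma measurable_scaleC:
  fixes g :: "'a \<Rightarrow> 'w::{complex_normed_vector, second_countable_topology}"
  assumes [measurable]: "c \<in> borel_measurable N" "g \<in> borel_measurable N"
  shows "(\<lambda>x. c x *\<^sub>C g x) \<in> borel_measurable N"
proof -
  have "continuous_on UNIV (\<lambda>p. fst p *\<^sub>C (snd p :: 'w))"
    by (intro bounded_bilinear.continuous_on[OF bounded_bilinear_scaleC] continuous_intros)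
  then have 1: "(\<lambda>p. fst p *\<^sub>C (snd p :: 'w)) \<in> borel_measurable (borel \<Otimes>\<^sub>M borel)"
    using borel_measurable_continuous_onI by (metis borel_prod)
  have 2: "(\<lambda>x. (c x, g x)) \<in> N \<rightarrow>\<^sub>M (borel \<Otimes>\<^sub>M borel)"
    by measurable
  show ?thesis
    using measurable_compose[OF 2 1] by simp
qed

lemma set_integrable_lebesgue_continuous:
  fixes f :: "real \<Rightarrow> 'a::{banach, second_countable_topology}"
  assumes "continuous_on {a..b} f"
  shows "set_integrable lebesgue {a..b} f"
proof -
  have "set_integrable lborel {a..b} f"
    by (rule borel_integrable_atLeastAtMost'[OF assms])
  then show ?thesis
    by (simp add: set_integrable_def integrable_completion borel_measurable_integrable)
qed

text \<open>By the resolvent identity, the resolvent at \<open>l\<close> is the one at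
  \<open>l0\<close> composed on the right with a bounded operator.\<close>

lemma compact_resolvent_all:
  fixes A :: "'w::complex_banach \<Rightarrow> 'w"
  assumes l0: "l0 \<in> resolvent_set D A" and c: "compact_operator (resolvent D A l0)" and l: "l \<in> resolvent_set D A"
  shows "compact_operator (resolvent D A l)"
proof -
  define U where "U = id_cblinfun + (l0 - l) *\<^sub>C resolvent D A l"
  have "resolvent D A l = resolvent D A l0 o\<^sub>C\<^sub>L U"
  proof (rule cblinfun_eqI)
    fix z
    define x where "x = resolvent D A l *\<^sub>V z"
    have x: "x \<in> D" "l *\<^sub>C x - A x = z"
      using is_resolvent_at_resolvent[OF l] by (auto simp: is_resolvent_at_def x_def)
    have "resolvent D A l0 *\<^sub>V (l0 *\<^sub>C x - A x) = x"
      using is_resolvent_at_resolvent[OF l0] x(1) by (auto simp: is_resolvent_at_def)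
    moreover have "(l0 - l) *\<^sub>C x = l0 *\<^sub>C x - l *\<^sub>C x"
      using bounded_bilinear.diff_left[OF bounded_bilinear_scaleC] .
    then have "l0 *\<^sub>C x - A x = z + (l0 - l) *\<^sub>C x"
      using x(2) by (simp add: algebra_simps)
    ultimately show "resolvent D A l *\<^sub>V z = (resolvent D A l0 o\<^sub>C\<^sub>L U) *\<^sub>V z"
      by (simp add: U_def cblinfun_compose_apply cblinfun_plus_apply cblinfun_scaleC_apply x_def)
  qed
  then show ?thesis
    using compact_operator_compose_right[OF c] by simp
qed

text \<open>The hypotheses speak of positive times; the value at time zero is discarded as a null
  set, and \<open>\<bar>P t\<bar>\<close> serves as majorant.\<close>

lemma Cd3_kernel_integrable:
  assumes Cd3: "Cd3 \<nu> DA A DN N Nhat" and z: "z \<in> DA"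
  shows "Re l > 0 \<Longrightarrow> laplace_converges (\<lambda>t. N t z) l" and "set_integrable lebesgue {0..b} (\<lambda>t. N t z)"
proof -
  obtain P where P: "\<And>b. set_integrable lebesgue {0..b} P"
    "\<And>l. Re l > 0 \<Longrightarrow> laplace_converges (\<lambda>t. complex_of_real (P t)) l"
    "\<And>t. t > 0 \<Longrightarrow> norm (N t z) \<le> P t * graph_norm A z"
  proof -
    have "\<exists>P :: real \<Rightarrow> real.
       (\<forall>b. set_integrable lebesgue {0..b} P) \<and>
       (\<forall>l. Re l > 0 \<longrightarrow> laplace_converges (\<lambda>t. complex_of_real (P t)) l) \<and>
       (\<forall>t>0. \<forall>z\<in>DA. norm (N t z) \<le> P t * graph_norm A z)"
      using Cd3 unfolding Cd3_def by (elim conjE)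
    then obtain P :: "real \<Rightarrow> real" where P: "\<forall>b. set_integrable lebesgue {0..b} P"
       "\<forall>l. Re l > 0 \<longrightarrow> laplace_converges (\<lambda>t. complex_of_real (P t)) l"
       "\<forall>t>0. \<forall>z\<in>DA. norm (N t z) \<le> P t * graph_norm A z"
      by (elim exE conjE)
    then show thesis
      using z by (intro that[of P]) blast+
  qed
  have "\<forall>z\<in>DA. strongly_measurable (lebesgue_on {0<..}) (\<lambda>t. N t z)"
    using Cd3 unfolding Cd3_def by (elim conjE)
  then have "strongly_measurable (lebesgue_on {0<..}) (\<lambda>t. N t z)"
    using z by (rule bspec)
  then have meas: "(\<lambda>t. indicator {0<..} t *\<^sub>R N t z) \<in> borel_measurable lebesgue"
    by (rule strongly_measurable_imp_measurable) auto
  have ae: "AE t in lebesgue. t \<noteq> (0::real)"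
    by (rule AE_completion[OF AE_lborel_singleton])
  show "laplace_converges (\<lambda>t. N t z) l" if l: "Re l > 0"
    unfolding laplace_converges_def set_integrable_def
  proof (rule Bochner_Integration.integrable_bound)
    show "integrable lebesgue (\<lambda>t. norm (indicator {0..} t *\<^sub>R (exp (- l * complex_of_real t) *\<^sub>C complex_of_real (P t))) * graph_norm A z)"
      using P(2)[OF l] unfolding laplace_converges_def set_integrable_def by (intro integrable_mult_left integrable_norm)
    have e: "(\<lambda>t. exp (- l * complex_of_real t)) \<in> borel_measurable lebesgue"
      by (intro measurable_completion) simp
    show "(\<lambda>t. indicator {0..} t *\<^sub>R (exp (- l * complex_of_real t) *\<^sub>C N t z)) \<in> borel_measurable lebesgue"
    proof (rule lebesgue_measurable_cong_AE[OF measurable_scaleC[OF e meas]])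
      show "AE t in lebesgue. indicator {0..} t *\<^sub>R (exp (- l * complex_of_real t) *\<^sub>C N t z) = exp (- l * complex_of_real t) *\<^sub>C (indicator {0<..} t *\<^sub>R N t z)"
        using ae by eventually_elim (auto simp: indicator_def scaleC_linear_simps)
    qed
    show "AE t in lebesgue. norm (indicator {0..} t *\<^sub>R (exp (- l * complex_of_real t) *\<^sub>C N t z))
      \<le> norm (norm (indicator {0..} t *\<^sub>R (exp (- l * complex_of_real t) *\<^sub>C complex_of_real (P t))) * graph_norm A z)"
      using ae
    proof eventually_elim
      case (elim t)
      show ?case
      proof (cases "t > 0")
        case True
        have "norm (N t z) \<le> \<bar>P t\<bar> * graph_norm A z"
          using P(3)[OF True] mult_right_mono[OF abs_ge_self[of "P t"] graph_norm_nonneg[of A z]] by linarith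
        then have "cmod (exp (- l * complex_of_real t)) * norm (N t z) \<le> cmod (exp (- l * complex_of_real t)) * (\<bar>P t\<bar> * graph_norm A z)"
          by (rule mult_left_mono) simp
        then show ?thesis
          using True graph_norm_nonneg[of A z] by (simp only: norm_scaleR norm_scaleC norm_of_real abs_mult norm_mult) simp
      qed (use elim in simp)
    qed
  qed
  show "set_integrable lebesgue {0..b} (\<lambda>t. N t z)"
    unfolding set_integrable_def
  proof (rule Bochner_Integration.integrable_bound)
    show "integrable lebesgue (\<lambda>t. norm (indicator {0..b} t *\<^sub>R P t) * graph_norm A z)"
      using P(1)[of b] unfolding set_integrable_def by (intro integrable_mult_left integrable_norm)
    have "(\<lambda>t. indicator {..b} t *\<^sub>R (indicator {0<..} t *\<^sub>R N t z)) \<in> borel_measurable lebesgue"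
      by (intro borel_measurable_scaleR meas borel_measurable_indicator) auto
    then show "(\<lambda>t. indicator {0..b} t *\<^sub>R N t z) \<in> borel_measurable lebesgue"
    proof (rule lebesgue_measurable_cong_AE)
      show "AE t in lebesgue. indicator {0..b} t *\<^sub>R N t z = indicator {..b} t *\<^sub>R (indicator {0<..} t *\<^sub>R N t z)"
        using ae by eventually_elim (auto simp: indicator_def)
    qed
    show "AE t in lebesgue. norm (indicator {0..b} t *\<^sub>R N t z) \<le> norm (norm (indicator {0..b} t *\<^sub>R P t) * graph_norm A z)"
      using ae
    proof eventually_elim
      case (elim t)
      show ?case
      proof (cases "t \<in> {0..b}")
        case True
        then have "t > 0"
          using elim by simp
        have "norm (N t z) \<le> \<bar>P t\<bar> * graph_norm A z"
          using P(3)[OF \<open>t > 0\<close>] mult_right_mono[OF abs_ge_self[of "P t"] graph_norm_nonneg[of A z]] by linarith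
        then show ?thesis
          using True graph_norm_nonneg[of A z] by (simp add: abs_mult)
      qed simp
    qed
  qed
qed

text \<open>A left inverse, from the transformed equation, meets a right inverse, from the
  perturbation argument; so the tested transform of \<open>R\<close> is the tested \<open>Q\<close>.
  Every bound for \<open>Q\<close> thereby becomes a bound for the transform.\<close>

lemma resolvent_operator_properties:
  fixes R :: "real \<Rightarrow> 'w::{complex_banach, second_countable_topology} \<Rightarrow>\<^sub>C\<^sub>L 'w"
  assumes A: "closed_linear_operator DA A"
    and Cd1: "Cd1 \<nu> DA A" and Cd2: "Cd2 \<nu> \<alpha> DA A G Ghat" and Cd3: "Cd3 \<nu> DA A DN N Nhat"
    and R: "resolvent_operator DA A G N R"
    and comp: "\<exists>l0\<in>resolvent_set DA A. compact_operator (resolvent DA A l0)"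
  obtains M \<omega> where "exp_bounded_family R M \<omega>" "continuous_on {0<..} R" "\<And>t. t > 0 \<Longrightarrow> compact_operator (R t)"
proof -
  obtain M0 \<omega>0 where M0: "\<And>t. t \<ge> 0 \<Longrightarrow> norm (R t) \<le> M0 * exp (\<omega>0 * t)"
    using R unfolding resolvent_operator_def by blast
  have M0_nonneg: "M0 \<ge> 0"
    using order_trans[OF norm_ge_zero M0[of 0]] by simp
  define \<omega> where "\<omega> = max 1 \<omega>0"
  interpret exp_bounded_family R M0 \<omega>
  proof
    show "continuous_on {0..} (\<lambda>t. R t *\<^sub>V z)" for z
      using R by (simp add: resolvent_operator_def)
    show "norm (R t) \<le> M0 * exp (\<omega> * t)" if "t \<ge> 0" for t
    proof -
      have "\<omega>0 * t \<le> \<omega> * t"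
        using that by (intro mult_right_mono) (auto simp: \<omega>_def)
      then have "M0 * exp (\<omega>0 * t) \<le> M0 * exp (\<omega> * t)"
        using M0_nonneg by (intro mult_left_mono) auto
      then show ?thesis
        using M0[OF that] by linarith
    qed
    show "\<omega> > 0" by (simp add: \<omega>_def)
  qed
  have \<nu>: "pi / 2 < \<nu>" "\<nu> < pi" and sec: "sector \<nu> \<subseteq> resolvent_set DA A"
    using Cd1 by (auto simp: Cd1_def)
  have identity: "laplace \<phi> l (char_op A Ghat Nhat l z) = \<phi> *\<^sub>V z" if z: "z \<in> DA" and l: "Re l > \<omega>" for \<phi> l z
  proof -
    have l0: "Re l > 0"
      using l \<omega>_pos by simp
    have "laplace \<phi> l (l *\<^sub>C z + l *\<^sub>C laplace_transform (\<lambda>s. G s *\<^sub>V z) l - A z - laplace_transform (\<lambda>s. N s z) l) = \<phi> *\<^sub>V z"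
    proof (rule resolvent_laplace_equation)
      show "R 0 = id_cblinfun"
        using R by (simp add: resolvent_operator_def)
      show "((\<lambda>t. R t *\<^sub>V z + (LINT s:{0..t}|lebesgue. R (t - s) *\<^sub>V G s *\<^sub>V z)) has_vector_derivative
             (R t *\<^sub>V A z + (LINT s:{0..t}|lebesgue. R (t - s) *\<^sub>V N s z))) (at t within {0..})" if "t \<ge> 0" for t
        using R z that unfolding resolvent_operator_def by blast
      show "laplace_converges (\<lambda>s. G s *\<^sub>V z) l" if "Re l > 0" for l
        using Cd2 that by (simp add: Cd2_def)
      show "set_integrable lebesgue {0..b} (\<lambda>s. G s *\<^sub>V z)" for b
      proof (rule set_integrable_lebesgue_continuous)
        have "continuous_on {0..} (\<lambda>t. G t *\<^sub>V z)"
          using Cd2 by (simp add: Cd2_def)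
        then show "continuous_on {0..b} (\<lambda>s. G s *\<^sub>V z)"
          by (rule continuous_on_subset) auto
      qed
      show "laplace_converges (\<lambda>s. N s z) l" if "Re l > 0" for l
        by (rule Cd3_kernel_integrable(1)[OF Cd3 z that])
      show "set_integrable lebesgue {0..b} (\<lambda>s. N s z)" for b
        by (rule Cd3_kernel_integrable(2)[OF Cd3 z])
    qed (rule l)
    moreover have "Ghat l *\<^sub>V z = laplace_transform (\<lambda>s. G s *\<^sub>V z) l"
      using Cd2 l0 unfolding Cd2_def by blast
    moreover have "Nhat l z = laplace_transform (\<lambda>s. N s z) l"
      using Cd3 l0 z unfolding Cd3_def by blast
    ultimately show ?thesis
      by (simp add: char_op_def)
  qed
  obtain Q r C where r: "r \<ge> 1" and C: "C \<ge> 0"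
    and Q: "\<And>l v. l \<in> sector \<nu> \<Longrightarrow> cmod l \<ge> r \<Longrightarrow> Q l *\<^sub>V v \<in> DA \<and> char_op A Ghat Nhat l (Q l *\<^sub>V v) = v"
    and Q_norm: "\<And>l v. l \<in> sector \<nu> \<Longrightarrow> cmod l \<ge> r \<Longrightarrow> norm (Q l *\<^sub>V v) \<le> C / cmod l * norm v"
    and Q_graph: "\<And>l v. l \<in> sector \<nu> \<Longrightarrow> cmod l \<ge> r \<Longrightarrow> graph_norm A (Q l *\<^sub>V v) \<le> C * norm v"
    and Q_comp: "\<And>l. l \<in> sector \<nu> \<Longrightarrow> cmod l \<ge> r \<Longrightarrow> \<exists>S. Q l = resolvent DA A l o\<^sub>C\<^sub>L S"
    by (rule char_op_right_inverse[OF Cd1 Cd2 Cd3 A]) blast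
  obtain r' C' where C': "C' \<ge> 0" and diff: "\<And>l x. Re l > 0 \<Longrightarrow> cmod l \<ge> r' \<Longrightarrow> x \<in> DA \<Longrightarrow>
      norm (char_op A Ghat Nhat l x - char_op A Ghat Nhat (l + 1) x) \<le> C' * (norm x + graph_norm A x / cmod l)"
    by (rule char_op_difference[OF \<nu> Cd2 Cd3]) blast
  \<comment> \<open>The vertical line of integration: to the right of the growth bound and of both
    thresholds, and with \<open>a \<ge> 1\<close>, which replaces \<open>a\<close> by 1 in the final
    denominator.\<close>
  define a where "a = max (max \<omega> r) r' + 1"
  have a: "a > \<omega>" "a > r" "a > r'"
    by (auto simp: a_def)
  have a0: "a > 0"
    using a r by simp
  have big: "l \<in> sector \<nu> \<and> cmod l \<ge> r \<and> cmod l \<ge> r' \<and> cmod l > 0" if "Re l \<ge> a" for l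
    using right_half_plane_subset_sector[OF \<nu>, of l] a a0 that complex_Re_le_cmod[of l] by auto
  have laplace_Q: "laplace \<phi> l v = \<phi> *\<^sub>V Q l *\<^sub>V v" if l: "Re l \<ge> a" for \<phi> l v
    using identity[of "Q l *\<^sub>V v" l \<phi>] Q[of l v] big[OF l] l a by simp
  define D where "D = 2 * C * C * C'"
  have D0: "D \<ge> 0"
    using C C' by (simp add: D_def)
  \<comment> \<open>A resolvent identity: the increment is \<open>Q (l + 1)\<close> after the
    increment of the characteristic operator after \<open>Q l\<close>. The outer factor gives one
    power of \<open>1 / cmod l\<close>; the other comes from the norm bound and the graph bound for
    \<open>Q l\<close>.\<close>
  have est: "cmod (laplace \<phi> (Complex a y) v - laplace \<phi> (Complex a y + 1) v) \<le> D * norm v * inverse (1 + y\<^sup>2)"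
    if \<phi>: "norm \<phi> \<le> 1" for \<phi> v y
  proof -
    define l where "l = Complex a y"
    have l: "Re l \<ge> a" "Re (l + 1) \<ge> a"
      by (simp_all add: l_def)
    note bl = big[OF l(1)] and bl1 = big[OF l(2)]
    define x where "x = Q l *\<^sub>V v"
    define d where "d = char_op A Ghat Nhat l x - char_op A Ghat Nhat (l + 1) x"
    have x: "x \<in> DA" "char_op A Ghat Nhat l x = v"
      using Q[of l v] bl by (auto simp: x_def)
    have "norm d \<le> C' * (norm x + graph_norm A x / cmod l)"
      unfolding d_def using l a0 bl x by (intro diff) auto
    also have "\<dots> \<le> C' * (C / cmod l * norm v + C * norm v / cmod l)"
      unfolding x_def using bl C' Q_norm[of l v] Q_graph[of l v]
      by (intro mult_left_mono add_mono divide_right_mono) auto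
    finally have d: "norm d \<le> 2 * C * C' * norm v / cmod l"
      by (simp add: field_simps)
    have "laplace \<phi> (l + 1) v = laplace \<phi> (l + 1) (char_op A Ghat Nhat (l + 1) x + d)"
      by (simp add: d_def x)
    also have "\<dots> = \<phi> *\<^sub>V x + laplace \<phi> (l + 1) d"
      using l a identity[OF x(1), of "l + 1" \<phi>] by (simp add: laplace_add)
    also have "\<dots> = laplace \<phi> l v + \<phi> *\<^sub>V Q (l + 1) *\<^sub>V d"
      using l by (simp add: laplace_Q x_def)
    finally have "cmod (laplace \<phi> l v - laplace \<phi> (l + 1) v) = cmod (\<phi> *\<^sub>V Q (l + 1) *\<^sub>V d)"
      by (simp add: norm_minus_commute)
    also have "\<dots> \<le> 1 * norm (Q (l + 1) *\<^sub>V d)"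
      by (rule norm_cblinfun_le[OF \<phi>])
    also have "\<dots> \<le> C / cmod (l + 1) * norm d"
      using Q_norm[of "l + 1" d] bl1 by simp
    also have "\<dots> \<le> C / cmod l * (2 * C * C' * norm v / cmod l)"
    proof (rule mult_mono)
      have "(cmod l)\<^sup>2 \<le> (cmod (l + 1))\<^sup>2"
        using l(1) a0 unfolding cmod_power2 by (simp add: power2_eq_square algebra_simps)
      then have "cmod l \<le> cmod (l + 1)"
        by (rule power2_le_imp_le) simp
      then show "C / cmod (l + 1) \<le> C / cmod l"
        using C bl bl1 by (intro divide_left_mono) auto
    qed (use d C bl in auto)
    also have "\<dots> = D * norm v * inverse ((cmod l)\<^sup>2)"
      by (simp add: D_def power2_eq_square divide_inverse)
    also have "\<dots> \<le> D * norm v * inverse (1 + y\<^sup>2)"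
    proof (intro mult_left_mono le_imp_inverse_le)
      have "1 * 1 \<le> a * a"
        using a r by (intro mult_mono) auto
      then show "1 + y\<^sup>2 \<le> (cmod l)\<^sup>2"
        unfolding cmod_power2 by (simp add: l_def power2_eq_square)
      show "0 < 1 + y\<^sup>2"
        using zero_le_power2[of y] by linarith
    qed (use D0 in simp)
    finally show ?thesis
      by (simp add: l_def)
  qed
  have cont: "continuous_on {0<..} R"
    by (rule norm_continuous[OF a(1) D0 est])
  have "compact_operator (R t)" if t: "t > 0" for t
  proof (rule compact_operator_by_laplace[OF cont a(1)])
    fix k :: nat
    have l: "Re (complex_of_real (a + real k)) \<ge> a"
      by simp
    obtain S where S: "Q (complex_of_real (a + real k)) = resolvent DA A (complex_of_real (a + real k)) o\<^sub>C\<^sub>L S"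
      using Q_comp big[OF l] by blast
    have "compact_operator (resolvent DA A (complex_of_real (a + real k)))"
      using comp compact_resolvent_all sec big[OF l] by blast
    then show "compact_operator (Q (complex_of_real (a + real k)))"
      unfolding S by (rule compact_operator_compose_right)
    show "\<phi> *\<^sub>V Q (complex_of_real (a + real k)) *\<^sub>V v = laplace \<phi> (complex_of_real (a + real k)) v" for \<phi> v
      by (rule laplace_Q[OF l, symmetric])
  qed (rule t)
  then show thesis
    using that exp_bounded_family_axioms cont by blast
qed

section \<open>Convolution with a compact family\<close>

text \<open>One representative per code value gives a finite net.\<close>

lemma finite_cover_by_code:
  fixes F :: "'a::metric_space set" and c :: "'a \<Rightarrow> 'b"
  assumes c: "finite (c ` F)" and code: "\<And>f g. f \<in> F \<Longrightarrow> g \<in> F \<Longrightarrow> c f = c g \<Longrightarrow> dist f g < e"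
  shows "\<exists>k. finite k \<and> F \<subseteq> (\<Union>x\<in>k. ball x e)"
proof -
  have "F \<subseteq> (\<Union>x\<in>inv_into F c ` c ` F. ball x e)"
  proof
    fix f assume f: "f \<in> F"
    then have "inv_into F c (c f) \<in> F" "c (inv_into F c (c f)) = c f"
      by (auto intro: inv_into_into f_inv_into_f)
    then have "f \<in> ball (inv_into F c (c f)) e"
      using code f by simp
    then show "f \<in> (\<Union>x\<in>inv_into F c ` c ` F. ball x e)"
      using f by blast
  qed
  then show ?thesis
    using c by blast
qed

lemma norm_integral_le_AE:
  fixes f :: "'a \<Rightarrow> 'b::{banach, second_countable_topology}"
  assumes "integrable N f" "integrable N g" "AE x in N. norm (f x) \<le> g x"
  shows "norm (integral\<^sup>L N f) \<le> integral\<^sup>L N g"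
  by (rule order_trans[OF integral_norm_bound integral_mono_AE[OF integrable_norm[OF assms(1)] assms(2,3)]])

section \<open>Paths on a compact interval and the Arzela-Ascoli theorem\<close>

definition clamp_time :: "real \<Rightarrow> real \<Rightarrow> real"
  where "clamp_time T t = max 0 (min t T)"

lemma clamp_time_in: "T \<ge> 0 \<Longrightarrow> clamp_time T t \<in> {0..T}"
  by (auto simp: clamp_time_def)

lemma clamp_time_id: "t \<in> {0..T} \<Longrightarrow> clamp_time T t = t"
  by (auto simp: clamp_time_def)

lemma continuous_on_clamp_time: "continuous_on S (clamp_time T)"
  unfolding clamp_time_def by (intro continuous_intros)

text \<open>Constant continuation beyond both ends embeds the continuous paths on
  \<open>{0..T}\<close> isometrically into bounded continuous functions on the line, a normed space
  to which Schauder's theorem applies.\<close>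

definition clamped :: "real \<Rightarrow> (real \<Rightarrow> 'a::real_normed_vector) \<Rightarrow> (real \<Rightarrow>\<^sub>C 'a)"
  where "clamped T h = Bcontfun (\<lambda>t. h (clamp_time T t))"

lemma apply_clamped:
  assumes T: "T \<ge> 0" and h: "continuous_on {0..T} h"
  shows "apply_bcontfun (clamped T h) t = h (clamp_time T t)"
proof -
  have "compact (h ` {0..T})"
    by (rule compact_continuous_image[OF h]) simp
  then have "bounded (range (\<lambda>t. h (clamp_time T t)))"
    using clamp_time_in[OF T] by (intro bounded_subset[OF compact_imp_bounded]) auto
  moreover have "continuous_on UNIV (\<lambda>t. h (clamp_time T t))"
    by (rule continuous_on_compose2[OF h continuous_on_clamp_time]) (use clamp_time_in[OF T] in auto)
  ultimately have "(\<lambda>t. h (clamp_time T t)) \<in> bcontfun"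
    by (simp add: bcontfun_def)
  then show ?thesis
    by (simp add: clamped_def Bcontfun_inverse)
qed

lemma dist_clamped_le:
  assumes T: "T \<ge> 0" and h: "continuous_on {0..T} h" "continuous_on {0..T} k"
    and le: "\<And>t. t \<in> {0..T} \<Longrightarrow> dist (h t) (k t) \<le> e"
  shows "dist (clamped T h) (clamped T k) \<le> e"
proof (rule dist_bound)
  fix t
  show "dist (apply_bcontfun (clamped T h) t) (apply_bcontfun (clamped T k) t) \<le> e"
    unfolding apply_clamped[OF T h(1)] apply_clamped[OF T h(2)] by (rule le[OF clamp_time_in[OF T]])
qed

text \<open>Pointwise total boundedness replaces boundedness, as the values lie in an
  infinite-dimensional space. A path is coded by net points near its values at finitely many
  times.\<close>

lemma arzela_ascoli_clamped:
  fixes F :: "(real \<Rightarrow> 'a::real_normed_vector) set"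
  assumes T: "T \<ge> 0" and cont: "\<And>f. f \<in> F \<Longrightarrow> continuous_on {0..T} f"
    and equi: "\<And>e. e > 0 \<Longrightarrow> \<exists>d>0. \<forall>f\<in>F. \<forall>s\<in>{0..T}. \<forall>t\<in>{0..T}. \<bar>s - t\<bar> < d \<longrightarrow> dist (f s) (f t) < e"
    and pt: "\<And>t. t \<in> {0..T} \<Longrightarrow> tot_bounded ((\<lambda>f. f t) ` F)"
  shows "tot_bounded (clamped T ` F)"
  unfolding tot_bounded_def
proof (intro allI impI)
  fix e :: real assume e: "e > 0"
  \<comment> \<open>Equal codes cost two steps in time and two steps to a common net point; the
    fifth share keeps the inequality strict after passing to the supremum.\<close>
  then have e5: "e / 5 > 0" by simp
  obtain d where d: "d > 0" and near: "\<And>f s t. f \<in> F \<Longrightarrow> s \<in> {0..T} \<Longrightarrow> t \<in> {0..T} \<Longrightarrow> \<bar>s - t\<bar> < d \<Longrightarrow> dist (f s) (f t) < e / 5"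
    using equi[OF e5] by blast
  obtain P where P: "finite P" "P \<subseteq> {0..T}" "{0..T} \<subseteq> (\<Union>p\<in>P. ball p d)"
    using seq_compact_imp_totally_bounded[of "{0..T}"] d compact_imp_seq_compact[OF compact_Icc] by metis
  have "\<exists>k. finite k \<and> (\<lambda>f. f p) ` F \<subseteq> (\<Union>x\<in>k. ball x (e / 5))" if "p \<in> P" for p
    using pt[of p] that P(2) e5 unfolding tot_bounded_def by blast
  then obtain k where k: "\<And>p. p \<in> P \<Longrightarrow> finite (k p)" "\<And>p. p \<in> P \<Longrightarrow> (\<lambda>f. f p) ` F \<subseteq> (\<Union>x\<in>k p. ball x (e / 5))"
    by metis
  have "\<exists>x\<in>k p. dist x (f p) < e / 5" if "p \<in> P" "f \<in> F" for p f
    using subsetD[OF k(2)[OF that(1)] imageI[OF that(2)]] by auto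
  then obtain x where x: "\<And>p f. p \<in> P \<Longrightarrow> f \<in> F \<Longrightarrow> x p f \<in> k p" "\<And>p f. p \<in> P \<Longrightarrow> f \<in> F \<Longrightarrow> dist (x p f) (f p) < e / 5"
    by metis
  define code where "code f = restrict (\<lambda>p. x p f) P" for f
  have fin: "finite (code ` F)"
    by (rule finite_subset[OF _ finite_PiE[OF P(1) k(1)]]) (auto simp: code_def x)
  \<comment> \<open>Different members of \<open>F\<close> may have the same clamped path, since they
    may differ outside \<open>{0..T}\<close>; hence a choice of one.\<close>
  define pick where "pick u = (SOME f. f \<in> F \<and> clamped T f = u)" for u
  have pick: "pick u \<in> F \<and> clamped T (pick u) = u" if "u \<in> clamped T ` F" for u
    using someI_ex[of "\<lambda>f. f \<in> F \<and> clamped T f = u"] that by (auto simp: pick_def)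
  show "\<exists>k. finite k \<and> clamped T ` F \<subseteq> (\<Union>x\<in>k. ball x e)"
  proof (rule finite_cover_by_code)
    have "(\<lambda>u. code (pick u)) ` clamped T ` F \<subseteq> code ` F"
      using pick by blast
    then show "finite ((\<lambda>u. code (pick u)) ` clamped T ` F)"
      using fin by (rule finite_subset)
  next
    fix u v assume uv: "u \<in> clamped T ` F" "v \<in> clamped T ` F" and eq: "code (pick u) = code (pick v)"
    define f g where "f = pick u" and "g = pick v"
    have fg: "f \<in> F" "g \<in> F" "u = clamped T f" "v = clamped T g"
      using pick uv by (auto simp: f_def g_def)
    have "dist (f t) (g t) \<le> 4 * (e / 5)" if t: "t \<in> {0..T}" for t
    proof -
      obtain p where p: "p \<in> P" "\<bar>p - t\<bar> < d"
        using P(3) t by (auto simp: dist_real_def)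
      have pT: "p \<in> {0..T}"
        using p P by blast
      have "x p f = x p g"
      proof -
        have "code f p = code g p"
          using eq by (simp add: f_def g_def)
        then show ?thesis
          using p(1) by (simp add: code_def)
      qed
      then have "dist (f p) (g p) < 2 * (e / 5)"
        using x(2)[OF p(1) fg(1)] x(2)[OF p(1) fg(2)] dist_triangle[of "f p" "g p" "x p f"] by (simp add: dist_commute)
      moreover have "dist (f p) (f t) < e / 5" "dist (g p) (g t) < e / 5"
        using near fg p pT t by auto
      ultimately show ?thesis
        using dist_triangle[of "f t" "g t" "f p"] dist_triangle[of "f p" "g t" "g p"] by (simp add: dist_commute)
    qed
    then have "dist u v \<le> 4 * (e / 5)"
      unfolding fg by (intro dist_clamped_le[OF T] cont fg)
    then show "dist u v < e"
      using e by simp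
  qed
qed

text \<open>Uniform continuity of the primitive of \<open>\<gamma>\<close> on a compact interval
  makes the length independent of the position.\<close>

lemma integral_short_interval:
  fixes \<gamma> :: "real \<Rightarrow> real"
  assumes int: "set_integrable lebesgue {0..T} \<gamma>" and e: "e > 0" and T: "T \<ge> 0"
  obtains d where "d > 0" "\<And>t. t \<in> {0..T} \<Longrightarrow> (LINT s:{max 0 (t - d)..t}|lebesgue. \<gamma> s) < e"
proof -
  define \<Gamma> where "\<Gamma> t = integral {0..t} \<gamma>" for t
  have i: "\<gamma> integrable_on {0..T}"
    using set_lebesgue_integral_eq_integral(1)[OF int] .
  have "continuous_on {0..T} \<Gamma>"
    unfolding \<Gamma>_def by (rule indefinite_integral_continuous_1[OF i])
  then have "uniformly_continuous_on {0..T} \<Gamma>"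
    by (rule compact_uniformly_continuous) simp
  then obtain d where d: "d > 0" and close: "\<And>s t. s \<in> {0..T} \<Longrightarrow> t \<in> {0..T} \<Longrightarrow> dist s t < d \<Longrightarrow> dist (\<Gamma> s) (\<Gamma> t) < e"
    using e unfolding uniformly_continuous_on_def by metis
  show thesis
  proof (rule that[of "d / 2"])
    fix t assume t: "t \<in> {0..T}"
    define a where "a = max 0 (t - d / 2)"
    have a: "0 \<le> a" "a \<le> t" "dist t a < d"
      using t d by (auto simp: a_def dist_real_def)
    have "set_integrable lebesgue {a..t} \<gamma>"
      by (rule set_integrable_subset[OF int]) (use a t in auto)
    then have "(LINT s:{a..t}|lebesgue. \<gamma> s) = integral {a..t} \<gamma>"
      by (rule set_lebesgue_integral_eq_integral(2))
    also have "\<dots> = \<Gamma> t - \<Gamma> a"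
      using Henstock_Kurzweil_Integration.integral_combine[of 0 a t \<gamma>] a integrable_subinterval_real[OF i, of 0 t] t
      by (simp add: \<Gamma>_def)
    also have "\<dots> < e"
      using close[of t a] a t by (simp add: dist_real_def)
    finally show "(LINT s:{max 0 (t - d / 2)..t}|lebesgue. \<gamma> s) < e"
      by (simp add: a_def)
  qed (use d in simp)
qed

locale compact_family = exp_bounded_family R M \<omega>
  for R :: "real \<Rightarrow> 'w::{complex_banach, second_countable_topology} \<Rightarrow>\<^sub>C\<^sub>L 'w" and M \<omega> :: real +
  assumes norm_cont: "continuous_on {0<..} R"
    and compact: "\<And>t. t > 0 \<Longrightarrow> compact_operator (R t)"
begin

definition mild_conv :: "(real \<Rightarrow> 'w) \<Rightarrow> real \<Rightarrow> 'w"
  where "mild_conv g t = (LINT s:{0..t}|lebesgue. R (t - s) *\<^sub>V g s)"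

text \<open>A norm continuous truncation of \<open>R\<close>, which removes the possible discontinuity at \<open>0\<close>.\<close>

definition cut :: "real \<Rightarrow> real \<Rightarrow> 'w \<Rightarrow>\<^sub>C\<^sub>L 'w"
  where "cut d t = min 1 (max 0 (t / d - 1)) *\<^sub>R R (max d t)"

text \<open>The truncated family vanishes for arguments up to \<open>d\<close>, negative ones
  included, so integration may run over all of \<open>{0..T}\<close>: \<open>t\<close> then occurs
  in the integrand only.\<close>

definition cut_conv :: "real \<Rightarrow> real \<Rightarrow> (real \<Rightarrow> 'w) \<Rightarrow> real \<Rightarrow> 'w"
  where "cut_conv T d g t = (LINT s:{0..T}|lebesgue. cut d (t - s) *\<^sub>V g s)"

lemma continuous_cut: "d > 0 \<Longrightarrow> continuous_on S (cut d)"
  unfolding cut_def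
  by (intro continuous_intros continuous_on_compose2[OF norm_cont]) auto

lemma compact_cut: "d > 0 \<Longrightarrow> compact_operator (cut d t)"
  unfolding cut_def by (intro compact_operator_scaleR compact) simp

lemma cut_bounded:
  assumes d: "d > 0"
  obtains B where "B \<ge> 0" "\<And>t. t \<in> {- T..T} \<Longrightarrow> norm (cut d t) \<le> B"
proof -
  have "compact (cut d ` {- T..T})"
    by (rule compact_continuous_image[OF continuous_cut[OF d]]) simp
  then have "\<exists>B. \<forall>x\<in>cut d ` {- T..T}. norm x \<le> B"
    unfolding bounded_iff[symmetric] by (rule compact_imp_bounded)
  then obtain B where B: "\<forall>x\<in>cut d ` {- T..T}. norm x \<le> B"
    by (elim exE)
  show thesis
  proof (rule that[of "max B 0"])
    fix t assume "t \<in> {- T..T}"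
    then have "norm (cut d t) \<le> B"
      using B by (intro bspec[OF B] imageI)
    then show "norm (cut d t) \<le> max B 0"
      by simp
  qed simp
qed

lemma cut_measurable:
  assumes d: "d > 0" and g: "set_integrable lebesgue {0..T} g"
  shows "(\<lambda>s. indicator {0..T} s *\<^sub>R (cut d (t - s) *\<^sub>V g s)) \<in> borel_measurable lebesgue"
proof -
  have gm: "(\<lambda>s. indicator {0..T} s *\<^sub>R g s) \<in> borel_measurable lebesgue"
    using g unfolding set_integrable_def by (rule borel_measurable_integrable)
  have "(\<lambda>s. R (max 0 (max d (t - s))) *\<^sub>V (indicator {0..T} s *\<^sub>R g s)) \<in> borel_measurable lebesgue"
    by (rule measurable_family_apply[OF _ gm]) (intro measurable_completion, simp)
  moreover have "(\<lambda>s. min 1 (max 0 ((t - s) / d - 1))) \<in> borel_measurable lebesgue"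
    by (intro measurable_completion) simp
  ultimately have "(\<lambda>s. min 1 (max 0 ((t - s) / d - 1)) *\<^sub>R (R (max 0 (max d (t - s))) *\<^sub>V (indicator {0..T} s *\<^sub>R g s))) \<in> borel_measurable lebesgue"
    by (intro borel_measurable_scaleR)
  moreover have "min 1 (max 0 ((t - s) / d - 1)) *\<^sub>R (R (max 0 (max d (t - s))) *\<^sub>V (indicator {0..T} s *\<^sub>R g s)) = indicator {0..T} s *\<^sub>R (cut d (t - s) *\<^sub>V g s)" for s
  proof -
    have "max 0 (max d (t - s)) = max d (t - s)"
      using d by auto
    then show ?thesis
      by (simp add: cut_def cblinfun_scaleR_apply cblinfun_linear_simps mult.commute)
  qed
  ultimately show ?thesis by simp
qed

lemma cut_integrable:
  assumes d: "d > 0" and g: "set_integrable lebesgue {0..T} g" and t: "t \<in> {0..T}"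
  shows "set_integrable lebesgue {0..T} (\<lambda>s. cut d (t - s) *\<^sub>V g s)"
proof -
  obtain B where B: "B \<ge> 0" "\<And>t. t \<in> {- T..T} \<Longrightarrow> norm (cut d t) \<le> B"
    using cut_bounded[OF d] by blast
  show ?thesis
    unfolding set_integrable_def
  proof (rule Bochner_Integration.integrable_bound)
    show "integrable lebesgue (\<lambda>s. B * norm (indicator {0..T} s *\<^sub>R g s))"
      using g unfolding set_integrable_def by (intro integrable_mult_right integrable_norm)
    show "AE s in lebesgue. norm (indicator {0..T} s *\<^sub>R (cut d (t - s) *\<^sub>V g s)) \<le> norm (B * norm (indicator {0..T} s *\<^sub>R g s))"
      using norm_cblinfun_le[OF B(2)] t B(1) by (intro AE_I2) (auto simp: indicator_def)
  qed (rule cut_measurable[OF d g])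
qed

text \<open>The truncation agrees with \<open>R\<close> at arguments beyond \<open>2 * d\<close> and
  is a fraction of it before, so the error is collected over the last stretch of length
  \<open>2 * d\<close> only.\<close>

lemma cut_error:
  assumes d: "d > 0" and g: "set_integrable lebesgue {0..T} g" and \<gamma>: "set_integrable lebesgue {0..T} \<gamma>"
    and le: "AE s in lebesgue. s \<in> {0..T} \<longrightarrow> norm (g s) \<le> \<gamma> s" and t: "t \<in> {0..T}"
  shows "norm (mild_conv g t - cut_conv T d g t) \<le> M * exp (\<omega> * T) * (LINT s:{max 0 (t - 2 * d)..t}|lebesgue. \<gamma> s)"
proof -
  define M' where "M' = M * exp (\<omega> * T)"
  have M': "M' \<ge> 0"
    using M_nonneg by (simp add: M'_def)
  have gt: "set_integrable lebesgue {0..t} g"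
    by (rule set_integrable_subset[OF g]) (use t in auto)
  have i1: "integrable lebesgue (\<lambda>s. indicator {0..t} s *\<^sub>R (R (t - s) *\<^sub>V g s))"
    using conv_integrable[OF gt] by (simp add: set_integrable_def)
  have i2: "integrable lebesgue (\<lambda>s. indicator {0..T} s *\<^sub>R (cut d (t - s) *\<^sub>V g s))"
    using cut_integrable[OF d g t] by (simp add: set_integrable_def)
  have i3: "integrable lebesgue (\<lambda>s. M' * (indicator {max 0 (t - 2 * d)..t} s *\<^sub>R \<gamma> s))"
  proof (rule integrable_mult_right)
    have "set_integrable lebesgue {max 0 (t - 2 * d)..t} \<gamma>"
      by (rule set_integrable_subset[OF \<gamma>]) (use t in auto)
    then show "integrable lebesgue (\<lambda>s. indicator {max 0 (t - 2 * d)..t} s *\<^sub>R \<gamma> s)"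
      by (simp add: set_integrable_def)
  qed
  have "norm (mild_conv g t - cut_conv T d g t) = norm (LINT s|lebesgue. indicator {0..t} s *\<^sub>R (R (t - s) *\<^sub>V g s) - indicator {0..T} s *\<^sub>R (cut d (t - s) *\<^sub>V g s))"
    unfolding mild_conv_def cut_conv_def set_lebesgue_integral_def using i1 i2 by simp
  also have "\<dots> \<le> (LINT s|lebesgue. M' * (indicator {max 0 (t - 2 * d)..t} s *\<^sub>R \<gamma> s))"
  proof (rule norm_integral_le_AE[OF Bochner_Integration.integrable_diff[OF i1 i2] i3])
    show "AE s in lebesgue. norm (indicator {0..t} s *\<^sub>R (R (t - s) *\<^sub>V g s) - indicator {0..T} s *\<^sub>R (cut d (t - s) *\<^sub>V g s))
        \<le> M' * (indicator {max 0 (t - 2 * d)..t} s *\<^sub>R \<gamma> s)"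
      using le
    proof eventually_elim
      case (elim s)
      show ?case
      proof (cases "s \<in> {0..t}")
        case False
        then have "cut d (t - s) = 0 \<or> s \<notin> {0..T}"
        proof (cases "s > t")
          case True
          then have "(t - s) / d < 0"
            using d by (simp add: divide_neg_pos)
          then show ?thesis
            by (simp add: cut_def)
        qed (use False in auto)
        then show ?thesis
          using False by (auto simp: indicator_def cblinfun_zero_apply)
      next
        case s: True
        have sT: "s \<in> {0..T}"
          using s t by auto
        define \<theta> where "\<theta> = min 1 (max 0 ((t - s) / d - 1))"
        have \<theta>: "0 \<le> \<theta>" "\<theta> \<le> 1"
          by (auto simp: \<theta>_def)
        have cut: "cut d (t - s) = \<theta> *\<^sub>R R (t - s)"
        proof (cases "t - s \<ge> d")
          case False
          then have "(t - s) / d \<le> 1"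
            using d by simp
          then show ?thesis
            by (simp add: cut_def \<theta>_def)
        qed (simp add: cut_def \<theta>_def max_absorb2)
        have "norm (R (t - s) *\<^sub>V g s) \<le> M * exp (\<omega> * t) * norm (g s)"
          by (rule conv_norm_le[OF s])
        also have "\<dots> \<le> M' * norm (g s)"
          unfolding M'_def using t \<omega>_pos M_nonneg by (intro mult_right_mono mult_left_mono) auto
        also have "\<dots> \<le> M' * \<gamma> s"
          using elim sT M' by (intro mult_left_mono) auto
        finally have b: "norm (R (t - s) *\<^sub>V g s) \<le> M' * \<gamma> s" .
        have "indicator {0..t} s *\<^sub>R (R (t - s) *\<^sub>V g s) - indicator {0..T} s *\<^sub>R (cut d (t - s) *\<^sub>V g s) = (1 - \<theta>) *\<^sub>R (R (t - s) *\<^sub>V g s)"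
          using s sT by (simp add: cut cblinfun_scaleR_apply scaleR_diff_left)
        also have "norm \<dots> = (1 - \<theta>) * norm (R (t - s) *\<^sub>V g s)"
          using \<theta> by simp
        also have "\<dots> \<le> M' * (indicator {max 0 (t - 2 * d)..t} s *\<^sub>R \<gamma> s)"
        proof (cases "s \<ge> t - 2 * d")
          case True
          have "(1 - \<theta>) * norm (R (t - s) *\<^sub>V g s) \<le> 1 * norm (R (t - s) *\<^sub>V g s)"
            using \<theta> by (intro mult_right_mono) auto
          then show ?thesis
            using True s b by simp
        next
          case False
          then have "2 \<le> (t - s) / d"
            using d by (simp add: le_divide_eq)
          then have "\<theta> = 1"
            by (simp add: \<theta>_def)
          moreover have "s \<notin> {max 0 (t - 2 * d)..t}"
            using False by simp
          ultimately show ?thesis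
            by simp
        qed
        finally show ?thesis .
      qed
    qed
  qed
  also have "\<dots> = M' * (LINT s:{max 0 (t - 2 * d)..t}|lebesgue. \<gamma> s)"
    unfolding set_lebesgue_integral_def by (rule integral_mult_right_zero)
  finally show ?thesis
    by (simp add: M'_def)
qed

end

definition dominated :: "real \<Rightarrow> (real \<Rightarrow> real) \<Rightarrow> (real \<Rightarrow> 'a::{banach, second_countable_topology}) set"
  where "dominated T \<gamma> = {g. set_integrable lebesgue {0..T} g \<and> (AE s in lebesgue. s \<in> {0..T} \<longrightarrow> norm (g s) \<le> \<gamma> s)}"

lemma set_integral_dominated_le:
  fixes k :: "real \<Rightarrow> 'b::{banach, second_countable_topology}"
  assumes g: "g \<in> dominated T \<gamma>" and \<gamma>: "set_integrable lebesgue {0..T} \<gamma>"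
    and k: "set_integrable lebesgue {0..T} k" and c: "c \<ge> 0"
    and le: "\<And>s. s \<in> {0..T} \<Longrightarrow> norm (k s) \<le> c * norm (g s)"
  shows "norm (LINT s:{0..T}|lebesgue. k s) \<le> c * (LINT s:{0..T}|lebesgue. \<gamma> s)"
proof -
  have "norm (LINT s:{0..T}|lebesgue. k s) \<le> (LINT s|lebesgue. c * (indicator {0..T} s *\<^sub>R \<gamma> s))"
    unfolding set_lebesgue_integral_def
  proof (rule norm_integral_le_AE)
    show "integrable lebesgue (\<lambda>s. indicator {0..T} s *\<^sub>R k s)"
      using k by (simp add: set_integrable_def)
    show "integrable lebesgue (\<lambda>s. c * (indicator {0..T} s *\<^sub>R \<gamma> s))"
      using \<gamma> unfolding set_integrable_def by (rule integrable_mult_right)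
    have "AE s in lebesgue. s \<in> {0..T} \<longrightarrow> norm (g s) \<le> \<gamma> s"
      using g by (simp add: dominated_def)
    then show "AE s in lebesgue. norm (indicator {0..T} s *\<^sub>R k s) \<le> c * (indicator {0..T} s *\<^sub>R \<gamma> s)"
    proof eventually_elim
      case (elim s)
      show ?case
      proof (cases "s \<in> {0..T}")
        case True
        then have "c * norm (g s) \<le> c * \<gamma> s"
          using elim c by (intro mult_left_mono) auto
        then show ?thesis
          using True le[OF True] by simp
      qed simp
    qed
  qed
  then show ?thesis
    by (simp add: set_lebesgue_integral_def)
qed

context compact_family
begin

lemma cut_approximates:
  assumes \<gamma>: "set_integrable lebesgue {0..T} \<gamma>" and T: "T \<ge> 0" and e: "e > 0"
  obtains d where "d > 0" "\<And>g t. g \<in> dominated T \<gamma> \<Longrightarrow> t \<in> {0..T} \<Longrightarrow> dist (mild_conv g t) (cut_conv T d g t) < e"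
proof -
  define M' where "M' = M * exp (\<omega> * T) + 1"
  have M': "M' > 0"
    using M_nonneg by (simp add: M'_def add_nonneg_pos)
  obtain d where d: "d > 0" and short: "\<And>t. t \<in> {0..T} \<Longrightarrow> (LINT s:{max 0 (t - d)..t}|lebesgue. \<gamma> s) < e / M'"
    using integral_short_interval[OF \<gamma> _ T, of "e / M'"] e M' by (metis divide_pos_pos)
  show thesis
  proof (rule that[of "d / 2"])
    fix g :: "real \<Rightarrow> 'w" and t assume g: "g \<in> dominated T \<gamma>" and t: "t \<in> {0..T}"
    define I where "I = (LINT s:{max 0 (t - d)..t}|lebesgue. \<gamma> s)"
    have le: "norm (mild_conv g t - cut_conv T (d / 2) g t) \<le> M * exp (\<omega> * T) * I"
      using cut_error[of "d / 2" T g \<gamma> t] d g \<gamma> t by (simp add: dominated_def I_def)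
    \<comment> \<open>The sign of \<open>I\<close> is not known here; for a negative
      \<open>I\<close> the bound is trivial.\<close>
    also have "\<dots> < e"
    proof (cases "I \<ge> 0")
      case True
      have "M * exp (\<omega> * T) * I \<le> M' * I"
        using True by (intro mult_right_mono) (simp_all add: M'_def)
      also have "\<dots> < e"
        using short[OF t] M' by (simp add: I_def less_divide_eq mult.commute)
      finally show ?thesis .
    next
      case False
      then have "M * exp (\<omega> * T) * I \<le> 0"
        using M_nonneg by (simp add: mult_nonneg_nonpos)
      then show ?thesis using e by linarith
    qed
    finally show "dist (mild_conv g t) (cut_conv T (d / 2) g t) < e"
      by (simp add: dist_norm)
  qed (use d in simp)
qed

text \<open>The truncated family is uniformly norm continuous on \<open>{- T..T}\<close>, which
  gives equicontinuity of the truncated convolutions; uniform approximation carries it over.\<close>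

lemma mild_conv_equicontinuous:
  assumes \<gamma>: "set_integrable lebesgue {0..T} \<gamma>" and T: "T \<ge> 0" and e: "e > 0"
  shows "\<exists>d>0. \<forall>g\<in>dominated T \<gamma>. \<forall>s\<in>{0..T}. \<forall>t\<in>{0..T}. \<bar>s - t\<bar> < d \<longrightarrow> dist (mild_conv g s) (mild_conv g t) < e"
proof -
  obtain \<delta> where \<delta>: "\<delta> > 0" and approx: "\<And>g t. g \<in> dominated T \<gamma> \<Longrightarrow> t \<in> {0..T} \<Longrightarrow> dist (mild_conv g t) (cut_conv T \<delta> g t) < e / 3"
    using cut_approximates[OF \<gamma> T, of "e / 3"] e by (metis divide_pos_pos zero_less_numeral)
  define C where "C = (LINT s:{0..T}|lebesgue. \<gamma> s)"
  define \<eta> where "\<eta> = e / (3 * (\<bar>C\<bar> + 1))"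
  have \<eta>: "\<eta> > 0"
    using e by (simp add: \<eta>_def add_nonneg_pos)
  have "uniformly_continuous_on {- T..T} (cut \<delta>)"
    by (rule compact_uniformly_continuous[OF continuous_cut[OF \<delta>]]) simp
  then obtain d where d: "d > 0" and uc: "\<And>s t. s \<in> {- T..T} \<Longrightarrow> t \<in> {- T..T} \<Longrightarrow> dist s t < d \<Longrightarrow> dist (cut \<delta> s) (cut \<delta> t) < \<eta>"
    using \<eta> unfolding uniformly_continuous_on_def by metis
  have "dist (mild_conv g s) (mild_conv g t) < e"
    if g: "g \<in> dominated T \<gamma>" and s: "s \<in> {0..T}" and t: "t \<in> {0..T}" and st: "\<bar>s - t\<bar> < d" for g s t
  proof -
    have gi: "set_integrable lebesgue {0..T} g"
      using g by (simp add: dominated_def)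
    note i = cut_integrable[OF \<delta> gi s] cut_integrable[OF \<delta> gi t]
    have "cut_conv T \<delta> g s - cut_conv T \<delta> g t = (LINT u:{0..T}|lebesgue. cut \<delta> (s - u) *\<^sub>V g u - cut \<delta> (t - u) *\<^sub>V g u)"
      unfolding cut_conv_def by (rule set_integral_diff(2)[OF i, symmetric])
    also have "norm \<dots> \<le> \<eta> * C"
      unfolding C_def
    proof (rule set_integral_dominated_le[OF g \<gamma> set_integral_diff(1)[OF i]])
      fix u assume u: "u \<in> {0..T}"
      have "dist (s - u) (t - u) < d"
        using st by (simp add: dist_real_def)
      then have "norm (cut \<delta> (s - u) - cut \<delta> (t - u)) \<le> \<eta>"
        using uc[of "s - u" "t - u"] s t u by (simp add: dist_norm)
      then show "norm (cut \<delta> (s - u) *\<^sub>V g u - cut \<delta> (t - u) *\<^sub>V g u) \<le> \<eta> * norm (g u)"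
        unfolding cblinfun_minus_apply[symmetric] by (rule norm_cblinfun_le)
    qed (use \<eta> in simp)
    also have "\<dots> \<le> e / 3"
    proof -
      have "\<eta> * C \<le> \<eta> * (\<bar>C\<bar> + 1)"
        using \<eta> by (intro mult_left_mono) auto
      also have "\<dots> = e / 3"
      proof -
        define K where "K = \<bar>C\<bar> + 1"
        have "K \<noteq> 0"
          unfolding K_def by linarith
        then show ?thesis
          by (simp add: \<eta>_def K_def[symmetric])
      qed
      finally show ?thesis .
    qed
    finally have "dist (cut_conv T \<delta> g s) (cut_conv T \<delta> g t) \<le> e / 3"
      by (simp add: dist_norm)
    then show ?thesis
      using approx[OF g s] approx[OF g t] dist_triangle[of "mild_conv g s" "mild_conv g t" "cut_conv T \<delta> g s"]
        dist_triangle[of "cut_conv T \<delta> g s" "mild_conv g t" "cut_conv T \<delta> g t"]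
        dist_commute[of "cut_conv T \<delta> g t" "mild_conv g t"] by linarith
  qed
  then show ?thesis
    using d by blast
qed

lemma mild_conv_continuous:
  assumes T: "T \<ge> 0" and g: "set_integrable lebesgue {0..T} g"
  shows "continuous_on {0..T} (mild_conv g)"
proof -
  have "g \<in> dominated T (\<lambda>s. norm (g s))"
    using g by (simp add: dominated_def)
  moreover have "set_integrable lebesgue {0..T} (\<lambda>s. norm (g s))"
    using g by (rule set_integrable_norm)
  ultimately show ?thesis
    unfolding continuous_on_iff
    using mild_conv_equicontinuous[OF _ T, of "\<lambda>s. norm (g s)"] by (metis dist_commute dist_real_def)
qed

text \<open>The operators \<open>cut d u\<close> for \<open>u\<close> in \<open>{- T..T}\<close>
  form a compact arc. A partition of unity on it replaces the integral by a finite sum of compact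
  operators, each applied to a vector of norm at most the integral of
  \<open>\<gamma>\<close>.\<close>

lemma cut_conv_tot_bounded:
  assumes \<gamma>: "set_integrable lebesgue {0..T} \<gamma>" and T: "T \<ge> 0" and d: "d > 0" and t: "t \<in> {0..T}"
  shows "tot_bounded ((\<lambda>g. cut_conv T d g t) ` dominated T \<gamma>)"
proof (rule tot_bounded_approx)
  fix e :: real assume e: "e > 0"
  define C where "C = (LINT s:{0..T}|lebesgue. \<gamma> s)"
  define \<eta> where "\<eta> = e / (2 * (\<bar>C\<bar> + 1))"
  have \<eta>: "\<eta> > 0"
    using e by (simp add: \<eta>_def add_nonneg_pos)
  have K: "compact (cut d ` {- T..T})"
    by (rule compact_continuous_image[OF continuous_cut[OF d]]) simp
  obtain Y \<rho> where Y: "finite Y" "Y \<subseteq> cut d ` {- T..T}"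
    and \<rho>_cont: "\<And>y. continuous_on (cut d ` {- T..T}) (\<rho> y)" and \<rho>0: "\<And>y x. x \<in> cut d ` {- T..T} \<Longrightarrow> \<rho> y x \<ge> (0::real)"
    and \<rho>1: "\<And>x. x \<in> cut d ` {- T..T} \<Longrightarrow> (\<Sum>y\<in>Y. \<rho> y x) = 1" and near: "\<And>y x. \<rho> y x \<noteq> 0 \<Longrightarrow> dist x y < \<eta>"
    by (rule compact_partition_of_unity[OF K \<eta>]) blast
  \<comment> \<open>Share of the centre \<open>y\<close> in the operator acting at time
    \<open>u\<close>.\<close>
  define r where "r y u = \<rho> y (cut d (t - u))" for y u
  have cutK: "cut d (t - u) \<in> cut d ` {- T..T}" if "u \<in> {0..T}" for u
    using that t by auto
  have r_cont: "continuous_on {0..T} (r y)" for y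
    unfolding r_def
    by (rule continuous_on_compose2[OF \<rho>_cont continuous_on_compose2[OF continuous_cut[OF d, of UNIV]]])
      (use cutK in \<open>auto intro!: continuous_intros\<close>)
  have r0: "r y u \<ge> 0" if "u \<in> {0..T}" for y u
    unfolding r_def by (rule \<rho>0[OF cutK[OF that]])
  have r1: "r y u \<le> 1" if "y \<in> Y" "u \<in> {0..T}" for y u
    using member_le_sum[of y Y "\<lambda>y. r y u"] \<rho>1[OF cutK[OF that(2)]] r0[OF that(2)] Y(1) that(1) by (simp add: r_def)
  have r_int: "set_integrable lebesgue {0..T} (\<lambda>u. r y u *\<^sub>R g u)" if y: "y \<in> Y" and g: "set_integrable lebesgue {0..T} g" for y and g :: "real \<Rightarrow> 'w"
    unfolding set_integrable_def
  proof (rule Bochner_Integration.integrable_bound)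
    show "integrable lebesgue (\<lambda>u. indicator {0..T} u *\<^sub>R g u)"
      using g by (simp add: set_integrable_def)
    have "(\<lambda>u. indicator {0..T} u *\<^sub>R r y u) \<in> borel_measurable borel"
      by (rule borel_measurable_continuous_on_indicator[OF _ r_cont]) simp
    then have "(\<lambda>u. indicator {0..T} u *\<^sub>R r y u) \<in> borel_measurable lebesgue"
      by (intro measurable_completion) simp
    then have "(\<lambda>u. (indicator {0..T} u *\<^sub>R r y u) *\<^sub>R (indicator {0..T} u *\<^sub>R g u)) \<in> borel_measurable lebesgue"
      by (rule borel_measurable_scaleR) (use g in \<open>simp add: set_integrable_def borel_measurable_integrable\<close>)
    moreover have "(\<lambda>u. (indicator {0..T} u *\<^sub>R r y u) *\<^sub>R (indicator {0..T} u *\<^sub>R g u)) = (\<lambda>u. indicator {0..T} u *\<^sub>R (r y u *\<^sub>R g u))"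
      by (auto simp: indicator_def)
    ultimately show "(\<lambda>u. indicator {0..T} u *\<^sub>R (r y u *\<^sub>R g u)) \<in> borel_measurable lebesgue"
      by (simp only:)
    show "AE u in lebesgue. norm (indicator {0..T} u *\<^sub>R (r y u *\<^sub>R g u)) \<le> norm (indicator {0..T} u *\<^sub>R g u)"
    proof (rule AE_I2)
      fix u
      show "norm (indicator {0..T} u *\<^sub>R (r y u *\<^sub>R g u)) \<le> norm (indicator {0..T} u *\<^sub>R g u)"
        using r0[of u y] r1[OF y, of u] by (cases "u \<in> {0..T}") (simp_all add: mult_left_le_one_le)
    qed
  qed
  define B where "B = {\<Sum>y\<in>Y. a y | a. \<forall>y\<in>Y. a y \<in> cblinfun_apply y ` cball 0 C}"
  have "tot_bounded B"
    unfolding B_def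
  proof (rule tot_bounded_sum[OF Y(1)])
    fix y assume "y \<in> Y"
    then have "compact_operator y"
      using Y(2) compact_cut[OF d] by auto
    then show "tot_bounded (cblinfun_apply y ` cball 0 C)"
      by (simp add: compact_operator_iff)
  qed
  moreover have "\<exists>b\<in>B. dist (cut_conv T d g t) b < e" if g: "g \<in> dominated T \<gamma>" for g
  proof -
    have gi: "set_integrable lebesgue {0..T} g"
      using g by (simp add: dominated_def)
    define m where "m y = (LINT u:{0..T}|lebesgue. r y u *\<^sub>R g u)" for y
    have m: "norm (m y) \<le> C" if y: "y \<in> Y" for y
    proof -
      have "norm (m y) \<le> 1 * C"
        unfolding m_def C_def
      proof (rule set_integral_dominated_le[OF g \<gamma> r_int[OF y gi]])
        fix u assume "u \<in> {0..T}"
        then show "norm (r y u *\<^sub>R g u) \<le> 1 * norm (g u)"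
          using r0[of u y] r1[OF y, of u] by (simp add: mult_left_le_one_le)
      qed simp
      then show ?thesis by simp
    qed
    have yi: "set_integrable lebesgue {0..T} (\<lambda>u. y *\<^sub>V (r y u *\<^sub>R g u))"
      and ym: "(LINT u:{0..T}|lebesgue. y *\<^sub>V (r y u *\<^sub>R g u)) = y *\<^sub>V m y" if y: "y \<in> Y" for y
    proof -
      have "indicator {0..T} u *\<^sub>R (y *\<^sub>V (r y u *\<^sub>R g u)) = y *\<^sub>V (indicator {0..T} u *\<^sub>R (r y u *\<^sub>R g u))" for u
        by (simp add: cblinfun_linear_simps)
      then show "set_integrable lebesgue {0..T} (\<lambda>u. y *\<^sub>V (r y u *\<^sub>R g u))"
        "(LINT u:{0..T}|lebesgue. y *\<^sub>V (r y u *\<^sub>R g u)) = y *\<^sub>V m y"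
        using r_int[OF y gi] integrable_bounded_linear[OF bounded_linear_cblinfun_apply[of y]]
          integral_bounded_linear[OF bounded_linear_cblinfun_apply[of y]]
        unfolding set_integrable_def set_lebesgue_integral_def m_def by simp_all
    qed
    have si: "set_integrable lebesgue {0..T} (\<lambda>u. \<Sum>y\<in>Y. y *\<^sub>V (r y u *\<^sub>R g u))"
      and sv: "(LINT u:{0..T}|lebesgue. \<Sum>y\<in>Y. y *\<^sub>V (r y u *\<^sub>R g u)) = (\<Sum>y\<in>Y. y *\<^sub>V m y)"
      using yi ym unfolding set_integrable_def set_lebesgue_integral_def scaleR_sum_right
      by (simp_all add: Bochner_Integration.integral_sum)
    note ci = cut_integrable[OF d gi t]
    have "(\<Sum>y\<in>Y. y *\<^sub>V m y) - cut_conv T d g t = (LINT u:{0..T}|lebesgue. (\<Sum>y\<in>Y. y *\<^sub>V (r y u *\<^sub>R g u)) - cut d (t - u) *\<^sub>V g u)"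
      unfolding cut_conv_def sv[symmetric] by (rule set_integral_diff(2)[OF si ci, symmetric])
    also have "norm \<dots> \<le> \<eta> * C"
      unfolding C_def
    proof (rule set_integral_dominated_le[OF g \<gamma> set_integral_diff(1)[OF si ci]])
      fix u assume u: "u \<in> {0..T}"
      have "norm ((\<Sum>y\<in>Y. r y u *\<^sub>R y) - cut d (t - u)) \<le> \<eta>"
        unfolding r_def
      proof (rule norm_convex_combination_diff[OF \<rho>1[OF cutK[OF u]] \<rho>0[OF cutK[OF u]]])
        show "norm (y - cut d (t - u)) \<le> \<eta>" if "\<rho> y (cut d (t - u)) \<noteq> 0" for y
          using near[OF that] by (simp add: dist_norm norm_minus_commute)
      qed
      moreover have "(\<Sum>y\<in>Y. y *\<^sub>V (r y u *\<^sub>R g u)) - cut d (t - u) *\<^sub>V g u = ((\<Sum>y\<in>Y. r y u *\<^sub>R y) - cut d (t - u)) *\<^sub>V g u"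
        by (simp add: cblinfun_minus_apply cblinfun_sum_apply cblinfun_scaleR_apply cblinfun_linear_simps)
      ultimately show "norm ((\<Sum>y\<in>Y. y *\<^sub>V (r y u *\<^sub>R g u)) - cut d (t - u) *\<^sub>V g u) \<le> \<eta> * norm (g u)"
        by (simp add: norm_cblinfun_le)
    qed (use \<eta> in simp)
    also have "\<dots> < e"
    proof -
      define K where "K = \<bar>C\<bar> + 1"
      have K: "K > 0" "C \<le> K"
        unfolding K_def by linarith+
      have "\<eta> * C \<le> \<eta> * K"
        using \<eta> K by (intro mult_left_mono) auto
      also have "\<dots> = e / 2"
        using K by (simp add: \<eta>_def K_def[symmetric])
      finally show ?thesis
        using e by linarith
    qed
    finally have "dist (cut_conv T d g t) (\<Sum>y\<in>Y. y *\<^sub>V m y) < e"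
      by (simp add: dist_norm norm_minus_commute)
    moreover have "(\<Sum>y\<in>Y. y *\<^sub>V m y) \<in> B"
      using m by (auto simp: B_def)
    ultimately show ?thesis by blast
  qed
  ultimately show "\<exists>B. tot_bounded B \<and> (\<forall>a\<in>(\<lambda>g. cut_conv T d g t) ` dominated T \<gamma>. \<exists>b\<in>B. dist a b < e)"
    by blast
qed

lemma mild_conv_tot_bounded:
  assumes \<gamma>: "set_integrable lebesgue {0..T} \<gamma>" and T: "T \<ge> 0"
  shows "tot_bounded (clamped T ` mild_conv ` dominated T \<gamma>)"
proof (rule arzela_ascoli_clamped[OF T])
  show "continuous_on {0..T} f" if "f \<in> mild_conv ` dominated T \<gamma>" for f
    using that mild_conv_continuous[OF T] by (auto simp: dominated_def)
  show "\<exists>d>0. \<forall>f\<in>mild_conv ` dominated T \<gamma>. \<forall>s\<in>{0..T}. \<forall>t\<in>{0..T}. \<bar>s - t\<bar> < d \<longrightarrow> dist (f s) (f t) < e" if "e > 0" for e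
    using mild_conv_equicontinuous[OF \<gamma> T that] by simp
  show "tot_bounded ((\<lambda>f. f t) ` mild_conv ` dominated T \<gamma>)" if t: "t \<in> {0..T}" for t
  proof (rule tot_bounded_approx)
    fix e :: real assume "e > 0"
    then obtain d where d: "d > 0" and approx: "\<And>g t. g \<in> dominated T \<gamma> \<Longrightarrow> t \<in> {0..T} \<Longrightarrow> dist (mild_conv g t) (cut_conv T d g t) < e"
      using cut_approximates[OF \<gamma> T] by metis
    then show "\<exists>B. tot_bounded B \<and> (\<forall>a\<in>(\<lambda>f. f t) ` mild_conv ` dominated T \<gamma>. \<exists>b\<in>B. dist a b < e)"
      using t cut_conv_tot_bounded[OF \<gamma> T d t]
      by (intro exI[of _ "(\<lambda>g. cut_conv T d g t) ` dominated T \<gamma>"]) auto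
  qed
qed

end

section \<open>The nonlinear term\<close>

text \<open>Subtracting \<open>x 0\<close> makes the extension continuous at \<open>0\<close> for every \<open>x\<close>; the fixed point satisfies
  \<open>x 0 = \<psi> 0\<close>.\<close>

definition extend_history :: "real \<Rightarrow> (real \<Rightarrow> 'w::real_normed_vector) \<Rightarrow> (real \<Rightarrow>\<^sub>C 'w) \<Rightarrow> real \<Rightarrow> 'w"
  where "extend_history T \<psi> x t = (if t \<le> 0 then \<psi> t else \<psi> 0 + (apply_bcontfun x (clamp_time T t) - apply_bcontfun x 0))"

lemma continuous_on_extend_history: "continuous_on {0..<S} (extend_history T \<psi> x)"
proof -
  have "continuous_on {0..<S} (\<lambda>t. \<psi> 0 + (apply_bcontfun x (clamp_time T t) - apply_bcontfun x 0))"
    by (intro continuous_intros continuous_on_compose2[OF continuous_on_apply_bcontfun[of UNIV] continuous_on_clamp_time] subset_UNIV)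
  moreover have "extend_history T \<psi> x t = \<psi> 0 + (apply_bcontfun x (clamp_time T t) - apply_bcontfun x 0)" if "t \<in> {0..<S}" for t
  proof (cases "t = 0")
    case True
    have "clamp_time T 0 = 0"
      by (simp add: clamp_time_def)
    then show ?thesis
      using True by (simp add: extend_history_def)
  qed (use that in \<open>simp add: extend_history_def\<close>)
  ultimately show ?thesis
    by (rule continuous_on_eq[OF _ sym])
qed

locale phase =
  fixes \<BB> :: "(real \<Rightarrow> 'w::complex_banach) set" and p
  assumes phase_space: "phase_space \<BB> p"
begin

lemma seminormed: "seminormed_function_space \<BB> p"
  using phase_space by (simp add: phase_space_def)

lemma zero_mem: "(\<lambda>\<theta>. 0) \<in> \<BB>" and p_zero: "p (\<lambda>\<theta>. 0) = 0"
proof -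
  show z: "(\<lambda>\<theta>. 0) \<in> \<BB>"
    using seminormed unfolding seminormed_function_space_def by (elim conjE)
  have "\<forall>c. \<forall>\<phi>\<in>\<BB>. (\<lambda>\<theta>. c *\<^sub>C \<phi> \<theta>) \<in> \<BB> \<and> p (\<lambda>\<theta>. c *\<^sub>C \<phi> \<theta>) = cmod c * p \<phi>"
    using seminormed unfolding seminormed_function_space_def by (elim conjE)
  from bspec[OF spec[OF this] z, of 0] have "p (\<lambda>\<theta>. 0 *\<^sub>C (0::'w)) = cmod 0 * p (\<lambda>\<theta>. 0)"
    by (rule conjunct2)
  then show "p (\<lambda>\<theta>. 0) = 0"
    by (simp add: scaleC_linear_simps)
qed

text \<open>Nonnegativity follows from the seminorm laws: zero is the seminorm of
  \<open>d + (- d)\<close>, hence at most twice that of \<open>d\<close>.\<close>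

lemma p_diff_nonneg:
  assumes a: "a \<in> \<BB>" and b: "b \<in> \<BB>"
  shows "p (\<lambda>\<theta>. a \<theta> - b \<theta>) \<ge> 0"
proof -
  have scale: "\<forall>c. \<forall>\<phi>\<in>\<BB>. (\<lambda>\<theta>. c *\<^sub>C \<phi> \<theta>) \<in> \<BB> \<and> p (\<lambda>\<theta>. c *\<^sub>C \<phi> \<theta>) = cmod c * p \<phi>"
    and add: "\<forall>\<phi>\<in>\<BB>. \<forall>\<psi>\<in>\<BB>. (\<lambda>\<theta>. \<phi> \<theta> + \<psi> \<theta>) \<in> \<BB> \<and> p (\<lambda>\<theta>. \<phi> \<theta> + \<psi> \<theta>) \<le> p \<phi> + p \<psi>"
    using seminormed unfolding seminormed_function_space_def by - (elim conjE, assumption)+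
  have m1: "(-1) *\<^sub>C v = - v" for v :: 'w
    using scaleC_of_real[of "-1" v] by simp
  have neg: "(\<lambda>\<theta>. - \<phi> \<theta>) \<in> \<BB>" "p (\<lambda>\<theta>. - \<phi> \<theta>) = p \<phi>" if "\<phi> \<in> \<BB>" for \<phi>
    using bspec[OF spec[OF scale, of "-1"] that] by (simp_all add: m1)
  have d: "(\<lambda>\<theta>. a \<theta> - b \<theta>) \<in> \<BB>"
    using bspec[OF bspec[OF add a] neg(1)[OF b]] by simp
  show ?thesis
    using bspec[OF bspec[OF add d] neg(1)[OF d]] neg(2)[OF d] by (simp add: p_zero)
qed

lemma segment_extend_history:
  assumes \<psi>: "\<psi> \<in> \<BB>"
  shows "segment (extend_history T \<psi> x) 0 = \<psi>"
proof
  fix \<theta>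
  have "\<forall>\<phi>\<in>\<BB>. \<forall>\<theta>>0. \<phi> \<theta> = 0"
    using seminormed unfolding seminormed_function_space_def by (elim conjE)
  then have "\<psi> \<theta> = 0" if "\<theta> > 0"
    using \<psi> that by simp
  then show "segment (extend_history T \<psi> x) 0 \<theta> = \<psi> \<theta>"
    by (auto simp: segment_def extend_history_def)
qed

definition segment_bounds :: "real \<Rightarrow> (real \<Rightarrow> real) \<Rightarrow> (real \<Rightarrow> real) \<Rightarrow> bool"
  where "segment_bounds K1 \<Lambda> \<Upsilon> \<longleftrightarrow>
       continuous_on {0..} \<Lambda> \<and> (\<forall>t\<ge>0. \<Lambda> t \<ge> 1) \<and>
       (\<forall>b. bounded (\<Upsilon> ` {0..b})) \<and> (\<forall>t\<ge>0. \<Upsilon> t \<ge> 1) \<and>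
       (\<forall>z \<sigma> \<tau>. \<tau> > 0 \<longrightarrow> continuous_on {\<sigma>..<\<sigma> + \<tau>} z \<longrightarrow> segment z \<sigma> \<in> \<BB> \<longrightarrow>
          (\<forall>t\<in>{\<sigma>..<\<sigma> + \<tau>}.
             segment z t \<in> \<BB> \<and>
             norm (z t) \<le> K1 * p (segment z t) \<and>
             p (segment z t) \<le> \<Lambda> (t - \<sigma>) * (SUP s\<in>{\<sigma>..t}. norm (z s))
                               + \<Upsilon> (t - \<sigma>) * p (segment z \<sigma>)))"

lemma segment_bounds_exist: "\<exists>K1 \<Lambda> \<Upsilon>. segment_bounds K1 \<Lambda> \<Upsilon>"
  using phase_space unfolding phase_space_def segment_bounds_def by (elim conjE)

lemma segment_bounds_D:
  assumes "segment_bounds K1 \<Lambda> \<Upsilon>"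
  shows "\<forall>t\<ge>0. \<Lambda> t \<ge> 1"
    and "\<lbrakk>\<tau> > 0; continuous_on {\<sigma>..<\<sigma> + \<tau>} z; segment z \<sigma> \<in> \<BB>; t \<in> {\<sigma>..<\<sigma> + \<tau>}\<rbrakk> \<Longrightarrow>
      segment z t \<in> \<BB> \<and> norm (z t) \<le> K1 * p (segment z t) \<and>
      p (segment z t) \<le> \<Lambda> (t - \<sigma>) * (SUP s\<in>{\<sigma>..t}. norm (z s)) + \<Upsilon> (t - \<sigma>) * p (segment z \<sigma>)"
proof -
  show "\<forall>t\<ge>0. \<Lambda> t \<ge> 1"
    using assms unfolding segment_bounds_def by (elim conjE)
  have "\<forall>z \<sigma> \<tau>. \<tau> > 0 \<longrightarrow> continuous_on {\<sigma>..<\<sigma> + \<tau>} z \<longrightarrow> segment z \<sigma> \<in> \<BB> \<longrightarrow>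
          (\<forall>t\<in>{\<sigma>..<\<sigma> + \<tau>}.
             segment z t \<in> \<BB> \<and>
             norm (z t) \<le> K1 * p (segment z t) \<and>
             p (segment z t) \<le> \<Lambda> (t - \<sigma>) * (SUP s\<in>{\<sigma>..t}. norm (z s))
                               + \<Upsilon> (t - \<sigma>) * p (segment z \<sigma>))"
    using assms unfolding segment_bounds_def by (elim conjE)
  from this[rule_format, of \<tau> \<sigma> z t]
  show "segment z t \<in> \<BB> \<and> norm (z t) \<le> K1 * p (segment z t) \<and>
      p (segment z t) \<le> \<Lambda> (t - \<sigma>) * (SUP s\<in>{\<sigma>..t}. norm (z s)) + \<Upsilon> (t - \<sigma>) * p (segment z \<sigma>)"
    if "\<tau> > 0" "continuous_on {\<sigma>..<\<sigma> + \<tau>} z" "segment z \<sigma> \<in> \<BB>" "t \<in> {\<sigma>..<\<sigma> + \<tau>}"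
    using that .
qed

lemma segment_mem:
  assumes \<psi>: "\<psi> \<in> \<BB>" and t: "t \<in> {0..T}"
  shows "segment (extend_history T \<psi> x) t \<in> \<BB>"
proof -
  obtain K1 \<Lambda> \<Upsilon> where b: "segment_bounds K1 \<Lambda> \<Upsilon>"
    using segment_bounds_exist by blast
  show ?thesis
    \<comment> \<open>The axiom speaks of half-open intervals; length \<open>T + 1\<close> makes the
      end point \<open>T\<close> available.\<close>
    by (rule segment_bounds_D(2)[OF b, of "T + 1" 0 "extend_history T \<psi> x" t, THEN conjunct1])
      (use t \<psi> in \<open>simp_all add: continuous_on_extend_history segment_extend_history\<close>)
qed

lemma segment_tendsto:
  assumes \<psi>: "\<psi> \<in> \<BB>" and t: "t \<in> {0..T}" and X: "X \<longlonglongrightarrow> t" and XT: "\<And>n. X n \<in> {0..T}"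
  shows "(\<lambda>n. p (\<lambda>\<theta>. segment (extend_history T \<psi> x) (X n) \<theta> - segment (extend_history T \<psi> x) t \<theta>)) \<longlonglongrightarrow> 0"
proof -
  let ?z = "extend_history T \<psi> x"
  let ?f = "\<lambda>s. p (\<lambda>\<theta>. segment ?z s \<theta> - segment ?z t \<theta>)"
  have "\<forall>z \<sigma> \<tau>. \<tau> > 0 \<longrightarrow> continuous_on {\<sigma>..<\<sigma> + \<tau>} z \<longrightarrow> segment z \<sigma> \<in> \<BB> \<longrightarrow>
       (\<forall>t\<in>{\<sigma>..<\<sigma> + \<tau>}. ((\<lambda>s. p (\<lambda>\<theta>. segment z s \<theta> - segment z t \<theta>)) \<longlongrightarrow> 0) (at t within {\<sigma>..<\<sigma> + \<tau>}))"
    using phase_space unfolding phase_space_def by (elim conjE)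
  note ax = this[rule_format, of "T + 1" 0 ?z t]
  have "(?f \<longlongrightarrow> 0) (at t within {0..<0 + (T + 1)})"
    by (rule ax) (use t \<psi> in \<open>simp_all add: continuous_on_extend_history segment_extend_history\<close>)
  then have lim: "(?f \<longlongrightarrow> 0) (at t within {0..<T + 1})"
    by simp
  have "?f t = 0"
    by (simp add: p_zero)
  then have "continuous (at t within {0..<T + 1}) ?f"
    using lim by (simp add: continuous_within)
  moreover have "\<forall>n. X n \<in> {0..<T + 1}"
  proof
    fix n
    show "X n \<in> {0..<T + 1}"
      using XT[of n] by simp
  qed
  ultimately have "(\<lambda>n. ?f (X n)) \<longlonglongrightarrow> ?f t"
    using X continuous_within_sequentially[of t "{0..<T + 1}" ?f] by (auto simp: o_def)
  then show ?thesis
    by (simp add: p_zero)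
qed

text \<open>Two extensions share their history, so their difference has zero initial segment and
  only the supremum term of the axiom survives. The factor 2 accounts for the subtraction of the
  value at 0.\<close>

lemma segment_Lipschitz:
  assumes \<psi>: "\<psi> \<in> \<BB>" and t: "t \<in> {0..T}"
  shows "\<exists>L. \<forall>x y. p (\<lambda>\<theta>. segment (extend_history T \<psi> x) t \<theta> - segment (extend_history T \<psi> y) t \<theta>) \<le> L * dist x y"
proof -
  obtain K1 \<Lambda> \<Upsilon> where b: "segment_bounds K1 \<Lambda> \<Upsilon>"
    using segment_bounds_exist by blast
  note \<Lambda> = segment_bounds_D(1)[OF b]
  show ?thesis
  proof (intro exI[of _ "\<Lambda> t * 2"] allI)
    fix x y
    define z where "z s = extend_history T \<psi> x s - extend_history T \<psi> y s" for s
    have seg: "segment z s = (\<lambda>\<theta>. segment (extend_history T \<psi> x) s \<theta> - segment (extend_history T \<psi> y) s \<theta>)" for s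
      by (auto simp: segment_def z_def)
    have seg0: "segment z 0 = (\<lambda>\<theta>. 0)"
      unfolding seg segment_extend_history[OF \<psi>] by simp
    have "continuous_on {0..<0 + (T + 1)} z"
      unfolding z_def by (intro continuous_intros continuous_on_extend_history)
    then have "p (segment z t) \<le> \<Lambda> (t - 0) * (SUP s\<in>{0..t}. norm (z s)) + \<Upsilon> (t - 0) * p (segment z 0)"
      using segment_bounds_D(2)[OF b, of "T + 1" 0 z t] t zero_mem by (simp add: seg0)
    then have le: "p (segment z t) \<le> \<Lambda> t * (SUP s\<in>{0..t}. norm (z s))"
      by (simp add: seg0 p_zero)
    have "(SUP s\<in>{0..t}. norm (z s)) \<le> 2 * dist x y"
    proof (rule cSUP_least)
      fix s assume "s \<in> {0..t}"
      have "norm (z s) \<le> dist (apply_bcontfun x (clamp_time T s)) (apply_bcontfun y (clamp_time T s)) + dist (apply_bcontfun x 0) (apply_bcontfun y 0)"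
        using norm_triangle_ineq4[of "apply_bcontfun x (clamp_time T s) - apply_bcontfun y (clamp_time T s)" "apply_bcontfun x 0 - apply_bcontfun y 0"]
        by (auto simp: z_def extend_history_def dist_norm algebra_simps)
      also have "\<dots> \<le> dist x y + dist x y"
        by (intro add_mono dist_bounded)
      finally show "norm (z s) \<le> 2 * dist x y"
        by simp
    qed (use t in auto)
    then have "\<Lambda> t * (SUP s\<in>{0..t}. norm (z s)) \<le> \<Lambda> t * (2 * dist x y)"
      using \<Lambda> t by (intro mult_left_mono) (auto intro: order_trans[OF zero_le_one])
    then show "p (\<lambda>\<theta>. segment (extend_history T \<psi> x) t \<theta> - segment (extend_history T \<psi> y) t \<theta>) \<le> \<Lambda> t * 2 * dist x y"
      using le by (simp add: seg)
  qed
qed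

end

locale caratheodory = compact_family R M \<omega> + phase \<BB> p
  for R :: "real \<Rightarrow> 'w::{complex_banach, second_countable_topology} \<Rightarrow>\<^sub>C\<^sub>L 'w" and M \<omega> :: real
    and \<BB> :: "(real \<Rightarrow> 'w) set" and p +
  fixes T :: real and f :: "real \<Rightarrow> (real \<Rightarrow> 'w) \<Rightarrow> 'w" and \<gamma> :: "real \<Rightarrow> real" and \<psi> :: "real \<Rightarrow> 'w"
  assumes T_pos: "T > 0" and \<psi>: "\<psi> \<in> \<BB>"
    and f_continuous: "AE t\<in>{0..T} in lebesgue. seminorm_continuous_on \<BB> p (f t)"
    and f_measurable: "\<And>\<phi>. \<phi> \<in> \<BB> \<Longrightarrow> strongly_measurable (lebesgue_on {0..T}) (\<lambda>t. f t \<phi>)"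
    and \<gamma>_integrable: "set_integrable lebesgue {0..T} \<gamma>"
    and f_bounded: "AE t\<in>{0..T} in lebesgue. \<forall>\<phi>\<in>\<BB>. norm (f t \<phi>) \<le> \<gamma> t"
begin

definition forcing :: "(real \<Rightarrow>\<^sub>C 'w) \<Rightarrow> real \<Rightarrow> 'w"
  where "forcing x s = f s (segment (extend_history T \<psi> x) s)"

lemma f_tendsto:
  assumes "seminorm_continuous_on \<BB> p (f s)" "\<And>n. a n \<in> \<BB>" "b \<in> \<BB>" "(\<lambda>n. p (\<lambda>\<theta>. a n \<theta> - b \<theta>)) \<longlonglongrightarrow> 0"
  shows "(\<lambda>n. f s (a n)) \<longlonglongrightarrow> f s b"
proof (rule LIMSEQ_I)
  fix e :: real assume "e > 0"
  then obtain d where d: "d > 0" "\<And>q. q \<in> \<BB> \<Longrightarrow> p (\<lambda>\<theta>. q \<theta> - b \<theta>) < d \<Longrightarrow> norm (f s q - f s b) < e"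
    using assms(1,3) unfolding seminorm_continuous_on_def by blast
  have "\<forall>\<^sub>F n in sequentially. p (\<lambda>\<theta>. a n \<theta> - b \<theta>) < d"
    using assms(4) d(1) by (rule order_tendstoD)
  then obtain N where "\<And>n. n \<ge> N \<Longrightarrow> p (\<lambda>\<theta>. a n \<theta> - b \<theta>) < d"
    by (auto simp: eventually_sequentially)
  then show "\<exists>no. \<forall>n\<ge>no. norm (f s (a n) - f s b) < e"
    using d(2) assms(2) by blast
qed

text \<open>Measurability of \<open>f\<close> is given for a fixed history, whereas here the history
  moves with time. Freezing it on the cells of a grid leaves countably many fixed histories, and
  continuity in the history yields the limit.\<close>

lemma forcing_measurable: "(\<lambda>s. indicator {0..T} s *\<^sub>R forcing x s) \<in> borel_measurable lebesgue"
proof (rule lebesgue_measurable_lim_AE)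
  define z where "z = extend_history T \<psi> x"
  \<comment> \<open>Clamping keeps the grid inside the interval on which segments belong to the
    phase space.\<close>
  define grid where "grid n i = clamp_time T (real_of_int i / real (Suc n))" for n i
  have grid: "segment z (grid n i) \<in> \<BB>" for n i
    unfolding z_def grid_def by (rule segment_mem[OF \<psi> clamp_time_in]) (use T_pos in simp)
  define h where "h n s = indicator {0..T} s *\<^sub>R f s (segment z (grid n \<lfloor>s * real (Suc n)\<rfloor>))" for n s
  show "h n \<in> borel_measurable lebesgue" for n
    unfolding h_def
  proof (rule measurable_compose_countable)
    show "(\<lambda>s. indicator {0..T} s *\<^sub>R f s (segment z (grid n i))) \<in> borel_measurable lebesgue" for i
      by (rule strongly_measurable_imp_measurable[OF f_measurable[OF grid]]) simp
    show "(\<lambda>s. \<lfloor>s * real (Suc n)\<rfloor>) \<in> lebesgue \<rightarrow>\<^sub>M count_space UNIV"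
      by (intro measurable_completion) simp
  qed
  show "AE s in lebesgue. (\<lambda>n. h n s) \<longlonglongrightarrow> indicator {0..T} s *\<^sub>R forcing x s"
    using f_continuous
  proof eventually_elim
    case (elim s)
    show ?case
    proof (cases "s \<in> {0..T}")
      case False
      then show ?thesis by (simp add: h_def)
    next
      case True
      define X where "X n = grid n \<lfloor>s * real (Suc n)\<rfloor>" for n
      have X: "X n \<in> {0..T}" "\<bar>X n - s\<bar> \<le> inverse (real (Suc n))" for n
      proof -
        define q where "q = real_of_int \<lfloor>s * real (Suc n)\<rfloor> / real (Suc n)"
        have "real_of_int \<lfloor>s * real (Suc n)\<rfloor> \<le> s * real (Suc n)" "s * real (Suc n) - 1 \<le> real_of_int \<lfloor>s * real (Suc n)\<rfloor>"
          by linarith+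
        note fl = this
        have "q \<le> s * real (Suc n) / real (Suc n)"
          unfolding q_def by (rule divide_right_mono[OF fl(1) of_nat_0_le_iff])
        moreover have "(s * real (Suc n) - 1) / real (Suc n) \<le> q"
          unfolding q_def by (rule divide_right_mono[OF fl(2) of_nat_0_le_iff])
        ultimately have "q \<le> s" "s - inverse (real (Suc n)) \<le> q"
          by (simp_all add: diff_divide_distrib inverse_eq_divide del: of_nat_Suc)
        moreover have "0 \<le> q"
          using True by (simp add: q_def)
        ultimately have "X n = q"
          using True by (simp add: X_def grid_def q_def[symmetric] clamp_time_id del: of_nat_Suc)
        then show "\<bar>X n - s\<bar> \<le> inverse (real (Suc n))" "X n \<in> {0..T}"
          using \<open>q \<le> s\<close> \<open>s - inverse (real (Suc n)) \<le> q\<close> \<open>0 \<le> q\<close> True by auto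
      qed
      have "(\<lambda>n. X n - s) \<longlonglongrightarrow> 0"
        by (rule Lim_null_comparison[OF _ LIMSEQ_inverse_real_of_nat]) (use X(2) in auto)
      then have Xs: "X \<longlonglongrightarrow> s"
        by (rule LIM_zero_cancel)
      have "(\<lambda>n. f s (segment z (X n))) \<longlonglongrightarrow> f s (segment z s)"
      proof (rule f_tendsto)
        show "seminorm_continuous_on \<BB> p (f s)"
          using elim True by simp
        show "segment z (X n) \<in> \<BB>" for n
          unfolding X_def by (rule grid)
        show "segment z s \<in> \<BB>"
          unfolding z_def by (rule segment_mem[OF \<psi> True])
        show "(\<lambda>n. p (\<lambda>\<theta>. segment z (X n) \<theta> - segment z s \<theta>)) \<longlonglongrightarrow> 0"
          unfolding z_def by (rule segment_tendsto[OF \<psi> True Xs X(1)])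
      qed
      then show ?thesis
        using True by (simp add: h_def X_def forcing_def z_def)
    qed
  qed
qed

lemma forcing_le: "AE s in lebesgue. s \<in> {0..T} \<longrightarrow> norm (forcing x s) \<le> \<gamma> s"
  using f_bounded
proof eventually_elim
  case (elim s)
  then show ?case
    using segment_mem[OF \<psi>, of s T x] by (auto simp: forcing_def)
qed

lemma forcing_dominated: "forcing x \<in> dominated T \<gamma>"
proof -
  have "set_integrable lebesgue {0..T} (forcing x)"
    unfolding set_integrable_def
  proof (rule Bochner_Integration.integrable_bound[OF _ forcing_measurable])
    show "integrable lebesgue (\<lambda>s. indicator {0..T} s *\<^sub>R \<gamma> s)"
      using \<gamma>_integrable by (simp add: set_integrable_def)
    show "AE s in lebesgue. norm (indicator {0..T} s *\<^sub>R forcing x s) \<le> norm (indicator {0..T} s *\<^sub>R \<gamma> s)"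
      using forcing_le[of x] by eventually_elim (auto simp: indicator_def)
  qed
  then show ?thesis
    using forcing_le by (simp add: dominated_def)
qed

lemma forcing_integrable: "set_integrable lebesgue {0..T} (forcing x)"
  using forcing_dominated by (simp add: dominated_def)

text \<open>Dominated convergence with majorant \<open>2 * \<gamma> s\<close>: at almost every time
  \<open>f\<close> is continuous in the history, which depends on the path in a Lipschitz
  way.\<close>

lemma forcing_L1_tendsto:
  assumes X: "X \<longlonglongrightarrow> x"
  shows "(\<lambda>n. LINT s:{0..T}|lebesgue. norm (forcing (X n) s - forcing x s)) \<longlonglongrightarrow> 0"
proof -
  have "(\<lambda>n. LINT s|lebesgue. indicator {0..T} s *\<^sub>R norm (forcing (X n) s - forcing x s)) \<longlonglongrightarrow> (LINT s::real|lebesgue. 0::real)"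
  proof (rule integral_dominated_convergence[where w = "\<lambda>s. 2 * (indicator {0..T} s *\<^sub>R \<gamma> s)"])
    show "integrable lebesgue (\<lambda>s. 2 * (indicator {0..T} s *\<^sub>R \<gamma> s))"
      by (rule integrable_mult_right) (rule \<gamma>_integrable[unfolded set_integrable_def])
    show "(\<lambda>s. indicator {0..T} s *\<^sub>R norm (forcing (X n) s - forcing x s)) \<in> borel_measurable lebesgue" for n
      by (rule borel_measurable_integrable[OF set_integrable_norm[OF set_integral_diff(1)[OF forcing_integrable forcing_integrable], unfolded set_integrable_def]])
    show "AE s in lebesgue. norm (indicator {0..T} s *\<^sub>R norm (forcing (X n) s - forcing x s)) \<le> 2 * (indicator {0..T} s *\<^sub>R \<gamma> s)" for n
      using forcing_le[of x] forcing_le[of "X n"]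
    proof eventually_elim
      case (elim s)
      then show ?case
        using norm_triangle_ineq4[of "forcing (X n) s" "forcing x s"] by (auto simp: indicator_def)
    qed
    show "AE s in lebesgue. (\<lambda>n. indicator {0..T} s *\<^sub>R norm (forcing (X n) s - forcing x s)) \<longlonglongrightarrow> 0"
      using f_continuous
    proof eventually_elim
      case (elim s)
      show ?case
      proof (cases "s \<in> {0..T}")
        case True
        from segment_Lipschitz[OF \<psi> True] obtain L
          where "\<forall>x y. p (\<lambda>\<theta>. segment (extend_history T \<psi> x) s \<theta> - segment (extend_history T \<psi> y) s \<theta>) \<le> L * dist x y" ..
        note L = this[THEN spec, THEN spec]
        have p_nonneg: "p (\<lambda>\<theta>. segment (extend_history T \<psi> y) s \<theta> - segment (extend_history T \<psi> x) s \<theta>) \<ge> 0" for y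
          by (rule p_diff_nonneg[OF segment_mem[OF \<psi> True] segment_mem[OF \<psi> True]])
        have "(\<lambda>n. L * dist (X n) x) \<longlonglongrightarrow> L * 0"
          by (rule tendsto_mult[OF tendsto_const tendsto_dist_iff[THEN iffD1, OF X]])
        then have L0: "(\<lambda>n. L * dist (X n) x) \<longlonglongrightarrow> 0"
          by simp
        have "(\<lambda>n. forcing (X n) s) \<longlonglongrightarrow> forcing x s"
          unfolding forcing_def
        proof (rule f_tendsto)
          show "seminorm_continuous_on \<BB> p (f s)"
            using elim True by simp
          show "(\<lambda>n. p (\<lambda>\<theta>. segment (extend_history T \<psi> (X n)) s \<theta> - segment (extend_history T \<psi> x) s \<theta>)) \<longlonglongrightarrow> 0"
          proof (rule Lim_null_comparison[OF always_eventually L0], rule allI)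
            fix n
            show "norm (p (\<lambda>\<theta>. segment (extend_history T \<psi> (X n)) s \<theta> - segment (extend_history T \<psi> x) s \<theta>)) \<le> L * dist (X n) x"
              unfolding real_norm_def abs_of_nonneg[OF p_nonneg] by (rule L)
          qed
        qed (rule segment_mem[OF \<psi> True])+
        then have "(\<lambda>n. norm (forcing (X n) s - forcing x s)) \<longlonglongrightarrow> norm (forcing x s - forcing x s)"
          by (intro tendsto_intros)
        then show ?thesis
          using True by simp
      qed simp
    qed
  qed simp
  then show ?thesis
    by (simp add: set_lebesgue_integral_def)
qed

definition response :: "(real \<Rightarrow>\<^sub>C 'w) \<Rightarrow> (real \<Rightarrow>\<^sub>C 'w)"
  where "response x = clamped T (mild_conv (forcing x))"

lemma mild_conv_diff_le:
  assumes t: "t \<in> {0..T}" and g: "set_integrable lebesgue {0..T} g" and k: "set_integrable lebesgue {0..T} k"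
  shows "dist (mild_conv g t) (mild_conv k t) \<le> M * exp (\<omega> * T) * (LINT s:{0..T}|lebesgue. norm (g s - k s))"
proof -
  have sub: "set_integrable lebesgue {0..t} g" "set_integrable lebesgue {0..t} k"
    using t by (auto intro: set_integrable_subset[OF g] set_integrable_subset[OF k])
  note i = conv_integrable[OF sub(1)] conv_integrable[OF sub(2)]
  have gk: "set_integrable lebesgue {0..T} (\<lambda>s. norm (g s - k s))"
    by (rule set_integrable_norm[OF set_integral_diff(1)[OF g k]])
  have "mild_conv g t - mild_conv k t = (LINT s:{0..t}|lebesgue. R (t - s) *\<^sub>V g s - R (t - s) *\<^sub>V k s)"
    unfolding mild_conv_def by (rule set_integral_diff(2)[OF i, symmetric])
  also have "norm \<dots> \<le> (LINT s|lebesgue. M * exp (\<omega> * T) * (indicator {0..T} s *\<^sub>R norm (g s - k s)))"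
    unfolding set_lebesgue_integral_def
  proof (rule norm_integral_le_AE)
    show "integrable lebesgue (\<lambda>s. indicator {0..t} s *\<^sub>R (R (t - s) *\<^sub>V g s - R (t - s) *\<^sub>V k s))"
      using set_integral_diff(1)[OF i] by (simp add: set_integrable_def)
    show "integrable lebesgue (\<lambda>s. M * exp (\<omega> * T) * (indicator {0..T} s *\<^sub>R norm (g s - k s)))"
      by (rule integrable_mult_right) (rule gk[unfolded set_integrable_def])
    show "AE s in lebesgue. norm (indicator {0..t} s *\<^sub>R (R (t - s) *\<^sub>V g s - R (t - s) *\<^sub>V k s)) \<le> M * exp (\<omega> * T) * (indicator {0..T} s *\<^sub>R norm (g s - k s))"
    proof (rule AE_I2)
      fix s
      show "norm (indicator {0..t} s *\<^sub>R (R (t - s) *\<^sub>V g s - R (t - s) *\<^sub>V k s)) \<le> M * exp (\<omega> * T) * (indicator {0..T} s *\<^sub>R norm (g s - k s))"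
      proof (cases "s \<in> {0..t}")
        case True
        have "norm (R (t - s) *\<^sub>V (g s - k s)) \<le> M * exp (\<omega> * t) * norm (g s - k s)"
          by (rule conv_norm_le[OF True])
        also have "\<dots> \<le> M * exp (\<omega> * T) * norm (g s - k s)"
          using t \<omega>_pos M_nonneg by (intro mult_right_mono mult_left_mono) auto
        finally show ?thesis
          using True t by (simp add: cblinfun_linear_simps)
      next
        case False
        then have "indicator {0..t} s = (0::real)"
          by simp
        then show ?thesis
          using M_nonneg by simp
      qed
    qed
  qed
  finally show ?thesis
    by (simp add: dist_norm set_lebesgue_integral_def)
qed

lemma continuous_response: "continuous_on UNIV response"
  unfolding continuous_on_sequentially
proof (intro allI ballI impI)
  fix X :: "nat \<Rightarrow> (real \<Rightarrow>\<^sub>C 'w)" and x assume "(\<forall>n. X n \<in> UNIV) \<and> X \<longlonglongrightarrow> x"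
  then have X: "X \<longlonglongrightarrow> x" by simp
  have T0: "T \<ge> 0" using T_pos by simp
  have "(\<lambda>n. M * exp (\<omega> * T) * (LINT s:{0..T}|lebesgue. norm (forcing (X n) s - forcing x s))) \<longlonglongrightarrow> M * exp (\<omega> * T) * 0"
    by (rule tendsto_mult[OF tendsto_const forcing_L1_tendsto[OF X]])
  then have lim: "(\<lambda>n. M * exp (\<omega> * T) * (LINT s:{0..T}|lebesgue. norm (forcing (X n) s - forcing x s))) \<longlonglongrightarrow> 0"
    by simp
  have le: "dist (response (X n)) (response x) \<le> M * exp (\<omega> * T) * (LINT s:{0..T}|lebesgue. norm (forcing (X n) s - forcing x s))" for n
    unfolding response_def
    by (rule dist_clamped_le[OF T0 mild_conv_continuous[OF T0 forcing_integrable]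
          mild_conv_continuous[OF T0 forcing_integrable] mild_conv_diff_le[OF _ forcing_integrable forcing_integrable]])
  have "(\<lambda>n. dist (response (X n)) (response x)) \<longlonglongrightarrow> 0"
    by (rule Lim_null_comparison[OF always_eventually lim]) (simp add: le)
  then show "(response \<circ> X) \<longlonglongrightarrow> response x"
    unfolding o_def by (rule tendsto_dist_iff[THEN iffD2])
qed

end

section \<open>Controls and the Gramian\<close>

text \<open>Continuity is asked on the half-open interval because controls involve
  \<open>R (T - s)\<close>, whose norm continuity may fail at \<open>s = T\<close>.\<close>

lemma set_integrable_continuous_bounded:
  fixes v :: "real \<Rightarrow> 'a::{banach, second_countable_topology}"
  assumes cont: "continuous_on {0..<T} v" and bound: "\<And>s. s \<in> {0..T} \<Longrightarrow> norm (v s) \<le> C"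
  shows "set_integrable lebesgue {0..T} v"
  unfolding set_integrable_def
proof (rule Bochner_Integration.integrable_bound)
  have "integrable lebesgue (\<lambda>s. indicator {0..T} s *\<^sub>R C)"
    using set_integrable_lebesgue_continuous[of 0 T "\<lambda>_. C"] by (simp add: set_integrable_def)
  then show "integrable lebesgue (\<lambda>s. indicator {0..T} s *\<^sub>R C)" .
  show "(\<lambda>s. indicator {0..T} s *\<^sub>R v s) \<in> borel_measurable lebesgue"
  proof (rule lebesgue_measurable_cong_AE)
    show "(\<lambda>s. indicator {0..<T} s *\<^sub>R v s) \<in> borel_measurable lebesgue"
      by (rule measurable_completion) (simp add: borel_measurable_continuous_on_indicator cont)
    have "AE s in lebesgue. s \<noteq> T"
      by (rule AE_completion[OF AE_lborel_singleton])
    then show "AE s in lebesgue. indicator {0..T} s *\<^sub>R v s = indicator {0..<T} s *\<^sub>R v s"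
      by eventually_elim (auto simp: indicator_def)
  qed
  show "AE s in lebesgue. norm (indicator {0..T} s *\<^sub>R v s) \<le> norm (indicator {0..T} s *\<^sub>R C)"
  proof (rule AE_I2)
    fix s
    show "norm (indicator {0..T} s *\<^sub>R v s) \<le> norm (indicator {0..T} s *\<^sub>R C)"
      using bound[of s] by (cases "s \<in> {0..T}") auto
  qed
qed

text \<open>The control space need not be separable, so strong measurability is established by
  explicit step functions. Rounding times down keeps them in the interval where \<open>v\<close> is
  continuous.\<close>

lemma L2_function_continuous_bounded:
  fixes v :: "real \<Rightarrow> 'a::real_normed_vector"
  assumes cont: "continuous_on {0..<T} v" and bound: "\<And>s. s \<in> {0..T} \<Longrightarrow> norm (v s) \<le> C"
  shows "L2_function T v"
  unfolding L2_function_def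
proof
  show "set_integrable lebesgue {0..T} (\<lambda>t. (norm (v t))\<^sup>2)"
  proof (rule set_integrable_continuous_bounded)
    show "continuous_on {0..<T} (\<lambda>t. (norm (v t))\<^sup>2)"
      by (intro continuous_intros cont)
    show "norm ((norm (v s))\<^sup>2) \<le> C\<^sup>2" if "s \<in> {0..T}" for s
      using power_mono[OF bound[OF that] norm_ge_zero] by simp
  qed
  define q where "q k x = real_of_int \<lfloor>x * real (Suc k)\<rfloor> / real (Suc k)" for k x
  have q: "q k x \<le> x" "x - inverse (real (Suc k)) \<le> q k x" for k x
  proof -
    have fl: "real_of_int \<lfloor>x * real (Suc k)\<rfloor> \<le> x * real (Suc k)" "x * real (Suc k) - 1 \<le> real_of_int \<lfloor>x * real (Suc k)\<rfloor>"
      by linarith+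
    have "q k x \<le> x * real (Suc k) / real (Suc k)"
      unfolding q_def by (rule divide_right_mono[OF fl(1) of_nat_0_le_iff])
    moreover have "(x * real (Suc k) - 1) / real (Suc k) \<le> q k x"
      unfolding q_def by (rule divide_right_mono[OF fl(2) of_nat_0_le_iff])
    ultimately show "q k x \<le> x" "x - inverse (real (Suc k)) \<le> q k x"
      by (simp_all add: diff_divide_distrib inverse_eq_divide del: of_nat_Suc)
  qed
  have q_nonneg: "q k x \<ge> 0" if "x \<ge> 0" for k x
    using that by (simp add: q_def)
  have q_lim: "(\<lambda>k. q k x) \<longlonglongrightarrow> x" for x
  proof (rule LIM_zero_cancel, rule Lim_null_comparison[OF always_eventually LIMSEQ_inverse_real_of_nat], rule allI)
    show "norm (q k x - x) \<le> inverse (real (Suc k))" for k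
      using q[where k = k and x = x] by (simp only: real_norm_def abs_le_iff) argo
  qed
  show "strongly_measurable (lebesgue_on {0..T}) v"
    unfolding strongly_measurable_def
  proof (intro exI conjI allI)
    show "simple_function (lebesgue_on {0..T}) (\<lambda>x. v (q k x))" for k
    proof -
      have "simple_function (lebesgue_on {0..T}) (\<lambda>x. \<lfloor>x * real (Suc k)\<rfloor>)"
        unfolding simple_function_def
      proof (intro conjI ballI)
        have "(\<lambda>x. \<lfloor>x * real (Suc k)\<rfloor>) ` space (lebesgue_on {0..T}) \<subseteq> {0..\<lfloor>T * real (Suc k)\<rfloor>}"
          by (auto simp del: of_nat_Suc intro!: floor_mono mult_right_mono)
        then show "finite ((\<lambda>x. \<lfloor>x * real (Suc k)\<rfloor>) ` space (lebesgue_on {0..T}))"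
          by (rule finite_subset) simp
        have "(\<lambda>x. \<lfloor>x * real (Suc k)\<rfloor>) \<in> lebesgue_on {0..T} \<rightarrow>\<^sub>M count_space UNIV"
          by (intro measurable_restrict_space1 measurable_completion) simp
        then show "(\<lambda>x. \<lfloor>x * real (Suc k)\<rfloor>) -` {i} \<inter> space (lebesgue_on {0..T}) \<in> sets (lebesgue_on {0..T})" for i
          by (rule measurable_sets) simp
      qed
      then show ?thesis
        unfolding q_def by (rule simple_function_compose1[where g = "\<lambda>i. v (real_of_int i / real (Suc k))"])
    qed
    have "AE x in lebesgue. x \<noteq> T"
      by (rule AE_completion[OF AE_lborel_singleton])
    then have "AE x in lebesgue. x \<in> {0..T} \<longrightarrow> (\<lambda>k. v (q k x)) \<longlonglongrightarrow> v x"
    proof eventually_elim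
      case (elim x)
      show ?case
      proof
        assume x: "x \<in> {0..T}"
        have "q k x \<in> {0..<T}" for k
          using q(1)[where k = k and x = x] q_nonneg[where k = k and x = x] x elim by simp
        then show "(\<lambda>k. v (q k x)) \<longlonglongrightarrow> v x"
          by (intro continuous_on_tendsto_compose[OF cont q_lim] always_eventually) (use x elim in auto)
      qed
    qed
    then show "AE x in lebesgue_on {0..T}. (\<lambda>k. v (q k x)) \<longlonglongrightarrow> v x"
      by (simp add: AE_restrict_space_iff)
  qed
qed

text \<open>Strong continuity of a family does not pass to its adjoints, norm continuity does; this
  estimate hands the norm continuity of \<open>R\<close> on to the controls.\<close>

lemma riesz_vector_lipschitz:
  fixes B :: "'u::complex_hilbert \<Rightarrow>\<^sub>C\<^sub>L 'w::complex_normed_vector" and \<phi> :: "'v::complex_normed_vector \<Rightarrow>\<^sub>C\<^sub>L complex"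
  shows "norm (riesz_vector (cadjoint B (cadjoint P \<phi>)) - riesz_vector (cadjoint B (cadjoint Q \<phi>)))
    \<le> norm \<phi> * norm (P - Q) * norm B"
proof -
  have "cadjoint B (cadjoint P \<phi>) - cadjoint B (cadjoint Q \<phi>) = (\<phi> o\<^sub>C\<^sub>L (P - Q)) o\<^sub>C\<^sub>L B"
    by (rule cblinfun_eqI)
      (simp add: cadjoint_apply cblinfun_compose_apply cblinfun_minus_apply cblinfun_linear_simps)
  then have "norm (riesz_vector (cadjoint B (cadjoint P \<phi>)) - riesz_vector (cadjoint B (cadjoint Q \<phi>)))
      \<le> norm ((\<phi> o\<^sub>C\<^sub>L (P - Q)) o\<^sub>C\<^sub>L B)"
    unfolding riesz_vector_diff[symmetric] by (metis norm_riesz_vector)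
  also have "\<dots> \<le> norm (\<phi> o\<^sub>C\<^sub>L (P - Q)) * norm B"
    by (rule norm_cblinfun_compose)
  also have "\<dots> \<le> norm \<phi> * norm (P - Q) * norm B"
    by (intro mult_right_mono norm_cblinfun_compose) simp
  finally show ?thesis .
qed

lemma norm_riesz_vector_cadjoint:
  fixes B :: "'u::complex_hilbert \<Rightarrow>\<^sub>C\<^sub>L 'w::complex_normed_vector" and \<phi> :: "'v::complex_normed_vector \<Rightarrow>\<^sub>C\<^sub>L complex"
  shows "norm (riesz_vector (cadjoint B (cadjoint P \<phi>))) \<le> norm \<phi> * norm P * norm B"
proof -
  have "norm (riesz_vector (cadjoint B (cadjoint P \<phi>))) \<le> norm (cadjoint B (cadjoint P \<phi>))"
    by (rule norm_riesz_vector)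
  also have "\<dots> \<le> norm (\<phi> o\<^sub>C\<^sub>L P) * norm B"
    unfolding cadjoint_def by (rule norm_cblinfun_compose)
  also have "\<dots> \<le> norm \<phi> * norm P * norm B"
    by (intro mult_right_mono norm_cblinfun_compose) simp
  finally show ?thesis .
qed

context compact_family begin

text \<open>The control whose final state, started from rest, is the Gramian applied to
  \<open>\<phi>\<close>.\<close>

definition control :: "real \<Rightarrow> ('u::complex_hilbert \<Rightarrow>\<^sub>C\<^sub>L 'w) \<Rightarrow> ('w \<Rightarrow>\<^sub>C\<^sub>L complex) \<Rightarrow> real \<Rightarrow> 'u"
  where "control T B \<phi> s = riesz_vector (cadjoint B (cadjoint (R (T - s)) \<phi>))"

lemma control_continuous: "continuous_on {0..<T} (control T B \<phi>)"
proof -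
  have "continuous_on UNIV (\<lambda>P :: 'w \<Rightarrow>\<^sub>C\<^sub>L 'w. riesz_vector (cadjoint B (cadjoint P \<phi>)))"
  proof (rule lipschitz_on_continuous_on, rule lipschitz_onI)
    show "dist (riesz_vector (cadjoint B (cadjoint P \<phi>))) (riesz_vector (cadjoint B (cadjoint Q \<phi>)))
        \<le> (norm \<phi> * norm B) * dist P Q" for P Q :: "'w \<Rightarrow>\<^sub>C\<^sub>L 'w"
      using riesz_vector_lipschitz[of B P \<phi> Q] by (simp add: dist_norm mult_ac)
  qed simp
  moreover have "continuous_on {0..<T} (\<lambda>s. R (T - s))"
    by (rule continuous_on_compose2[OF norm_cont]) (auto intro!: continuous_intros)
  ultimately show ?thesis
    unfolding control_def by (rule continuous_on_compose2) simp
qed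

lemma norm_control_le:
  assumes "s \<in> {0..T}"
  shows "norm (control T B \<phi> s) \<le> norm B * (M * exp (\<omega> * T)) * norm \<phi>"
proof -
  have "norm (R (T - s)) \<le> M * exp (\<omega> * (T - s))"
    using assms by (intro bound) simp
  also have "\<dots> \<le> M * exp (\<omega> * T)"
    using assms \<omega>_pos M_nonneg by (intro mult_left_mono) auto
  finally have "norm \<phi> * norm (R (T - s)) * norm B \<le> norm \<phi> * (M * exp (\<omega> * T)) * norm B"
    by (intro mult_right_mono mult_left_mono) auto
  then show ?thesis
    unfolding control_def using norm_riesz_vector_cadjoint[of B "R (T - s)" \<phi>] by (simp add: mult_ac)
qed

lemma control_integrable: "set_integrable lebesgue {0..T} (\<lambda>s. B *\<^sub>V control T B \<phi> s)"
proof (rule set_integrable_continuous_bounded)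
  show "continuous_on {0..<T} (\<lambda>s. B *\<^sub>V control T B \<phi> s)"
    by (rule bounded_linear.continuous_on[OF bounded_linear_cblinfun_apply control_continuous])
  show "norm (B *\<^sub>V control T B \<phi> s) \<le> norm B * (norm B * (M * exp (\<omega> * T)) * norm \<phi>)" if "s \<in> {0..T}" for s
    by (rule order_trans[OF norm_cblinfun mult_left_mono[OF norm_control_le[OF that] norm_ge_zero]])
qed

lemma gramian_eq_mild_conv: "gramian T R B \<phi> = mild_conv (\<lambda>s. B *\<^sub>V control T B \<phi> s) T"
  by (simp add: gramian_def mild_conv_def control_def)

text \<open>The form is the real inner product of two controls in square-integrable functions, from
  which symmetry and positivity are both visible. In real parts the antilinearity of the Riesz
  identification does no harm.\<close>

lemma Re_functional_gramian:
  "Re (\<eta> *\<^sub>V gramian T R B \<phi>) = (LINT s|lebesgue. indicator {0..T} s * Re (cinner (control T B \<eta> s) (control T B \<phi> s)))"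
proof -
  have bl: "bounded_linear (\<lambda>x. Re (\<eta> *\<^sub>V x))"
    by (rule bounded_linear_compose[OF bounded_linear_Re bounded_linear_cblinfun_apply])
  have "Re (\<eta> *\<^sub>V gramian T R B \<phi>) =
      (LINT s|lebesgue. Re (\<eta> *\<^sub>V (indicator {0..T} s *\<^sub>R (R (T - s) *\<^sub>V B *\<^sub>V control T B \<phi> s))))"
    unfolding gramian_eq_mild_conv mild_conv_def set_lebesgue_integral_def
    by (rule integral_bounded_linear[OF bl, symmetric])
      (rule conv_integrable[OF control_integrable, unfolded set_integrable_def])
  also have "\<dots> = (LINT s|lebesgue. indicator {0..T} s * Re (cinner (control T B \<eta> s) (control T B \<phi> s)))"
    by (intro Bochner_Integration.integral_cong refl)
      (simp add: cblinfun_linear_simps control_def riesz_vector_apply[symmetric] cadjoint_apply)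
  finally show ?thesis .
qed

lemma norm_gramian_le:
  assumes T: "T \<ge> 0"
  shows "norm (gramian T R B \<phi>) \<le> (T * (M * exp (\<omega> * T) * (norm B * (norm B * (M * exp (\<omega> * T)))))) * norm \<phi>"
proof -
  let ?c = "M * exp (\<omega> * T) * (norm B * (norm B * (M * exp (\<omega> * T)) * norm \<phi>))"
  have "norm (gramian T R B \<phi>) \<le> (LINT s|lebesgue. indicator {0..T} s *\<^sub>R ?c)"
    unfolding gramian_eq_mild_conv mild_conv_def set_lebesgue_integral_def
  proof (rule norm_integral_le_AE)
    show "integrable lebesgue (\<lambda>s. indicator {0..T} s *\<^sub>R (R (T - s) *\<^sub>V B *\<^sub>V control T B \<phi> s))"
      by (rule conv_integrable[OF control_integrable, unfolded set_integrable_def])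
    show "integrable lebesgue (\<lambda>s. indicator {0..T} s *\<^sub>R ?c)"
      using set_integrable_lebesgue_continuous[of 0 T "\<lambda>_. ?c"] by (simp add: set_integrable_def)
    show "AE s in lebesgue. norm (indicator {0..T} s *\<^sub>R (R (T - s) *\<^sub>V B *\<^sub>V control T B \<phi> s)) \<le> indicator {0..T} s *\<^sub>R ?c"
    proof (rule AE_I2)
      fix s
      show "norm (indicator {0..T} s *\<^sub>R (R (T - s) *\<^sub>V B *\<^sub>V control T B \<phi> s)) \<le> indicator {0..T} s *\<^sub>R ?c"
      proof (cases "s \<in> {0..T}")
        case True
        have "norm (B *\<^sub>V control T B \<phi> s) \<le> norm B * (norm B * (M * exp (\<omega> * T)) * norm \<phi>)"
          by (rule order_trans[OF norm_cblinfun mult_left_mono[OF norm_control_le[OF True] norm_ge_zero]])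
        then have "norm (R (T - s) *\<^sub>V B *\<^sub>V control T B \<phi> s) \<le> ?c"
          using M_nonneg by (intro order_trans[OF conv_norm_le[OF True]] mult_left_mono) auto
        then show ?thesis
          using True by simp
      qed simp
    qed
  qed
  also have "\<dots> = T * ?c"
    using T by (simp add: measure_completion)
  finally show ?thesis
    by (simp add: mult_ac)
qed

text \<open>\<open>gramian_resolvent\<close> is given by \<open>inv\<close>; once the regularised
  map is known to attain \<open>y\<close>, applying it to the value of \<open>inv\<close> returns
  \<open>y\<close>. The defect in steering to \<open>y\<close> is then the vector that tends to zero
  by hypothesis.\<close>

lemma gramian_approx:
  assumes uc: "uniformly_convex TYPE('w \<Rightarrow>\<^sub>C\<^sub>L complex)" and T: "T \<ge> 0" and e: "e > 0"
    and cond: "((\<lambda>\<kappa>. \<kappa> *\<^sub>R gramian_resolvent T R B \<kappa> y) \<longlongrightarrow> 0) (at_right 0)"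
  shows "\<exists>\<phi>. norm (gramian T R B \<phi> - y) < e"
proof -
  have "\<forall>\<^sub>F \<kappa> in at_right 0. norm (\<kappa> *\<^sub>R gramian_resolvent T R B \<kappa> y) < e"
    using tendstoD[OF cond e] by simp
  then have "\<forall>\<^sub>F \<kappa> in at_right 0. norm (\<kappa> *\<^sub>R gramian_resolvent T R B \<kappa> y) < e \<and> \<kappa> > 0"
    using eventually_at_right_less by (rule eventually_conj)
  then obtain \<kappa> :: real where \<kappa>: "norm (\<kappa> *\<^sub>R gramian_resolvent T R B \<kappa> y) < e" "\<kappa> > 0"
    using eventually_happens'[OF trivial_limit_at_right_real] by blast
  let ?F = "\<lambda>z. \<kappa> *\<^sub>R z + gramian T R B (duality_map z)"
  have sym: "Re (\<eta> *\<^sub>V gramian T R B \<phi>) = Re (\<phi> *\<^sub>V gramian T R B \<eta>)" for \<phi> \<eta>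
    unfolding Re_functional_gramian by (subst Re_cinner_commute) (rule refl)
  have pos: "Re (\<phi> *\<^sub>V gramian T R B \<phi>) \<ge> 0" for \<phi>
    unfolding Re_functional_gramian
    by (intro Bochner_Integration.integral_nonneg) (simp add: cinner_self)
  obtain x where "?F x = y"
    by (rule regularised_equation_solvable[OF uc sym pos norm_gramian_le[OF T] \<kappa>(2)])
  then have "y \<in> range ?F"
    by blast
  then have "?F (gramian_resolvent T R B \<kappa> y) = y"
    unfolding gramian_resolvent_def by (rule f_inv_into_f)
  then have "gramian T R B (duality_map (gramian_resolvent T R B \<kappa> y)) - y = - (\<kappa> *\<^sub>R gramian_resolvent T R B \<kappa> y)"
    by (simp add: algebra_simps eq_neg_iff_add_eq_0)
  then show ?thesis
    using \<kappa>(1) by (metis norm_minus_cancel)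
qed

lemma mild_conv_add:
  assumes "set_integrable lebesgue {0..t} g" "set_integrable lebesgue {0..t} k"
  shows "mild_conv (\<lambda>s. g s + k s) t = mild_conv g t + mild_conv k t"
  unfolding mild_conv_def using set_integral_add(2)[OF conv_integrable[OF assms(1)] conv_integrable[OF assms(2)]]
  by (simp add: cblinfun_linear_simps)

lemma mild_conv_sum:
  assumes "\<And>y. y \<in> Y \<Longrightarrow> set_integrable lebesgue {0..t} (g y)"
  shows "mild_conv (\<lambda>s. \<Sum>y\<in>Y. c y *\<^sub>R g y s) t = (\<Sum>y\<in>Y. c y *\<^sub>R mild_conv (g y) t)"
proof -
  have "mild_conv (\<lambda>s. \<Sum>y\<in>Y. c y *\<^sub>R g y s) t
      = (LINT s|lebesgue. (\<Sum>y\<in>Y. c y *\<^sub>R (indicator {0..t} s *\<^sub>R (R (t - s) *\<^sub>V g y s))))"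
    unfolding mild_conv_def set_lebesgue_integral_def
    by (intro Bochner_Integration.integral_cong refl)
      (simp add: cblinfun_apply_sum cblinfun_linear_simps scaleR_sum_right mult_ac)
  also have "\<dots> = (\<Sum>y\<in>Y. LINT s|lebesgue. c y *\<^sub>R (indicator {0..t} s *\<^sub>R (R (t - s) *\<^sub>V g y s)))"
    by (intro Bochner_Integration.integral_sum integrable_scaleR_right)
      (rule conv_integrable[OF assms, unfolded set_integrable_def])
  finally show ?thesis
    by (simp only: mild_conv_def set_lebesgue_integral_def integral_scaleR_right)
qed

lemma mild_conv_0: "mild_conv g 0 = 0"
proof -
  have "AE s in lebesgue. s \<noteq> (0::real)"
    by (rule AE_completion[OF AE_lborel_singleton])
  then have "AE s in lebesgue. indicator {0..0} s *\<^sub>R (R (0 - s) *\<^sub>V g s) = 0"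
    by eventually_elim simp
  then show ?thesis
    unfolding mild_conv_def set_lebesgue_integral_def by (rule integral_eq_zero_AE)
qed

end

section \<open>The closed-loop equation\<close>

lemma apply_bcontfun_sum: "apply_bcontfun (\<Sum>i\<in>I. g i) t = (\<Sum>i\<in>I. apply_bcontfun (g i) t)"
  for g :: "'i \<Rightarrow> ('a::topological_space \<Rightarrow>\<^sub>C 'b::real_normed_vector)"
  by (induction I rule: infinite_finite_induct) (simp_all add: plus_bcontfun.rep_eq zero_bcontfun.rep_eq)

lemma continuous_on_eval: "continuous_on S (\<lambda>x :: 'a::topological_space \<Rightarrow>\<^sub>C 'b::metric_space. apply_bcontfun x t)"
  by (rule lipschitz_on_continuous_on[of 1]) (simp add: lipschitz_on_def dist_bounded)

context caratheodory begin

text \<open>For each of the finitely many centres \<open>y\<close> of a partition of unity, one control steers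
  approximately to \<open>y\<close>; mixing these with the weights of the partition avoids any continuity
  of the choice of the control.\<close>

lemma controlled_solution:
  fixes B :: "'u::complex_hilbert \<Rightarrow>\<^sub>C\<^sub>L 'w"
  assumes h: "continuous_on {0..T} h" and e: "e > 0"
    and approx: "\<And>y d. d > 0 \<Longrightarrow> \<exists>\<phi>. norm (gramian T R B \<phi> - y) < d"
  shows "\<exists>u x. L2_function T u \<and> set_integrable lebesgue {0..T} (\<lambda>s. B *\<^sub>V u s) \<and>
    (\<forall>t\<in>{0..T}. apply_bcontfun x t = h t + mild_conv (\<lambda>s. B *\<^sub>V u s) t + mild_conv (forcing x) t) \<and>
    norm (apply_bcontfun x T - \<zeta>) \<le> e"
proof -
  have T0: "T \<ge> 0"
    using T_pos by simp
  define S where "S = clamped T ` mild_conv ` dominated T \<gamma>"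
  have S: "tot_bounded S"
    unfolding S_def by (rule mild_conv_tot_bounded[OF \<gamma>_integrable T0])
  have response_S: "response x \<in> S" for x
    unfolding S_def response_def by (intro imageI forcing_dominated)
  \<comment> \<open>What the control still has to contribute at time \<open>T\<close>, once the free
    motion and the nonlinear response are accounted for.\<close>
  define target where "target z = \<zeta> - h T - apply_bcontfun z T" for z
  define K where "K = target ` closure S"
  have target_cont: "continuous_on A target" for A
    unfolding target_def by (intro continuous_intros continuous_on_eval)
  have "compact K"
    unfolding K_def by (rule compact_continuous_image[OF target_cont]) (simp add: compact_closure_iff_tot_bounded S)
  moreover have e2: "e / 2 > 0"
    using e by simp
  ultimately obtain Y \<rho> where Y: "finite Y" "Y \<subseteq> K" and \<rho>_cont: "\<And>y. continuous_on K (\<rho> y)"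
    and \<rho>_nonneg: "\<And>y x. x \<in> K \<Longrightarrow> \<rho> y x \<ge> (0::real)"
    and \<rho>_sum: "\<And>x. x \<in> K \<Longrightarrow> (\<Sum>y\<in>Y. \<rho> y x) = 1"
    and \<rho>_near: "\<And>y x. \<rho> y x \<noteq> 0 \<Longrightarrow> dist x y < e / 2"
    by (rule compact_partition_of_unity) blast
  have "\<exists>\<Phi>. \<forall>y. norm (gramian T R B (\<Phi> y) - y) < e / 2"
    by (rule choice) (use approx[OF e2] in blast)
  then obtain \<Phi> where \<Phi>: "\<And>y. norm (gramian T R B (\<Phi> y) - y) < e / 2"
    by blast
  define z where "z y = clamped T (mild_conv (\<lambda>s. B *\<^sub>V control T B (\<Phi> y) s))" for y
  define c where "c x y = \<rho> y (target (response x))" for x y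
  have mem_K: "target (response x) \<in> K" for x
    unfolding K_def using response_S closure_subset by blast
  have c_nonneg: "c x y \<ge> 0" for x y
    unfolding c_def by (rule \<rho>_nonneg[OF mem_K])
  have c_sum: "(\<Sum>y\<in>Y. c x y) = 1" for x
    unfolding c_def by (rule \<rho>_sum[OF mem_K])
  have c_le: "c x y \<le> 1" if "y \<in> Y" for x y
    using member_le_sum[OF that, of "c x"] Y(1) c_nonneg c_sum by simp
  have c_cont: "continuous_on UNIV (\<lambda>x. c x y)" for y
    unfolding c_def
  proof (rule continuous_on_compose2[OF \<rho>_cont])
    show "continuous_on UNIV (\<lambda>x. target (response x))"
      by (rule continuous_on_compose2[OF target_cont continuous_response subset_UNIV])
    show "range (\<lambda>x. target (response x)) \<subseteq> K"
      using mem_K by blast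
  qed
  \<comment> \<open>The path enters the control only through its response. Responses range over a
    totally bounded set and the weights lie between 0 and 1, so the image of the whole space is
    relatively compact without any prior bound on \<open>x\<close>.\<close>
  define Fix where "Fix x = clamped T h + ((\<Sum>y\<in>Y. c x y *\<^sub>R z y) + response x)" for x
  define S1 where "S1 = {\<Sum>y\<in>Y. a y | a. \<forall>y\<in>Y. a y \<in> (\<lambda>r. r *\<^sub>R z y) ` {0..1}}"
  define S2 where "S2 = {a + b | a b. a \<in> S1 \<and> b \<in> S}"
  define S3 where "S3 = {a + b | a b. a \<in> {clamped T h} \<and> b \<in> S2}"
  have "tot_bounded S1"
    unfolding S1_def
    by (intro tot_bounded_sum Y(1) compact_imp_tot_bounded compact_continuous_image continuous_intros) simp
  then have "tot_bounded S2"
    unfolding S2_def using S by (rule tot_bounded_add)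
  moreover have "tot_bounded {clamped T h}"
    by (rule compact_imp_tot_bounded) simp
  ultimately have "tot_bounded S3"
    unfolding S3_def by (rule tot_bounded_add[rotated])
  then have comp: "compact (closure S3)"
    by (simp add: compact_closure_iff_tot_bounded)
  have Fix_mem: "Fix x \<in> closure S3" for x
  proof -
    have "(\<Sum>y\<in>Y. c x y *\<^sub>R z y) \<in> S1"
      unfolding S1_def using c_nonneg[of x] c_le[of _ x]
      by (intro CollectI exI[of _ "\<lambda>y. c x y *\<^sub>R z y"] conjI refl ballI imageI) simp
    then have "(\<Sum>y\<in>Y. c x y *\<^sub>R z y) + response x \<in> S2"
      unfolding S2_def using response_S by blast
    then have "Fix x \<in> S3"
      unfolding S3_def Fix_def by blast
    then show ?thesis
      by (rule subsetD[OF closure_subset])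
  qed
  have "continuous_on UNIV Fix"
    unfolding Fix_def by (intro continuous_intros c_cont continuous_response)
  then obtain x where x: "Fix x = x"
    by (rule schauder_fixed_point[where \<Phi> = Fix, OF _ comp Fix_mem])
  define u where "u s = (\<Sum>y\<in>Y. c x y *\<^sub>R control T B (\<Phi> y) s)" for s
  have u_bound: "norm (u s) \<le> (\<Sum>y\<in>Y. norm (c x y) * (norm B * (M * exp (\<omega> * T)) * norm (\<Phi> y)))" if "s \<in> {0..T}" for s
    unfolding u_def using norm_control_le[OF that]
    by (intro order_trans[OF norm_sum] sum_mono) (auto intro!: mult_left_mono)
  have u_cont: "continuous_on {0..<T} u"
    unfolding u_def by (intro continuous_intros control_continuous)
  have Bu: "B *\<^sub>V u s = (\<Sum>y\<in>Y. c x y *\<^sub>R (B *\<^sub>V control T B (\<Phi> y) s))" for s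
    by (simp add: u_def cblinfun_apply_sum cblinfun_linear_simps)
  have sub: "set_integrable lebesgue {0..t} (\<lambda>s. B *\<^sub>V control T B (\<Phi> y) s)" if "t \<in> {0..T}" for t y
    by (rule set_integrable_subset[OF control_integrable]) (use that in auto)
  have mild_Bu: "mild_conv (\<lambda>s. B *\<^sub>V u s) t = (\<Sum>y\<in>Y. c x y *\<^sub>R mild_conv (\<lambda>s. B *\<^sub>V control T B (\<Phi> y) s) t)" if "t \<in> {0..T}" for t
    unfolding Bu by (rule mild_conv_sum[OF sub[OF that]])
  have x_eq: "apply_bcontfun x t = h t + mild_conv (\<lambda>s. B *\<^sub>V u s) t + mild_conv (forcing x) t" if t: "t \<in> {0..T}" for t
  proof -
    have z: "apply_bcontfun (z y) t = mild_conv (\<lambda>s. B *\<^sub>V control T B (\<Phi> y) s) t" for y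
      unfolding z_def apply_clamped[OF T0 mild_conv_continuous[OF T0 control_integrable]] clamp_time_id[OF t] ..
    have r: "apply_bcontfun (response x) t = mild_conv (forcing x) t"
      unfolding response_def apply_clamped[OF T0 mild_conv_continuous[OF T0 forcing_integrable]] clamp_time_id[OF t] ..
    have hh: "apply_bcontfun (clamped T h) t = h t"
      unfolding apply_clamped[OF T0 h] clamp_time_id[OF t] ..
    have "apply_bcontfun x t = apply_bcontfun (Fix x) t"
      by (simp add: x)
    then show ?thesis
      unfolding Fix_def mild_Bu[OF t]
      by (simp add: plus_bcontfun.rep_eq apply_bcontfun_sum scaleR_bcontfun.rep_eq z r hh add.assoc)
  qed
  have TT: "T \<in> {0..T}"
    using T0 by simp
  have "apply_bcontfun (response x) T = mild_conv (forcing x) T"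
    unfolding response_def apply_clamped[OF T0 mild_conv_continuous[OF T0 forcing_integrable]] clamp_time_id[OF TT] ..
  \<comment> \<open>At the final time the error is that of the mixed Gramian states against the
    target. Each active centre is within \<open>e / 2\<close> of the target and is steered to within
    \<open>e / 2\<close>.\<close>
  then have "apply_bcontfun x T - \<zeta> = (\<Sum>y\<in>Y. c x y *\<^sub>R gramian T R B (\<Phi> y)) - target (response x)"
    unfolding x_eq[OF TT] mild_Bu[OF TT] target_def gramian_eq_mild_conv by simp
  moreover have "norm ((\<Sum>y\<in>Y. c x y *\<^sub>R gramian T R B (\<Phi> y)) - target (response x)) \<le> e"
  proof (rule norm_convex_combination_diff[OF c_sum c_nonneg])
    fix y assume "c x y \<noteq> 0"
    then have "dist (target (response x)) y < e / 2"
      unfolding c_def by (rule \<rho>_near)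
    moreover have "dist (gramian T R B (\<Phi> y)) y < e / 2"
      using \<Phi>[of y] by (simp add: dist_norm)
    ultimately have "dist (gramian T R B (\<Phi> y)) (target (response x)) < e"
      by (metis dist_triangle_half_r dist_commute)
    then show "norm (gramian T R B (\<Phi> y) - target (response x)) \<le> e"
      by (simp add: dist_norm)
  qed
  ultimately have "norm (apply_bcontfun x T - \<zeta>) \<le> e"
    by simp
  moreover have "set_integrable lebesgue {0..T} (\<lambda>s. B *\<^sub>V u s)"
    by (rule set_integrable_continuous_bounded[OF bounded_linear.continuous_on[OF bounded_linear_cblinfun_apply u_cont]
          order_trans[OF norm_cblinfun mult_left_mono[OF u_bound norm_ge_zero]]])
  ultimately show ?thesis
    using L2_function_continuous_bounded[OF u_cont u_bound] x_eq by (intro exI[of _ u] exI[of _ x] conjI ballI)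
qed

end

theorem theorem4p2:
  fixes T \<nu> \<alpha> :: real
    and DA :: "'w::{complex_banach, second_countable_topology} set"
    and A :: "'w \<Rightarrow> 'w"
    and G :: "real \<Rightarrow> 'w \<Rightarrow>\<^sub>C\<^sub>L 'w"
    and Ghat :: "complex \<Rightarrow> 'w \<Rightarrow>\<^sub>C\<^sub>L 'w"
    and DN :: "real \<Rightarrow> 'w set"
    and N :: "real \<Rightarrow> 'w \<Rightarrow> 'w"
    and Nhat :: "complex \<Rightarrow> 'w \<Rightarrow> 'w"
    and R :: "real \<Rightarrow> 'w \<Rightarrow>\<^sub>C\<^sub>L 'w"
    and B :: "'u::complex_hilbert \<Rightarrow>\<^sub>C\<^sub>L 'w"
    and \<BB> :: "(real \<Rightarrow> 'w) set"
    and p :: "(real \<Rightarrow> 'w) \<Rightarrow> real"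
    and f :: "real \<Rightarrow> (real \<Rightarrow> 'w) \<Rightarrow> 'w"
    and \<gamma> :: "real \<Rightarrow> real"
  assumes T_pos: "T > 0"
    and W_reflexive: "reflexive_space TYPE('w)"
    and W_dual_uniformly_convex: "uniformly_convex TYPE('w \<Rightarrow>\<^sub>C\<^sub>L complex)"
    and A_closed: "closed_linear_operator DA A"
    and Cd1: "Cd1 \<nu> DA A"
    and Cd2: "Cd2 \<nu> \<alpha> DA A G Ghat"
    and Cd3: "Cd3 \<nu> DA A DN N Nhat"
    and Cd4: "Cd4 \<nu> \<alpha> DA A Ghat Nhat"
    and R_resolvent: "resolvent_operator DA A G N R"
    and phase_space: "phase_space \<BB> p"
    and gramian_cond:
      "\<And>y. ((\<lambda>\<kappa>. \<kappa> *\<^sub>R gramian_resolvent T R B \<kappa> y) \<longlongrightarrow> 0) (at_right 0)"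
    and compact_resolvent:
      "\<exists>l0\<in>resolvent_set DA A. compact_operator (resolvent DA A l0)"
    and f_continuous:
      "AE t\<in>{0..T} in lebesgue. seminorm_continuous_on \<BB> p (f t)"
    and f_measurable:
      "\<And>\<phi>. \<phi> \<in> \<BB> \<Longrightarrow> strongly_measurable (lebesgue_on {0..T}) (\<lambda>t. f t \<phi>)"
    and \<gamma>_nonneg: "\<And>t. t \<in> {0..T} \<Longrightarrow> \<gamma> t \<ge> 0"
    and \<gamma>_integrable: "set_integrable lebesgue {0..T} \<gamma>"
    and f_bounded:
      "AE t\<in>{0..T} in lebesgue. \<forall>\<phi>\<in>\<BB>. norm (f t \<phi>) \<le> \<gamma> t"
  shows "approximately_controllable T R G DN N B f \<BB>"
proof -
  obtain M \<omega> where "exp_bounded_family R M \<omega>" "continuous_on {0<..} R" "\<And>t. t > 0 \<Longrightarrow> compact_operator (R t)"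
    by (rule resolvent_operator_properties[OF A_closed Cd1 Cd2 Cd3 R_resolvent compact_resolvent]) (rule that; simp)
  then interpret compact_family R M \<omega>
    by (intro compact_family.intro compact_family_axioms.intro)
  have T0: "T \<ge> 0"
    using T_pos by simp
  have approx: "\<exists>\<phi>. norm (gramian T R B \<phi> - y) < d" if "d > 0" for y d
    by (rule gramian_approx[OF W_dual_uniformly_convex T0 that gramian_cond])
  have R0: "R 0 = id_cblinfun"
    using R_resolvent unfolding resolvent_operator_def by (elim conjE)
  show ?thesis
    unfolding approximately_controllable_def
  proof (intro ballI allI impI)
    fix \<psi> f1' \<zeta>1 and \<epsilon> :: real
    assume \<psi>: "\<psi> \<in> \<BB>" and adm: "admissible_history T G DN N \<psi> f1'" and \<epsilon>: "\<epsilon> > 0"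
    interpret caratheodory R M \<omega> \<BB> p T f \<gamma> \<psi>
      by (unfold_locales; fact phase_space T_pos \<psi> f_continuous f_measurable \<gamma>_integrable f_bounded)
    \<comment> \<open>The inhomogeneity inherited from the history; it does not depend on the
      control.\<close>
    define g where "g s = f1' s + history_N N \<psi> s" for s
    have "set_integrable lebesgue {0..T} f1'" "set_integrable lebesgue {0..T} (history_N N \<psi>)"
      using adm unfolding admissible_history_def has_W11_derivative_def by simp_all
    then have g: "set_integrable lebesgue {0..T} g"
      unfolding g_def by (rule set_integral_add(1))
    define h where "h t = R t *\<^sub>V \<psi> 0 + mild_conv g t" for t
    have "continuous_on {0..T} (\<lambda>t. R t *\<^sub>V \<psi> 0)"
      by (rule continuous_on_subset[OF strongly_continuous]) auto
    then have h: "continuous_on {0..T} h"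
      unfolding h_def by (intro continuous_on_add mild_conv_continuous[OF T0 g])
    from controlled_solution[OF h \<epsilon> approx]
    obtain u x where u: "L2_function T u" and Bu: "set_integrable lebesgue {0..T} (\<lambda>s. B *\<^sub>V u s)"
      and x: "\<And>t. t \<in> {0..T} \<Longrightarrow> apply_bcontfun x t = h t + mild_conv (\<lambda>s. B *\<^sub>V u s) t + mild_conv (forcing x) t"
      and near: "norm (apply_bcontfun x T - \<zeta>1) \<le> \<epsilon>"
      by blast
    \<comment> \<open>Both convolutions vanish at time zero and \<open>R 0\<close> is the identity,
      so the subtraction of \<open>x 0\<close> in \<open>extend_history\<close> cancels against
      \<open>\<psi> 0\<close> and \<open>w\<close> agrees with \<open>x\<close> on the
      interval.\<close>
    have x0: "apply_bcontfun x 0 = \<psi> 0"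
      using x[of 0] T0 by (simp add: h_def mild_conv_0 R0)
    define w where "w = extend_history T \<psi> x"
    have w: "w t = apply_bcontfun x t" if "t \<in> {0..T}" for t
      using that x0 by (auto simp: w_def extend_history_def clamp_time_id)
    have "mild_solution T R N B f \<psi> f1' u w"
      unfolding mild_solution_def
    proof (intro conjI ballI)
      show "segment w 0 = \<psi>"
        unfolding w_def by (rule segment_extend_history[OF \<psi>])
      show "continuous_on {0..T} w"
        unfolding w_def by (rule continuous_on_subset[OF continuous_on_extend_history[of "T + 1"]]) auto
      fix t assume t: "t \<in> {0..T}"
      have sub: "set_integrable lebesgue {0..t} k" if "set_integrable lebesgue {0..T} k" for k :: "real \<Rightarrow> 'w"
        by (rule set_integrable_subset[OF that]) (use t in auto)
      show "set_integrable lebesgue {0..t} (\<lambda>s. R (t - s) *\<^sub>V (B *\<^sub>V u s + f s (segment w s)))"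
        using conv_integrable[OF set_integral_add(1)[OF sub[OF Bu] sub[OF forcing_integrable[of x]]]]
        by (simp add: forcing_def w_def)
      show "set_integrable lebesgue {0..t} (\<lambda>s. R (t - s) *\<^sub>V (f1' s + history_N N \<psi> s))"
        using conv_integrable[OF sub[OF g]] by (simp add: g_def)
      have "w t = R t *\<^sub>V \<psi> 0 + (mild_conv (\<lambda>s. B *\<^sub>V u s) t + mild_conv (forcing x) t) + mild_conv g t"
        by (simp add: w[OF t] x[OF t] h_def)
      then show "w t = R t *\<^sub>V \<psi> 0
          + (LINT s:{0..t}|lebesgue. R (t - s) *\<^sub>V (B *\<^sub>V u s + f s (segment w s)))
          + (LINT s:{0..t}|lebesgue. R (t - s) *\<^sub>V (f1' s + history_N N \<psi> s))"
        unfolding mild_conv_add[OF sub[OF Bu] sub[OF forcing_integrable], symmetric]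
        by (simp add: mild_conv_def g_def forcing_def w_def)
    qed
    moreover have "norm (w T - \<zeta>1) \<le> \<epsilon>"
      using near w[of T] T0 by simp
    ultimately show "\<exists>u w. L2_function T u \<and> mild_solution T R N B f \<psi> f1' u w \<and> norm (w T - \<zeta>1) \<le> \<epsilon>"
      using u by blast
  qed
qed


end
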